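(* Let $B=\bigoplus_{i\ge 0}B_{(i)}$ be a graded bialgebra over a field $\mathbb{K}$. There exists a natural bijection $$\mathrm{Lift}(B)\;\simeq\; iso\,\mathcal{E}(B)$$ between the set $\mathrm{Lift}(B)$ of equivalence classes of liftings of $B$ and the set $iso\,\mathcal{E}(B)$ of isomorphism classes of graded bialgebra deformations of $B$.
   Context: All tensor products are over the field $\mathbb{K}$ unless indicated. $B=\bigoplus_{i\ge 0}B_{(i)}$ is a graded bialgebra with identity $1_B$, multiplication $m$, counit $\varepsilon$ and comultiplication $\Delta$ (all structure maps homogeneous of degree $0$, with $\mathbb{K}$ in degree $0$). Put $B_i=\bigoplus_{j\le i}B_{(j)}$; this is a bialgebra filtration of $B$. A filtered bialgebra is a bialgebra $U$ with an exhaustive filtration $U_0\subseteq U_1\subseteq\cdots$ such that $1\in U_0$, $U_iU_j\subseteq U_{i+j}$ and $\Delta_U(U_n)\subseteq\sum_{i+j=n}U_i\otimes U_j$; it has an associated graded bialgebra $\mathrm{gr}\,U=\bigoplus_i U_i/U_{i-1}$ (with $U_{-1}=0$). Liftings. A lifting of $B$ is a filtered bialgebra structure, denoted $U$, on the underlying filtered vector space $(B,(B_i)_{i\ge0})$ such that $\mathrm{gr}\,U=B$ as graded bialgebras, under the natural identification $\mathrm{gr}\,U_{(i)}=B_i/B_{i-1}\cong B_{(i)}$ for each $i\ge 0$. Two liftings $U,V$ are equivalent if there is an isomorphism of filtered bialgebras $\theta:U\to V$ with $\mathrm{gr}\,\theta=\mathrm{Id}_B$, where $\mathrm{gr}\,\theta$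 is the graded morphism associated to $\theta$ (using the identifications $\mathrm{gr}\,U=B$ and $\mathrm{gr}\,V=B$). $\mathrm{Lift}(B)$ is the set of equivalence classes of liftings of $B$. Deformations. View $B[t]$ as a free $\mathbb{K}[t]$-module and as a graded $\mathbb{K}$-space with $\deg t=1$ and $\deg b=n$ for $b\in B_{(n)}$. A (graded bialgebra) deformation $(B[t],m_t,\Delta_t)$ of $B$ consists of $\mathbb{K}[t]$-linear maps, homogeneous of degree zero, $m_t:(B\otimes B)[t]\to B[t]$ and $\Delta_t:B[t]\to(B\otimes B)[t]\cong B[t]\otimes_{\mathbb{K}[t]}B[t]$ such that (i) $B[t]$ is a bialgebra over $\mathbb{K}[t]$ with identity $1_B$, multiplication $m_t$, counit $\varepsilon_t$ given by $\varepsilon_t(bt^j)=\varepsilon(b)t^j$ for $b\in B$, $j\ge 0$, and comultiplication $\Delta_t$; (ii) $m_t\equiv m\otimes\mathrm{Id}_{\mathbb{K}[t]}$ and $\Delta_t\equiv\Delta\otimes\mathrm{Id}_{\mathbb{K}[t]}$ mod $(t)$. The set of deformations is $\mathcal{E}(B)$. Two deformations are isomorphic if there is an isomorphism $\phi$ of $\mathbb{K}[t]$-bialgebras between them which is homogeneous of degree zero and satisfies $\phi\equiv\mathrm{Id}_B\otimes\mathrm{Id}_{\mathbb{K}[t]}$ mod $(t)$. $iso\,\mathcal{E}(B)$ is the set of isomorphism classes of deformations of $B$. *)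

theory Defs
  imports "HOL-Algebra.UnivPoly" "HOL-Algebra.QuotRing"
begin

section \<open>Tensor products of modules\<close>

text \<open>
  The library record \<open>module\<close> extends \<open>ring\<close>, so a module carries the (here meaningless)
  fields \<open>mult\<close> and \<open>one\<close>; they are left \<open>undefined\<close> where only a module is meant.
  All notions below only depend on the values of functions on the relevant carriers.
\<close>

definition free_module :: "('r, 'x) ring_scheme \<Rightarrow> 's set \<Rightarrow> ('r, 's \<Rightarrow> 'r) module" where
  "free_module R S =
    \<lparr> carrier = {c. (\<forall>s\<in>S. c s \<in> carrier R) \<and> (\<forall>s. s \<notin> S \<longrightarrow> c s = \<zero>\<^bsub>R\<^esub>) \<and> finite {s. c s \<noteq> \<zero>\<^bsub>R\<^esub>}},
      mult = undefined, one = undefined,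
      zero = (\<lambda>s. \<zero>\<^bsub>R\<^esub>),
      add = (\<lambda>c d s. c s \<oplus>\<^bsub>R\<^esub> d s),
      smult = (\<lambda>r c s. r \<otimes>\<^bsub>R\<^esub> c s) \<rparr>"

definition free_gen :: "('r, 'x) ring_scheme \<Rightarrow> 's \<Rightarrow> 's \<Rightarrow> 'r" where
  "free_gen R s = (\<lambda>s'. if s' = s then \<one>\<^bsub>R\<^esub> else \<zero>\<^bsub>R\<^esub>)"

definition module_span :: "('r, 'x) ring_scheme \<Rightarrow> ('r, 'm, 'y) module_scheme \<Rightarrow> 'm set \<Rightarrow> 'm set" where
  "module_span R M S = \<Inter>{N. submodule N R M \<and> S \<subseteq> N}"

definition quotient_module :: "('r, 'm, 'y) module_scheme \<Rightarrow> 'm set \<Rightarrow> ('r, 'm set) module" where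
  "quotient_module M N =
    \<lparr> carrier = a_rcosets\<^bsub>M\<^esub> N,
      mult = undefined, one = undefined,
      zero = N,
      add = (\<lambda>X Y. X <+>\<^bsub>M\<^esub> Y),
      smult = (\<lambda>r X. \<Union>x\<in>X. N +>\<^bsub>M\<^esub> (r \<odot>\<^bsub>M\<^esub> x)) \<rparr>"

definition tensor_relators ::
  "('r, 'x) ring_scheme \<Rightarrow> ('r, 'm, 'y) module_scheme \<Rightarrow> ('r, 'n, 'z) module_scheme \<Rightarrow> ('m \<times> 'n \<Rightarrow> 'r) set" where
  "tensor_relators R M N = (let F = free_module R (carrier M \<times> carrier N); g = free_gen R in
      {g (x \<oplus>\<^bsub>M\<^esub> x', y) \<ominus>\<^bsub>F\<^esub> (g (x, y) \<oplus>\<^bsub>F\<^esub> g (x', y)) | x x' y.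
          x \<in> carrier M \<and> x' \<in> carrier M \<and> y \<in> carrier N}
    \<union> {g (x, y \<oplus>\<^bsub>N\<^esub> y') \<ominus>\<^bsub>F\<^esub> (g (x, y) \<oplus>\<^bsub>F\<^esub> g (x, y')) | x y y'.
          x \<in> carrier M \<and> y \<in> carrier N \<and> y' \<in> carrier N}
    \<union> {g (r \<odot>\<^bsub>M\<^esub> x, y) \<ominus>\<^bsub>F\<^esub> r \<odot>\<^bsub>F\<^esub> g (x, y) | r x y.
          r \<in> carrier R \<and> x \<in> carrier M \<and> y \<in> carrier N}
    \<union> {g (x, r \<odot>\<^bsub>N\<^esub> y) \<ominus>\<^bsub>F\<^esub> r \<odot>\<^bsub>F\<^esub> g (x, y) | r x y.
          r \<in> carrier R \<and> x \<in> carrier M \<and> y \<in> carrier N})"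

definition tensor_null ::
  "('r, 'x) ring_scheme \<Rightarrow> ('r, 'm, 'y) module_scheme \<Rightarrow> ('r, 'n, 'z) module_scheme \<Rightarrow> ('m \<times> 'n \<Rightarrow> 'r) set" where
  "tensor_null R M N =
    module_span R (free_module R (carrier M \<times> carrier N)) (tensor_relators R M N)"

definition tensor ::
  "('r, 'x) ring_scheme \<Rightarrow> ('r, 'm, 'y) module_scheme \<Rightarrow> ('r, 'n, 'z) module_scheme
    \<Rightarrow> ('r, ('m \<times> 'n \<Rightarrow> 'r) set) module" where
  "tensor R M N = quotient_module (free_module R (carrier M \<times> carrier N)) (tensor_null R M N)"

definition tens ::
  "('r, 'x) ring_scheme \<Rightarrow> ('r, 'm, 'y) module_scheme \<Rightarrow> ('r, 'n, 'z) module_scheme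
    \<Rightarrow> 'm \<Rightarrow> 'n \<Rightarrow> ('m \<times> 'n \<Rightarrow> 'r) set" where
  "tens R M N x y =
    tensor_null R M N +>\<^bsub>free_module R (carrier M \<times> carrier N)\<^esub> free_gen R (x, y)"

text \<open>
  The linear map on the tensor product of \<open>M\<close> and \<open>N\<close> induced by a bilinear map \<open>\<beta>\<close> into \<open>P\<close>:
  all formal sums in a class \<open>X\<close> have the same value in \<open>P\<close>.
\<close>

definition tensor_lift ::
  "('r, 'x) ring_scheme \<Rightarrow> ('r, 'p, 'w) module_scheme
    \<Rightarrow> ('m \<Rightarrow> 'n \<Rightarrow> 'p) \<Rightarrow> ('m \<times> 'n \<Rightarrow> 'r) set \<Rightarrow> 'p" where
  "tensor_lift R P \<beta> X =
    (THE p. \<forall>c\<in>X. p = (\<Oplus>\<^bsub>P\<^esub>s\<in>{s. c s \<noteq> \<zero>\<^bsub>R\<^esub>}. c s \<odot>\<^bsub>P\<^esub> \<beta> (fst s) (snd s)))"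

definition tensor_map ::
  "('r, 'x) ring_scheme \<Rightarrow> ('r, 'p, 'y) module_scheme \<Rightarrow> ('r, 'q, 'z) module_scheme
    \<Rightarrow> ('m \<Rightarrow> 'p) \<Rightarrow> ('n \<Rightarrow> 'q) \<Rightarrow> ('m \<times> 'n \<Rightarrow> 'r) set \<Rightarrow> ('p \<times> 'q \<Rightarrow> 'r) set" where
  "tensor_map R P Q f g = tensor_lift R (tensor R P Q) (\<lambda>x y. tens R P Q (f x) (g y))"

definition tensor_assoc ::
  "('r, 'x) ring_scheme \<Rightarrow> ('r, 'm, 'y) module_scheme
    \<Rightarrow> (('m \<times> 'm \<Rightarrow> 'r) set \<times> 'm \<Rightarrow> 'r) set \<Rightarrow> ('m \<times> ('m \<times> 'm \<Rightarrow> 'r) set \<Rightarrow> 'r) set" where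
  "tensor_assoc R M = (let T = tensor R M M; T3 = tensor R M T in
    tensor_lift R T3 (\<lambda>u z. tensor_lift R T3 (\<lambda>x y. tens R M T x (tens R M M y z)) u))"

definition tensor_algebra ::
  "('r, 'x) ring_scheme \<Rightarrow> ('r, 'm, 'y) module_scheme \<Rightarrow> ('r, ('m \<times> 'm \<Rightarrow> 'r) set) module" where
  "tensor_algebra R A = (let T = tensor R A A in
    T\<lparr> mult := (\<lambda>u v. tensor_lift R T (\<lambda>a b. tensor_lift R T
                 (\<lambda>a' b'. tens R A A (a \<otimes>\<^bsub>A\<^esub> a') (b \<otimes>\<^bsub>A\<^esub> b')) v) u),
       one := tens R A A \<one>\<^bsub>A\<^esub> \<one>\<^bsub>A\<^esub> \<rparr>)"

definition module_homs ::
  "('r, 'x) ring_scheme \<Rightarrow> ('r, 'm, 'y) module_scheme \<Rightarrow> ('r, 'n, 'z) module_scheme \<Rightarrow> ('m \<Rightarrow> 'n) set" where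
  "module_homs R M N = {f \<in> carrier M \<rightarrow> carrier N.
      (\<forall>x\<in>carrier M. \<forall>y\<in>carrier M. f (x \<oplus>\<^bsub>M\<^esub> y) = f x \<oplus>\<^bsub>N\<^esub> f y) \<and>
      (\<forall>r\<in>carrier R. \<forall>x\<in>carrier M. f (r \<odot>\<^bsub>M\<^esub> x) = r \<odot>\<^bsub>N\<^esub> f x)}"


section \<open>Bialgebras over a commutative ring\<close>

record ('r, 'b) bialg = "('r, 'b) module" +
  counit :: "'b \<Rightarrow> 'r"
  comult :: "'b \<Rightarrow> ('b \<times> 'b \<Rightarrow> 'r) set"

locale bialgebra = module R A + A?: ring A
  for R :: "('r, 'x) ring_scheme" (structure) and A :: "('r, 'b) bialg" (structure) +
  assumes smult_mult_left:
      "\<lbrakk>r \<in> carrier R; x \<in> carrier A; y \<in> carrier A\<rbrakk>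
        \<Longrightarrow> (r \<odot>\<^bsub>A\<^esub> x) \<otimes>\<^bsub>A\<^esub> y = r \<odot>\<^bsub>A\<^esub> (x \<otimes>\<^bsub>A\<^esub> y)"
    and smult_mult_right:
      "\<lbrakk>r \<in> carrier R; x \<in> carrier A; y \<in> carrier A\<rbrakk>
        \<Longrightarrow> x \<otimes>\<^bsub>A\<^esub> (r \<odot>\<^bsub>A\<^esub> y) = r \<odot>\<^bsub>A\<^esub> (x \<otimes>\<^bsub>A\<^esub> y)"
    and counit_ring_hom: "counit A \<in> ring_hom A R"
    and counit_smult:
      "\<lbrakk>r \<in> carrier R; x \<in> carrier A\<rbrakk> \<Longrightarrow> counit A (r \<odot>\<^bsub>A\<^esub> x) = r \<otimes>\<^bsub>R\<^esub> counit A x"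
    and comult_module_hom: "comult A \<in> module_homs R A (tensor R A A)"
    and comult_ring_hom: "comult A \<in> ring_hom A (tensor_algebra R A)"
    and counit_left:
      "x \<in> carrier A \<Longrightarrow> tensor_lift R A (\<lambda>a b. counit A a \<odot>\<^bsub>A\<^esub> b) (comult A x) = x"
    and counit_right:
      "x \<in> carrier A \<Longrightarrow> tensor_lift R A (\<lambda>a b. counit A b \<odot>\<^bsub>A\<^esub> a) (comult A x) = x"
    and coassoc:
      "x \<in> carrier A \<Longrightarrow>
        tensor_assoc R A (tensor_map R (tensor R A A) A (comult A) (\<lambda>b. b) (comult A x)) =
        tensor_map R A (tensor R A A) (\<lambda>a. a) (comult A) (comult A x)"

definition bialg_iso ::
  "('r, 'x) ring_scheme \<Rightarrow> ('r, 'a) bialg \<Rightarrow> ('r, 'b) bialg \<Rightarrow> ('a \<Rightarrow> 'b) set" where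
  "bialg_iso R A A' = {f \<in> ring_iso A A'. f \<in> module_homs R A A' \<and>
      (\<forall>x\<in>carrier A. counit A' (f x) = counit A x) \<and>
      (\<forall>x\<in>carrier A. comult A' (f x) = tensor_map R A' A' f f (comult A x))}"


section \<open>Gradings and filtrations\<close>

definition module_grading ::
  "('r, 'x) ring_scheme \<Rightarrow> ('r, 'm, 'y) module_scheme \<Rightarrow> (nat \<Rightarrow> 'm set) \<Rightarrow> bool" where
  "module_grading R M G \<longleftrightarrow>
    (\<forall>i. submodule (G i) R M) \<and>
    (\<forall>x\<in>carrier M. \<exists>!f. (\<forall>i. f i \<in> G i) \<and> finite {i. f i \<noteq> \<zero>\<^bsub>M\<^esub>} \<and>
        x = (\<Oplus>\<^bsub>M\<^esub>i\<in>{i. f i \<noteq> \<zero>\<^bsub>M\<^esub>}. f i))"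

definition component ::
  "('r, 'm, 'y) module_scheme \<Rightarrow> (nat \<Rightarrow> 'm set) \<Rightarrow> 'm \<Rightarrow> nat \<Rightarrow> 'm" where
  "component M G x = (THE f. (\<forall>i. f i \<in> G i) \<and> finite {i. f i \<noteq> \<zero>\<^bsub>M\<^esub>} \<and>
        x = (\<Oplus>\<^bsub>M\<^esub>i\<in>{i. f i \<noteq> \<zero>\<^bsub>M\<^esub>}. f i))"

text \<open>
  For a family \<open>G\<close> of submodules of \<open>M\<close>, the submodule \<open>\<Sum>\<^bsub>i+j=n\<^esub> G i \<otimes> G j\<close> of the tensor square.
  It is used both for gradings and for filtrations.
\<close>

definition tensor_degree ::
  "('r, 'x) ring_scheme \<Rightarrow> ('r, 'm, 'y) module_scheme \<Rightarrow> (nat \<Rightarrow> 'm set)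
    \<Rightarrow> nat \<Rightarrow> ('m \<times> 'm \<Rightarrow> 'r) set set" where
  "tensor_degree R M G n = module_span R (tensor R M M)
    {tens R M M x y | x y i j. i + j = n \<and> x \<in> G i \<and> y \<in> G j}"

locale graded_bialgebra = bialgebra K B
  for K :: "('k, 'x) ring_scheme" (structure) and B :: "('k, 'b) bialg" (structure)
    and G :: "nat \<Rightarrow> 'b set" +
  assumes grading: "module_grading K B G"
    and one_degree: "\<one>\<^bsub>B\<^esub> \<in> G 0"
    and mult_degree: "\<lbrakk>x \<in> G i; y \<in> G j\<rbrakk> \<Longrightarrow> x \<otimes>\<^bsub>B\<^esub> y \<in> G (i + j)"
    and counit_degree: "\<lbrakk>n > 0; x \<in> G n\<rbrakk> \<Longrightarrow> counit B x = \<zero>\<^bsub>K\<^esub>"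
    and comult_degree: "x \<in> G n \<Longrightarrow> comult B x \<in> tensor_degree K B G n"

locale filtered_bialgebra = bialgebra K U
  for K :: "('k, 'x) ring_scheme" (structure) and U :: "('k, 'b) bialg" (structure)
    and F :: "nat \<Rightarrow> 'b set" +
  assumes filtration_submodule: "submodule (F i) K U"
    and filtration_mono: "F i \<subseteq> F (Suc i)"
    and filtration_exhaustive: "(\<Union>i. F i) = carrier U"
    and one_filtration: "\<one>\<^bsub>U\<^esub> \<in> F 0"
    and mult_filtration: "\<lbrakk>x \<in> F i; y \<in> F j\<rbrakk> \<Longrightarrow> x \<otimes>\<^bsub>U\<^esub> y \<in> F (i + j)"
    and comult_filtration: "x \<in> F n \<Longrightarrow> comult U x \<in> tensor_degree K U F n"

definition filtration_of ::
  "('r, 'm, 'y) module_scheme \<Rightarrow> (nat \<Rightarrow> 'm set) \<Rightarrow> nat \<Rightarrow> 'm set" where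
  "filtration_of M G i = {\<Oplus>\<^bsub>M\<^esub>j\<in>{..i}. f j | f. \<forall>j\<le>i. f j \<in> G j}"

definition graded_bialg_iso ::
  "('r, 'x) ring_scheme \<Rightarrow> ('r, 'a) bialg \<Rightarrow> (nat \<Rightarrow> 'a set) \<Rightarrow> ('r, 'b) bialg \<Rightarrow> (nat \<Rightarrow> 'b set)
    \<Rightarrow> ('a \<Rightarrow> 'b) set" where
  "graded_bialg_iso R A G A' G' = {f \<in> bialg_iso R A A'. \<forall>n. f ` G n = G' n}"

text \<open>Isomorphisms of filtered bialgebras: the inverse is required to preserve the filtration too.\<close>

definition filtered_bialg_iso ::
  "('r, 'x) ring_scheme \<Rightarrow> ('r, 'a) bialg \<Rightarrow> (nat \<Rightarrow> 'a set) \<Rightarrow> ('r, 'b) bialg \<Rightarrow> (nat \<Rightarrow> 'b set)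
    \<Rightarrow> ('a \<Rightarrow> 'b) set" where
  "filtered_bialg_iso R A F A' F' = {f \<in> bialg_iso R A A'. \<forall>n. f ` F n = F' n}"


section \<open>The associated graded bialgebra\<close>

text \<open>
  An element of \<open>gr U = \<Oplus>\<^sub>i U\<^sub>i / U\<^bsub>i-1\<^esub>\<close> is a sequence of cosets, almost all of them zero.
  The operations are computed on representatives; \<open>rep\<close> picks one.
\<close>

definition pred_filtration ::
  "('r, 'm, 'y) module_scheme \<Rightarrow> (nat \<Rightarrow> 'm set) \<Rightarrow> nat \<Rightarrow> 'm set" where
  "pred_filtration M F i = (case i of 0 \<Rightarrow> {\<zero>\<^bsub>M\<^esub>} | Suc j \<Rightarrow> F j)"

definition gr_class ::
  "('r, 'm, 'y) module_scheme \<Rightarrow> (nat \<Rightarrow> 'm set) \<Rightarrow> nat \<Rightarrow> 'm \<Rightarrow> 'm set" where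
  "gr_class M F i u = pred_filtration M F i +>\<^bsub>M\<^esub> u"

definition gr_in ::
  "('r, 'm, 'y) module_scheme \<Rightarrow> (nat \<Rightarrow> 'm set) \<Rightarrow> nat \<Rightarrow> 'm \<Rightarrow> nat \<Rightarrow> 'm set" where
  "gr_in M F i u = (\<lambda>k. if k = i then gr_class M F i u else pred_filtration M F k)"

definition rep :: "'m set \<Rightarrow> 'm" where
  "rep X = (SOME x. x \<in> X)"

definition gr_algebra ::
  "('r, 'm, 'y) module_scheme \<Rightarrow> (nat \<Rightarrow> 'm set) \<Rightarrow> ('r, nat \<Rightarrow> 'm set) module" where
  "gr_algebra U F =
    \<lparr> carrier = {X. (\<forall>i. X i \<in> gr_class U F i ` F i) \<and> finite {i. X i \<noteq> pred_filtration U F i}},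
      mult = (\<lambda>X Y n. gr_class U F n (\<Oplus>\<^bsub>U\<^esub>i\<in>{..n}. rep (X i) \<otimes>\<^bsub>U\<^esub> rep (Y (n - i)))),
      one = gr_in U F 0 \<one>\<^bsub>U\<^esub>,
      zero = pred_filtration U F,
      add = (\<lambda>X Y i. gr_class U F i (rep (X i) \<oplus>\<^bsub>U\<^esub> rep (Y i))),
      smult = (\<lambda>r X i. gr_class U F i (r \<odot>\<^bsub>U\<^esub> rep (X i))) \<rparr>"

text \<open>
  The comultiplication of \<open>gr U\<close> on the class of \<open>u \<in> U\<^sub>n\<close>: the element \<open>\<Delta> u\<close> of
  \<open>\<Sum>\<^bsub>i+j=n\<^esub> U\<^sub>i \<otimes> U\<^sub>j\<close> is the image of a family \<open>w i \<in> U\<^sub>i \<otimes> U\<^bsub>n-i\<^esub>\<close>, whose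
  image under the projections \<open>U\<^sub>i \<rightarrow> U\<^sub>i / U\<^bsub>i-1\<^esub>\<close> does not depend on the choice of
  the family.
\<close>

definition gr_comult_class ::
  "('r, 'x) ring_scheme \<Rightarrow> ('r, 'b) bialg \<Rightarrow> (nat \<Rightarrow> 'b set) \<Rightarrow> nat \<Rightarrow> 'b
    \<Rightarrow> ((nat \<Rightarrow> 'b set) \<times> (nat \<Rightarrow> 'b set) \<Rightarrow> 'r) set" where
  "gr_comult_class K U F n u = (THE z. \<exists>w.
      (\<forall>i\<le>n. w i \<in> carrier (tensor K (U\<lparr>carrier := F i\<rparr>) (U\<lparr>carrier := F (n - i)\<rparr>))) \<and>
      comult U u = (\<Oplus>\<^bsub>tensor K U U\<^esub>i\<in>{..n}. tensor_map K U U (\<lambda>x. x) (\<lambda>y. y) (w i)) \<and>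
      z = (\<Oplus>\<^bsub>tensor K (gr_algebra U F) (gr_algebra U F)\<^esub>i\<in>{..n}.
             tensor_map K (gr_algebra U F) (gr_algebra U F) (gr_in U F i) (gr_in U F (n - i)) (w i)))"

definition gr_bialgebra ::
  "('r, 'x) ring_scheme \<Rightarrow> ('r, 'b) bialg \<Rightarrow> (nat \<Rightarrow> 'b set) \<Rightarrow> ('r, nat \<Rightarrow> 'b set) bialg" where
  "gr_bialgebra K U F =
    \<lparr> carrier = carrier (gr_algebra U F),
      mult = mult (gr_algebra U F),
      one = one (gr_algebra U F),
      zero = zero (gr_algebra U F),
      add = add (gr_algebra U F),
      smult = smult (gr_algebra U F),
      counit = (\<lambda>X. counit U (rep (X 0))),
      comult = (\<lambda>X. \<Oplus>\<^bsub>tensor K (gr_algebra U F) (gr_algebra U F)\<^esub>n\<in>{n. X n \<noteq> pred_filtration U F n}.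
                  gr_comult_class K U F n (rep (X n))) \<rparr>"

definition gr_degree ::
  "('r, 'm, 'y) module_scheme \<Rightarrow> (nat \<Rightarrow> 'm set) \<Rightarrow> nat \<Rightarrow> (nat \<Rightarrow> 'm set) set" where
  "gr_degree U F n = gr_in U F n ` F n"

definition gr_map ::
  "('r, 'n, 'y) module_scheme \<Rightarrow> (nat \<Rightarrow> 'n set) \<Rightarrow> ('m \<Rightarrow> 'n) \<Rightarrow> (nat \<Rightarrow> 'm set) \<Rightarrow> nat \<Rightarrow> 'n set" where
  "gr_map V F' \<theta> X = (\<lambda>i. gr_class V F' i (\<theta> (rep (X i))))"


section \<open>Liftings\<close>

text \<open>
  The natural identification of \<open>B\<close> with \<open>gr B\<close>, where \<open>B\<close> carries the filtration of its
  grading \<open>G\<close>: it sends \<open>b = \<Sum> b\<^sub>i\<close> to the sequence of the classes \<open>b\<^sub>i + B\<^bsub>i-1\<^esub>\<close>. It only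
  depends on the underlying graded space.
\<close>

definition gr_ident ::
  "('r, 'm, 'y) module_scheme \<Rightarrow> (nat \<Rightarrow> 'm set) \<Rightarrow> 'm \<Rightarrow> nat \<Rightarrow> 'm set" where
  "gr_ident B G b = (\<lambda>i. gr_class B (filtration_of B G) i (component B G b i))"

definition liftings ::
  "('k, 'x) ring_scheme \<Rightarrow> ('k, 'b) bialg \<Rightarrow> (nat \<Rightarrow> 'b set) \<Rightarrow> ('k, 'b) bialg set" where
  "liftings K B G = {U.
      carrier U = carrier B \<and> zero U = zero B \<and> add U = add B \<and> smult U = smult B \<and>
      filtered_bialgebra K U (filtration_of B G) \<and>
      gr_ident B G \<in> graded_bialg_iso K B G
        (gr_bialgebra K U (filtration_of B G)) (gr_degree U (filtration_of B G))}"

definition lifting_equiv ::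
  "('k, 'x) ring_scheme \<Rightarrow> ('k, 'b) bialg \<Rightarrow> (nat \<Rightarrow> 'b set) \<Rightarrow> (('k, 'b) bialg \<times> ('k, 'b) bialg) set" where
  "lifting_equiv K B G = {(U, V). U \<in> liftings K B G \<and> V \<in> liftings K B G \<and>
      (\<exists>\<theta> \<in> filtered_bialg_iso K U (filtration_of B G) V (filtration_of B G).
         \<forall>b\<in>carrier B. gr_map V (filtration_of B G) \<theta> (gr_ident B G b) = gr_ident B G b)}"

definition Lift ::
  "('k, 'x) ring_scheme \<Rightarrow> ('k, 'b) bialg \<Rightarrow> (nat \<Rightarrow> 'b set) \<Rightarrow> ('k, 'b) bialg set set" where
  "Lift K B G = liftings K B G // lifting_equiv K B G"


section \<open>Graded deformations\<close>

text \<open>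
  \<open>poly_module R M\<close> is \<open>M[t]\<close> as a module over \<open>R[t] = UP R\<close>; a polynomial is its sequence of
  coefficients.
\<close>

definition poly_module ::
  "('r, 'x) ring_scheme \<Rightarrow> ('r, 'm, 'y) module_scheme \<Rightarrow> (nat \<Rightarrow> 'r, nat \<Rightarrow> 'm) module" where
  "poly_module R M =
    \<lparr> carrier = {p. (\<forall>n. p n \<in> carrier M) \<and> finite {n. p n \<noteq> \<zero>\<^bsub>M\<^esub>}},
      mult = undefined, one = undefined,
      zero = (\<lambda>n. \<zero>\<^bsub>M\<^esub>),
      add = (\<lambda>p q n. p n \<oplus>\<^bsub>M\<^esub> q n),
      smult = (\<lambda>a p n. \<Oplus>\<^bsub>M\<^esub>i\<in>{..n}. coeff (UP R) a i \<odot>\<^bsub>M\<^esub> p (n - i)) \<rparr>"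

definition poly_const :: "('r, 'm, 'y) module_scheme \<Rightarrow> 'm \<Rightarrow> nat \<Rightarrow> 'm" where
  "poly_const M x = (\<lambda>n. if n = 0 then x else \<zero>\<^bsub>M\<^esub>)"

text \<open>The homogeneous polynomials of degree \<open>n\<close>, where \<open>t\<close> has degree \<open>1\<close>.\<close>

definition poly_degree ::
  "('r, 'm, 'y) module_scheme \<Rightarrow> (nat \<Rightarrow> 'm set) \<Rightarrow> nat \<Rightarrow> (nat \<Rightarrow> 'm) set" where
  "poly_degree M G n = {p. (\<forall>j\<le>n. p j \<in> G (n - j)) \<and> (\<forall>j>n. p j = \<zero>\<^bsub>M\<^esub>)}"

definition cong_mod_t ::
  "('r, 'x) ring_scheme \<Rightarrow> ('r, 'm, 'y) module_scheme \<Rightarrow> (nat \<Rightarrow> 'm) \<Rightarrow> (nat \<Rightarrow> 'm) \<Rightarrow> bool" where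
  "cong_mod_t R M p q \<longleftrightarrow> (\<exists>z\<in>carrier (poly_module R M).
      p = q \<oplus>\<^bsub>poly_module R M\<^esub> (monom (UP R) \<one>\<^bsub>R\<^esub> 1 \<odot>\<^bsub>poly_module R M\<^esub> z))"

text \<open>
  The isomorphism from \<open>B[t] \<otimes>\<^bsub>K[t]\<^esub> B[t]\<close> to \<open>(B \<otimes> B)[t]\<close> is induced by
  \<open>(p, q) \<mapsto> \<Sum> (p\<^sub>i \<otimes> q\<^sub>j) t\<^bsup>i+j\<^esup>\<close>.
\<close>

definition poly_tens ::
  "('r, 'x) ring_scheme \<Rightarrow> ('r, 'm, 'y) module_scheme
    \<Rightarrow> (nat \<Rightarrow> 'm) \<Rightarrow> (nat \<Rightarrow> 'm) \<Rightarrow> nat \<Rightarrow> ('m \<times> 'm \<Rightarrow> 'r) set" where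
  "poly_tens R M p q = (\<lambda>n. \<Oplus>\<^bsub>tensor R M M\<^esub>i\<in>{..n}. tens R M M (p i) (q (n - i)))"

definition poly_tensor_iso ::
  "('r, 'x) ring_scheme \<Rightarrow> ('r, 'm, 'y) module_scheme
    \<Rightarrow> ((nat \<Rightarrow> 'm) \<times> (nat \<Rightarrow> 'm) \<Rightarrow> nat \<Rightarrow> 'r) set \<Rightarrow> nat \<Rightarrow> ('m \<times> 'm \<Rightarrow> 'r) set" where
  "poly_tensor_iso R M =
    tensor_lift (UP R) (poly_module R (tensor R M M)) (poly_tens R M)"

text \<open>
  A deformation is given by \<open>m\<^sub>t : (B \<otimes> B)[t] \<rightarrow> B[t]\<close> and
  \<open>\<Delta>\<^sub>t : B[t] \<rightarrow> (B \<otimes> B)[t]\<close>.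
\<close>

type_synonym ('k, 'b) deformation =
  "((nat \<Rightarrow> ('b \<times> 'b \<Rightarrow> 'k) set) \<Rightarrow> nat \<Rightarrow> 'b) \<times> ((nat \<Rightarrow> 'b) \<Rightarrow> nat \<Rightarrow> ('b \<times> 'b \<Rightarrow> 'k) set)"

definition deformation_bialgebra ::
  "('k, 'x) ring_scheme \<Rightarrow> ('k, 'b) bialg \<Rightarrow> ('k, 'b) deformation \<Rightarrow> (nat \<Rightarrow> 'k, nat \<Rightarrow> 'b) bialg" where
  "deformation_bialgebra K B D = (case D of (mt, \<Delta>t) \<Rightarrow>
    \<lparr> carrier = carrier (poly_module K B),
      mult = (\<lambda>p q. mt (poly_tens K B p q)),
      one = poly_const B \<one>\<^bsub>B\<^esub>,
      zero = zero (poly_module K B),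
      add = add (poly_module K B),
      smult = smult (poly_module K B),
      counit = (\<lambda>p j. counit B (p j)),
      comult = (\<lambda>p. inv_into (carrier (tensor (UP K) (poly_module K B) (poly_module K B)))
                  (poly_tensor_iso K B) (\<Delta>t p)) \<rparr>)"

definition deformations ::
  "('k, 'x) ring_scheme \<Rightarrow> ('k, 'b) bialg \<Rightarrow> (nat \<Rightarrow> 'b set) \<Rightarrow> ('k, 'b) deformation set" where
  "deformations K B G = {(mt, \<Delta>t).
    (let T = tensor K B B; Bt = poly_module K B; Tt = poly_module K T in
      mt \<in> module_homs (UP K) Tt Bt \<and>
      \<Delta>t \<in> module_homs (UP K) Bt Tt \<and>
      (\<forall>n. mt ` poly_degree T (tensor_degree K B G) n \<subseteq> poly_degree B G n) \<and>
      (\<forall>n. \<Delta>t ` poly_degree B G n \<subseteq> poly_degree T (tensor_degree K B G) n) \<and>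
      bialgebra (UP K) (deformation_bialgebra K B (mt, \<Delta>t)) \<and>
      (\<forall>w\<in>carrier Tt. cong_mod_t K B (mt w) (\<lambda>n. tensor_lift K B (mult B) (w n))) \<and>
      (\<forall>p\<in>carrier Bt. cong_mod_t K T (\<Delta>t p) (\<lambda>n. comult B (p n))))}"

definition deformation_iso ::
  "('k, 'x) ring_scheme \<Rightarrow> ('k, 'b) bialg \<Rightarrow> (nat \<Rightarrow> 'b set)
    \<Rightarrow> (('k, 'b) deformation \<times> ('k, 'b) deformation) set" where
  "deformation_iso K B G = {(D, D'). D \<in> deformations K B G \<and> D' \<in> deformations K B G \<and>
      (\<exists>\<phi> \<in> bialg_iso (UP K) (deformation_bialgebra K B D) (deformation_bialgebra K B D').
         (\<forall>n. \<phi> ` poly_degree B G n \<subseteq> poly_degree B G n) \<and>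
         (\<forall>p\<in>carrier (poly_module K B). cong_mod_t K B (\<phi> p) p))}"

definition iso_deformations ::
  "('k, 'x) ring_scheme \<Rightarrow> ('k, 'b) bialg \<Rightarrow> (nat \<Rightarrow> 'b set) \<Rightarrow> ('k, 'b) deformation set set" where
  "iso_deformations K B G = deformations K B G // deformation_iso K B G"

text \<open>
  The specialization at \<open>t = 1\<close> of a deformation. The naturality of the bijection between
  liftings and deformations is expressed through it.
\<close>

definition eval_at_one :: "('r, 'm, 'y) module_scheme \<Rightarrow> (nat \<Rightarrow> 'm) \<Rightarrow> 'm" where
  "eval_at_one M p = (\<Oplus>\<^bsub>M\<^esub>n\<in>{n. p n \<noteq> \<zero>\<^bsub>M\<^esub>}. p n)"

definition specialization ::
  "('k, 'x) ring_scheme \<Rightarrow> ('k, 'b) bialg \<Rightarrow> ('k, 'b) deformation \<Rightarrow> ('k, 'b) bialg" where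
  "specialization K B D = (case D of (mt, \<Delta>t) \<Rightarrow>
    B\<lparr> mult := (\<lambda>x y. eval_at_one B (mt (poly_const (tensor K B B) (tens K B B x y)))),
       comult := (\<lambda>x. eval_at_one (tensor K B B) (\<Delta>t (poly_const B x))) \<rparr>)"

end

theory Submission
  imports Defs
begin

text \<open>
  The bijection is induced by setting \<open>t = 1\<close>; its inverse is homogenization, as for the Rees algebra
  of a filtered algebra.

  Evaluation at \<open>t = 1\<close> identifies the homogeneous polynomials of degree \<open>n\<close> in \<open>M[t]\<close>, for a graded
  module \<open>M\<close>, with the step \<open>F n = \<Oplus>\<^bsub>i \<le> n\<^esub> M\<^bsub>(i)\<^esub>\<close> of the filtration. So a homogeneous
  \<open>K[t]\<close>-linear map \<open>M[t] \<rightarrow> N[t]\<close> is the same as a filtered \<open>K\<close>-linear map \<open>M \<rightarrow> N\<close>, and the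
  coefficient of \<open>t\<^sup>0\<close> in the former is the symbol of the latter, that is, the map that it induces
  on associated graded modules. Applied to \<open>m\<^sub>t : (B \<otimes> B)[t] \<rightarrow> B[t]\<close> and
  \<open>\<Delta>\<^sub>t : B[t] \<rightarrow> (B \<otimes> B)[t]\<close>, this turns the condition of being congruent to \<open>m\<close> and
  \<open>\<Delta>\<close> modulo \<open>t\<close> into the condition that the specialization has \<open>B\<close> as its associated graded
  bialgebra. Applied to isomorphisms, it turns homogeneous isomorphisms congruent to the identity
  modulo \<open>t\<close> into filtered isomorphisms with identity symbol. The correspondence is worked out in the
  locale \<open>graded_pair\<close>.

  It remains to move the axioms of a bialgebra along the correspondence. Consider a map \<open>f\<close> of
  would-be bialgebras over possibly different rings that is compatible with all structure maps. If the
  image of \<open>f\<close> generates the target, the axioms pass from the source to the target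
  (\<open>bialgebra_pushforward\<close>); if \<open>f\<close>, \<open>f \<otimes> f\<close> and \<open>f \<otimes> (f \<otimes> f)\<close> are injective, they
  pass from the target to the source (\<open>bialgebra_pullback\<close>). Evaluation at \<open>1\<close> is surjective, which
  makes every specialization a bialgebra (\<open>V_lifting\<close>). Conversely, for a lifting \<open>U\<close> the embedding
  \<open>U \<rightarrow> U[t]\<close> generates \<open>U[t]\<close>, and the Rees embedding \<open>B[t] \<rightarrow> U[t]\<close>, which sends
  \<open>b t\<^sup>j\<close> to \<open>b t\<^bsup>i+j\<^esup>\<close> for \<open>b\<close> of degree \<open>i\<close>, is injective together with its tensor
  squares and cubes; so the homogenized structure maps are a deformation (\<open>deformation_mem\<close>).

  One point is not formal. A deformation keeps the counit of \<open>B\<close>, whereas the counit \<open>\<epsilon>\<^sub>U\<close> of a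
  lifting is only required to agree with \<open>\<epsilon>\<close> in degree \<open>0\<close>. The filtered isomorphism
  \<open>b \<mapsto> b + (\<epsilon>\<^sub>U(b) - \<epsilon>(b)) 1\<close> has identity symbol and carries \<open>U\<close> to an equivalent
  lifting with counit \<open>\<epsilon>\<close> (\<open>lifting_normalize\<close>).

  Since specialization reflects and preserves equivalence (\<open>deformation_iso_iff_specialization\<close>)
  and reaches every equivalence class of liftings (\<open>lifting_deformation_exists\<close>), it induces the
  bijection on quotients.
\<close>

section \<open>Additive maps and additive spans\<close>

definition additive_maps :: "('a, 'x) ring_scheme \<Rightarrow> ('b, 'y) ring_scheme \<Rightarrow> ('a \<Rightarrow> 'b) set" where
  "additive_maps M N = {f \<in> carrier M \<rightarrow> carrier N.
     \<forall>x\<in>carrier M. \<forall>y\<in>carrier M. f (x \<oplus>\<^bsub>M\<^esub> y) = f x \<oplus>\<^bsub>N\<^esub> f y}"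

text \<open>
  Spans are taken without scalars: one generation principle then serves modules over \<open>K\<close> and over
  \<open>K[t]\<close>, and maps that are linear only after a change of scalars.
\<close>

inductive_set additive_span :: "('a, 'x) ring_scheme \<Rightarrow> 'a set \<Rightarrow> 'a set"
  for M X where
  zero: "\<zero>\<^bsub>M\<^esub> \<in> additive_span M X"
| base: "x \<in> X \<Longrightarrow> x \<in> additive_span M X"
| add: "x \<in> additive_span M X \<Longrightarrow> y \<in> additive_span M X \<Longrightarrow> x \<oplus>\<^bsub>M\<^esub> y \<in> additive_span M X"

lemma additive_mapsI:
  assumes "\<And>x. x \<in> carrier M \<Longrightarrow> f x \<in> carrier N"
    and "\<And>x y. x \<in> carrier M \<Longrightarrow> y \<in> carrier M \<Longrightarrow> f (x \<oplus>\<^bsub>M\<^esub> y) = f x \<oplus>\<^bsub>N\<^esub> f y"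
  shows "f \<in> additive_maps M N"
  using assms by (auto simp: additive_maps_def)

lemma additive_maps_closed: "f \<in> additive_maps M N \<Longrightarrow> x \<in> carrier M \<Longrightarrow> f x \<in> carrier N"
  by (auto simp: additive_maps_def)

lemma additive_maps_add:
  "f \<in> additive_maps M N \<Longrightarrow> x \<in> carrier M \<Longrightarrow> y \<in> carrier M \<Longrightarrow> f (x \<oplus>\<^bsub>M\<^esub> y) = f x \<oplus>\<^bsub>N\<^esub> f y"
  by (auto simp: additive_maps_def)

lemma additive_maps_zero:
  assumes "abelian_group M" "abelian_group N" "f \<in> additive_maps M N"
  shows "f \<zero>\<^bsub>M\<^esub> = \<zero>\<^bsub>N\<^esub>"
proof -
  interpret M: abelian_group M by fact
  interpret N: abelian_group N by fact
  have "f \<zero>\<^bsub>M\<^esub> = f \<zero>\<^bsub>M\<^esub> \<oplus>\<^bsub>N\<^esub> f \<zero>\<^bsub>M\<^esub>"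
    using additive_maps_add[OF assms(3), of "\<zero>\<^bsub>M\<^esub>" "\<zero>\<^bsub>M\<^esub>"] by simp
  moreover have "f \<zero>\<^bsub>M\<^esub> \<in> carrier N"
    using additive_maps_closed[OF assms(3)] by simp
  ultimately show ?thesis by (metis N.add.r_cancel_one')
qed

lemma additive_maps_minus:
  assumes "abelian_group M" "abelian_group N" "f \<in> additive_maps M N" "x \<in> carrier M"
  shows "f (\<ominus>\<^bsub>M\<^esub> x) = \<ominus>\<^bsub>N\<^esub> f x"
proof -
  interpret M: abelian_group M by fact
  interpret N: abelian_group N by fact
  have "f (\<ominus>\<^bsub>M\<^esub> x) \<oplus>\<^bsub>N\<^esub> f x = \<zero>\<^bsub>N\<^esub>"
    using additive_maps_add[OF assms(3), of "\<ominus>\<^bsub>M\<^esub> x" x] assms(4) additive_maps_zero[OF assms(1-3)]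
    by (simp add: M.l_neg)
  then show ?thesis
    using additive_maps_closed[OF assms(3)] assms(4) by (metis M.a_inv_closed N.minus_equality)
qed

lemma additive_maps_diff:
  assumes "abelian_group M" "abelian_group N" "f \<in> additive_maps M N" "x \<in> carrier M" "y \<in> carrier M"
  shows "f (x \<ominus>\<^bsub>M\<^esub> y) = f x \<ominus>\<^bsub>N\<^esub> f y"
proof -
  interpret M: abelian_group M by fact
  interpret N: abelian_group N by fact
  show ?thesis
    using assms by (simp add: a_minus_def additive_maps_add additive_maps_minus)
qed

lemma additive_maps_inj_onI:
  assumes "abelian_group M" "abelian_group N" "f \<in> additive_maps M N"
    and "\<And>x. x \<in> carrier M \<Longrightarrow> f x = \<zero>\<^bsub>N\<^esub> \<Longrightarrow> x = \<zero>\<^bsub>M\<^esub>"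
  shows "inj_on f (carrier M)"
proof (rule inj_onI)
  interpret M: abelian_group M by fact
  interpret N: abelian_group N by fact
  fix x y assume xy: "x \<in> carrier M" "y \<in> carrier M" "f x = f y"
  have "f (x \<ominus>\<^bsub>M\<^esub> y) = \<zero>\<^bsub>N\<^esub>"
    using xy additive_maps_closed[OF assms(3)]
    by (simp add: additive_maps_diff[OF assms(1-3)]) (simp add: N.r_neg a_minus_def)
  then have "x \<ominus>\<^bsub>M\<^esub> y = \<zero>\<^bsub>M\<^esub>" using assms(4) xy by simp
  moreover have "x = (x \<ominus>\<^bsub>M\<^esub> y) \<oplus>\<^bsub>M\<^esub> y"
    using xy by (simp add: M.minus_eq M.a_assoc M.l_neg)
  ultimately show "x = y" using xy by simp
qed

lemma additive_maps_finsum: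
  assumes "abelian_group M" "abelian_group N" "f \<in> additive_maps M N" "g \<in> A \<rightarrow> carrier M"
  shows "f (\<Oplus>\<^bsub>M\<^esub>i\<in>A. g i) = (\<Oplus>\<^bsub>N\<^esub>i\<in>A. f (g i))"
proof -
  interpret M: abelian_group M by fact
  interpret N: abelian_group N by fact
  show ?thesis
  proof (cases "finite A")
    case True
    then show ?thesis using assms(4)
    proof (induction A rule: finite_induct)
      case empty
      then show ?case using additive_maps_zero[OF assms(1-3)] by simp
    next
      case (insert a A)
      have "g \<in> A \<rightarrow> carrier M" "g a \<in> carrier M" using insert by auto
      moreover have "(\<lambda>i. f (g i)) \<in> insert a A \<rightarrow> carrier N"
        using insert additive_maps_closed[OF assms(3)] by auto
      ultimately show ?case
        using insert by (simp add: additive_maps_add[OF assms(3)] M.finsum_insert N.finsum_insert)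
    qed
  next
    case False
    then show ?thesis using additive_maps_zero[OF assms(1-3)]
      by (simp add: M.finsum_infinite N.finsum_infinite)
  qed
qed

lemma additive_maps_id: "(\<lambda>x. x) \<in> additive_maps M M"
  by (auto simp: additive_maps_def)

lemma additive_maps_comp:
  "f \<in> additive_maps M N \<Longrightarrow> g \<in> additive_maps N P \<Longrightarrow> (\<lambda>x. g (f x)) \<in> additive_maps M P"
  by (auto simp: additive_maps_def Pi_def)

lemma additive_maps_zero_map: "abelian_group N \<Longrightarrow> (\<lambda>x. \<zero>\<^bsub>N\<^esub>) \<in> additive_maps M N"
  by (auto simp: additive_maps_def abelian_group_def abelian_monoid.l_zero abelian_monoid.zero_closed)

lemma additive_maps_sum:
  assumes "abelian_group N" "\<And>i. i \<in> A \<Longrightarrow> f i \<in> additive_maps M N"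
  shows "(\<lambda>x. \<Oplus>\<^bsub>N\<^esub>i\<in>A. f i x) \<in> additive_maps M N"
proof (rule additive_mapsI)
  interpret N: abelian_group N by fact
  fix x assume x: "x \<in> carrier M"
  show "(\<Oplus>\<^bsub>N\<^esub>i\<in>A. f i x) \<in> carrier N"
    using x additive_maps_closed[OF assms(2)] by (intro N.finsum_closed) auto
  fix y assume y: "y \<in> carrier M"
  have "(\<Oplus>\<^bsub>N\<^esub>i\<in>A. f i (x \<oplus>\<^bsub>M\<^esub> y)) = (\<Oplus>\<^bsub>N\<^esub>i\<in>A. f i x \<oplus>\<^bsub>N\<^esub> f i y)"
    using x y additive_maps_add[OF assms(2)] additive_maps_closed[OF assms(2)]
    by (intro N.finsum_cong') auto
  also have "\<dots> = (\<Oplus>\<^bsub>N\<^esub>i\<in>A. f i x) \<oplus>\<^bsub>N\<^esub> (\<Oplus>\<^bsub>N\<^esub>i\<in>A. f i y)"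
    using x y additive_maps_closed[OF assms(2)] by (intro N.finsum_addf) auto
  finally show "(\<Oplus>\<^bsub>N\<^esub>i\<in>A. f i (x \<oplus>\<^bsub>M\<^esub> y)) = \<dots>" .
qed

lemma additive_maps_plus:
  assumes "abelian_group N" "f \<in> additive_maps M N" "g \<in> additive_maps M N"
  shows "(\<lambda>x. f x \<oplus>\<^bsub>N\<^esub> g x) \<in> additive_maps M N"
proof -
  interpret N: abelian_group N by fact
  show ?thesis
    using assms(2,3) by (intro additive_mapsI) (simp_all add: additive_maps_add additive_maps_closed N.a_ac)
qed

lemma additive_span_subset:
  assumes "abelian_group M" "X \<subseteq> carrier M" shows "additive_span M X \<subseteq> carrier M"
proof
  interpret M: abelian_group M by fact
  fix x assume "x \<in> additive_span M X"
  then show "x \<in> carrier M" by induction (use assms(2) in auto)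
qed

text \<open>
  The main tool below: identities between maps out of tensor products, polynomial modules and graded
  modules are all checked on generators.
\<close>

lemma additive_maps_eq:
  assumes "abelian_group M" "abelian_group N" "f \<in> additive_maps M N" "g \<in> additive_maps M N"
    and "x \<in> additive_span M X" "X \<subseteq> carrier M" "\<And>x. x \<in> X \<Longrightarrow> f x = g x"
  shows "f x = g x"
  using assms(5)
proof (induction)
  case zero
  then show ?case using additive_maps_zero[OF assms(1,2,3)] additive_maps_zero[OF assms(1,2,4)] by simp
next
  case (add x y)
  then show ?case using additive_span_subset[OF assms(1,6)] assms(3,4)
    by (simp add: additive_maps_add subset_iff)
qed (use assms(7) in auto)

lemma additive_span_finsum:
  assumes "abelian_group M" "X \<subseteq> carrier M" "\<And>i. i \<in> A \<Longrightarrow> g i \<in> additive_span M X"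
  shows "(\<Oplus>\<^bsub>M\<^esub>i\<in>A. g i) \<in> additive_span M X"
proof -
  interpret M: abelian_group M by fact
  show ?thesis
  proof (cases "finite A")
    case True
    then show ?thesis using assms(3)
    proof (induction A rule: finite_induct)
      case empty
      then show ?case by (simp add: additive_span.zero)
    next
      case (insert a A)
      have "g \<in> insert a A \<rightarrow> carrier M"
        using insert additive_span_subset[OF assms(1,2)] by auto
      then show ?case
        using insert by (simp add: M.finsum_insert Pi_def additive_span.add)
    qed
  next
    case False
    then show ?thesis by (simp add: M.finsum_infinite additive_span.zero)
  qed
qed

lemma additive_span_image:
  assumes "abelian_group M" "abelian_group N" "f \<in> additive_maps M N" "X \<subseteq> carrier M"
    and "x \<in> additive_span M X"
  shows "f x \<in> additive_span N (f ` X)"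
  using assms(5)
proof induction
  case zero
  then show ?case using additive_maps_zero[OF assms(1-3)] by (simp add: additive_span.zero)
next
  case (base x)
  then show ?case by (simp add: additive_span.base)
next
  case (add x y)
  then show ?case using additive_span_subset[OF assms(1,4)]
    by (simp add: additive_maps_add[OF assms(3)] additive_span.add subset_iff)
qed

lemma additive_span_trans:
  assumes "x \<in> additive_span M X" "\<And>x. x \<in> X \<Longrightarrow> x \<in> additive_span M Y"
  shows "x \<in> additive_span M Y"
  using assms(1) by induction (auto intro: additive_span.intros assms(2))

subsection \<open>Semilinear and bilinear maps\<close>

definition semilinear_maps ::
  "('r, 'x) ring_scheme \<Rightarrow> ('r \<Rightarrow> 's) \<Rightarrow> ('r, 'm, 'y) module_scheme \<Rightarrow> ('s, 'n, 'z) module_scheme \<Rightarrow> ('m \<Rightarrow> 'n) set" where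
  "semilinear_maps R h M N = {f \<in> additive_maps M N.
      \<forall>r\<in>carrier R. \<forall>x\<in>carrier M. f (r \<odot>\<^bsub>M\<^esub> x) = h r \<odot>\<^bsub>N\<^esub> f x}"

lemma semilinear_mapsI:
  assumes "f \<in> additive_maps M N"
    and "\<And>r x. r \<in> carrier R \<Longrightarrow> x \<in> carrier M \<Longrightarrow> f (r \<odot>\<^bsub>M\<^esub> x) = h r \<odot>\<^bsub>N\<^esub> f x"
  shows "f \<in> semilinear_maps R h M N"
  using assms by (auto simp: semilinear_maps_def)

lemma semilinear_maps_additive: "f \<in> semilinear_maps R h M N \<Longrightarrow> f \<in> additive_maps M N"
  by (auto simp: semilinear_maps_def)

lemma semilinear_maps_smult:
  "f \<in> semilinear_maps R h M N \<Longrightarrow> r \<in> carrier R \<Longrightarrow> x \<in> carrier M \<Longrightarrow> f (r \<odot>\<^bsub>M\<^esub> x) = h r \<odot>\<^bsub>N\<^esub> f x"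
  by (auto simp: semilinear_maps_def)

lemma module_homs_semilinear: "module_homs R M N = semilinear_maps R (\<lambda>r. r) M N"
  by (auto simp: semilinear_maps_def module_homs_def additive_maps_def)

lemma module_homsI:
  assumes "f \<in> additive_maps M N"
    and "\<And>r x. r \<in> carrier R \<Longrightarrow> x \<in> carrier M \<Longrightarrow> f (r \<odot>\<^bsub>M\<^esub> x) = r \<odot>\<^bsub>N\<^esub> f x"
  shows "f \<in> module_homs R M N"
  using assms by (auto simp: semilinear_maps_def module_homs_semilinear)

lemma module_homs_additive: "f \<in> module_homs R M N \<Longrightarrow> f \<in> additive_maps M N"
  by (auto simp: semilinear_maps_def module_homs_semilinear)

lemma module_homs_closed: "f \<in> module_homs R M N \<Longrightarrow> x \<in> carrier M \<Longrightarrow> f x \<in> carrier N"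
  by (auto simp: module_homs_def)

lemma module_homs_add:
  "f \<in> module_homs R M N \<Longrightarrow> x \<in> carrier M \<Longrightarrow> y \<in> carrier M \<Longrightarrow> f (x \<oplus>\<^bsub>M\<^esub> y) = f x \<oplus>\<^bsub>N\<^esub> f y"
  by (auto simp: module_homs_def)

lemma module_homs_smult:
  "f \<in> module_homs R M N \<Longrightarrow> r \<in> carrier R \<Longrightarrow> x \<in> carrier M \<Longrightarrow> f (r \<odot>\<^bsub>M\<^esub> x) = r \<odot>\<^bsub>N\<^esub> f x"
  by (auto simp: module_homs_def)

lemma module_homs_id: "(\<lambda>x. x) \<in> module_homs R M M"
  by (auto simp: module_homs_def)

lemma module_homs_comp:
  "f \<in> module_homs R M N \<Longrightarrow> g \<in> module_homs R N P \<Longrightarrow> (\<lambda>x. g (f x)) \<in> module_homs R M P"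
  by (auto simp: module_homs_def Pi_def)

lemma module_homs_sum:
  assumes "module R N" "finite A" "\<And>i. i \<in> A \<Longrightarrow> f i \<in> module_homs R M N"
  shows "(\<lambda>x. \<Oplus>\<^bsub>N\<^esub>i\<in>A. f i x) \<in> module_homs R M N"
proof -
  interpret N: module R N by fact
  show ?thesis
  proof (rule module_homsI)
    show "(\<lambda>x. \<Oplus>\<^bsub>N\<^esub>i\<in>A. f i x) \<in> additive_maps M N"
      using module_homs_additive[OF assms(3)] by (intro additive_maps_sum N.abelian_group_axioms)
    fix r x assume rx: "r \<in> carrier R" "x \<in> carrier M"
    have "(\<Oplus>\<^bsub>N\<^esub>i\<in>A. f i (r \<odot>\<^bsub>M\<^esub> x)) = (\<Oplus>\<^bsub>N\<^esub>i\<in>A. r \<odot>\<^bsub>N\<^esub> f i x)"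
      using rx module_homs_smult[OF assms(3)] module_homs_closed[OF assms(3)]
      by (intro N.finsum_cong') auto
    also have "\<dots> = r \<odot>\<^bsub>N\<^esub> (\<Oplus>\<^bsub>N\<^esub>i\<in>A. f i x)"
      using assms(2) rx module_homs_closed[OF assms(3)]
      by (intro N.finsum_smult_ldistr[symmetric]) auto
    finally show "(\<Oplus>\<^bsub>N\<^esub>i\<in>A. f i (r \<odot>\<^bsub>M\<^esub> x)) = \<dots>" .
  qed
qed

lemma module_homs_plus:
  assumes "module R N" "f \<in> module_homs R M N" "g \<in> module_homs R M N"
  shows "(\<lambda>x. f x \<oplus>\<^bsub>N\<^esub> g x) \<in> module_homs R M N"
proof -
  interpret N: module R N by fact
  show ?thesis
    using assms(2,3) additive_maps_plus[OF N.abelian_group_axioms module_homs_additive[OF assms(2)] module_homs_additive[OF assms(3)]]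
    by (intro module_homsI) (auto simp: module_homs_smult module_homs_closed N.smult_r_distr)
qed

lemma module_homs_smult_map:
  assumes "module R N" "f \<in> module_homs R M N" "a \<in> carrier R"
  shows "(\<lambda>x. a \<odot>\<^bsub>N\<^esub> f x) \<in> module_homs R M N"
proof -
  interpret N: module R N by fact
  have "a \<odot>\<^bsub>N\<^esub> (r \<odot>\<^bsub>N\<^esub> y) = r \<odot>\<^bsub>N\<^esub> (a \<odot>\<^bsub>N\<^esub> y)" if "r \<in> carrier R" "y \<in> carrier N" for r y
    using that assms(3) by (metis N.R.m_comm N.smult_assoc1)
  then show ?thesis
    using assms(2,3) by (auto simp: module_homs_def N.smult_r_distr Pi_def)
qed

definition bilinear_maps ::
  "('r, 'x) ring_scheme \<Rightarrow> ('r, 'm, 'y) module_scheme \<Rightarrow> ('r, 'n, 'z) module_scheme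
    \<Rightarrow> ('r, 'p, 'w) module_scheme \<Rightarrow> ('m \<Rightarrow> 'n \<Rightarrow> 'p) set" where
  "bilinear_maps R M N P = {\<beta>. (\<forall>y\<in>carrier N. (\<lambda>x. \<beta> x y) \<in> module_homs R M P) \<and>
     (\<forall>x\<in>carrier M. \<beta> x \<in> module_homs R N P)}"

lemma bilinear_mapsI:
  assumes "\<And>y. y \<in> carrier N \<Longrightarrow> (\<lambda>x. \<beta> x y) \<in> module_homs R M P"
    and "\<And>x. x \<in> carrier M \<Longrightarrow> (\<lambda>y. \<beta> x y) \<in> module_homs R N P"
  shows "\<beta> \<in> bilinear_maps R M N P"
  using assms by (auto simp: bilinear_maps_def)

lemma bilinear_maps_left: "\<beta> \<in> bilinear_maps R M N P \<Longrightarrow> y \<in> carrier N \<Longrightarrow> (\<lambda>x. \<beta> x y) \<in> module_homs R M P"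
  and bilinear_maps_right: "\<beta> \<in> bilinear_maps R M N P \<Longrightarrow> x \<in> carrier M \<Longrightarrow> (\<lambda>y. \<beta> x y) \<in> module_homs R N P"
  by (auto simp: bilinear_maps_def)

text \<open>
  Used where the operations of \<open>N\<close> are only known on representatives: for quotient modules and for
  the associated graded module.
\<close>

lemma module_surjective_image:
  assumes "module R M"
    and "f ` carrier M = carrier N"
    and "\<And>x y. x \<in> carrier M \<Longrightarrow> y \<in> carrier M \<Longrightarrow> f (x \<oplus>\<^bsub>M\<^esub> y) = f x \<oplus>\<^bsub>N\<^esub> f y"
    and "\<And>r x. r \<in> carrier R \<Longrightarrow> x \<in> carrier M \<Longrightarrow> f (r \<odot>\<^bsub>M\<^esub> x) = r \<odot>\<^bsub>N\<^esub> f x"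
    and "f \<zero>\<^bsub>M\<^esub> = \<zero>\<^bsub>N\<^esub>"
  shows "module R N"
proof -
  interpret M: module R M by fact
  have ex: "\<exists>x\<in>carrier M. y = f x" if "y \<in> carrier N" for y using that assms(2) by blast
  have cl: "f x \<in> carrier N" if "x \<in> carrier M" for x using that assms(2) by blast
  note h = assms(3)[symmetric] assms(4)[symmetric] assms(5)[symmetric]
  show ?thesis
  proof (rule moduleI[OF M.R.is_cring], rule abelian_groupI)
    fix x y assume "x \<in> carrier N" "y \<in> carrier N"
    then show "x \<oplus>\<^bsub>N\<^esub> y \<in> carrier N" using ex cl by (metis M.a_closed h(1))
  next
    show "\<zero>\<^bsub>N\<^esub> \<in> carrier N" by (simp add: h cl)
  next
    fix x y z assume "x \<in> carrier N" "y \<in> carrier N" "z \<in> carrier N"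
    then show "x \<oplus>\<^bsub>N\<^esub> y \<oplus>\<^bsub>N\<^esub> z = x \<oplus>\<^bsub>N\<^esub> (y \<oplus>\<^bsub>N\<^esub> z)"
      by (auto dest!: ex simp: h M.a_assoc)
  next
    fix x y assume "x \<in> carrier N" "y \<in> carrier N"
    then show "x \<oplus>\<^bsub>N\<^esub> y = y \<oplus>\<^bsub>N\<^esub> x" by (auto dest!: ex simp: h M.a_comm)
  next
    fix x assume "x \<in> carrier N"
    then show "\<zero>\<^bsub>N\<^esub> \<oplus>\<^bsub>N\<^esub> x = x" by (auto dest!: ex simp: h)
  next
    fix x assume "x \<in> carrier N"
    then obtain a where a: "a \<in> carrier M" "x = f a" using ex by blast
    show "\<exists>y\<in>carrier N. y \<oplus>\<^bsub>N\<^esub> x = \<zero>\<^bsub>N\<^esub>"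
      by (rule bexI[of _ "f (\<ominus>\<^bsub>M\<^esub> a)"]) (use a cl in \<open>auto simp: h M.l_neg\<close>)
  next
    fix a x assume "a \<in> carrier R" "x \<in> carrier N"
    then show "a \<odot>\<^bsub>N\<^esub> x \<in> carrier N" by (auto dest!: ex simp: h cl)
  next
    fix a b x assume "a \<in> carrier R" "b \<in> carrier R" "x \<in> carrier N"
    then show "(a \<oplus>\<^bsub>R\<^esub> b) \<odot>\<^bsub>N\<^esub> x = a \<odot>\<^bsub>N\<^esub> x \<oplus>\<^bsub>N\<^esub> b \<odot>\<^bsub>N\<^esub> x"
      by (auto dest!: ex simp: h M.smult_l_distr)
  next
    fix a x y assume "a \<in> carrier R" "x \<in> carrier N" "y \<in> carrier N"
    then show "a \<odot>\<^bsub>N\<^esub> (x \<oplus>\<^bsub>N\<^esub> y) = a \<odot>\<^bsub>N\<^esub> x \<oplus>\<^bsub>N\<^esub> a \<odot>\<^bsub>N\<^esub> y"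
      by (auto dest!: ex simp: h M.smult_r_distr)
  next
    fix a b x assume "a \<in> carrier R" "b \<in> carrier R" "x \<in> carrier N"
    then show "(a \<otimes>\<^bsub>R\<^esub> b) \<odot>\<^bsub>N\<^esub> x = a \<odot>\<^bsub>N\<^esub> (b \<odot>\<^bsub>N\<^esub> x)"
      by (auto dest!: ex simp: h M.smult_assoc1)
  next
    fix x assume "x \<in> carrier N"
    then show "\<one>\<^bsub>R\<^esub> \<odot>\<^bsub>N\<^esub> x = x" by (auto dest!: ex simp: h)
  qed
qed

section \<open>Finitely supported functions\<close>

definition fsingle :: "('a, 'x) ring_scheme \<Rightarrow> 's \<Rightarrow> 'a \<Rightarrow> 's \<Rightarrow> 'a" where
  "fsingle M s x = (\<lambda>s'. if s' = s then x else \<zero>\<^bsub>M\<^esub>)"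

definition support_sum :: "('a, 'x) ring_scheme \<Rightarrow> ('b, 'y) ring_scheme \<Rightarrow> ('s \<Rightarrow> 'a \<Rightarrow> 'b) \<Rightarrow> ('s \<Rightarrow> 'a) \<Rightarrow> 'b" where
  "support_sum M N F c = (\<Oplus>\<^bsub>N\<^esub>s\<in>{s. c s \<noteq> \<zero>\<^bsub>M\<^esub>}. F s (c s))"

text \<open>
  Free modules, polynomial modules \<open>M[t]\<close> and the ring \<open>K[t]\<close> have the same additive group up
  to the choice of \<open>M\<close> and \<open>S\<close>. The operations are described on the carrier only, because the
  addition of \<^term>\<open>UP K\<close> is a restricted function.
\<close>

locale finsupp_group = M?: abelian_group M
  for M :: "('a, 'x) ring_scheme" and P :: "('s \<Rightarrow> 'a, 'y) ring_scheme" and S :: "'s set" +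
  assumes carrier_P: "carrier P = {c. (\<forall>s\<in>S. c s \<in> carrier M) \<and> (\<forall>s. s \<notin> S \<longrightarrow> c s = \<zero>\<^bsub>M\<^esub>) \<and> finite {s. c s \<noteq> \<zero>\<^bsub>M\<^esub>}}"
    and zero_P: "\<zero>\<^bsub>P\<^esub> = (\<lambda>s. \<zero>\<^bsub>M\<^esub>)"
    and add_P: "c \<in> carrier P \<Longrightarrow> d \<in> carrier P \<Longrightarrow> c \<oplus>\<^bsub>P\<^esub> d = (\<lambda>s. c s \<oplus>\<^bsub>M\<^esub> d s)"
begin

lemma value_closed: "c \<in> carrier P \<Longrightarrow> c s \<in> carrier M"
  by (cases "s \<in> S") (auto simp: carrier_P)

lemma add_closed_P: "c \<in> carrier P \<Longrightarrow> d \<in> carrier P \<Longrightarrow> (\<lambda>s. c s \<oplus>\<^bsub>M\<^esub> d s) \<in> carrier P"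
proof -
  assume cd: "c \<in> carrier P" "d \<in> carrier P"
  have "{s. c s \<oplus>\<^bsub>M\<^esub> d s \<noteq> \<zero>\<^bsub>M\<^esub>} \<subseteq> {s. c s \<noteq> \<zero>\<^bsub>M\<^esub>} \<union> {s. d s \<noteq> \<zero>\<^bsub>M\<^esub>}" by auto
  then show ?thesis using cd unfolding carrier_P
    by (auto intro: finite_subset)
qed

lemma group_P: "abelian_group P"
proof (rule abelian_groupI)
  fix x y assume "x \<in> carrier P" "y \<in> carrier P"
  then show "x \<oplus>\<^bsub>P\<^esub> y \<in> carrier P" by (simp add: add_P add_closed_P)
next
  show "\<zero>\<^bsub>P\<^esub> \<in> carrier P" by (simp add: carrier_P zero_P)
next
  fix x y z assume "x \<in> carrier P" "y \<in> carrier P" "z \<in> carrier P"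
  then show "x \<oplus>\<^bsub>P\<^esub> y \<oplus>\<^bsub>P\<^esub> z = x \<oplus>\<^bsub>P\<^esub> (y \<oplus>\<^bsub>P\<^esub> z)"
    by (simp add: add_P add_closed_P value_closed a_assoc)
next
  fix x y assume "x \<in> carrier P" "y \<in> carrier P"
  then show "x \<oplus>\<^bsub>P\<^esub> y = y \<oplus>\<^bsub>P\<^esub> x" by (simp add: add_P value_closed a_comm)
next
  fix x assume x: "x \<in> carrier P"
  moreover have "(\<lambda>s. \<zero>\<^bsub>M\<^esub>) \<in> carrier P" by (simp add: carrier_P)
  ultimately show "\<zero>\<^bsub>P\<^esub> \<oplus>\<^bsub>P\<^esub> x = x" by (simp add: add_P value_closed zero_P)
next
  fix x assume x: "x \<in> carrier P"
  have m: "(\<lambda>s. \<ominus>\<^bsub>M\<^esub> x s) \<in> carrier P"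
  proof -
    have "{s. \<ominus>\<^bsub>M\<^esub> x s \<noteq> \<zero>\<^bsub>M\<^esub>} \<subseteq> {s. x s \<noteq> \<zero>\<^bsub>M\<^esub>}" by auto
    then show ?thesis using x unfolding carrier_P by (auto intro: finite_subset)
  qed
  then show "\<exists>y\<in>carrier P. y \<oplus>\<^bsub>P\<^esub> x = \<zero>\<^bsub>P\<^esub>"
    using x by (intro bexI[OF _ m]) (simp add: add_P value_closed zero_P l_neg)
qed

sublocale P: abelian_group P by (rule group_P)

lemma value_additive: "(\<lambda>c. c s) \<in> additive_maps P M"
  by (intro additive_mapsI) (auto simp: value_closed add_P)

lemma fsingle_closed: "s \<in> S \<Longrightarrow> x \<in> carrier M \<Longrightarrow> fsingle M s x \<in> carrier P"
  by (auto simp: carrier_P fsingle_def)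

lemma fsingle_additive: "s \<in> S \<Longrightarrow> fsingle M s \<in> additive_maps M P"
  by (intro additive_mapsI fsingle_closed) (auto simp: add_P fsingle_closed, auto simp: fsingle_def)

text \<open>
  Induction on a finite set that contains the support, removing one point at a time.
\<close>

lemma carrier_eq_span: "carrier P = additive_span P {fsingle M s x | s x. s \<in> S \<and> x \<in> carrier M}" (is "_ = ?span")
proof
  show "?span \<subseteq> carrier P"
    by (rule additive_span_subset[OF group_P]) (auto intro: fsingle_closed)
  show "carrier P \<subseteq> ?span"
  proof
    fix c assume c: "c \<in> carrier P"
    have "c \<in> ?span" if "finite A" "c \<in> carrier P" "{s. c s \<noteq> \<zero>\<^bsub>M\<^esub>} \<subseteq> A" for A c
      using that
    proof (induction A arbitrary: c rule: finite_induct)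
      case empty
      then have "c = \<zero>\<^bsub>P\<^esub>" by (auto simp: zero_P)
      then show ?case by (simp add: additive_span.zero)
    next
      case (insert a A)
      let ?d = "c(a := \<zero>\<^bsub>M\<^esub>)"
      have "{s. ?d s \<noteq> \<zero>\<^bsub>M\<^esub>} \<subseteq> {s. c s \<noteq> \<zero>\<^bsub>M\<^esub>}" by auto
      then have d: "?d \<in> carrier P" using insert(4) unfolding carrier_P by (auto intro: finite_subset)
      have "{s. ?d s \<noteq> \<zero>\<^bsub>M\<^esub>} \<subseteq> A" using insert(5) by auto
      then have sd: "?d \<in> ?span" using insert.IH[OF d] by blast
      show ?case
      proof (cases "a \<in> S")
        case True
        have eq: "fsingle M a (c a) \<oplus>\<^bsub>P\<^esub> ?d = c"
          using add_P[OF fsingle_closed[OF True value_closed[OF insert(4)]] d] value_closed[OF insert(4)]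
          by (auto simp: fsingle_def fun_eq_iff)
        have "fsingle M a (c a) \<in> ?span"
          using True value_closed[OF insert(4)] by (auto intro!: additive_span.base)
        from additive_span.add[OF this sd] show ?thesis unfolding eq .
      next
        case False
        then have "c a = \<zero>\<^bsub>M\<^esub>" using insert(4) by (simp add: carrier_P)
        then have "?d = c" by (simp add: fun_upd_idem)
        then show ?thesis using sd by simp
      qed
    qed
    then show "c \<in> ?span" using c by (auto simp: carrier_P)
  qed
qed

lemma additive_maps_eqI:
  assumes "abelian_group N" "f \<in> additive_maps P N" "g \<in> additive_maps P N" "c \<in> carrier P"
    and "\<And>s x. s \<in> S \<Longrightarrow> x \<in> carrier M \<Longrightarrow> f (fsingle M s x) = g (fsingle M s x)"
  shows "f c = g c"
  by (rule additive_maps_eq[OF group_P assms(1-3), of c "{fsingle M s x | s x. s \<in> S \<and> x \<in> carrier M}"])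
     (use assms carrier_eq_span fsingle_closed in auto)

text \<open>
  A larger finite index set gives the same sum, so two functions can be summed over a common set.
\<close>

lemma support_sum_eq:
  assumes "abelian_group N" "\<And>s. s \<in> S \<Longrightarrow> F s \<in> additive_maps M N" "c \<in> carrier P"
    and "finite A" "{s. c s \<noteq> \<zero>\<^bsub>M\<^esub>} \<subseteq> A" "A \<subseteq> S"
  shows "support_sum M N F c = (\<Oplus>\<^bsub>N\<^esub>s\<in>A. F s (c s))"
proof -
  interpret N: abelian_group N by fact
  show ?thesis unfolding support_sum_def
    by (rule N.add.finprod_mono_neutral_cong_left)
       (use assms additive_maps_closed[OF assms(2)] additive_maps_zero[OF abelian_group_axioms assms(1) assms(2)] in \<open>auto simp: value_closed\<close>)
qed

lemma support_subset: "c \<in> carrier P \<Longrightarrow> {s. c s \<noteq> \<zero>\<^bsub>M\<^esub>} \<subseteq> S"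
  by (auto simp: carrier_P)

lemma finite_support: "c \<in> carrier P \<Longrightarrow> finite {s. c s \<noteq> \<zero>\<^bsub>M\<^esub>}"
  by (auto simp: carrier_P)

lemma support_sum_additive:
  assumes "abelian_group N" "\<And>s. s \<in> S \<Longrightarrow> F s \<in> additive_maps M N"
  shows "support_sum M N F \<in> additive_maps P N"
proof (rule additive_mapsI)
  interpret N: abelian_group N by fact
  fix c assume c: "c \<in> carrier P"
  show "support_sum M N F c \<in> carrier N"
    unfolding support_sum_def
    using support_subset[OF c] additive_maps_closed[OF assms(2)] value_closed[OF c]
    by (intro N.finsum_closed) blast
  fix d assume d: "d \<in> carrier P"
  let ?A = "{s. c s \<noteq> \<zero>\<^bsub>M\<^esub>} \<union> {s. d s \<noteq> \<zero>\<^bsub>M\<^esub>}"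
  have fin: "finite ?A" and AS: "?A \<subseteq> S" using c d finite_support support_subset by auto
  have "support_sum M N F (c \<oplus>\<^bsub>P\<^esub> d) = (\<Oplus>\<^bsub>N\<^esub>s\<in>?A. F s ((c \<oplus>\<^bsub>P\<^esub> d) s))"
    by (rule support_sum_eq[OF assms _ fin _ AS]) (use c d in \<open>auto simp: add_P add_closed_P\<close>)
  also have "\<dots> = (\<Oplus>\<^bsub>N\<^esub>s\<in>?A. F s (c s) \<oplus>\<^bsub>N\<^esub> F s (d s))"
    using c d AS additive_maps_add[OF assms(2)] additive_maps_closed[OF assms(2)]
    by (intro N.finsum_cong') (auto simp: add_P value_closed subset_iff)
  also have "\<dots> = (\<Oplus>\<^bsub>N\<^esub>s\<in>?A. F s (c s)) \<oplus>\<^bsub>N\<^esub> (\<Oplus>\<^bsub>N\<^esub>s\<in>?A. F s (d s))"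
    using c d AS additive_maps_closed[OF assms(2)] by (intro N.finsum_addf) (auto simp: value_closed subset_iff)
  also have "\<dots> = support_sum M N F c \<oplus>\<^bsub>N\<^esub> support_sum M N F d"
    using support_sum_eq[OF assms c fin _ AS] support_sum_eq[OF assms d fin _ AS] by auto
  finally show "support_sum M N F (c \<oplus>\<^bsub>P\<^esub> d) = \<dots>" .
qed

lemma support_sum_fsingle:
  assumes "abelian_group N" "\<And>s. s \<in> S \<Longrightarrow> F s \<in> additive_maps M N" "s \<in> S" "x \<in> carrier M"
  shows "support_sum M N F (fsingle M s x) = F s x"
proof -
  interpret N: abelian_group N by fact
  have "support_sum M N F (fsingle M s x) = (\<Oplus>\<^bsub>N\<^esub>s'\<in>{s}. F s' (fsingle M s x s'))"
    by (rule support_sum_eq[OF assms(1,2)]) (use assms(3,4) in \<open>auto simp: fsingle_closed\<close>, auto simp: fsingle_def split: if_splits)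
  also have "\<dots> = F s x"
    using additive_maps_closed[OF assms(2)[OF assms(3)] assms(4)] by (simp add: fsingle_def)
  finally show ?thesis .
qed

end

section \<open>Free modules, quotients and tensor products\<close>

lemma module_finsupp:
  assumes "cring R" "finsupp_group M P S"
    and "\<And>a c. a \<in> carrier R \<Longrightarrow> c \<in> carrier P \<Longrightarrow> a \<odot>\<^bsub>P\<^esub> c = (\<lambda>s. a \<odot>\<^bsub>M\<^esub> c s)"
    and "module R M"
  shows "module R P"
proof -
  interpret M: module R M by fact
  interpret F: finsupp_group M P S by fact
  have cl: "(\<lambda>s. a \<odot>\<^bsub>M\<^esub> c s) \<in> carrier P" if "a \<in> carrier R" "c \<in> carrier P" for a c
  proof -
    have "{s. a \<odot>\<^bsub>M\<^esub> c s \<noteq> \<zero>\<^bsub>M\<^esub>} \<subseteq> {s. c s \<noteq> \<zero>\<^bsub>M\<^esub>}" using that by auto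
    then show ?thesis using that unfolding F.carrier_P by (auto intro: finite_subset)
  qed
  show ?thesis
  proof (rule moduleI[OF assms(1) F.group_P])
    fix a x assume "a \<in> carrier R" "x \<in> carrier P"
    then show "a \<odot>\<^bsub>P\<^esub> x \<in> carrier P" using cl assms(3) by simp
  next
    fix a b x assume "a \<in> carrier R" "b \<in> carrier R" "x \<in> carrier P"
    then show "(a \<oplus>\<^bsub>R\<^esub> b) \<odot>\<^bsub>P\<^esub> x = a \<odot>\<^bsub>P\<^esub> x \<oplus>\<^bsub>P\<^esub> b \<odot>\<^bsub>P\<^esub> x"
      by (simp add: assms(3) cl F.add_P F.value_closed M.smult_l_distr)
  next
    fix a x y assume "a \<in> carrier R" "x \<in> carrier P" "y \<in> carrier P"
    then show "a \<odot>\<^bsub>P\<^esub> (x \<oplus>\<^bsub>P\<^esub> y) = a \<odot>\<^bsub>P\<^esub> x \<oplus>\<^bsub>P\<^esub> a \<odot>\<^bsub>P\<^esub> y"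
      by (simp add: assms(3) cl F.add_P F.add_closed_P F.value_closed M.smult_r_distr)
  next
    fix a b x assume "a \<in> carrier R" "b \<in> carrier R" "x \<in> carrier P"
    then show "(a \<otimes>\<^bsub>R\<^esub> b) \<odot>\<^bsub>P\<^esub> x = a \<odot>\<^bsub>P\<^esub> (b \<odot>\<^bsub>P\<^esub> x)"
      by (simp add: assms(3) cl F.value_closed M.smult_assoc1)
  next
    fix x assume "x \<in> carrier P"
    then show "\<one>\<^bsub>R\<^esub> \<odot>\<^bsub>P\<^esub> x = x"
      by (simp add: assms(3) cl F.value_closed)
  qed
qed

lemma ring_is_module:
  assumes "cring R"
  shows "module R \<lparr>carrier = carrier R, mult = mult R, one = one R, zero = zero R, add = add R, smult = mult R\<rparr>"
proof -
  interpret R: cring R by fact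
  have "abelian_group \<lparr>carrier = carrier R, mult = mult R, one = one R, zero = zero R, add = add R, smult = mult R\<rparr>"
    by (rule abelian_groupI) (auto simp: R.a_ac intro: R.l_neg)
  then show ?thesis
    by (intro moduleI) (auto simp: R.is_cring R.l_distr R.r_distr R.m_assoc)
qed

lemma finsupp_free_module:
  assumes "cring R" shows "finsupp_group R (free_module R S) S"
proof -
  interpret R: cring R by fact
  show ?thesis by unfold_locales (auto simp: free_module_def)
qed

lemma free_module_module:
  assumes "cring R" shows "module R (free_module R S)"
proof -
  interpret R: cring R by fact
  interpret F: finsupp_group R "free_module R S" S by (rule finsupp_free_module[OF assms])
  let ?M = "\<lparr>carrier = carrier R, mult = mult R, one = one R, zero = zero R, add = add R, smult = mult R\<rparr>"
  interpret M: module R ?M by (rule ring_is_module[OF assms])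
  show ?thesis
  proof (rule module_finsupp[OF assms _ _ M.module_axioms])
    show "finsupp_group ?M (free_module R S) S"
      by unfold_locales (auto simp: free_module_def)
  qed (auto simp: free_module_def)
qed

lemma free_gen_fsingle: "free_gen R s = fsingle R s \<one>\<^bsub>R\<^esub>"
  by (simp add: free_gen_def fsingle_def)

lemma module_span_submodule:
  assumes "module R M" "X \<subseteq> carrier M"
  shows "submodule (module_span R M X) R M"
proof -
  interpret M: module R M by fact
  have C: "submodule (carrier M) R M" by (rule M.carrier_is_submodule)
  note E = M.submoduleE
  show ?thesis
  proof (rule M.submoduleI)
    show "module_span R M X \<subseteq> carrier M" using C assms(2) by (auto simp: module_span_def)
    show "\<zero>\<^bsub>M\<^esub> \<in> module_span R M X"
      by (auto simp: module_span_def submodule_def subgroup_def)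
  qed (auto simp: module_span_def E(3) E(4) E(5))
qed

lemma module_span_superset: "X \<subseteq> module_span R M X"
  by (auto simp: module_span_def)

lemma module_span_least: "submodule N R M \<Longrightarrow> X \<subseteq> N \<Longrightarrow> module_span R M X \<subseteq> N"
  by (auto simp: module_span_def)

lemma kernel_submodule:
  assumes "module R M" "module R N" "f \<in> module_homs R M N"
  shows "submodule {x \<in> carrier M. f x = \<zero>\<^bsub>N\<^esub>} R M"
proof -
  interpret M: module R M by fact
  interpret N: module R N by fact
  note fa = module_homs_additive[OF assms(3)]
  show ?thesis
    by (rule M.submoduleI)
       (auto simp: additive_maps_zero[OF M.abelian_group_axioms N.abelian_group_axioms fa]
        additive_maps_minus[OF M.abelian_group_axioms N.abelian_group_axioms fa]
        module_homs_add[OF assms(3)] module_homs_smult[OF assms(3)])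
qed

lemma module_span_eq_additive_span:
  assumes "module R M" "X \<subseteq> carrier M" "\<And>r x. r \<in> carrier R \<Longrightarrow> x \<in> X \<Longrightarrow> r \<odot>\<^bsub>M\<^esub> x \<in> X"
  shows "module_span R M X = additive_span M X"
proof
  interpret M: module R M by fact
  note sub = additive_span_subset[OF M.abelian_group_axioms assms(2)]
  have sm: "r \<odot>\<^bsub>M\<^esub> x \<in> additive_span M X" if "r \<in> carrier R" "x \<in> additive_span M X" for r x
    using that(2)
  proof induction
    case zero
    then show ?case using that(1) by (simp add: additive_span.zero)
  next
    case (base x)
    then show ?case using that(1) assms(3) by (simp add: additive_span.base)
  next
    case (add x y)
    then have "x \<in> carrier M" "y \<in> carrier M" using sub by auto
    then show ?case using that(1) additive_span.add[OF add.IH] by (simp add: M.smult_r_distr)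
  qed
  have "submodule (additive_span M X) R M"
  proof (rule M.submoduleI)
    fix a assume a: "a \<in> additive_span M X"
    have "\<ominus>\<^bsub>M\<^esub> a = (\<ominus>\<^bsub>R\<^esub> \<one>\<^bsub>R\<^esub>) \<odot>\<^bsub>M\<^esub> a"
      using a sub by (simp add: M.smult_l_minus subset_iff)
    then show "\<ominus>\<^bsub>M\<^esub> a \<in> additive_span M X" using sm a by simp
  qed (use sub sm in \<open>auto intro: additive_span.intros\<close>)
  then show "module_span R M X \<subseteq> additive_span M X"
    by (rule module_span_least) (auto intro: additive_span.base)
  interpret S: submodule "module_span R M X" R M by (rule module_span_submodule[OF assms(1,2)])
  show "additive_span M X \<subseteq> module_span R M X"
  proof
    fix x assume "x \<in> additive_span M X"
    then show "x \<in> module_span R M X"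
    proof induction
      case zero then show ?case using S.one_closed by simp
    next
      case (base x) then show ?case using module_span_superset[of X R M] by auto
    next
      case (add x y) then show ?case using S.m_closed by simp
    qed
  qed
qed

subsection \<open>Quotients\<close>

locale quotient = M?: module R M for R (structure) and M (structure) +
  fixes N
  assumes sub: "submodule N R M"
begin

lemma subgroup_N: "subgroup N (add_monoid M)" using sub by (simp add: submodule_def)

sublocale N: abelian_subgroup N M
  by (rule abelian_subgroupI3[OF additive_subgroupI[OF subgroup_N] abelian_group_axioms])

lemma coset_eq: "x \<in> carrier M \<Longrightarrow> y \<in> N +>\<^bsub>M\<^esub> x \<Longrightarrow> N +>\<^bsub>M\<^esub> y = N +>\<^bsub>M\<^esub> x"
  using a_repr_independence[OF _ _ subgroup_N] by simp

lemma mem_coset_self: "x \<in> carrier M \<Longrightarrow> x \<in> N +>\<^bsub>M\<^esub> x" by (rule N.a_rcos_self)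

lemma coset_mem_iff: "x \<in> carrier M \<Longrightarrow> y \<in> N +>\<^bsub>M\<^esub> x \<longleftrightarrow> (\<exists>n\<in>N. y = n \<oplus>\<^bsub>M\<^esub> x)"
  by (auto simp: a_r_coset_def')

lemma coset_add: "x \<in> carrier M \<Longrightarrow> y \<in> carrier M \<Longrightarrow> N +>\<^bsub>M\<^esub> (x \<oplus>\<^bsub>M\<^esub> y) = (N +>\<^bsub>M\<^esub> x) <+>\<^bsub>M\<^esub> (N +>\<^bsub>M\<^esub> y)"
  by (rule N.a_rcos_sum[symmetric])

text \<open>
  The union in the definition of \<open>quotient_module\<close> runs over equal cosets, since \<open>N\<close> absorbs
  \<open>r\<close> times the difference of two representatives.
\<close>

lemma coset_smult:
  assumes "r \<in> carrier R" "x \<in> carrier M"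
  shows "N +>\<^bsub>M\<^esub> (r \<odot>\<^bsub>M\<^esub> x) = (\<Union>y\<in>N +>\<^bsub>M\<^esub> x. N +>\<^bsub>M\<^esub> (r \<odot>\<^bsub>M\<^esub> y))"
proof -
  have "N +>\<^bsub>M\<^esub> (r \<odot>\<^bsub>M\<^esub> y) = N +>\<^bsub>M\<^esub> (r \<odot>\<^bsub>M\<^esub> x)" if "y \<in> N +>\<^bsub>M\<^esub> x" for y
  proof -
    obtain n where n: "n \<in> N" "y = n \<oplus>\<^bsub>M\<^esub> x" using \<open>y \<in> _\<close> coset_mem_iff[OF assms(2)] by blast
    then have "r \<odot>\<^bsub>M\<^esub> y = r \<odot>\<^bsub>M\<^esub> n \<oplus>\<^bsub>M\<^esub> r \<odot>\<^bsub>M\<^esub> x"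
      using assms N.a_subset by (auto simp: smult_r_distr subset_iff)
    moreover have "r \<odot>\<^bsub>M\<^esub> n \<in> N" using submoduleE(4)[OF sub] n assms by simp
    ultimately have "r \<odot>\<^bsub>M\<^esub> y \<in> N +>\<^bsub>M\<^esub> (r \<odot>\<^bsub>M\<^esub> x)"
      using assms coset_mem_iff[of "r \<odot>\<^bsub>M\<^esub> x"] by simp
    then show ?thesis using assms by (intro coset_eq) simp_all
  qed
  then have "(\<Union>y\<in>N +>\<^bsub>M\<^esub> x. N +>\<^bsub>M\<^esub> (r \<odot>\<^bsub>M\<^esub> y)) = (\<Union>y\<in>N +>\<^bsub>M\<^esub> x. N +>\<^bsub>M\<^esub> (r \<odot>\<^bsub>M\<^esub> x))"
    by (intro SUP_cong refl)
  also have "\<dots> = N +>\<^bsub>M\<^esub> (r \<odot>\<^bsub>M\<^esub> x)" using mem_coset_self[OF assms(2)] by auto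
  finally show ?thesis by (rule sym)
qed

lemma coset_zero: "N +>\<^bsub>M\<^esub> \<zero>\<^bsub>M\<^esub> = N" using N.a_subset by simp

lemma quotient_carrier: "carrier (quotient_module M N) = (\<lambda>x. N +>\<^bsub>M\<^esub> x) ` carrier M"
  by (auto simp: quotient_module_def A_RCOSETS_def')

lemma quotient_module: "module R (quotient_module M N)"
  by (rule module_surjective_image[OF module_axioms quotient_carrier[symmetric]])
     (auto simp: quotient_module_def coset_add coset_smult coset_zero)

lemma coset_hom: "(\<lambda>x. N +>\<^bsub>M\<^esub> x) \<in> module_homs R M (quotient_module M N)"
  by (intro module_homsI additive_mapsI)
     (auto simp: quotient_carrier coset_add coset_smult, auto simp: quotient_module_def)

end

subsection \<open>The universal property of the tensor product\<close>

locale tensor_product = M?: module R M + N: module R N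
  for R :: "('r, 'x) ring_scheme" (structure) and M :: "('r, 'm, 'y) module_scheme"
    and N :: "('r, 'n, 'z) module_scheme"
begin

abbreviation "T \<equiv> tensor R M N"
abbreviation "F \<equiv> free_module R (carrier M \<times> carrier N)"
abbreviation "g \<equiv> free_gen R"

sublocale F: finsupp_group R F "carrier M \<times> carrier N"
  by (rule finsupp_free_module[OF R.is_cring])

sublocale F: module R F by (rule free_module_module[OF R.is_cring])

lemma gen_closed: "x \<in> carrier M \<Longrightarrow> y \<in> carrier N \<Longrightarrow> g (x, y) \<in> carrier F"
  unfolding free_gen_fsingle by (intro F.fsingle_closed) auto

lemma relators_closed: "tensor_relators R M N \<subseteq> carrier F"
  by (auto simp: tensor_relators_def Let_def gen_closed)

sublocale Q: quotient R F "tensor_null R M N"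
  using module_span_submodule[OF F.module_axioms relators_closed]
  by (intro quotient.intro F.module_axioms quotient_axioms.intro) (simp add: tensor_null_def)

lemma tensor_eq: "T = quotient_module F (tensor_null R M N)" by (simp add: tensor_def)

lemma module_T: "module R T" unfolding tensor_eq by (rule Q.quotient_module)

sublocale T: module R T by (rule module_T)

abbreviation "q c \<equiv> tensor_null R M N +>\<^bsub>F\<^esub> c"

lemma q_hom: "q \<in> module_homs R F T" unfolding tensor_eq by (rule Q.coset_hom)

lemma carrier_T: "carrier T = q ` carrier F" unfolding tensor_eq by (rule Q.quotient_carrier)

lemma tens_eq: "tens R M N x y = q (g (x, y))" by (simp add: tens_def)

lemma tens_closed [simp, intro]: "x \<in> carrier M \<Longrightarrow> y \<in> carrier N \<Longrightarrow> tens R M N x y \<in> carrier T"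
  unfolding tens_eq by (rule module_homs_closed[OF q_hom gen_closed])

lemma q_eq:
  assumes "a \<in> carrier F" "b \<in> carrier F" "a \<ominus>\<^bsub>F\<^esub> b \<in> tensor_relators R M N"
  shows "q a = q b"
proof -
  have "a \<ominus>\<^bsub>F\<^esub> b \<in> tensor_null R M N"
    using assms(3) module_span_superset[of "tensor_relators R M N" R F] unfolding tensor_null_def by auto
  moreover have "a = (a \<ominus>\<^bsub>F\<^esub> b) \<oplus>\<^bsub>F\<^esub> b"
    using assms(1,2) by (simp add: a_minus_def F.P.a_assoc F.P.l_neg)
  ultimately have "a \<in> q b" using assms(1) Q.coset_mem_iff[OF assms(2)] by blast
  then show ?thesis using assms(2) by (intro Q.coset_eq)
qed

lemma tens_add_left:
  assumes "x \<in> carrier M" "x' \<in> carrier M" "y \<in> carrier N"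
  shows "tens R M N (x \<oplus>\<^bsub>M\<^esub> x') y = tens R M N x y \<oplus>\<^bsub>T\<^esub> tens R M N x' y"
proof -
  have "q (g (x \<oplus>\<^bsub>M\<^esub> x', y)) = q (g (x, y) \<oplus>\<^bsub>F\<^esub> g (x', y))"
    by (rule q_eq) (use assms in \<open>simp_all add: gen_closed\<close>, use assms in \<open>unfold tensor_relators_def Let_def, blast\<close>)
  then show ?thesis using assms by (simp add: tens_eq module_homs_add[OF q_hom] gen_closed)
qed

lemma tens_add_right:
  assumes "x \<in> carrier M" "y \<in> carrier N" "y' \<in> carrier N"
  shows "tens R M N x (y \<oplus>\<^bsub>N\<^esub> y') = tens R M N x y \<oplus>\<^bsub>T\<^esub> tens R M N x y'"
proof -
  have "q (g (x, y \<oplus>\<^bsub>N\<^esub> y')) = q (g (x, y) \<oplus>\<^bsub>F\<^esub> g (x, y'))"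
    by (rule q_eq) (use assms in \<open>simp_all add: gen_closed\<close>, use assms in \<open>unfold tensor_relators_def Let_def, blast\<close>)
  then show ?thesis using assms by (simp add: tens_eq module_homs_add[OF q_hom] gen_closed)
qed

lemma tens_smult_left:
  assumes "r \<in> carrier R" "x \<in> carrier M" "y \<in> carrier N"
  shows "tens R M N (r \<odot>\<^bsub>M\<^esub> x) y = r \<odot>\<^bsub>T\<^esub> tens R M N x y"
proof -
  have "q (g (r \<odot>\<^bsub>M\<^esub> x, y)) = q (r \<odot>\<^bsub>F\<^esub> g (x, y))"
    by (rule q_eq) (use assms in \<open>simp_all add: gen_closed\<close>, use assms in \<open>unfold tensor_relators_def Let_def, blast\<close>)
  then show ?thesis using assms by (simp add: tens_eq module_homs_smult[OF q_hom] gen_closed)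
qed

lemma tens_smult_right:
  assumes "r \<in> carrier R" "x \<in> carrier M" "y \<in> carrier N"
  shows "tens R M N x (r \<odot>\<^bsub>N\<^esub> y) = r \<odot>\<^bsub>T\<^esub> tens R M N x y"
proof -
  have "q (g (x, r \<odot>\<^bsub>N\<^esub> y)) = q (r \<odot>\<^bsub>F\<^esub> g (x, y))"
    by (rule q_eq) (use assms in \<open>simp_all add: gen_closed\<close>, use assms in \<open>unfold tensor_relators_def Let_def, blast\<close>)
  then show ?thesis using assms by (simp add: tens_eq module_homs_smult[OF q_hom] gen_closed)
qed

lemma tens_bilinear: "tens R M N \<in> bilinear_maps R M N T"
  by (intro bilinear_mapsI module_homsI additive_mapsI)
     (auto simp: tens_add_left tens_add_right tens_smult_left tens_smult_right)

definition "pure_tensors = {tens R M N x y | x y. x \<in> carrier M \<and> y \<in> carrier N}"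

lemma pure_tensors_closed: "pure_tensors \<subseteq> carrier T"
  by (auto simp: pure_tensors_def)

text \<open>
  A generator \<open>r (x, y)\<close> of the free module becomes the pure tensor \<open>(r x) \<otimes> y\<close>, so no scalars
  are left over.
\<close>

lemma tensor_span: "carrier T = additive_span T pure_tensors"
proof
  show "additive_span T pure_tensors \<subseteq> carrier T"
    by (rule additive_span_subset[OF T.abelian_group_axioms pure_tensors_closed])
  show "carrier T \<subseteq> additive_span T pure_tensors"
  proof
    fix w assume "w \<in> carrier T"
    then obtain c where c: "c \<in> carrier F" "w = q c" unfolding carrier_T by blast
    let ?X = "{fsingle R s x | s x. s \<in> carrier M \<times> carrier N \<and> x \<in> carrier R}"
    have X: "?X \<subseteq> carrier F" using F.fsingle_closed by auto
    have "q c \<in> additive_span T (q ` ?X)"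
      using c F.carrier_eq_span
      by (intro additive_span_image[OF F.P.abelian_group_axioms T.abelian_group_axioms module_homs_additive[OF q_hom] X]) simp
    moreover have "z \<in> additive_span T pure_tensors" if "z \<in> q ` ?X" for z
    proof -
      from that obtain x y r where z: "z = q (fsingle R (x, y) r)" "x \<in> carrier M" "y \<in> carrier N" "r \<in> carrier R"
        by auto
      have "fsingle R (x, y) r = r \<odot>\<^bsub>F\<^esub> g (x, y)"
        using z by (auto simp: fsingle_def free_module_def free_gen_def)
      then have "z = tens R M N (r \<odot>\<^bsub>M\<^esub> x) y"
        using z by (simp add: tens_eq[symmetric] tens_smult_left module_homs_smult[OF q_hom] gen_closed)
      then show ?thesis using z unfolding pure_tensors_def by (intro additive_span.base) auto
    qed
    ultimately show "w \<in> additive_span T pure_tensors" unfolding c(2) by (rule additive_span_trans)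
  qed
qed

lemma tensor_induct [consumes 1, case_names zero tens add]:
  assumes "w \<in> carrier T" "Q \<zero>\<^bsub>T\<^esub>"
    and "\<And>x y. x \<in> carrier M \<Longrightarrow> y \<in> carrier N \<Longrightarrow> Q (tens R M N x y)"
    and "\<And>u v. u \<in> carrier T \<Longrightarrow> v \<in> carrier T \<Longrightarrow> Q u \<Longrightarrow> Q v \<Longrightarrow> Q (u \<oplus>\<^bsub>T\<^esub> v)"
  shows "Q w"
proof -
  have "w \<in> additive_span T pure_tensors" using assms(1) tensor_span by simp
  then show ?thesis
  proof induction
    case (add x y)
    then show ?case using assms(4) tensor_span by simp
  qed (use assms(2,3) in \<open>auto simp: pure_tensors_def\<close>)
qed

lemma tensor_maps_eqI:
  assumes "abelian_group P" "f \<in> additive_maps T P" "h \<in> additive_maps T P" "w \<in> carrier T"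
    and "\<And>x y. x \<in> carrier M \<Longrightarrow> y \<in> carrier N \<Longrightarrow> f (tens R M N x y) = h (tens R M N x y)"
  shows "f w = h w"
  by (rule additive_maps_eq[OF T.abelian_group_axioms assms(1-3), of w pure_tensors])
     (use assms(4,5) tensor_span pure_tensors_closed in \<open>auto simp: pure_tensors_def\<close>)

text \<open>
  The extension of \<open>\<beta>\<close> to the free module is linear and kills the relators, hence the submodule
  that they span. It is therefore constant on cosets, which makes the definite description in
  \<open>tensor_lift\<close> denote its value.
\<close>

lemma tensor_lift_exists:
  assumes P: "module R P" and \<beta>: "\<beta> \<in> bilinear_maps R M N P"
  shows "tensor_lift R P \<beta> \<in> module_homs R T P \<and>
    (\<forall>x\<in>carrier M. \<forall>y\<in>carrier N. tensor_lift R P \<beta> (tens R M N x y) = \<beta> x y)"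
proof -
  interpret P: module R P by fact
  note \<beta>l = bilinear_maps_left[OF \<beta>] and \<beta>r = bilinear_maps_right[OF \<beta>]
  have \<beta>_closed: "\<beta> x y \<in> carrier P" if "x \<in> carrier M" "y \<in> carrier N" for x y
    using that module_homs_closed[OF \<beta>l] by simp
  let ?E = "support_sum R P (\<lambda>s r. r \<odot>\<^bsub>P\<^esub> \<beta> (fst s) (snd s))"
  have Fs: "(\<lambda>r. r \<odot>\<^bsub>P\<^esub> \<beta> (fst s) (snd s)) \<in> additive_maps R P" if "s \<in> carrier M \<times> carrier N" for s
    using that by (intro additive_mapsI) (auto simp: \<beta>_closed P.smult_l_distr)
  have Ea: "?E \<in> additive_maps F P"
    by (rule F.support_sum_additive[OF P.abelian_group_axioms Fs])
  have Esingle: "?E (fsingle R (x, y) r) = r \<odot>\<^bsub>P\<^esub> \<beta> x y" if "x \<in> carrier M" "y \<in> carrier N" "r \<in> carrier R" for x y r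
    using F.support_sum_fsingle[OF P.abelian_group_axioms, of "\<lambda>s r. r \<odot>\<^bsub>P\<^esub> \<beta> (fst s) (snd s)" "(x, y)" r] Fs that by simp
  have Eg: "?E (g (x, y)) = \<beta> x y" if "x \<in> carrier M" "y \<in> carrier N" for x y
    using Esingle[OF that] that by (simp add: free_gen_fsingle \<beta>_closed)
  have Eh: "?E \<in> module_homs R F P"
  proof (rule module_homsI[OF Ea])
    fix r c assume r: "r \<in> carrier R" and c: "c \<in> carrier F"
    show "?E (r \<odot>\<^bsub>F\<^esub> c) = r \<odot>\<^bsub>P\<^esub> ?E c"
    proof (rule F.additive_maps_eqI[OF P.abelian_group_axioms _ _ c])
      show "(\<lambda>c. ?E (r \<odot>\<^bsub>F\<^esub> c)) \<in> additive_maps F P"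
        by (rule additive_maps_comp[OF _ Ea]) (use r in \<open>auto intro!: additive_mapsI simp: F.smult_r_distr\<close>)
      show "(\<lambda>c. r \<odot>\<^bsub>P\<^esub> ?E c) \<in> additive_maps F P"
        by (rule additive_maps_comp[OF Ea]) (use r in \<open>auto intro!: additive_mapsI simp: P.smult_r_distr\<close>)
      fix s a assume s: "s \<in> carrier M \<times> carrier N" and a: "a \<in> carrier R"
      have "r \<odot>\<^bsub>F\<^esub> fsingle R s a = fsingle R s (r \<otimes>\<^bsub>R\<^esub> a)"
        using r a by (auto simp: fsingle_def free_module_def)
      then show "?E (r \<odot>\<^bsub>F\<^esub> fsingle R s a) = r \<odot>\<^bsub>P\<^esub> ?E (fsingle R s a)"
        using s r a by (auto simp: Esingle \<beta>_closed P.smult_assoc1)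
    qed
  qed
  have ker: "?E n = \<zero>\<^bsub>P\<^esub>" if "n \<in> tensor_null R M N" for n
  proof -
    have diff: "?E (a \<ominus>\<^bsub>F\<^esub> b) = ?E a \<ominus>\<^bsub>P\<^esub> ?E b" if "a \<in> carrier F" "b \<in> carrier F" for a b
      by (rule additive_maps_diff[OF F.P.abelian_group_axioms P.abelian_group_axioms Ea that])
    have "tensor_relators R M N \<subseteq> {x \<in> carrier F. ?E x = \<zero>\<^bsub>P\<^esub>}"
      unfolding tensor_relators_def Let_def
      by (auto simp: gen_closed diff additive_maps_add[OF Ea] module_homs_smult[OF Eh] Eg
          module_homs_add[OF \<beta>l] module_homs_add[OF \<beta>r] module_homs_smult[OF \<beta>l] module_homs_smult[OF \<beta>r]
          \<beta>_closed P.r_neg P.minus_eq)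
    from module_span_least[OF kernel_submodule[OF F.module_axioms P Eh] this] that
    show ?thesis unfolding tensor_null_def by auto
  qed
  have lift: "tensor_lift R P \<beta> (q c) = ?E c" if c: "c \<in> carrier F" for c
  proof -
    have const: "?E d = ?E c" if "d \<in> q c" for d
    proof -
      obtain n where n: "n \<in> tensor_null R M N" "d = n \<oplus>\<^bsub>F\<^esub> c"
        using \<open>d \<in> q c\<close> Q.coset_mem_iff[OF c] by blast
      then have "n \<in> carrier F" using Q.N.a_subset n(1) by blast
      then show ?thesis using n c ker additive_maps_add[OF Ea] additive_maps_closed[OF Ea] by simp
    qed
    have "(THE p. \<forall>d\<in>q c. p = ?E d) = ?E c"
    proof (rule the_equality)
      show "\<forall>d\<in>q c. ?E c = ?E d" using const[symmetric] by blast
      show "p = ?E c" if "\<forall>d\<in>q c. p = ?E d" for p using that Q.mem_coset_self[OF c] by (rule bspec)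
    qed
    then show ?thesis by (simp add: tensor_lift_def support_sum_def)
  qed
  show ?thesis
  proof (intro conjI ballI)
    show "tensor_lift R P \<beta> \<in> module_homs R T P"
    proof (intro module_homsI additive_mapsI)
      fix w assume "w \<in> carrier T"
      then obtain c where c: "c \<in> carrier F" "w = q c" unfolding carrier_T by blast
      show "tensor_lift R P \<beta> w \<in> carrier P" using c lift additive_maps_closed[OF Ea] by simp
      fix r assume r: "r \<in> carrier R"
      show "tensor_lift R P \<beta> (r \<odot>\<^bsub>T\<^esub> w) = r \<odot>\<^bsub>P\<^esub> tensor_lift R P \<beta> w"
        using c r module_homs_smult[OF Eh] by (simp add: lift module_homs_smult[OF q_hom, symmetric])
    next
      fix w v assume "w \<in> carrier T" "v \<in> carrier T"
      then obtain c d where c: "c \<in> carrier F" "w = q c" "d \<in> carrier F" "v = q d" unfolding carrier_T by blast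
      show "tensor_lift R P \<beta> (w \<oplus>\<^bsub>T\<^esub> v) = tensor_lift R P \<beta> w \<oplus>\<^bsub>P\<^esub> tensor_lift R P \<beta> v"
        using c module_homs_add[OF Eh] by (simp add: lift module_homs_add[OF q_hom, symmetric])
    qed
    fix x y assume "x \<in> carrier M" "y \<in> carrier N"
    then show "tensor_lift R P \<beta> (tens R M N x y) = \<beta> x y" by (simp add: tens_eq lift gen_closed Eg)
  qed
qed

lemma tensor_lift_hom:
  "module R P \<Longrightarrow> \<beta> \<in> bilinear_maps R M N P \<Longrightarrow> tensor_lift R P \<beta> \<in> module_homs R T P"
  using tensor_lift_exists by blast

lemma tensor_lift_tens:
  "module R P \<Longrightarrow> \<beta> \<in> bilinear_maps R M N P \<Longrightarrow> x \<in> carrier M \<Longrightarrow> y \<in> carrier N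
    \<Longrightarrow> tensor_lift R P \<beta> (tens R M N x y) = \<beta> x y"
  using tensor_lift_exists by blast

end

subsection \<open>Tensor products of semilinear maps\<close>

text \<open>
  Semilinear maps are linear maps into the module with restricted scalars. This gives semilinear maps on
  tensor products from the universal property for linear ones.
\<close>

definition restrict_scalars :: "('r \<Rightarrow> 's) \<Rightarrow> ('s, 'n, 'z) module_scheme \<Rightarrow> ('r, 'n) module" where
  "restrict_scalars h N = \<lparr>carrier = carrier N, mult = mult N, one = one N, zero = zero N, add = add N,
     smult = (\<lambda>r x. h r \<odot>\<^bsub>N\<^esub> x)\<rparr>"

lemma restrict_scalars_module:
  assumes "cring R" "module S N" "h \<in> ring_hom R S"
  shows "module R (restrict_scalars h N)"
proof -
  interpret N: module S N by fact
  interpret R: cring R by fact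
  have "abelian_group (restrict_scalars h N)"
    unfolding restrict_scalars_def by (rule abelian_groupI) (auto simp: N.a_ac intro: N.l_neg)
  then show ?thesis
    by (intro moduleI assms(1))
       (auto simp: restrict_scalars_def ring_hom_closed[OF assms(3)] ring_hom_add[OF assms(3)]
         ring_hom_mult[OF assms(3)] ring_hom_one[OF assms(3)] N.smult_l_distr N.smult_r_distr N.smult_assoc1)
qed

lemma semilinear_maps_restrict: "semilinear_maps R h M N = module_homs R M (restrict_scalars h N)"
  by (auto simp: semilinear_maps_def module_homs_def additive_maps_def restrict_scalars_def)

definition semi_tensor ::
  "('r, 'x) ring_scheme \<Rightarrow> ('r \<Rightarrow> 's) \<Rightarrow> ('s, 'w) ring_scheme \<Rightarrow> ('s, 'p, 'y) module_scheme \<Rightarrow> ('s, 'q, 'z) module_scheme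
    \<Rightarrow> ('m \<Rightarrow> 'p) \<Rightarrow> ('n \<Rightarrow> 'q) \<Rightarrow> ('m \<times> 'n \<Rightarrow> 'r) set \<Rightarrow> ('p \<times> 'q \<Rightarrow> 's) set" where
  "semi_tensor R h S P Q f g =
     tensor_lift R (restrict_scalars h (tensor S P Q)) (\<lambda>x y. tens S P Q (f x) (g y))"

context tensor_product
begin

lemma tens_comp_bilinear:
  assumes "h \<in> ring_hom R S" "module S M'" "module S N'"
    and "f \<in> semilinear_maps R h M M'" "k \<in> semilinear_maps R h N N'"
  shows "(\<lambda>x y. tens S M' N' (f x) (k y)) \<in> bilinear_maps R M N (restrict_scalars h (tensor S M' N'))"
proof -
  interpret T': tensor_product S M' N' using assms(2,3) by (rule tensor_product.intro)
  note f = additive_maps_closed[OF semilinear_maps_additive[OF assms(4)]]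
    additive_maps_add[OF semilinear_maps_additive[OF assms(4)]] semilinear_maps_smult[OF assms(4)]
  note k = additive_maps_closed[OF semilinear_maps_additive[OF assms(5)]]
    additive_maps_add[OF semilinear_maps_additive[OF assms(5)]] semilinear_maps_smult[OF assms(5)]
  show ?thesis
    unfolding bilinear_maps_def semilinear_maps_restrict[symmetric]
    by (auto intro!: semilinear_mapsI additive_mapsI simp: f k ring_hom_closed[OF assms(1)]
        T'.tens_add_left T'.tens_add_right T'.tens_smult_left T'.tens_smult_right)
qed

lemma semi_tensor_semilinear:
  assumes "h \<in> ring_hom R S" "module S M'" "module S N'"
    and "f \<in> semilinear_maps R h M M'" "k \<in> semilinear_maps R h N N'"
  shows "semi_tensor R h S M' N' f k \<in> semilinear_maps R h T (tensor S M' N')"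
proof -
  interpret T': tensor_product S M' N' using assms(2,3) by (rule tensor_product.intro)
  show ?thesis
    unfolding semi_tensor_def semilinear_maps_restrict
    by (rule tensor_lift_hom[OF restrict_scalars_module[OF R.is_cring T'.module_T assms(1)] tens_comp_bilinear[OF assms]])
qed

lemma semi_tensor_tens:
  assumes "h \<in> ring_hom R S" "module S M'" "module S N'"
    and "f \<in> semilinear_maps R h M M'" "k \<in> semilinear_maps R h N N'"
    and "x \<in> carrier M" "y \<in> carrier N"
  shows "semi_tensor R h S M' N' f k (tens R M N x y) = tens S M' N' (f x) (k y)"
proof -
  interpret T': tensor_product S M' N' using assms(2,3) by (rule tensor_product.intro)
  show ?thesis
    unfolding semi_tensor_def
    by (rule tensor_lift_tens[OF restrict_scalars_module[OF R.is_cring T'.module_T assms(1)] tens_comp_bilinear[OF assms(1-5)] assms(6,7)])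
qed

lemma tensor_map_bilinear:
  assumes "module R M'" "module R N'" "f \<in> module_homs R M M'" "k \<in> module_homs R N N'"
  shows "(\<lambda>x y. tens R M' N' (f x) (k y)) \<in> bilinear_maps R M N (tensor R M' N')"
proof -
  interpret T': tensor_product R M' N' using assms(1,2) by (rule tensor_product.intro)
  note h = module_homs_closed[OF assms(3)] module_homs_closed[OF assms(4)] module_homs_add[OF assms(3)]
    module_homs_add[OF assms(4)] module_homs_smult[OF assms(3)] module_homs_smult[OF assms(4)]
  show ?thesis
    by (auto intro!: bilinear_mapsI module_homsI additive_mapsI simp: h
        T'.tens_add_left T'.tens_add_right T'.tens_smult_left T'.tens_smult_right)
qed

lemma tensor_map_hom:
  assumes "module R M'" "module R N'" "f \<in> module_homs R M M'" "k \<in> module_homs R N N'"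
  shows "tensor_map R M' N' f k \<in> module_homs R T (tensor R M' N')"
proof -
  interpret T': tensor_product R M' N' using assms(1,2) by (rule tensor_product.intro)
  show ?thesis unfolding tensor_map_def
    by (rule tensor_lift_hom[OF T'.module_T tensor_map_bilinear[OF assms]])
qed

lemma tensor_map_tens:
  assumes "module R M'" "module R N'" "f \<in> module_homs R M M'" "k \<in> module_homs R N N'"
    "x \<in> carrier M" "y \<in> carrier N"
  shows "tensor_map R M' N' f k (tens R M N x y) = tens R M' N' (f x) (k y)"
proof -
  interpret T': tensor_product R M' N' using assms(1,2) by (rule tensor_product.intro)
  show ?thesis unfolding tensor_map_def
    by (rule tensor_lift_tens[OF T'.module_T tensor_map_bilinear[OF assms(1-4)] assms(5,6)])
qed

lemma tensor_map_comp:
  assumes "module R M'" "module R N'" "f \<in> module_homs R M M'" "k \<in> module_homs R N N'"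
    and "module R M''" "module R N''" "f' \<in> module_homs R M' M''" "k' \<in> module_homs R N' N''"
    and w: "w \<in> carrier T"
  shows "tensor_map R M'' N'' f' k' (tensor_map R M' N' f k w) = tensor_map R M'' N'' (\<lambda>x. f' (f x)) (\<lambda>y. k' (k y)) w"
proof -
  interpret T': tensor_product R M' N' using assms(1,2) by (rule tensor_product.intro)
  interpret T'': tensor_product R M'' N'' using assms(5,6) by (rule tensor_product.intro)
  note c1 = module_homs_comp[OF assms(3,7)] and c2 = module_homs_comp[OF assms(4,8)]
  show ?thesis
    by (rule tensor_maps_eqI[OF T''.T.abelian_group_axioms
          module_homs_additive[OF module_homs_comp[OF tensor_map_hom[OF assms(1-4)] T'.tensor_map_hom[OF assms(5-8)]]]
          module_homs_additive[OF tensor_map_hom[OF assms(5,6) c1 c2]] w])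
       (simp add: tensor_map_tens[OF assms(1-4)] tensor_map_tens[OF assms(5,6) c1 c2]
         T'.tensor_map_tens[OF assms(5-8)] module_homs_closed[OF assms(3)] module_homs_closed[OF assms(4)])
qed

lemma tensor_map_ident:
  assumes "f \<in> module_homs R M M" "k \<in> module_homs R N N"
    and "\<And>x. x \<in> carrier M \<Longrightarrow> f x = x" "\<And>x. x \<in> carrier N \<Longrightarrow> k x = x" "w \<in> carrier T"
  shows "tensor_map R M N f k w = w"
  by (rule tensor_maps_eqI[OF T.abelian_group_axioms
        module_homs_additive[OF tensor_map_hom[OF M.module_axioms N.module_axioms assms(1,2)]] additive_maps_id assms(5)])
     (simp add: tensor_map_tens[OF M.module_axioms N.module_axioms assms(1,2)] assms(3,4))

lemma zero_tens: "y \<in> carrier N \<Longrightarrow> tens R M N \<zero>\<^bsub>M\<^esub> y = \<zero>\<^bsub>T\<^esub>"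
  by (rule additive_maps_zero[OF M.abelian_group_axioms T.abelian_group_axioms
        module_homs_additive[OF bilinear_maps_left[OF tens_bilinear]]])

lemma tens_zero: "x \<in> carrier M \<Longrightarrow> tens R M N x \<zero>\<^bsub>N\<^esub> = \<zero>\<^bsub>T\<^esub>"
  by (rule additive_maps_zero[OF N.abelian_group_axioms T.abelian_group_axioms
        module_homs_additive[OF bilinear_maps_right[OF tens_bilinear]]])

end

section \<open>Bialgebras and base change\<close>

text \<open>
  The structure maps of a bialgebra, with their linearity but without the axioms. Transferring axioms
  requires both structures to be available before either is known to satisfy them.
\<close>

locale prebialgebra = A?: module R A
  for R :: "('r, 'x) ring_scheme" (structure) and A :: "('r, 'b) bialg" (structure) +
  assumes one_closed_A: "\<one>\<^bsub>A\<^esub> \<in> carrier A"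
    and mult_bilinear: "mult A \<in> bilinear_maps R A A A"
    and counit_additive: "counit A \<in> additive_maps A R"
    and counit_smult_A: "r \<in> carrier R \<Longrightarrow> x \<in> carrier A \<Longrightarrow> counit A (r \<odot>\<^bsub>A\<^esub> x) = r \<otimes>\<^bsub>R\<^esub> counit A x"
    and comult_hom: "comult A \<in> module_homs R A (tensor R A A)"
begin

sublocale TP: tensor_product R A A by unfold_locales
sublocale TR: tensor_product R A "tensor R A A" using TP.module_T by unfold_locales
sublocale TL: tensor_product R "tensor R A A" A using TP.module_T by unfold_locales

lemma mult_closed_A: "x \<in> carrier A \<Longrightarrow> y \<in> carrier A \<Longrightarrow> x \<otimes>\<^bsub>A\<^esub> y \<in> carrier A"
  using module_homs_closed[OF bilinear_maps_right[OF mult_bilinear]] by simp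
lemma mult_add_left: "x \<in> carrier A \<Longrightarrow> x' \<in> carrier A \<Longrightarrow> y \<in> carrier A \<Longrightarrow> (x \<oplus>\<^bsub>A\<^esub> x') \<otimes>\<^bsub>A\<^esub> y = x \<otimes>\<^bsub>A\<^esub> y \<oplus>\<^bsub>A\<^esub> x' \<otimes>\<^bsub>A\<^esub> y"
  using module_homs_add[OF bilinear_maps_left[OF mult_bilinear]] by simp
lemma mult_add_right: "x \<in> carrier A \<Longrightarrow> y \<in> carrier A \<Longrightarrow> y' \<in> carrier A \<Longrightarrow> x \<otimes>\<^bsub>A\<^esub> (y \<oplus>\<^bsub>A\<^esub> y') = x \<otimes>\<^bsub>A\<^esub> y \<oplus>\<^bsub>A\<^esub> x \<otimes>\<^bsub>A\<^esub> y'"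
  using module_homs_add[OF bilinear_maps_right[OF mult_bilinear]] by simp
lemma mult_smult_left: "r \<in> carrier R \<Longrightarrow> x \<in> carrier A \<Longrightarrow> y \<in> carrier A \<Longrightarrow> (r \<odot>\<^bsub>A\<^esub> x) \<otimes>\<^bsub>A\<^esub> y = r \<odot>\<^bsub>A\<^esub> (x \<otimes>\<^bsub>A\<^esub> y)"
  using module_homs_smult[OF bilinear_maps_left[OF mult_bilinear]] by simp
lemma mult_smult_right: "r \<in> carrier R \<Longrightarrow> x \<in> carrier A \<Longrightarrow> y \<in> carrier A \<Longrightarrow> x \<otimes>\<^bsub>A\<^esub> (r \<odot>\<^bsub>A\<^esub> y) = r \<odot>\<^bsub>A\<^esub> (x \<otimes>\<^bsub>A\<^esub> y)"
  using module_homs_smult[OF bilinear_maps_right[OF mult_bilinear]] by simp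
lemmas mult_simps = mult_closed_A mult_add_left mult_add_right mult_smult_left mult_smult_right

lemma counit_closed: "x \<in> carrier A \<Longrightarrow> counit A x \<in> carrier R"
  by (rule additive_maps_closed[OF counit_additive])
lemma counit_add: "x \<in> carrier A \<Longrightarrow> y \<in> carrier A \<Longrightarrow> counit A (x \<oplus>\<^bsub>A\<^esub> y) = counit A x \<oplus>\<^bsub>R\<^esub> counit A y"
  by (rule additive_maps_add[OF counit_additive])
lemma comult_closed: "x \<in> carrier A \<Longrightarrow> comult A x \<in> carrier TP.T"
  by (rule module_homs_closed[OF comult_hom])

abbreviation "counit_l \<equiv> tensor_lift R A (\<lambda>a b. counit A a \<odot>\<^bsub>A\<^esub> b)"
abbreviation "counit_r \<equiv> tensor_lift R A (\<lambda>a b. counit A b \<odot>\<^bsub>A\<^esub> a)"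

lemma smult_comm: "r \<in> carrier R \<Longrightarrow> s \<in> carrier R \<Longrightarrow> x \<in> carrier A \<Longrightarrow> r \<odot>\<^bsub>A\<^esub> (s \<odot>\<^bsub>A\<^esub> x) = s \<odot>\<^bsub>A\<^esub> (r \<odot>\<^bsub>A\<^esub> x)"
  by (metis R.m_comm smult_assoc1)

lemma counit_l_bilinear: "(\<lambda>a b. counit A a \<odot>\<^bsub>A\<^esub> b) \<in> bilinear_maps R A A A"
  by (auto intro!: bilinear_mapsI module_homsI additive_mapsI
      simp: counit_closed counit_add counit_smult_A smult_l_distr smult_r_distr smult_assoc1 intro: smult_comm)

lemma counit_r_bilinear: "(\<lambda>a b. counit A b \<odot>\<^bsub>A\<^esub> a) \<in> bilinear_maps R A A A"
  by (auto intro!: bilinear_mapsI module_homsI additive_mapsI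
      simp: counit_closed counit_add counit_smult_A smult_l_distr smult_r_distr smult_assoc1 intro: smult_comm)

lemmas counit_l_hom = TP.tensor_lift_hom[OF A.module_axioms counit_l_bilinear]
lemmas counit_r_hom = TP.tensor_lift_hom[OF A.module_axioms counit_r_bilinear]
lemmas counit_l_tens = TP.tensor_lift_tens[OF A.module_axioms counit_l_bilinear]
lemmas counit_r_tens = TP.tensor_lift_tens[OF A.module_axioms counit_r_bilinear]

abbreviation "tmult \<equiv> mult (tensor_algebra R A)"

lemma tmult_inner_bilinear:
  assumes "a \<in> carrier A" "b \<in> carrier A"
  shows "(\<lambda>a' b'. tens R A A (a \<otimes>\<^bsub>A\<^esub> a') (b \<otimes>\<^bsub>A\<^esub> b')) \<in> bilinear_maps R A A TP.T"
  by (rule TP.tensor_map_bilinear[OF A.module_axioms A.module_axioms])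
     (use assms bilinear_maps_right[OF mult_bilinear] in auto)

text \<open>
  The inner lift depends bilinearly on \<open>a\<close> and \<open>b\<close>: all maps involved are linear in \<open>v\<close>, so it
  suffices to compare them for pure tensors \<open>v\<close>.
\<close>

lemma tmult_outer_bilinear:
  assumes v: "v \<in> carrier TP.T"
  shows "(\<lambda>a b. tensor_lift R TP.T (\<lambda>a' b'. tens R A A (a \<otimes>\<^bsub>A\<^esub> a') (b \<otimes>\<^bsub>A\<^esub> b')) v) \<in> bilinear_maps R A A TP.T"
proof -
  note hom = TP.tensor_lift_hom[OF TP.module_T tmult_inner_bilinear]
  note val = TP.tensor_lift_tens[OF TP.module_T tmult_inner_bilinear]
  have eqI: "f v = g v" if "f \<in> module_homs R TP.T TP.T" "g \<in> module_homs R TP.T TP.T"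
    "\<And>x y. x \<in> carrier A \<Longrightarrow> y \<in> carrier A \<Longrightarrow> f (tens R A A x y) = g (tens R A A x y)" for f g
    by (rule TP.tensor_maps_eqI[OF TP.T.abelian_group_axioms module_homs_additive[OF that(1)] module_homs_additive[OF that(2)] v that(3)])
  show ?thesis
  proof (intro bilinear_mapsI module_homsI additive_mapsI)
    fix a b assume ab: "a \<in> carrier A" "b \<in> carrier A"
    then show "tensor_lift R TP.T (\<lambda>a' b'. tens R A A (a \<otimes>\<^bsub>A\<^esub> a') (b \<otimes>\<^bsub>A\<^esub> b')) v \<in> carrier TP.T"
      using module_homs_closed[OF hom] v by simp
    then show "tensor_lift R TP.T (\<lambda>a' b'. tens R A A (a \<otimes>\<^bsub>A\<^esub> a') (b \<otimes>\<^bsub>A\<^esub> b')) v \<in> carrier TP.T" .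
  next
    fix y a b assume ab: "y \<in> carrier A" "a \<in> carrier A" "b \<in> carrier A"
    show "tensor_lift R TP.T (\<lambda>a' b'. tens R A A ((a \<oplus>\<^bsub>A\<^esub> b) \<otimes>\<^bsub>A\<^esub> a') (y \<otimes>\<^bsub>A\<^esub> b')) v =
      tensor_lift R TP.T (\<lambda>a' b'. tens R A A (a \<otimes>\<^bsub>A\<^esub> a') (y \<otimes>\<^bsub>A\<^esub> b')) v \<oplus>\<^bsub>TP.T\<^esub>
      tensor_lift R TP.T (\<lambda>a' b'. tens R A A (b \<otimes>\<^bsub>A\<^esub> a') (y \<otimes>\<^bsub>A\<^esub> b')) v"
      by (rule eqI[OF hom module_homs_plus[OF TP.module_T hom hom]])
         (use ab in \<open>simp_all add: val mult_simps TP.tens_add_left\<close>)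
    show "tensor_lift R TP.T (\<lambda>a' b'. tens R A A (y \<otimes>\<^bsub>A\<^esub> a') ((a \<oplus>\<^bsub>A\<^esub> b) \<otimes>\<^bsub>A\<^esub> b')) v =
      tensor_lift R TP.T (\<lambda>a' b'. tens R A A (y \<otimes>\<^bsub>A\<^esub> a') (a \<otimes>\<^bsub>A\<^esub> b')) v \<oplus>\<^bsub>TP.T\<^esub>
      tensor_lift R TP.T (\<lambda>a' b'. tens R A A (y \<otimes>\<^bsub>A\<^esub> a') (b \<otimes>\<^bsub>A\<^esub> b')) v"
      by (rule eqI[OF hom module_homs_plus[OF TP.module_T hom hom]])
         (use ab in \<open>simp_all add: val mult_simps TP.tens_add_right\<close>)
  next
    fix y r a assume ab: "y \<in> carrier A" "r \<in> carrier R" "a \<in> carrier A"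
    show "tensor_lift R TP.T (\<lambda>a' b'. tens R A A ((r \<odot>\<^bsub>A\<^esub> a) \<otimes>\<^bsub>A\<^esub> a') (y \<otimes>\<^bsub>A\<^esub> b')) v =
      r \<odot>\<^bsub>TP.T\<^esub> tensor_lift R TP.T (\<lambda>a' b'. tens R A A (a \<otimes>\<^bsub>A\<^esub> a') (y \<otimes>\<^bsub>A\<^esub> b')) v"
      by (rule eqI[OF hom module_homs_smult_map[OF TP.module_T hom]])
         (use ab in \<open>simp_all add: val mult_simps TP.tens_smult_left\<close>)
    show "tensor_lift R TP.T (\<lambda>a' b'. tens R A A (y \<otimes>\<^bsub>A\<^esub> a') ((r \<odot>\<^bsub>A\<^esub> a) \<otimes>\<^bsub>A\<^esub> b')) v =
      r \<odot>\<^bsub>TP.T\<^esub> tensor_lift R TP.T (\<lambda>a' b'. tens R A A (y \<otimes>\<^bsub>A\<^esub> a') (a \<otimes>\<^bsub>A\<^esub> b')) v"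
      by (rule eqI[OF hom module_homs_smult_map[OF TP.module_T hom]])
         (use ab in \<open>simp_all add: val mult_simps TP.tens_smult_right\<close>)
  qed
qed

lemma tmult_eq: "tmult u v = tensor_lift R TP.T (\<lambda>a b. tensor_lift R TP.T (\<lambda>a' b'. tens R A A (a \<otimes>\<^bsub>A\<^esub> a') (b \<otimes>\<^bsub>A\<^esub> b')) v) u"
  by (simp add: tensor_algebra_def Let_def)

lemma tmult_left_hom: "v \<in> carrier TP.T \<Longrightarrow> (\<lambda>u. tmult u v) \<in> module_homs R TP.T TP.T"
  unfolding tmult_eq by (rule TP.tensor_lift_hom[OF TP.module_T tmult_outer_bilinear])

lemma tmult_tens_left:
  "a \<in> carrier A \<Longrightarrow> b \<in> carrier A \<Longrightarrow> v \<in> carrier TP.T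
    \<Longrightarrow> tmult (tens R A A a b) v = tensor_lift R TP.T (\<lambda>a' b'. tens R A A (a \<otimes>\<^bsub>A\<^esub> a') (b \<otimes>\<^bsub>A\<^esub> b')) v"
  unfolding tmult_eq by (rule TP.tensor_lift_tens[OF TP.module_T tmult_outer_bilinear])

lemma tmult_tens:
  "a \<in> carrier A \<Longrightarrow> b \<in> carrier A \<Longrightarrow> a' \<in> carrier A \<Longrightarrow> b' \<in> carrier A
    \<Longrightarrow> tmult (tens R A A a b) (tens R A A a' b') = tens R A A (a \<otimes>\<^bsub>A\<^esub> a') (b \<otimes>\<^bsub>A\<^esub> b')"
  using TP.tensor_lift_tens[OF TP.module_T tmult_inner_bilinear] by (simp add: tmult_tens_left)

lemma tmult_closed: "u \<in> carrier TP.T \<Longrightarrow> v \<in> carrier TP.T \<Longrightarrow> tmult u v \<in> carrier TP.T"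
  by (rule module_homs_closed[OF tmult_left_hom])

lemma tmult_right_hom: assumes u: "u \<in> carrier TP.T" shows "(\<lambda>v. tmult u v) \<in> module_homs R TP.T TP.T"
proof -
  have pure: "(\<lambda>v. tmult (tens R A A a b) v) \<in> module_homs R TP.T TP.T" if "a \<in> carrier A" "b \<in> carrier A" for a b
  proof -
    note h = TP.tensor_lift_hom[OF TP.module_T tmult_inner_bilinear[OF that]]
    show ?thesis
      by (intro module_homsI additive_mapsI)
         (auto simp: tmult_tens_left[OF that] module_homs_closed[OF h] module_homs_add[OF h] module_homs_smult[OF h])
  qed
  show ?thesis using u
  proof (induction rule: TP.tensor_induct)
    case zero
    have "tmult \<zero>\<^bsub>TP.T\<^esub> v = \<zero>\<^bsub>TP.T\<^esub>" if "v \<in> carrier TP.T" for v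
      by (rule additive_maps_zero[OF TP.T.abelian_group_axioms TP.T.abelian_group_axioms module_homs_additive[OF tmult_left_hom[OF that]]])
    then show ?case by (intro module_homsI additive_mapsI) auto
  next
    case (tens x y)
    then show ?case using pure by simp
  next
    case (add u v)
    have "tmult (u \<oplus>\<^bsub>TP.T\<^esub> v) w = tmult u w \<oplus>\<^bsub>TP.T\<^esub> tmult v w" if "w \<in> carrier TP.T" for w
      by (rule module_homs_add[OF tmult_left_hom[OF that] add(1,2)])
    moreover have "(\<lambda>w. tmult u w \<oplus>\<^bsub>TP.T\<^esub> tmult v w) \<in> module_homs R TP.T TP.T"
      by (rule module_homs_plus[OF TP.module_T add(3,4)])
    ultimately show ?case by (auto simp: module_homs_def)
  qed
qed

lemma tensor_algebra_simps:
  "carrier (tensor_algebra R A) = carrier TP.T" "one (tensor_algebra R A) = tens R A A \<one>\<^bsub>A\<^esub> \<one>\<^bsub>A\<^esub>"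
  "add (tensor_algebra R A) = add TP.T"
  by (simp_all add: tensor_algebra_def Let_def)

lemma assoc_inner_bilinear:
  assumes "z \<in> carrier A"
  shows "(\<lambda>x y. tens R A TP.T x (tens R A A y z)) \<in> bilinear_maps R A A TR.T"
  using assms by (auto intro!: bilinear_mapsI module_homsI additive_mapsI
    simp: TP.tens_add_left TP.tens_smult_left TR.tens_add_left TR.tens_add_right TR.tens_smult_left TR.tens_smult_right)

lemmas assoc_inner_hom = TP.tensor_lift_hom[OF TR.module_T assoc_inner_bilinear]
lemmas assoc_inner_tens = TP.tensor_lift_tens[OF TR.module_T assoc_inner_bilinear]

lemma assoc_outer_bilinear:
  "(\<lambda>u z. tensor_lift R TR.T (\<lambda>x y. tens R A TP.T x (tens R A A y z)) u) \<in> bilinear_maps R TP.T A TR.T"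
proof (rule bilinear_mapsI)
  fix z assume "z \<in> carrier A"
  then show "tensor_lift R TR.T (\<lambda>x y. tens R A TP.T x (tens R A A y z)) \<in> module_homs R TP.T TR.T"
    by (rule assoc_inner_hom)
next
  fix u assume u: "u \<in> carrier TP.T"
  have eqI: "f u = g u" if "f \<in> module_homs R TP.T TR.T" "g \<in> module_homs R TP.T TR.T"
    "\<And>x y. x \<in> carrier A \<Longrightarrow> y \<in> carrier A \<Longrightarrow> f (tens R A A x y) = g (tens R A A x y)" for f g
    by (rule TP.tensor_maps_eqI[OF TR.T.abelian_group_axioms module_homs_additive[OF that(1)] module_homs_additive[OF that(2)] u that(3)])
  show "(\<lambda>z. tensor_lift R TR.T (\<lambda>x y. tens R A TP.T x (tens R A A y z)) u) \<in> module_homs R A TR.T"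
  proof (intro module_homsI additive_mapsI)
    fix z assume z: "z \<in> carrier A"
    then show "tensor_lift R TR.T (\<lambda>x y. tens R A TP.T x (tens R A A y z)) u \<in> carrier TR.T"
      using module_homs_closed[OF assoc_inner_hom] u by simp
    fix z' assume z': "z' \<in> carrier A"
    show "tensor_lift R TR.T (\<lambda>x y. tens R A TP.T x (tens R A A y (z \<oplus>\<^bsub>A\<^esub> z'))) u =
      tensor_lift R TR.T (\<lambda>x y. tens R A TP.T x (tens R A A y z)) u \<oplus>\<^bsub>TR.T\<^esub>
      tensor_lift R TR.T (\<lambda>x y. tens R A TP.T x (tens R A A y z')) u"
      by (rule eqI[OF assoc_inner_hom module_homs_plus[OF TR.module_T assoc_inner_hom assoc_inner_hom]])
         (use z z' in \<open>simp_all add: assoc_inner_tens TP.tens_add_right TR.tens_add_right\<close>)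
  next
    fix r z assume z: "r \<in> carrier R" "z \<in> carrier A"
    show "tensor_lift R TR.T (\<lambda>x y. tens R A TP.T x (tens R A A y (r \<odot>\<^bsub>A\<^esub> z))) u =
      r \<odot>\<^bsub>TR.T\<^esub> tensor_lift R TR.T (\<lambda>x y. tens R A TP.T x (tens R A A y z)) u"
      by (rule eqI[OF assoc_inner_hom module_homs_smult_map[OF TR.module_T assoc_inner_hom]])
         (use z in \<open>simp_all add: assoc_inner_tens TP.tens_smult_right TR.tens_smult_right\<close>)
  qed
qed

lemma assoc_hom: "tensor_assoc R A \<in> module_homs R TL.T TR.T"
  unfolding tensor_assoc_def Let_def by (rule TL.tensor_lift_hom[OF TR.module_T assoc_outer_bilinear])

lemma assoc_tens: "u \<in> carrier TP.T \<Longrightarrow> z \<in> carrier A \<Longrightarrow>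
    tensor_assoc R A (tens R TP.T A u z) = tensor_lift R TR.T (\<lambda>x y. tens R A TP.T x (tens R A A y z)) u"
  unfolding tensor_assoc_def Let_def by (rule TL.tensor_lift_tens[OF TR.module_T assoc_outer_bilinear])

abbreviation "comult_l \<equiv> tensor_map R TP.T A (comult A) (\<lambda>b. b)"
abbreviation "comult_r \<equiv> tensor_map R A TP.T (\<lambda>a. a) (comult A)"

lemmas comult_l_hom = TP.tensor_map_hom[OF TP.module_T A.module_axioms comult_hom module_homs_id]
lemmas comult_r_hom = TP.tensor_map_hom[OF A.module_axioms TP.module_T module_homs_id comult_hom]
lemmas comult_l_tens = TP.tensor_map_tens[OF TP.module_T A.module_axioms comult_hom module_homs_id]
lemmas comult_r_tens = TP.tensor_map_tens[OF A.module_axioms TP.module_T module_homs_id comult_hom]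

lemma bialgebraI:
  assumes "\<And>x y z. x \<in> carrier A \<Longrightarrow> y \<in> carrier A \<Longrightarrow> z \<in> carrier A \<Longrightarrow> (x \<otimes>\<^bsub>A\<^esub> y) \<otimes>\<^bsub>A\<^esub> z = x \<otimes>\<^bsub>A\<^esub> (y \<otimes>\<^bsub>A\<^esub> z)"
    and "\<And>x. x \<in> carrier A \<Longrightarrow> \<one>\<^bsub>A\<^esub> \<otimes>\<^bsub>A\<^esub> x = x" "\<And>x. x \<in> carrier A \<Longrightarrow> x \<otimes>\<^bsub>A\<^esub> \<one>\<^bsub>A\<^esub> = x"
    and "\<And>x y. x \<in> carrier A \<Longrightarrow> y \<in> carrier A \<Longrightarrow> counit A (x \<otimes>\<^bsub>A\<^esub> y) = counit A x \<otimes>\<^bsub>R\<^esub> counit A y"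
    and "counit A \<one>\<^bsub>A\<^esub> = \<one>\<^bsub>R\<^esub>"
    and "\<And>x y. x \<in> carrier A \<Longrightarrow> y \<in> carrier A \<Longrightarrow> comult A (x \<otimes>\<^bsub>A\<^esub> y) = tmult (comult A x) (comult A y)"
    and "comult A \<one>\<^bsub>A\<^esub> = tens R A A \<one>\<^bsub>A\<^esub> \<one>\<^bsub>A\<^esub>"
    and "\<And>x. x \<in> carrier A \<Longrightarrow> counit_l (comult A x) = x"
    and "\<And>x. x \<in> carrier A \<Longrightarrow> counit_r (comult A x) = x"
    and "\<And>x. x \<in> carrier A \<Longrightarrow> tensor_assoc R A (comult_l (comult A x)) = comult_r (comult A x)"
  shows "bialgebra R A"
proof -
  have "ring A"
    by (rule ringI[OF A.M.abelian_group_axioms]) (use assms(1-3) in \<open>auto intro!: monoidI simp: mult_simps one_closed_A\<close>)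
  moreover have "counit A \<in> ring_hom A R"
    by (rule ring_hom_memI) (use assms(4,5) in \<open>auto simp: counit_closed counit_add\<close>)
  moreover have "comult A \<in> ring_hom A (tensor_algebra R A)"
    by (rule ring_hom_memI)
       (use assms(6,7) in \<open>auto simp: tensor_algebra_simps comult_closed module_homs_add[OF comult_hom]\<close>)
  ultimately show ?thesis
    using assms(8-10) comult_hom counit_smult_A
    by (intro bialgebra.intro A.module_axioms bialgebra_axioms.intro) (simp_all add: mult_smult_left mult_smult_right)
qed

end

lemma (in bialgebra) prebialgebra: "prebialgebra R A"
proof -
  interpret A: ring A by unfold_locales
  show ?thesis
    by unfold_locales
       (auto intro!: bilinear_mapsI module_homsI additive_mapsI comult_module_hom
        simp: A.l_distr A.r_distr smult_mult_left smult_mult_right counit_smult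
          ring_hom_closed[OF counit_ring_hom] ring_hom_add[OF counit_ring_hom])
qed

text \<open>
  A morphism of bialgebras along a change of scalars \<open>h\<close>. Three instances are used: evaluation
  \<open>B[t] \<rightarrow> B\<close> at \<open>t = 1\<close>, constants \<open>U \<rightarrow> U[t]\<close>, and, with \<open>h\<close> the identity,
  maps over one ring.
\<close>

locale bialgebra_morphism = A: prebialgebra R A + A': prebialgebra S A'
  for R :: "('r, 'x) ring_scheme" and A :: "('r, 'a) bialg" and S :: "('s, 'y) ring_scheme" and A' :: "('s, 'b) bialg"
    and h :: "'r \<Rightarrow> 's" and f :: "'a \<Rightarrow> 'b" +
  assumes h_hom: "h \<in> ring_hom R S"
    and f_semilinear: "f \<in> semilinear_maps R h A A'"
    and f_one: "f \<one>\<^bsub>A\<^esub> = \<one>\<^bsub>A'\<^esub>"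
    and f_mult: "x \<in> carrier A \<Longrightarrow> y \<in> carrier A \<Longrightarrow> f (x \<otimes>\<^bsub>A\<^esub> y) = f x \<otimes>\<^bsub>A'\<^esub> f y"
    and f_counit: "x \<in> carrier A \<Longrightarrow> h (counit A x) = counit A' (f x)"
    and f_comult: "x \<in> carrier A \<Longrightarrow> semi_tensor R h S A' A' f f (comult A x) = comult A' (f x)"
begin

abbreviation "f2 \<equiv> semi_tensor R h S A' A' f f"
abbreviation "f3 \<equiv> semi_tensor R h S A' A'.TP.T f f2"

lemmas f_additive = semilinear_maps_additive[OF f_semilinear]
lemmas f_closed = additive_maps_closed[OF f_additive]
lemmas f_smult = semilinear_maps_smult[OF f_semilinear]

lemmas f2_semilinear = A.TP.semi_tensor_semilinear[OF h_hom A'.A.module_axioms A'.A.module_axioms f_semilinear f_semilinear]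
lemmas f2_tens = A.TP.semi_tensor_tens[OF h_hom A'.A.module_axioms A'.A.module_axioms f_semilinear f_semilinear]
lemmas f2_additive = semilinear_maps_additive[OF f2_semilinear]
lemmas f2_closed = additive_maps_closed[OF f2_additive]

lemmas f3_semilinear = A.TR.semi_tensor_semilinear[OF h_hom A'.A.module_axioms A'.TP.module_T f_semilinear f2_semilinear]
lemmas f3_tens = A.TR.semi_tensor_tens[OF h_hom A'.A.module_axioms A'.TP.module_T f_semilinear f2_semilinear]
lemmas f3_additive = semilinear_maps_additive[OF f3_semilinear]
lemmas f3_closed = additive_maps_closed[OF f3_additive]

lemma f_counit_l:
  assumes "w \<in> carrier A.TP.T"
  shows "f (A.counit_l w) = A'.counit_l (f2 w)"
  by (rule A.TP.tensor_maps_eqI[OF A'.A.M.abelian_group_axioms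
        additive_maps_comp[OF module_homs_additive[OF A.counit_l_hom] f_additive]
        additive_maps_comp[OF f2_additive module_homs_additive[OF A'.counit_l_hom]] assms])
     (simp add: A.counit_l_tens A'.counit_l_tens f2_tens f_closed f_smult A.counit_closed f_counit)

lemma f_counit_r:
  assumes "w \<in> carrier A.TP.T"
  shows "f (A.counit_r w) = A'.counit_r (f2 w)"
  by (rule A.TP.tensor_maps_eqI[OF A'.A.M.abelian_group_axioms
        additive_maps_comp[OF module_homs_additive[OF A.counit_r_hom] f_additive]
        additive_maps_comp[OF f2_additive module_homs_additive[OF A'.counit_r_hom]] assms])
     (simp add: A.counit_r_tens A'.counit_r_tens f2_tens f_closed f_smult A.counit_closed f_counit)

lemma f2_tmult:
  assumes "u \<in> carrier A.TP.T" "v \<in> carrier A.TP.T"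
  shows "f2 (A.tmult u v) = A'.tmult (f2 u) (f2 v)"
proof -
  have pure: "f2 (A.tmult (tens R A A a b) v) = A'.tmult (f2 (tens R A A a b)) (f2 v)"
    if ab: "a \<in> carrier A" "b \<in> carrier A" for a b
    by (rule A.TP.tensor_maps_eqI[OF A'.TP.T.M.abelian_group_axioms
        additive_maps_comp[OF module_homs_additive[OF A.tmult_right_hom] f2_additive]
        additive_maps_comp[OF f2_additive module_homs_additive[OF A'.tmult_right_hom]] assms(2)])
       (use ab in \<open>simp_all add: f2_tens A.tmult_tens A'.tmult_tens f_closed f_mult A.mult_closed_A\<close>)
  show ?thesis
    by (rule A.TP.tensor_maps_eqI[OF A'.TP.T.M.abelian_group_axioms
        additive_maps_comp[OF module_homs_additive[OF A.tmult_left_hom[OF assms(2)]] f2_additive]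
        additive_maps_comp[OF f2_additive module_homs_additive[OF A'.tmult_left_hom[OF f2_closed[OF assms(2)]]]] assms(1)])
       (rule pure)
qed

lemma f3_comult_r:
  assumes "w \<in> carrier A.TP.T"
  shows "f3 (A.comult_r w) = A'.comult_r (f2 w)"
  by (rule A.TP.tensor_maps_eqI[OF A'.TR.T.M.abelian_group_axioms
        additive_maps_comp[OF module_homs_additive[OF A.comult_r_hom] f3_additive]
        additive_maps_comp[OF f2_additive module_homs_additive[OF A'.comult_r_hom]] assms])
     (simp add: A.comult_r_tens A'.comult_r_tens f2_tens f3_tens f_closed f_comult A.comult_closed)

lemma f3_assoc_inner:
  assumes "u \<in> carrier A.TP.T" and z: "z \<in> carrier A"
  shows "f3 (tensor_lift R A.TR.T (\<lambda>x y. tens R A A.TP.T x (tens R A A y z)) u) =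
     tensor_lift S A'.TR.T (\<lambda>x y. tens S A' A'.TP.T x (tens S A' A' y (f z))) (f2 u)"
  by (rule A.TP.tensor_maps_eqI[OF A'.TR.T.M.abelian_group_axioms
        additive_maps_comp[OF module_homs_additive[OF A.assoc_inner_hom[OF z]] f3_additive]
        additive_maps_comp[OF f2_additive module_homs_additive[OF A'.assoc_inner_hom[OF f_closed[OF z]]]] assms(1)])
     (use z in \<open>simp add: A.assoc_inner_tens A'.assoc_inner_tens f2_tens f3_tens f_closed\<close>)

text \<open>
  Both composites in the coassociativity law are natural in the bialgebra; with \<open>f3_comult_r\<close> this
  transfers the law in either direction.
\<close>

lemma f3_assoc_comult_l:
  assumes "w \<in> carrier A.TP.T"
  shows "f3 (tensor_assoc R A (A.comult_l w)) = tensor_assoc S A' (A'.comult_l (f2 w))"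
  by (rule A.TP.tensor_maps_eqI[OF A'.TR.T.M.abelian_group_axioms
        additive_maps_comp[OF module_homs_additive[OF module_homs_comp[OF A.comult_l_hom A.assoc_hom]] f3_additive]
        additive_maps_comp[OF f2_additive module_homs_additive[OF module_homs_comp[OF A'.comult_l_hom A'.assoc_hom]]] assms])
     (simp add: A.comult_l_tens A'.comult_l_tens f2_tens f_closed A.assoc_tens A'.assoc_tens A.comult_closed
        A'.comult_closed f3_assoc_inner f_comult)

lemma f2_one: "f2 (tens R A A \<one>\<^bsub>A\<^esub> \<one>\<^bsub>A\<^esub>) = tens S A' A' \<one>\<^bsub>A'\<^esub> \<one>\<^bsub>A'\<^esub>"
  by (simp add: f2_tens A.one_closed_A f_one)

theorem bialgebra_pullback:
  assumes "bialgebra S A'"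
    and "inj_on h (carrier R)" "inj_on f (carrier A)" "inj_on f2 (carrier A.TP.T)" "inj_on f3 (carrier A.TR.T)"
  shows "bialgebra R A"
proof -
  interpret B: bialgebra S A' by fact
  note inj = inj_onD[OF assms(2)] inj_onD[OF assms(3)] inj_onD[OF assms(4)] inj_onD[OF assms(5)]
  note hm = ring_hom_mult[OF B.comult_ring_hom, unfolded A'.tensor_algebra_simps]
  show ?thesis
  proof (rule A.bialgebraI)
    fix x y z assume xyz: "x \<in> carrier A" "y \<in> carrier A" "z \<in> carrier A"
    show "x \<otimes>\<^bsub>A\<^esub> y \<otimes>\<^bsub>A\<^esub> z = x \<otimes>\<^bsub>A\<^esub> (y \<otimes>\<^bsub>A\<^esub> z)"
      by (rule inj(2)) (use xyz in \<open>simp_all add: A.mult_closed_A f_mult f_closed B.A.m_assoc\<close>)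
  next
    fix x assume x: "x \<in> carrier A"
    show "\<one>\<^bsub>A\<^esub> \<otimes>\<^bsub>A\<^esub> x = x"
      by (rule inj(2)) (use x in \<open>simp_all add: A.mult_closed_A f_mult f_closed A.one_closed_A f_one\<close>)
    show "x \<otimes>\<^bsub>A\<^esub> \<one>\<^bsub>A\<^esub> = x"
      by (rule inj(2)) (use x in \<open>simp_all add: A.mult_closed_A f_mult f_closed A.one_closed_A f_one\<close>)
    show "A.counit_l (comult A x) = x"
      by (rule inj(2)) (use x in \<open>simp_all add: f_counit_l A.comult_closed f_comult f_closed B.counit_left
          module_homs_closed[OF A.counit_l_hom]\<close>)
    show "A.counit_r (comult A x) = x"
      by (rule inj(2)) (use x in \<open>simp_all add: f_counit_r A.comult_closed f_comult f_closed B.counit_right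
          module_homs_closed[OF A.counit_r_hom]\<close>)
    show "tensor_assoc R A (A.comult_l (comult A x)) = A.comult_r (comult A x)"
      by (rule inj(4)) (use x in \<open>simp_all add: f3_assoc_comult_l f3_comult_r A.comult_closed f_comult f_closed B.coassoc
          module_homs_closed[OF A.comult_r_hom] module_homs_closed[OF A.comult_l_hom] module_homs_closed[OF A.assoc_hom]\<close>)
  next
    fix x y assume xy: "x \<in> carrier A" "y \<in> carrier A"
    show "counit A (x \<otimes>\<^bsub>A\<^esub> y) = counit A x \<otimes>\<^bsub>R\<^esub> counit A y"
      by (rule inj(1)) (use xy in \<open>simp_all add: A.mult_closed_A A.counit_closed ring_hom_mult[OF h_hom] f_counit f_mult f_closed
         ring_hom_mult[OF B.counit_ring_hom]\<close>)
    show "comult A (x \<otimes>\<^bsub>A\<^esub> y) = A.tmult (comult A x) (comult A y)"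
      by (rule inj(3)) (use xy in \<open>simp_all add: A.mult_closed_A A.comult_closed A.tmult_closed f_comult f_mult f_closed f2_tmult hm\<close>)
  next
    show "counit A \<one>\<^bsub>A\<^esub> = \<one>\<^bsub>R\<^esub>"
      by (rule inj(1)) (simp_all add: A.one_closed_A A.counit_closed f_counit f_one ring_hom_one[OF h_hom] ring_hom_one[OF B.counit_ring_hom])
    show "comult A \<one>\<^bsub>A\<^esub> = tens R A A \<one>\<^bsub>A\<^esub> \<one>\<^bsub>A\<^esub>"
      by (rule inj(3)) (simp_all add: A.one_closed_A A.comult_closed f_comult f_one f2_one
        ring_hom_one[OF B.comult_ring_hom, unfolded A'.tensor_algebra_simps])
  qed
qed

abbreviation "generators \<equiv> {s \<odot>\<^bsub>A'\<^esub> f x | s x. s \<in> carrier S \<and> x \<in> carrier A}"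

text \<open>
  Every axiom is an identity between maps that are linear in each variable, so it may be checked on
  elements \<open>f x\<close>, where it is the image of an identity in \<open>A\<close>. For identities in several variables
  the arguments are specialized to such elements one after the other.
\<close>

theorem bialgebra_pushforward:
  assumes "bialgebra R A" and gen: "carrier A' = additive_span A' generators"
  shows "bialgebra S A'"
proof -
  interpret B: bialgebra R A by fact
  have gcl: "generators \<subseteq> carrier A'" using f_closed by auto
  have eqI: "L y = K y" if "L \<in> additive_maps A' P" "K \<in> additive_maps A' P" "abelian_group P" "y \<in> carrier A'"
    "\<And>s x. s \<in> carrier S \<Longrightarrow> x \<in> carrier A \<Longrightarrow> L (s \<odot>\<^bsub>A'\<^esub> f x) = K (s \<odot>\<^bsub>A'\<^esub> f x)"
    for L K y and P :: "('d, 'e) ring_scheme"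
    by (rule additive_maps_eq[OF A'.A.M.abelian_group_axioms that(3,1,2) _ gcl]) (use that(4,5) gen in auto)
  have homI: "L y = K y" if "L \<in> module_homs S A' P" "K \<in> module_homs S A' P" "abelian_group P" "y \<in> carrier A'"
    "\<And>x. x \<in> carrier A \<Longrightarrow> L (f x) = K (f x)"
    for L K y and P :: "('s, 'd, 'e) module_scheme"
    by (rule eqI[OF module_homs_additive[OF that(1)] module_homs_additive[OF that(2)] that(3,4)])
       (simp add: module_homs_smult[OF that(1)] module_homs_smult[OF that(2)] f_closed that(5))
  note Aab = A'.A.M.abelian_group_axioms and Tab = A'.TP.T.M.abelian_group_axioms
  note ml = bilinear_maps_left[OF A'.mult_bilinear] and mr = bilinear_maps_right[OF A'.mult_bilinear]
  note hm = ring_hom_mult[OF B.comult_ring_hom, unfolded A.tensor_algebra_simps]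
  let ?S = "\<lparr>carrier = carrier S, mult = mult S, one = one S, zero = zero S, add = add S, smult = mult S\<rparr>"
  interpret SM: module S ?S by (rule ring_is_module[OF A'.A.R.is_cring])
  have eps: "counit A' \<in> module_homs S A' ?S"
    by (intro module_homsI additive_mapsI) (simp_all add: A'.counit_closed A'.counit_add A'.counit_smult_A)
  have epsL: "(\<lambda>x. counit A' x \<otimes>\<^bsub>S\<^esub> s) \<in> module_homs S A' ?S" if "s \<in> carrier S" for s
    using that by (intro module_homsI additive_mapsI)
      (simp_all add: A'.counit_closed A'.counit_add A'.counit_smult_A A'.A.R.l_distr A'.A.R.m_assoc)
  have epsR: "(\<lambda>x. s \<otimes>\<^bsub>S\<^esub> counit A' x) \<in> module_homs S A' ?S" if "s \<in> carrier S" for s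
    using that by (intro module_homsI additive_mapsI)
      (simp_all add: A'.counit_closed A'.counit_add A'.counit_smult_A A'.A.R.r_distr A'.A.R.m_lcomm)
  show ?thesis
  proof (rule A'.bialgebraI)
    fix x y z assume xyz: "x \<in> carrier A'" "y \<in> carrier A'" "z \<in> carrier A'"
    have a1: "f a \<otimes>\<^bsub>A'\<^esub> f b \<otimes>\<^bsub>A'\<^esub> f c = f a \<otimes>\<^bsub>A'\<^esub> (f b \<otimes>\<^bsub>A'\<^esub> f c)"
      if "a \<in> carrier A" "b \<in> carrier A" "c \<in> carrier A" for a b c
      using that by (simp add: f_mult[symmetric] A.mult_closed_A B.A.m_assoc)
    have a2: "f a \<otimes>\<^bsub>A'\<^esub> f b \<otimes>\<^bsub>A'\<^esub> z = f a \<otimes>\<^bsub>A'\<^esub> (f b \<otimes>\<^bsub>A'\<^esub> z)"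
      if "a \<in> carrier A" "b \<in> carrier A" for a b
      by (rule homI[OF mr module_homs_comp[OF mr mr] Aab xyz(3) a1]) (use that f_closed A'.mult_closed_A in auto)
    have a3: "f a \<otimes>\<^bsub>A'\<^esub> y \<otimes>\<^bsub>A'\<^esub> z = f a \<otimes>\<^bsub>A'\<^esub> (y \<otimes>\<^bsub>A'\<^esub> z)" if "a \<in> carrier A" for a
      by (rule homI[OF module_homs_comp[OF mr ml] module_homs_comp[OF ml mr] Aab xyz(2) a2]) (use that f_closed xyz in auto)
    show "x \<otimes>\<^bsub>A'\<^esub> y \<otimes>\<^bsub>A'\<^esub> z = x \<otimes>\<^bsub>A'\<^esub> (y \<otimes>\<^bsub>A'\<^esub> z)"
      by (rule homI[OF module_homs_comp[OF ml ml] ml Aab xyz(1) a3]) (use xyz A'.mult_closed_A in auto)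
  next
    fix x assume x: "x \<in> carrier A'"
    show "\<one>\<^bsub>A'\<^esub> \<otimes>\<^bsub>A'\<^esub> x = x"
      by (rule homI[OF mr module_homs_id Aab x])
         (simp_all add: A'.one_closed_A f_one[symmetric] f_mult[symmetric] A.one_closed_A f_closed)
    show "x \<otimes>\<^bsub>A'\<^esub> \<one>\<^bsub>A'\<^esub> = x"
      by (rule homI[OF ml module_homs_id Aab x])
         (simp_all add: A'.one_closed_A f_one[symmetric] f_mult[symmetric] A.one_closed_A f_closed)
    show "A'.counit_l (comult A' x) = x"
      by (rule homI[OF module_homs_comp[OF A'.comult_hom A'.counit_l_hom] module_homs_id Aab x])
         (simp add: f_comult[symmetric] f_counit_l[symmetric] A.comult_closed B.counit_left)
    show "A'.counit_r (comult A' x) = x"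
      by (rule homI[OF module_homs_comp[OF A'.comult_hom A'.counit_r_hom] module_homs_id Aab x])
         (simp add: f_comult[symmetric] f_counit_r[symmetric] A.comult_closed B.counit_right)
    show "tensor_assoc S A' (A'.comult_l (comult A' x)) = A'.comult_r (comult A' x)"
      by (rule homI[OF module_homs_comp[OF module_homs_comp[OF A'.comult_hom A'.comult_l_hom] A'.assoc_hom]
            module_homs_comp[OF A'.comult_hom A'.comult_r_hom] A'.TR.T.M.abelian_group_axioms x])
         (simp add: f_comult[symmetric] f3_assoc_comult_l[symmetric] f3_comult_r[symmetric] A.comult_closed B.coassoc)
  next
    fix x y assume xy: "x \<in> carrier A'" "y \<in> carrier A'"
    have a1: "counit A' (f a \<otimes>\<^bsub>A'\<^esub> f b) = counit A' (f a) \<otimes>\<^bsub>S\<^esub> counit A' (f b)"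
      if "a \<in> carrier A" "b \<in> carrier A" for a b
      using that by (simp add: f_mult[symmetric] f_counit[symmetric] A.mult_closed_A A.counit_closed
          ring_hom_mult[OF B.counit_ring_hom] ring_hom_mult[OF h_hom])
    have a2: "counit A' (f a \<otimes>\<^bsub>A'\<^esub> y) = counit A' (f a) \<otimes>\<^bsub>S\<^esub> counit A' y" if "a \<in> carrier A" for a
      by (rule homI[OF module_homs_comp[OF mr eps] epsR SM.M.abelian_group_axioms xy(2) a1])
         (use that f_closed A'.counit_closed in auto)
    show "counit A' (x \<otimes>\<^bsub>A'\<^esub> y) = counit A' x \<otimes>\<^bsub>S\<^esub> counit A' y"
      by (rule homI[OF module_homs_comp[OF ml eps] epsL SM.M.abelian_group_axioms xy(1) a2])
         (use xy A'.counit_closed in auto)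
    have b1: "comult A' (f a \<otimes>\<^bsub>A'\<^esub> f b) = A'.tmult (comult A' (f a)) (comult A' (f b))"
      if "a \<in> carrier A" "b \<in> carrier A" for a b
      using that by (simp add: f_mult[symmetric] f_comult[symmetric] A.mult_closed_A A.comult_closed hm f2_tmult)
    have b2: "comult A' (f a \<otimes>\<^bsub>A'\<^esub> y) = A'.tmult (comult A' (f a)) (comult A' y)" if "a \<in> carrier A" for a
      by (rule homI[OF module_homs_comp[OF mr A'.comult_hom] module_homs_comp[OF A'.comult_hom A'.tmult_right_hom] Tab xy(2) b1])
         (use that f_closed A'.comult_closed in auto)
    show "comult A' (x \<otimes>\<^bsub>A'\<^esub> y) = A'.tmult (comult A' x) (comult A' y)"
      by (rule homI[OF module_homs_comp[OF ml A'.comult_hom] module_homs_comp[OF A'.comult_hom A'.tmult_left_hom] Tab xy(1) b2])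
         (use xy A'.comult_closed in auto)
  next
    show "counit A' \<one>\<^bsub>A'\<^esub> = \<one>\<^bsub>S\<^esub>"
      using f_counit[OF A.one_closed_A] by (simp add: f_one ring_hom_one[OF h_hom] ring_hom_one[OF B.counit_ring_hom])
    show "comult A' \<one>\<^bsub>A'\<^esub> = tens S A' A' \<one>\<^bsub>A'\<^esub> \<one>\<^bsub>A'\<^esub>"
      using f_comult[OF A.one_closed_A]
      by (simp add: f_one f2_one ring_hom_one[OF B.comult_ring_hom, unfolded A.tensor_algebra_simps])
  qed
qed

end

section \<open>Polynomials with coefficients in a module\<close>

text \<open>
  The Cauchy product for a biadditive \<open>\<beta>\<close>. It covers the scalar multiplication of \<open>M[t]\<close> and the
  map \<open>M[t] \<times> N[t] \<rightarrow> (M \<otimes> N)[t]\<close>.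
\<close>

definition convolution ::
  "('c, 'z) ring_scheme \<Rightarrow> ('a \<Rightarrow> 'b \<Rightarrow> 'c) \<Rightarrow> (nat \<Rightarrow> 'a) \<Rightarrow> (nat \<Rightarrow> 'b) \<Rightarrow> nat \<Rightarrow> 'c" where
  "convolution P \<beta> p q = (\<lambda>n. \<Oplus>\<^bsub>P\<^esub>i\<in>{..n}. \<beta> (p i) (q (n - i)))"

locale convolution_maps =
  M: finsupp_group M Mt "UNIV :: nat set" + N: finsupp_group N Nt "UNIV :: nat set"
  + P: finsupp_group P Pt "UNIV :: nat set"
  for M :: "('a, 'x) ring_scheme" and Mt and N :: "('b, 'y) ring_scheme" and Nt
    and P :: "('c, 'z) ring_scheme" and Pt +
  fixes \<beta>
  assumes left: "y \<in> carrier N \<Longrightarrow> (\<lambda>x. \<beta> x y) \<in> additive_maps M P"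
    and right: "x \<in> carrier M \<Longrightarrow> \<beta> x \<in> additive_maps N P"
begin

lemma closed: "x \<in> carrier M \<Longrightarrow> y \<in> carrier N \<Longrightarrow> \<beta> x y \<in> carrier P"
  using additive_maps_closed[OF right] by simp

lemma zero_left: "y \<in> carrier N \<Longrightarrow> \<beta> \<zero>\<^bsub>M\<^esub> y = \<zero>\<^bsub>P\<^esub>"
  by (rule additive_maps_zero[OF M.abelian_group_axioms P.abelian_group_axioms left])

lemma zero_right: "x \<in> carrier M \<Longrightarrow> \<beta> x \<zero>\<^bsub>N\<^esub> = \<zero>\<^bsub>P\<^esub>"
  by (rule additive_maps_zero[OF N.abelian_group_axioms P.abelian_group_axioms right])

lemma convolution_closed:
  assumes p: "p \<in> carrier Mt" and q: "q \<in> carrier Nt"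
  shows "convolution P \<beta> p q \<in> carrier Pt"
proof -
  obtain k where k: "\<And>i. p i \<noteq> \<zero>\<^bsub>M\<^esub> \<Longrightarrow> i \<le> k"
    using iffD1[OF finite_nat_set_iff_bounded_le M.finite_support[OF p]] by auto
  obtain l where l: "\<And>i. q i \<noteq> \<zero>\<^bsub>N\<^esub> \<Longrightarrow> i \<le> l"
    using iffD1[OF finite_nat_set_iff_bounded_le N.finite_support[OF q]] by auto
  have z: "convolution P \<beta> p q n = \<zero>\<^bsub>P\<^esub>" if "k + l < n" for n
  proof -
    have "\<beta> (p i) (q (n - i)) = \<zero>\<^bsub>P\<^esub>" for i
    proof (cases "i \<le> k")
      case True
      then have "l < n - i" using that by simp
      then have "q (n - i) = \<zero>\<^bsub>N\<^esub>" using l[of "n - i"] by auto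
      then show ?thesis using zero_right M.value_closed[OF p] by simp
    next
      case False
      then have "p i = \<zero>\<^bsub>M\<^esub>" using k[of i] by auto
      then show ?thesis using zero_left N.value_closed[OF q] by simp
    qed
    then show ?thesis by (simp add: convolution_def)
  qed
  have "{n. convolution P \<beta> p q n \<noteq> \<zero>\<^bsub>P\<^esub>} \<subseteq> {..k + l}" using z by (auto simp: not_less[symmetric])
  then have "finite {n. convolution P \<beta> p q n \<noteq> \<zero>\<^bsub>P\<^esub>}" by (rule finite_subset) simp
  moreover have "convolution P \<beta> p q n \<in> carrier P" for n
    unfolding convolution_def using M.value_closed[OF p] N.value_closed[OF q] closed by (intro P.finsum_closed) simp
  ultimately show ?thesis by (simp add: P.carrier_P)
qed

lemma convolution_left: 
  assumes q: "q \<in> carrier Nt"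
  shows "(\<lambda>p. convolution P \<beta> p q) \<in> additive_maps Mt Pt"
proof (rule additive_mapsI)
  fix p p' assume p: "p \<in> carrier Mt" and p': "p' \<in> carrier Mt"
  have "convolution P \<beta> (p \<oplus>\<^bsub>Mt\<^esub> p') q n = convolution P \<beta> p q n \<oplus>\<^bsub>P\<^esub> convolution P \<beta> p' q n" for n
    unfolding convolution_def
    using M.value_closed[OF p] M.value_closed[OF p'] N.value_closed[OF q] closed additive_maps_add[OF left]
    by (subst P.finsum_addf[symmetric]) (auto intro!: P.finsum_cong' simp: M.add_P[OF p p'])
  then show "convolution P \<beta> (p \<oplus>\<^bsub>Mt\<^esub> p') q = convolution P \<beta> p q \<oplus>\<^bsub>Pt\<^esub> convolution P \<beta> p' q"
    using p p' q by (simp add: P.add_P convolution_closed fun_eq_iff)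
qed (use q convolution_closed in auto)

lemma convolution_right: 
  assumes p: "p \<in> carrier Mt"
  shows "(\<lambda>q. convolution P \<beta> p q) \<in> additive_maps Nt Pt"
proof (rule additive_mapsI)
  fix q q' assume q: "q \<in> carrier Nt" and q': "q' \<in> carrier Nt"
  have "convolution P \<beta> p (q \<oplus>\<^bsub>Nt\<^esub> q') n = convolution P \<beta> p q n \<oplus>\<^bsub>P\<^esub> convolution P \<beta> p q' n" for n
    unfolding convolution_def
    using N.value_closed[OF q] N.value_closed[OF q'] M.value_closed[OF p] closed additive_maps_add[OF right]
    by (subst P.finsum_addf[symmetric]) (auto intro!: P.finsum_cong' simp: N.add_P[OF q q'])
  then show "convolution P \<beta> p (q \<oplus>\<^bsub>Nt\<^esub> q') = convolution P \<beta> p q \<oplus>\<^bsub>Pt\<^esub> convolution P \<beta> p q'"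
    using p q q' by (simp add: P.add_P convolution_closed fun_eq_iff)
qed (use p convolution_closed in auto)

lemma convolution_fsingle:
  assumes x: "x \<in> carrier M" and y: "y \<in> carrier N"
  shows "convolution P \<beta> (fsingle M i x) (fsingle N j y) = fsingle P (i + j) (\<beta> x y)"
proof
  fix n
  have "convolution P \<beta> (fsingle M i x) (fsingle N j y) n =
    (\<Oplus>\<^bsub>P\<^esub>k\<in>{..n}. if i = k then (if n = i + j then \<beta> x y else \<zero>\<^bsub>P\<^esub>) else \<zero>\<^bsub>P\<^esub>)"
    unfolding convolution_def
    by (rule P.finsum_cong') (use x y in \<open>auto simp: fsingle_def closed zero_left zero_right\<close>)
  also have "\<dots> = fsingle P (i + j) (\<beta> x y) n"
  proof (cases "i \<le> n")
    case True
    then show ?thesis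
      using closed[OF x y] P.finsum_singleton[of i "{..n}" "\<lambda>_. if n = i + j then \<beta> x y else \<zero>\<^bsub>P\<^esub>"]
      by (simp add: fsingle_def)
  next
    case False
    have "(\<Oplus>\<^bsub>P\<^esub>k\<in>{..n}. if i = k then (if n = i + j then \<beta> x y else \<zero>\<^bsub>P\<^esub>) else \<zero>\<^bsub>P\<^esub>) = (\<Oplus>\<^bsub>P\<^esub>k\<in>{..n}. \<zero>\<^bsub>P\<^esub>)"
      by (rule P.finsum_cong') (use False in auto)
    then show ?thesis using False by (simp add: fsingle_def)
  qed
  finally show "convolution P \<beta> (fsingle M i x) (fsingle N j y) n = \<dots>" .
qed

end

lemma finsupp_UP:
  assumes "cring K" shows "finsupp_group K (UP K) UNIV"
proof -
  interpret K: cring K by fact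
  have fin: "(\<exists>n. bound \<zero>\<^bsub>K\<^esub> n c) \<longleftrightarrow> finite {s. c s \<noteq> \<zero>\<^bsub>K\<^esub>}" for c :: "nat \<Rightarrow> 'a"
  proof
    assume "\<exists>n. bound \<zero>\<^bsub>K\<^esub> n c"
    then obtain n where "bound \<zero>\<^bsub>K\<^esub> n c" ..
    then have "{s. c s \<noteq> \<zero>\<^bsub>K\<^esub>} \<subseteq> {..n}" by (auto dest: bound_below)
    then show "finite {s. c s \<noteq> \<zero>\<^bsub>K\<^esub>}" by (rule finite_subset) simp
  next
    assume fin: "finite {s. c s \<noteq> \<zero>\<^bsub>K\<^esub>}"
    obtain k where k: "\<And>i. c i \<noteq> \<zero>\<^bsub>K\<^esub> \<Longrightarrow> i \<le> k"
      using iffD1[OF finite_nat_set_iff_bounded_le fin] by auto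
    have "c m = \<zero>\<^bsub>K\<^esub>" if "k < m" for m using k[of m] that by auto
    then have "bound \<zero>\<^bsub>K\<^esub> k c" by (rule bound.intro)
    then show "\<exists>n. bound \<zero>\<^bsub>K\<^esub> n c" ..
  qed
  show ?thesis
    by unfold_locales (auto simp: UP_def up_def fin)
qed

lemma finsupp_poly_module:
  assumes "module K M" shows "finsupp_group M (poly_module K M) UNIV"
proof -
  interpret M: module K M by fact
  show ?thesis by unfold_locales (auto simp: poly_module_def)
qed

definition eval_scalar :: "('k, 'x) ring_scheme \<Rightarrow> (nat \<Rightarrow> 'k) \<Rightarrow> 'k" where
  "eval_scalar K = support_sum K K (\<lambda>n x. x)"

locale poly_coeffs = module K M for K :: "('k, 'x) ring_scheme" and M :: "('k, 'm, 'y) module_scheme"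
begin

abbreviation "Mt \<equiv> poly_module K M"

sublocale Pf: finsupp_group M Mt "UNIV :: nat set"
  by (rule finsupp_poly_module[OF module_axioms])
sublocale Kt: finsupp_group K "UP K" "UNIV :: nat set"
  by (rule finsupp_UP[OF R.is_cring])
sublocale UPK: UP_cring K "UP K" by (intro UP_cring.intro R.is_cring)
sublocale SC: convolution_maps K "UP K" M Mt M Mt "smult M"
  by unfold_locales (auto intro!: additive_mapsI simp: smult_l_distr smult_r_distr)

lemma monom_eq: "r \<in> carrier K \<Longrightarrow> monom (UP K) r n = fsingle K n r"
  by (auto simp: UP_def fsingle_def)

lemma smult_Mt: "a \<in> carrier (UP K) \<Longrightarrow> a \<odot>\<^bsub>Mt\<^esub> p = convolution M (smult M) a p"
  by (auto simp: poly_module_def convolution_def UP_def)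

lemma smult_fsingle:
  "r \<in> carrier K \<Longrightarrow> x \<in> carrier M \<Longrightarrow> fsingle K i r \<odot>\<^bsub>Mt\<^esub> fsingle M j x = fsingle M (i + j) (r \<odot>\<^bsub>M\<^esub> x)"
  using Kt.fsingle_closed[of i r] by (simp add: smult_Mt SC.convolution_fsingle)

lemma mult_fsingle:
  assumes "r \<in> carrier K" "s \<in> carrier K"
  shows "fsingle K i r \<otimes>\<^bsub>UP K\<^esub> fsingle K j s = fsingle K (i + j) (r \<otimes>\<^bsub>K\<^esub> s)"
  using UPK.monom_mult[OF assms, of i j] assms by (simp add: monom_eq)

lemma smult_left_additive: "p \<in> carrier Mt \<Longrightarrow> (\<lambda>a. a \<odot>\<^bsub>Mt\<^esub> p) \<in> additive_maps (UP K) Mt"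
  using SC.convolution_left[of p] by (auto simp: additive_maps_def smult_Mt)

lemma smult_right_additive: "a \<in> carrier (UP K) \<Longrightarrow> (\<lambda>p. a \<odot>\<^bsub>Mt\<^esub> p) \<in> additive_maps Mt Mt"
  using SC.convolution_right[of a] by (auto simp: additive_maps_def smult_Mt)

lemma module_Mt: "module (UP K) Mt"
proof (rule moduleI[OF UPK.UP_cring Pf.group_P])
  fix a x assume a: "a \<in> carrier (UP K)" and x: "x \<in> carrier Mt"
  show "a \<odot>\<^bsub>Mt\<^esub> x \<in> carrier Mt" using additive_maps_closed[OF smult_right_additive] a x by simp
  fix b assume b: "b \<in> carrier (UP K)"
  show "(a \<oplus>\<^bsub>UP K\<^esub> b) \<odot>\<^bsub>Mt\<^esub> x = a \<odot>\<^bsub>Mt\<^esub> x \<oplus>\<^bsub>Mt\<^esub> b \<odot>\<^bsub>Mt\<^esub> x"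
    using additive_maps_add[OF smult_left_additive] a b x by simp
  have mult_left: "(\<lambda>a. a \<otimes>\<^bsub>UP K\<^esub> b) \<in> additive_maps (UP K) (UP K)" if "b \<in> carrier (UP K)" for b
    using that by (intro additive_mapsI) (auto simp: UPK.P.l_distr)
  have mult_right: "(\<lambda>b. a \<otimes>\<^bsub>UP K\<^esub> b) \<in> additive_maps (UP K) (UP K)" if "a \<in> carrier (UP K)" for a
    using that by (intro additive_mapsI) (auto simp: UPK.P.r_distr)
  note sl = smult_left_additive and sr = smult_right_additive and Kc = Kt.fsingle_closed[OF UNIV_I] and Mc = Pf.fsingle_closed[OF UNIV_I]
  have cl: "c \<odot>\<^bsub>Mt\<^esub> y \<in> carrier Mt" if "c \<in> carrier (UP K)" "y \<in> carrier Mt" for c y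
    using additive_maps_closed[OF sr] that by simp
  have 1: "(fsingle K i r \<otimes>\<^bsub>UP K\<^esub> fsingle K j s) \<odot>\<^bsub>Mt\<^esub> y = fsingle K i r \<odot>\<^bsub>Mt\<^esub> (fsingle K j s \<odot>\<^bsub>Mt\<^esub> y)"
    if "r \<in> carrier K" "s \<in> carrier K" "y \<in> carrier Mt" for i j r s y
    by (rule Pf.additive_maps_eqI[OF Pf.group_P sr additive_maps_comp[OF sr sr] that(3)])
       (use that in \<open>simp_all add: Kc UPK.P.m_closed mult_fsingle smult_fsingle smult_assoc1 add.assoc\<close>)
  have 2: "(fsingle K i r \<otimes>\<^bsub>UP K\<^esub> b) \<odot>\<^bsub>Mt\<^esub> x = fsingle K i r \<odot>\<^bsub>Mt\<^esub> (b \<odot>\<^bsub>Mt\<^esub> x)"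
    if "r \<in> carrier K" for i r
    by (rule Kt.additive_maps_eqI[OF Pf.group_P additive_maps_comp[OF mult_right sl] additive_maps_comp[OF sl sr] b 1])
       (use that x Kc in auto)
  show "(a \<otimes>\<^bsub>UP K\<^esub> b) \<odot>\<^bsub>Mt\<^esub> x = a \<odot>\<^bsub>Mt\<^esub> (b \<odot>\<^bsub>Mt\<^esub> x)"
    by (rule Kt.additive_maps_eqI[OF Pf.group_P additive_maps_comp[OF mult_left sl] sl a 2])
       (use b x cl in auto)
next
  fix a x y assume "a \<in> carrier (UP K)" "x \<in> carrier Mt" "y \<in> carrier Mt"
  then show "a \<odot>\<^bsub>Mt\<^esub> (x \<oplus>\<^bsub>Mt\<^esub> y) = a \<odot>\<^bsub>Mt\<^esub> x \<oplus>\<^bsub>Mt\<^esub> a \<odot>\<^bsub>Mt\<^esub> y"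
    using additive_maps_add[OF smult_right_additive] by simp
next
  fix x assume x: "x \<in> carrier Mt"
  have "\<one>\<^bsub>UP K\<^esub> = fsingle K 0 \<one>\<^bsub>K\<^esub>" by (auto simp: UP_def fsingle_def)
  then show "\<one>\<^bsub>UP K\<^esub> \<odot>\<^bsub>Mt\<^esub> x = x"
    by (intro Pf.additive_maps_eqI[OF Pf.group_P smult_right_additive additive_maps_id x])
       (simp_all add: Kt.fsingle_closed smult_fsingle)
qed

sublocale Mt: module "UP K" Mt by (rule module_Mt)

text \<open>
  Linearity over \<open>K[t]\<close> is reduced to monomials in both arguments.
\<close>

lemma poly_semilinearI:
  assumes "module S N" "h \<in> additive_maps (UP K) S" "f \<in> additive_maps Mt N"
    and "\<And>i j r x. r \<in> carrier K \<Longrightarrow> x \<in> carrier M \<Longrightarrow>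
      f (fsingle M (i + j) (r \<odot>\<^bsub>M\<^esub> x)) = h (fsingle K i r) \<odot>\<^bsub>N\<^esub> f (fsingle M j x)"
  shows "f \<in> semilinear_maps (UP K) h Mt N"
proof (rule semilinear_mapsI[OF assms(3)])
  interpret N: module S N by fact
  note Kc = Kt.fsingle_closed[OF UNIV_I] and Mc = Pf.fsingle_closed[OF UNIV_I]
  have smN: "(\<lambda>y. s \<odot>\<^bsub>N\<^esub> y) \<in> additive_maps N N" if "s \<in> carrier S" for s
    using that by (intro additive_mapsI) (auto simp: N.smult_r_distr)
  have smN': "(\<lambda>s. s \<odot>\<^bsub>N\<^esub> y) \<in> additive_maps S N" if "y \<in> carrier N" for y
    using that by (intro additive_mapsI) (auto simp: N.smult_l_distr)
  note hc = additive_maps_closed[OF assms(2)] and fc = additive_maps_closed[OF assms(3)]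
  fix a p assume a: "a \<in> carrier (UP K)" and p: "p \<in> carrier Mt"
  have 1: "f (fsingle K i r \<odot>\<^bsub>Mt\<^esub> p) = h (fsingle K i r) \<odot>\<^bsub>N\<^esub> f p" if "r \<in> carrier K" for i r
    by (rule Pf.additive_maps_eqI[OF N.M.abelian_group_axioms additive_maps_comp[OF smult_right_additive assms(3)]
       additive_maps_comp[OF assms(3) smN] p]) (use that assms(4) in \<open>simp_all add: smult_fsingle Kc hc\<close>)
  show "f (a \<odot>\<^bsub>Mt\<^esub> p) = h a \<odot>\<^bsub>N\<^esub> f p"
    by (rule Kt.additive_maps_eqI[OF N.M.abelian_group_axioms additive_maps_comp[OF smult_left_additive assms(3)]
       additive_maps_comp[OF assms(2) smN'] a 1]) (use p fc in auto)
qed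

lemma poly_homI:
  assumes "module (UP K) N" "f \<in> additive_maps Mt N"
    and "\<And>i j r x. r \<in> carrier K \<Longrightarrow> x \<in> carrier M \<Longrightarrow>
      f (fsingle M (i + j) (r \<odot>\<^bsub>M\<^esub> x)) = fsingle K i r \<odot>\<^bsub>N\<^esub> f (fsingle M j x)"
  shows "f \<in> module_homs (UP K) Mt N"
  unfolding module_homs_semilinear
  by (rule poly_semilinearI[OF assms(1) additive_maps_id assms(2,3)])

lemma poly_const_eq: "poly_const M x = fsingle M 0 x"
  by (simp add: poly_const_def fsingle_def)

lemma t_power_const: "x \<in> carrier M \<Longrightarrow> fsingle K i \<one>\<^bsub>K\<^esub> \<odot>\<^bsub>Mt\<^esub> fsingle M 0 x = fsingle M i x"
  by (simp add: smult_fsingle)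

lemma const_ring_hom: "fsingle K 0 \<in> ring_hom K (UP K)"
  by (rule ring_hom_memI)
     (auto simp: Kt.fsingle_closed mult_fsingle additive_maps_add[OF Kt.fsingle_additive], auto simp: UP_def fsingle_def)

lemma const_semilinear: "fsingle M 0 \<in> semilinear_maps K (fsingle K 0) M Mt"
  by (rule semilinear_mapsI[OF Pf.fsingle_additive]) (simp_all add: smult_fsingle)

lemma eval_at_one_eq: "eval_at_one M = support_sum M M (\<lambda>n x. x)"
  by (simp add: eval_at_one_def support_sum_def fun_eq_iff)

lemma eval_additive: "eval_at_one M \<in> additive_maps Mt M"
  unfolding eval_at_one_eq by (rule Pf.support_sum_additive[OF M.abelian_group_axioms additive_maps_id])

lemma eval_fsingle: "x \<in> carrier M \<Longrightarrow> eval_at_one M (fsingle M n x) = x"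
  unfolding eval_at_one_eq by (rule Pf.support_sum_fsingle[OF M.abelian_group_axioms additive_maps_id UNIV_I])

lemma eval_K_eq: "eval_scalar K = support_sum K K (\<lambda>n x. x)"
  by (rule eval_scalar_def)

lemma eval_K_additive: "eval_scalar K \<in> additive_maps (UP K) K"
  unfolding eval_K_eq by (rule Kt.support_sum_additive[OF R.abelian_group_axioms additive_maps_id])

lemma eval_K_fsingle: "x \<in> carrier K \<Longrightarrow> eval_scalar K (fsingle K n x) = x"
  unfolding eval_K_eq by (rule Kt.support_sum_fsingle[OF R.abelian_group_axioms additive_maps_id UNIV_I])

lemma eval_ring_hom: "eval_scalar K \<in> ring_hom (UP K) K"
proof (rule ring_hom_memI)
  note ec = additive_maps_closed[OF eval_K_additive] and Kc = Kt.fsingle_closed[OF UNIV_I]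
  fix a assume a: "a \<in> carrier (UP K)"
  show "eval_scalar K a \<in> carrier K" using ec a by simp
  fix b assume b: "b \<in> carrier (UP K)"
  show "eval_scalar K (a \<oplus>\<^bsub>UP K\<^esub> b) = eval_scalar K a \<oplus>\<^bsub>K\<^esub> eval_scalar K b"
    using additive_maps_add[OF eval_K_additive] a b by simp
  have ml: "(\<lambda>a. a \<otimes>\<^bsub>UP K\<^esub> b) \<in> additive_maps (UP K) (UP K)" if "b \<in> carrier (UP K)" for b
    using that by (intro additive_mapsI) (auto simp: UPK.P.l_distr)
  have mr: "(\<lambda>b. a \<otimes>\<^bsub>UP K\<^esub> b) \<in> additive_maps (UP K) (UP K)" if "a \<in> carrier (UP K)" for a
    using that by (intro additive_mapsI) (auto simp: UPK.P.r_distr)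
  have kl: "(\<lambda>a. a \<otimes>\<^bsub>K\<^esub> b) \<in> additive_maps K K" if "b \<in> carrier K" for b
    using that by (intro additive_mapsI) (auto simp: R.l_distr)
  have kr: "(\<lambda>b. a \<otimes>\<^bsub>K\<^esub> b) \<in> additive_maps K K" if "a \<in> carrier K" for a
    using that by (intro additive_mapsI) (auto simp: R.r_distr)
  have 1: "eval_scalar K (fsingle K i r \<otimes>\<^bsub>UP K\<^esub> b) = eval_scalar K (fsingle K i r) \<otimes>\<^bsub>K\<^esub> eval_scalar K b"
    if "r \<in> carrier K" for i r
    by (rule Kt.additive_maps_eqI[OF R.abelian_group_axioms additive_maps_comp[OF mr eval_K_additive]
          additive_maps_comp[OF eval_K_additive kr] b])
       (use that in \<open>simp_all add: Kc eval_K_fsingle mult_fsingle\<close>)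
  show "eval_scalar K (a \<otimes>\<^bsub>UP K\<^esub> b) = eval_scalar K a \<otimes>\<^bsub>K\<^esub> eval_scalar K b"
    by (rule Kt.additive_maps_eqI[OF R.abelian_group_axioms additive_maps_comp[OF ml eval_K_additive]
          additive_maps_comp[OF eval_K_additive kl] a 1]) (use b ec in auto)
next
  have "\<one>\<^bsub>UP K\<^esub> = fsingle K 0 \<one>\<^bsub>K\<^esub>" by (auto simp: UP_def fsingle_def)
  then show "eval_scalar K \<one>\<^bsub>UP K\<^esub> = \<one>\<^bsub>K\<^esub>" by (simp add: eval_K_fsingle)
qed

lemma eval_semilinear: "eval_at_one M \<in> semilinear_maps (UP K) (eval_scalar K) Mt M"
  by (rule poly_semilinearI[OF module_axioms eval_K_additive eval_additive])
     (simp add: eval_fsingle eval_K_fsingle)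

text \<open>
  Multiplication by \<open>t\<close> is the shift of coefficients, so its image consists of the polynomials without
  constant term.
\<close>

lemma cong_mod_t_iff:
  assumes p: "p \<in> carrier Mt" and q: "q \<in> carrier Mt"
  shows "cong_mod_t K M p q \<longleftrightarrow> p 0 = q 0"
proof
  have t: "monom (UP K) \<one>\<^bsub>K\<^esub> 1 \<odot>\<^bsub>Mt\<^esub> z = (\<lambda>n. if n = 0 then \<zero>\<^bsub>M\<^esub> else z (n - 1))" if z: "z \<in> carrier Mt" for z
  proof
    fix n
    have sh: "(\<lambda>n. if n = 0 then \<zero>\<^bsub>M\<^esub> else z (n - 1)) \<in> carrier Mt" if z: "z \<in> carrier Mt" for z
    proof -
      have "{n. (if n = 0 then \<zero>\<^bsub>M\<^esub> else z (n - 1)) \<noteq> \<zero>\<^bsub>M\<^esub>} \<subseteq> Suc ` {n. z n \<noteq> \<zero>\<^bsub>M\<^esub>}"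
        by (auto simp: image_iff split: if_splits intro!: exI[of _ "_ - Suc 0"])
      then have "finite {n. (if n = 0 then \<zero>\<^bsub>M\<^esub> else z (n - 1)) \<noteq> \<zero>\<^bsub>M\<^esub>}"
        by (rule finite_subset) (intro finite_imageI Pf.finite_support z)
      then show ?thesis using Pf.value_closed[OF z] by (simp add: Pf.carrier_P)
    qed
    have sa: "(\<lambda>z n. if n = 0 then \<zero>\<^bsub>M\<^esub> else z (n - 1)) \<in> additive_maps Mt Mt"
      by (rule additive_mapsI) (use sh in \<open>auto simp: Pf.add_P fun_eq_iff\<close>)
    have "monom (UP K) \<one>\<^bsub>K\<^esub> 1 \<odot>\<^bsub>Mt\<^esub> z = (\<lambda>n. if n = 0 then \<zero>\<^bsub>M\<^esub> else z (n - 1))"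
      by (rule Pf.additive_maps_eqI[OF Pf.group_P smult_right_additive sa z])
         (auto simp: monom_eq Kt.fsingle_closed smult_fsingle, auto simp: fsingle_def fun_eq_iff)
    then show "(monom (UP K) \<one>\<^bsub>K\<^esub> 1 \<odot>\<^bsub>Mt\<^esub> z) n = (if n = 0 then \<zero>\<^bsub>M\<^esub> else z (n - 1))" by simp
  qed
  have tc: "monom (UP K) \<one>\<^bsub>K\<^esub> 1 \<odot>\<^bsub>Mt\<^esub> z \<in> carrier Mt" if "z \<in> carrier Mt" for z
    using that by simp
  {
    assume "cong_mod_t K M p q"
    then obtain z where z: "z \<in> carrier Mt" "p = q \<oplus>\<^bsub>Mt\<^esub> (monom (UP K) \<one>\<^bsub>K\<^esub> 1 \<odot>\<^bsub>Mt\<^esub> z)"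
      by (auto simp: cong_mod_t_def)
    have "p 0 = q 0 \<oplus>\<^bsub>M\<^esub> (monom (UP K) \<one>\<^bsub>K\<^esub> 1 \<odot>\<^bsub>Mt\<^esub> z) 0"
      using z(2) by (simp only: Pf.add_P[OF q tc[OF z(1)]])
    then have "p 0 = q 0 \<oplus>\<^bsub>M\<^esub> \<zero>\<^bsub>M\<^esub>" by (simp only: t[OF z(1)]) simp
    then show "p 0 = q 0" using Pf.value_closed[OF q] by simp
  }
  assume e: "p 0 = q 0"
  let ?z = "\<lambda>n. (p \<ominus>\<^bsub>Mt\<^esub> q) (Suc n)"
  have d: "p \<ominus>\<^bsub>Mt\<^esub> q \<in> carrier Mt" using p q by (simp add: Pf.P.minus_closed)
  have "finite (Suc -` {n. (p \<ominus>\<^bsub>Mt\<^esub> q) n \<noteq> \<zero>\<^bsub>M\<^esub>})"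
    by (rule finite_vimageI[OF Pf.finite_support[OF d]]) simp
  then have z: "?z \<in> carrier Mt"
    using Pf.value_closed[OF d] by (simp add: Pf.carrier_P vimage_def)
  have pd: "p = q \<oplus>\<^bsub>Mt\<^esub> (p \<ominus>\<^bsub>Mt\<^esub> q)"
    using p q by (simp add: a_minus_def Pf.P.a_lcomm Pf.P.r_neg)
  then have "p 0 = q 0 \<oplus>\<^bsub>M\<^esub> (p \<ominus>\<^bsub>Mt\<^esub> q) 0" using Pf.add_P[OF q d] by metis
  then have "(p \<ominus>\<^bsub>Mt\<^esub> q) 0 = \<zero>\<^bsub>M\<^esub>"
    using e Pf.value_closed[OF q, of 0] Pf.value_closed[OF d, of 0] by simp
  then have "monom (UP K) \<one>\<^bsub>K\<^esub> 1 \<odot>\<^bsub>Mt\<^esub> ?z = p \<ominus>\<^bsub>Mt\<^esub> q"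
    by (subst t[OF z]) (auto simp: fun_eq_iff)
  then show "cong_mod_t K M p q" using z pd unfolding cong_mod_t_def by metis
qed

end

subsection \<open>Coefficientwise maps\<close>

lemma coeffwise_hom:
  assumes "module K M" "module K N" "f \<in> module_homs K M N"
  shows "(\<lambda>p n. f (p n)) \<in> module_homs (UP K) (poly_module K M) (poly_module K N)"
    and "x \<in> carrier M \<Longrightarrow> (\<lambda>n. f (fsingle M (j::nat) x n)) = fsingle N j (f x)"
proof -
  interpret M: poly_coeffs K M by (rule poly_coeffs.intro[OF assms(1)])
  interpret N: poly_coeffs K N by (rule poly_coeffs.intro[OF assms(2)])
  note fa = module_homs_additive[OF assms(3)]
  have f0: "f \<zero>\<^bsub>M\<^esub> = \<zero>\<^bsub>N\<^esub>" by (rule additive_maps_zero[OF M.M.abelian_group_axioms N.M.abelian_group_axioms fa])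
  have single: "(\<lambda>n. f (fsingle M j x n)) = fsingle N j (f x)" for x and j :: nat
    by (auto simp: fsingle_def f0)
  then show "x \<in> carrier M \<Longrightarrow> (\<lambda>n. f (fsingle M j x n)) = fsingle N j (f x)" by simp
  have cl: "(\<lambda>n. f (p n)) \<in> carrier N.Mt" if p: "p \<in> carrier M.Mt" for p
  proof -
    have "{n. f (p n) \<noteq> \<zero>\<^bsub>N\<^esub>} \<subseteq> {n. p n \<noteq> \<zero>\<^bsub>M\<^esub>}" using f0 by auto
    then have "finite {n. f (p n) \<noteq> \<zero>\<^bsub>N\<^esub>}" by (rule finite_subset) (rule M.Pf.finite_support[OF p])
    then show ?thesis using M.Pf.value_closed[OF p] module_homs_closed[OF assms(3)] by (simp add: N.Pf.carrier_P)
  qed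
  show "(\<lambda>p n. f (p n)) \<in> module_homs (UP K) M.Mt N.Mt"
  proof (rule M.poly_homI[OF N.module_Mt])
    show "(\<lambda>p n. f (p n)) \<in> additive_maps M.Mt N.Mt"
      by (rule additive_mapsI)
         (simp_all add: cl M.Pf.add_P N.Pf.add_P module_homs_add[OF assms(3)] M.Pf.value_closed)
    fix i j r x assume "r \<in> carrier K" "x \<in> carrier M"
    then show "(\<lambda>n. f (fsingle M (i + j) (r \<odot>\<^bsub>M\<^esub> x) n)) = fsingle K i r \<odot>\<^bsub>N.Mt\<^esub> (\<lambda>n. f (fsingle M j x n))"
      unfolding single by (simp add: N.smult_fsingle module_homs_smult[OF assms(3)] module_homs_closed[OF assms(3)])
  qed
qed

subsection \<open>Tensor products of polynomial modules\<close>

text \<open>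
  The generalization of \<open>poly_tens\<close> to two modules: triple tensor products need it for \<open>B\<close> and
  \<open>B \<otimes> B\<close> as well.
\<close>

definition poly_tensor ::
  "('r, 'x) ring_scheme \<Rightarrow> ('r, 'm, 'y) module_scheme \<Rightarrow> ('r, 'n, 'z) module_scheme
    \<Rightarrow> (nat \<Rightarrow> 'm) \<Rightarrow> (nat \<Rightarrow> 'n) \<Rightarrow> nat \<Rightarrow> ('m \<times> 'n \<Rightarrow> 'r) set" where
  "poly_tensor R M N = convolution (tensor R M N) (tens R M N)"

definition poly_tensor_map ::
  "('r, 'x) ring_scheme \<Rightarrow> ('r, 'm, 'y) module_scheme \<Rightarrow> ('r, 'n, 'z) module_scheme
    \<Rightarrow> ((nat \<Rightarrow> 'm) \<times> (nat \<Rightarrow> 'n) \<Rightarrow> nat \<Rightarrow> 'r) set \<Rightarrow> nat \<Rightarrow> ('m \<times> 'n \<Rightarrow> 'r) set" where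
  "poly_tensor_map R M N = tensor_lift (UP R) (poly_module R (tensor R M N)) (poly_tensor R M N)"

lemma poly_tens_eq: "poly_tens K M = poly_tensor K M M"
  by (simp add: poly_tens_def poly_tensor_def convolution_def fun_eq_iff)

lemma poly_tensor_iso_eq: "poly_tensor_iso K M = poly_tensor_map K M M"
  by (simp add: poly_tensor_iso_def poly_tensor_map_def poly_tens_eq)

locale poly_tensor_product = TP: tensor_product K M N
  for K :: "('k, 'x) ring_scheme" and M :: "('k, 'm, 'y) module_scheme" and N :: "('k, 'n, 'z) module_scheme"
begin

sublocale Mp: poly_coeffs K M by unfold_locales
sublocale Np: poly_coeffs K N by unfold_locales
sublocale Tp: poly_coeffs K "tensor K M N" using TP.module_T by (rule poly_coeffs.intro)
sublocale TT: tensor_product "UP K" "poly_module K M" "poly_module K N"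
  using Mp.module_Mt Np.module_Mt by (rule tensor_product.intro)

sublocale C: convolution_maps M "poly_module K M" N "poly_module K N" "tensor K M N" "poly_module K (tensor K M N)" "tens K M N"
  using bilinear_maps_left[OF TP.tens_bilinear] bilinear_maps_right[OF TP.tens_bilinear]
  by unfold_locales (auto dest: module_homs_additive)

lemma poly_tensor_fsingle:
  "x \<in> carrier M \<Longrightarrow> y \<in> carrier N \<Longrightarrow>
    poly_tensor K M N (fsingle M i x) (fsingle N j y) = fsingle (tensor K M N) (i + j) (tens K M N x y)"
  unfolding poly_tensor_def by (rule C.convolution_fsingle)

lemma poly_tensor_left: "q \<in> carrier Np.Mt \<Longrightarrow> (\<lambda>p. poly_tensor K M N p q) \<in> additive_maps Mp.Mt Tp.Mt"
  unfolding poly_tensor_def by (rule C.convolution_left)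
lemma poly_tensor_right: "p \<in> carrier Mp.Mt \<Longrightarrow> (\<lambda>q. poly_tensor K M N p q) \<in> additive_maps Np.Mt Tp.Mt"
  unfolding poly_tensor_def by (rule C.convolution_right)

lemma poly_tensor_closed: "p \<in> carrier Mp.Mt \<Longrightarrow> q \<in> carrier Np.Mt \<Longrightarrow> poly_tensor K M N p q \<in> carrier Tp.Mt"
  unfolding poly_tensor_def by (rule C.convolution_closed)

lemma poly_tensor_bilinear: "poly_tensor K M N \<in> bilinear_maps (UP K) Mp.Mt Np.Mt Tp.Mt"
proof (rule bilinear_mapsI)
  note Mc = Mp.Pf.fsingle_closed[OF UNIV_I] and Nc = Np.Pf.fsingle_closed[OF UNIV_I] and Kc = Mp.Kt.fsingle_closed[OF UNIV_I]
  fix q assume q: "q \<in> carrier Np.Mt"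
  show "(\<lambda>p. poly_tensor K M N p q) \<in> module_homs (UP K) Mp.Mt Tp.Mt"
  proof (rule Mp.poly_homI[OF Tp.module_Mt poly_tensor_left[OF q]])
    fix i j r x assume rx: "r \<in> carrier K" "x \<in> carrier M"
    show "poly_tensor K M N (fsingle M (i + j) (r \<odot>\<^bsub>M\<^esub> x)) q = fsingle K i r \<odot>\<^bsub>Tp.Mt\<^esub> poly_tensor K M N (fsingle M j x) q"
      by (rule Np.Pf.additive_maps_eqI[OF Tp.Pf.group_P poly_tensor_right
            additive_maps_comp[OF poly_tensor_right Tp.smult_right_additive] q])
         (use rx in \<open>simp_all add: Mc Kc poly_tensor_fsingle Tp.smult_fsingle TP.tens_smult_left add.assoc\<close>)
  qed
next
  note Mc = Mp.Pf.fsingle_closed[OF UNIV_I] and Nc = Np.Pf.fsingle_closed[OF UNIV_I] and Kc = Mp.Kt.fsingle_closed[OF UNIV_I]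
  fix p assume p: "p \<in> carrier Mp.Mt"
  show "(\<lambda>q. poly_tensor K M N p q) \<in> module_homs (UP K) Np.Mt Tp.Mt"
  proof (rule Np.poly_homI[OF Tp.module_Mt poly_tensor_right[OF p]])
    fix i j r x assume rx: "r \<in> carrier K" "x \<in> carrier N"
    show "poly_tensor K M N p (fsingle N (i + j) (r \<odot>\<^bsub>N\<^esub> x)) = fsingle K i r \<odot>\<^bsub>Tp.Mt\<^esub> poly_tensor K M N p (fsingle N j x)"
      by (rule Mp.Pf.additive_maps_eqI[OF Tp.Pf.group_P poly_tensor_left
            additive_maps_comp[OF poly_tensor_left Tp.smult_right_additive] p])
         (use rx in \<open>simp_all add: Nc Kc poly_tensor_fsingle Tp.smult_fsingle TP.tens_smult_right add.left_commute\<close>)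
  qed
qed

abbreviation "PT \<equiv> poly_tensor_map K M N"

lemma PT_hom: "PT \<in> module_homs (UP K) TT.T Tp.Mt"
  unfolding poly_tensor_map_def by (rule TT.tensor_lift_hom[OF Tp.module_Mt poly_tensor_bilinear])

lemma PT_tens: "p \<in> carrier Mp.Mt \<Longrightarrow> q \<in> carrier Np.Mt \<Longrightarrow> PT (tens (UP K) Mp.Mt Np.Mt p q) = poly_tensor K M N p q"
  unfolding poly_tensor_map_def by (rule TT.tensor_lift_tens[OF Tp.module_Mt poly_tensor_bilinear])

abbreviation "const_tensor \<equiv> semi_tensor K (fsingle K 0) (UP K) Mp.Mt Np.Mt (fsingle M 0) (fsingle N 0)"

lemmas const_tensor_semilinear = TP.semi_tensor_semilinear[OF Mp.const_ring_hom Mp.module_Mt Np.module_Mt Mp.const_semilinear Np.const_semilinear]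
lemmas const_tensor_tens = TP.semi_tensor_tens[OF Mp.const_ring_hom Mp.module_Mt Np.module_Mt Mp.const_semilinear Np.const_semilinear]
lemmas const_tensor_additive = semilinear_maps_additive[OF const_tensor_semilinear]

lemma PT_const_tensor:
  assumes w: "w \<in> carrier TP.T" shows "PT (const_tensor w) = fsingle TP.T 0 w"
  by (rule TP.tensor_maps_eqI[OF Tp.Pf.group_P additive_maps_comp[OF const_tensor_additive module_homs_additive[OF PT_hom]]
        Tp.Pf.fsingle_additive[OF UNIV_I] w])
     (simp add: const_tensor_tens PT_tens Mp.Pf.fsingle_closed Np.Pf.fsingle_closed poly_tensor_fsingle)

text \<open>
  The inverse sends \<open>t\<^sup>n w\<close> to \<open>t\<^sup>n\<close> times the image of \<open>w\<close> under \<open>x \<otimes> y \<mapsto> x \<otimes> y\<close>,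
  with \<open>x\<close> and \<open>y\<close> regarded as constant polynomials.
\<close>

definition "PT_inv = support_sum TP.T TT.T (\<lambda>n w. fsingle K n \<one>\<^bsub>K\<^esub> \<odot>\<^bsub>TT.T\<^esub> const_tensor w)"

lemma PT_inv_summand: "(\<lambda>w. fsingle K n \<one>\<^bsub>K\<^esub> \<odot>\<^bsub>TT.T\<^esub> const_tensor w) \<in> additive_maps TP.T TT.T"
  by (rule additive_maps_comp[OF const_tensor_additive])
     (auto intro!: additive_mapsI simp: Mp.Kt.fsingle_closed TT.T.smult_r_distr)

lemma PT_inv_additive: "PT_inv \<in> additive_maps Tp.Mt TT.T"
  unfolding PT_inv_def by (rule Tp.Pf.support_sum_additive[OF TT.T.M.abelian_group_axioms PT_inv_summand])

lemma PT_inv_fsingle: "w \<in> carrier TP.T \<Longrightarrow> PT_inv (fsingle TP.T n w) = fsingle K n \<one>\<^bsub>K\<^esub> \<odot>\<^bsub>TT.T\<^esub> const_tensor w"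
  unfolding PT_inv_def by (rule Tp.Pf.support_sum_fsingle[OF TT.T.M.abelian_group_axioms PT_inv_summand UNIV_I])

lemma PT_PT_inv:
  assumes "w \<in> carrier Tp.Mt" shows "PT (PT_inv w) = w"
  by (rule Tp.Pf.additive_maps_eqI[OF Tp.Pf.group_P additive_maps_comp[OF PT_inv_additive module_homs_additive[OF PT_hom]]
        additive_maps_id assms])
     (simp add: PT_inv_fsingle module_homs_smult[OF PT_hom] Mp.Kt.fsingle_closed
        additive_maps_closed[OF const_tensor_additive] PT_const_tensor Tp.t_power_const)

text \<open>
  By additivity it is enough to consider \<open>t\<^sup>i x \<otimes> t\<^sup>j y\<close>, where the powers of \<open>t\<close> can be moved
  out of the tensor product over \<open>K[t]\<close>.
\<close>

lemma PT_inv_PT: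
  assumes "w \<in> carrier TT.T" shows "PT_inv (PT w) = w"
proof -
  note ad = additive_maps_comp[OF module_homs_additive[OF PT_hom] PT_inv_additive]
  note Mc = Mp.Pf.fsingle_closed[OF UNIV_I] and Nc = Np.Pf.fsingle_closed[OF UNIV_I] and Kc = Mp.Kt.fsingle_closed[OF UNIV_I]
  note tl = module_homs_additive[OF bilinear_maps_left[OF TT.tens_bilinear]]
  note tr = module_homs_additive[OF bilinear_maps_right[OF TT.tens_bilinear]]
  have 0: "PT_inv (PT (tens (UP K) Mp.Mt Np.Mt (fsingle M i x) (fsingle N j y))) = tens (UP K) Mp.Mt Np.Mt (fsingle M i x) (fsingle N j y)"
    if "x \<in> carrier M" "y \<in> carrier N" for i j x y
  proof -
    have K1: "fsingle K i \<one>\<^bsub>K\<^esub> \<in> carrier (UP K)" for i by (simp add: Kc)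
    \<comment> \<open>the order of the factors is that in which the scalars leave the tensor\<close>
    have e: "fsingle K (i + j) \<one>\<^bsub>K\<^esub> = fsingle K j \<one>\<^bsub>K\<^esub> \<otimes>\<^bsub>UP K\<^esub> fsingle K i \<one>\<^bsub>K\<^esub>"
      by (simp add: Mp.mult_fsingle add.commute)
    have "PT_inv (PT (tens (UP K) Mp.Mt Np.Mt (fsingle M i x) (fsingle N j y))) =
      fsingle K (i + j) \<one>\<^bsub>K\<^esub> \<odot>\<^bsub>TT.T\<^esub> tens (UP K) Mp.Mt Np.Mt (fsingle M 0 x) (fsingle N 0 y)"
      using that by (simp add: PT_tens Mc Nc poly_tensor_fsingle PT_inv_fsingle const_tensor_tens)
    also have "\<dots> = tens (UP K) Mp.Mt Np.Mt (fsingle K i \<one>\<^bsub>K\<^esub> \<odot>\<^bsub>Mp.Mt\<^esub> fsingle M 0 x) (fsingle K j \<one>\<^bsub>K\<^esub> \<odot>\<^bsub>Np.Mt\<^esub> fsingle N 0 y)"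
      unfolding e using that K1
      by (simp add: TT.tens_smult_left TT.tens_smult_right TT.T.smult_assoc1 Mc Nc)
    finally show ?thesis using that by (simp add: Mp.t_power_const Np.t_power_const)
  qed
  have 1: "PT_inv (PT (tens (UP K) Mp.Mt Np.Mt (fsingle M i x) q)) = tens (UP K) Mp.Mt Np.Mt (fsingle M i x) q"
    if "x \<in> carrier M" "q \<in> carrier Np.Mt" for i x q
    by (rule Np.Pf.additive_maps_eqI[OF TT.T.M.abelian_group_axioms additive_maps_comp[OF tr ad] tr that(2)])
       (use that Mc 0 in auto)
  have 2: "PT_inv (PT (tens (UP K) Mp.Mt Np.Mt p q)) = tens (UP K) Mp.Mt Np.Mt p q"
    if "p \<in> carrier Mp.Mt" "q \<in> carrier Np.Mt" for p q
    by (rule Mp.Pf.additive_maps_eqI[OF TT.T.M.abelian_group_axioms additive_maps_comp[OF tl ad] tl that(1)])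
       (use that 1 in auto)
  show ?thesis
    by (rule TT.tensor_maps_eqI[OF TT.T.M.abelian_group_axioms ad additive_maps_id assms 2])
qed

lemma PT_bij: "bij_betw PT (carrier TT.T) (carrier Tp.Mt)"
  by (rule bij_betwI[where g = PT_inv])
     (use module_homs_closed[OF PT_hom] additive_maps_closed[OF PT_inv_additive] PT_PT_inv PT_inv_PT in auto)

end

section \<open>Graded modules\<close>

text \<open>
  A grading is handled through its projections \<open>P i\<close>, since these are linear maps and have tensor
  products. The elements of degree \<open>d\<close> and the filtration are then given by equations.
\<close>

definition homogeneous :: "('a, 'x) ring_scheme \<Rightarrow> (nat \<Rightarrow> 'a \<Rightarrow> 'a) \<Rightarrow> nat \<Rightarrow> 'a set" where
  "homogeneous M P d = {x \<in> carrier M. \<forall>i. P i x = (if i = d then x else \<zero>\<^bsub>M\<^esub>)}"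

definition filtered_part :: "('a, 'x) ring_scheme \<Rightarrow> (nat \<Rightarrow> 'a \<Rightarrow> 'a) \<Rightarrow> nat \<Rightarrow> 'a set" where
  "filtered_part M P n = {x \<in> carrier M. \<forall>i>n. P i x = \<zero>\<^bsub>M\<^esub>}"

text \<open>
  The map \<open>b t\<^sup>j \<mapsto> b t\<^bsup>i+j\<^esup>\<close> for \<open>b\<close> of degree \<open>i\<close>. It sends a homogeneous
  polynomial \<open>p\<close> of degree \<open>n\<close> to \<open>p(1) t\<^sup>n\<close>, so it records the values at \<open>t = 1\<close> of all
  homogeneous components and is injective, in contrast to evaluation at \<open>t = 1\<close>.
\<close>

definition rees :: "('a, 'x) ring_scheme \<Rightarrow> (nat \<Rightarrow> 'a, 'y) ring_scheme \<Rightarrow> (nat \<Rightarrow> 'a \<Rightarrow> 'a) \<Rightarrow> (nat \<Rightarrow> 'a) \<Rightarrow> nat \<Rightarrow> 'a" where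
  "rees M Mt P = support_sum M Mt (\<lambda>j x n. if j \<le> n then P (n - j) x else \<zero>\<^bsub>M\<^esub>)"

text \<open>
  The map \<open>b t\<^sup>n \<mapsto> b t\<^bsup>n-i\<^esup>\<close> for \<open>b\<close> of degree \<open>i \<le> n\<close>, which inverts \<open>rees\<close>.
  Components of degree greater than \<open>n\<close> are discarded, so it is an inverse only on polynomials whose
  coefficient of \<open>t\<^sup>n\<close> lies in \<open>F n\<close>.
\<close>

definition homogenize :: "('a, 'x) ring_scheme \<Rightarrow> (nat \<Rightarrow> 'a, 'y) ring_scheme \<Rightarrow> (nat \<Rightarrow> 'a \<Rightarrow> 'a) \<Rightarrow> (nat \<Rightarrow> 'a) \<Rightarrow> nat \<Rightarrow> 'a" where
  "homogenize M Mt P = support_sum M Mt (\<lambda>n x j. if j \<le> n then P (n - j) x else \<zero>\<^bsub>M\<^esub>)"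

locale graded_module = poly_coeffs K M
  for K :: "('k, 'x) ring_scheme" and M :: "('k, 'm, 'y) module_scheme" +
  fixes P :: "nat \<Rightarrow> 'm \<Rightarrow> 'm"
  assumes proj_hom: "P i \<in> module_homs K M M"
    and generated: "carrier M = additive_span M (\<Union>d. homogeneous M P d)"
begin

abbreviation "H \<equiv> homogeneous M P"
abbreviation "F \<equiv> filtered_part M P"

lemmas proj_additive = module_homs_additive[OF proj_hom]
lemmas proj_closed = module_homs_closed[OF proj_hom]
lemmas proj_zero = additive_maps_zero[OF M.abelian_group_axioms M.abelian_group_axioms proj_additive]

lemma H_closed: "x \<in> H d \<Longrightarrow> x \<in> carrier M" by (auto simp: homogeneous_def)
lemma F_closed: "x \<in> F d \<Longrightarrow> x \<in> carrier M" by (auto simp: filtered_part_def)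
lemma H_proj: "x \<in> H d \<Longrightarrow> P i x = (if i = d then x else \<zero>\<^bsub>M\<^esub>)" by (auto simp: homogeneous_def)

lemma UN_H_closed: "(\<Union>d. H d) \<subseteq> carrier M" by (auto simp: homogeneous_def)

lemma H_zero: "\<zero>\<^bsub>M\<^esub> \<in> H d" by (auto simp: homogeneous_def proj_zero)

lemma H_smult: "r \<in> carrier K \<Longrightarrow> x \<in> H d \<Longrightarrow> r \<odot>\<^bsub>M\<^esub> x \<in> H d"
  by (simp add: homogeneous_def module_homs_smult[OF proj_hom])

lemma F_zero: "\<zero>\<^bsub>M\<^esub> \<in> F d" by (auto simp: filtered_part_def proj_zero)

lemma F_add: "x \<in> F n \<Longrightarrow> y \<in> F n \<Longrightarrow> x \<oplus>\<^bsub>M\<^esub> y \<in> F n"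
  by (auto simp: filtered_part_def module_homs_add[OF proj_hom])

lemma F_minus: "x \<in> F n \<Longrightarrow> \<ominus>\<^bsub>M\<^esub> x \<in> F n"
  by (auto simp: filtered_part_def additive_maps_minus[OF M.abelian_group_axioms M.abelian_group_axioms proj_additive])

lemma F_smult: "r \<in> carrier K \<Longrightarrow> x \<in> F n \<Longrightarrow> r \<odot>\<^bsub>M\<^esub> x \<in> F n"
  by (auto simp: filtered_part_def module_homs_smult[OF proj_hom])

lemma H_subset_F: assumes "d \<le> n" shows "H d \<subseteq> F n"
proof
  fix x assume x: "x \<in> H d"
  show "x \<in> F n" using assms H_closed[OF x] by (simp add: filtered_part_def H_proj[OF x])
qed

lemma F_mono: "m \<le> n \<Longrightarrow> F m \<subseteq> F n"
  by (auto simp: filtered_part_def)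

lemma F_submodule: "submodule (F n) K M"
  by (rule submoduleI) (auto simp: F_zero F_add F_minus F_smult dest: F_closed)

lemma graded_maps_eqI:
  assumes "abelian_group N" "f \<in> additive_maps M N" "g \<in> additive_maps M N" "x \<in> carrier M"
    and "\<And>d x. x \<in> H d \<Longrightarrow> f x = g x"
  shows "f x = g x"
  by (rule additive_maps_eq[OF M.abelian_group_axioms assms(1-3) _ UN_H_closed]) (use assms(4,5) generated in auto)

lemma proj_proj:
  assumes "x \<in> carrier M" shows "P i (P j x) = (if i = j then P j x else \<zero>\<^bsub>M\<^esub>)"
proof -
  have "(\<lambda>x. if i = j then P j x else \<zero>\<^bsub>M\<^esub>) \<in> additive_maps M M"
    using proj_additive[of j] additive_maps_zero_map[OF M.abelian_group_axioms] by (cases "i = j") auto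
  then show ?thesis
    by (rule graded_maps_eqI[OF M.abelian_group_axioms additive_maps_comp[OF proj_additive proj_additive] _ assms])
       (auto simp: H_proj proj_zero)
qed

lemma proj_H: "x \<in> carrier M \<Longrightarrow> P d x \<in> H d"
  by (simp add: homogeneous_def proj_closed proj_proj)

text \<open>
  Stated for all sufficiently large bounds so that it is preserved under sums.
\<close>

lemma decomposition_exists:
  assumes "x \<in> carrier M"
  shows "\<exists>k. (\<forall>i>k. P i x = \<zero>\<^bsub>M\<^esub>) \<and> (\<forall>n\<ge>k. (\<Oplus>\<^bsub>M\<^esub>i\<in>{..n}. P i x) = x)"
proof -
  have "x \<in> additive_span M (\<Union>d. H d)" using assms generated by simp
  then show ?thesis
  proof induction
    case zero
    show ?case by (simp add: proj_zero)
  next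
    case (base x)
    then obtain d where d: "x \<in> H d" by blast
    have "(\<Oplus>\<^bsub>M\<^esub>i\<in>{..n}. P i x) = x" if "n \<ge> d" for n
    proof -
      have "(\<Oplus>\<^bsub>M\<^esub>i\<in>{..n}. P i x) = (\<Oplus>\<^bsub>M\<^esub>i\<in>{..n}. if d = i then x else \<zero>\<^bsub>M\<^esub>)"
        by (rule M.finsum_cong') (use d H_closed in \<open>auto simp: H_proj\<close>)
      also have "\<dots> = x" using that H_closed[OF d] M.finsum_singleton[of d "{..n}" "\<lambda>_. x"] by simp
      finally show ?thesis .
    qed
    then show ?case by (intro exI[of _ d]) (simp add: H_proj[OF d])
  next
    case (add x y)
    then obtain k l where kl: "\<forall>i>k. P i x = \<zero>\<^bsub>M\<^esub>" "\<forall>n\<ge>k. (\<Oplus>\<^bsub>M\<^esub>i\<in>{..n}. P i x) = x"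
      "\<forall>i>l. P i y = \<zero>\<^bsub>M\<^esub>" "\<forall>n\<ge>l. (\<Oplus>\<^bsub>M\<^esub>i\<in>{..n}. P i y) = y" by blast
    have xy: "x \<in> carrier M" "y \<in> carrier M" using add(1,2) generated by auto
    have "(\<Oplus>\<^bsub>M\<^esub>i\<in>{..n}. P i (x \<oplus>\<^bsub>M\<^esub> y)) = x \<oplus>\<^bsub>M\<^esub> y" if "n \<ge> max k l" for n
    proof -
      have "(\<Oplus>\<^bsub>M\<^esub>i\<in>{..n}. P i (x \<oplus>\<^bsub>M\<^esub> y)) = (\<Oplus>\<^bsub>M\<^esub>i\<in>{..n}. P i x \<oplus>\<^bsub>M\<^esub> P i y)"
        by (rule M.finsum_cong') (use xy proj_closed in \<open>auto simp: module_homs_add[OF proj_hom]\<close>)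
      also have "\<dots> = (\<Oplus>\<^bsub>M\<^esub>i\<in>{..n}. P i x) \<oplus>\<^bsub>M\<^esub> (\<Oplus>\<^bsub>M\<^esub>i\<in>{..n}. P i y)"
        by (rule M.finsum_addf) (use xy proj_closed in auto)
      finally show ?thesis using kl that by simp
    qed
    then show ?case using kl xy
      by (intro exI[of _ "max k l"]) (simp add: module_homs_add[OF proj_hom])
  qed
qed

lemma finite_proj: "x \<in> carrier M \<Longrightarrow> finite {i. P i x \<noteq> \<zero>\<^bsub>M\<^esub>}"
proof -
  assume "x \<in> carrier M"
  then obtain k where "\<forall>i>k. P i x = \<zero>\<^bsub>M\<^esub>" using decomposition_exists by blast
  then have "{i. P i x \<noteq> \<zero>\<^bsub>M\<^esub>} \<subseteq> {..k}" using not_le by auto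
  then show ?thesis by (rule finite_subset) simp
qed

lemma decomposition:
  assumes x: "x \<in> carrier M" and A: "finite A" "{i. P i x \<noteq> \<zero>\<^bsub>M\<^esub>} \<subseteq> A"
  shows "(\<Oplus>\<^bsub>M\<^esub>i\<in>A. P i x) = x"
proof -
  obtain k where k: "\<forall>i>k. P i x = \<zero>\<^bsub>M\<^esub>" "(\<Oplus>\<^bsub>M\<^esub>i\<in>{..k}. P i x) = x"
    using decomposition_exists[OF x] by blast
  have k': "i \<le> k" if "P i x \<noteq> \<zero>\<^bsub>M\<^esub>" for i using k(1) that not_le by blast
  have "(\<Oplus>\<^bsub>M\<^esub>i\<in>{i. P i x \<noteq> \<zero>\<^bsub>M\<^esub>}. P i x) = (\<Oplus>\<^bsub>M\<^esub>i\<in>A. P i x)"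
    by (rule M.add.finprod_mono_neutral_cong_left) (use A x proj_closed in auto)
  moreover have "(\<Oplus>\<^bsub>M\<^esub>i\<in>{i. P i x \<noteq> \<zero>\<^bsub>M\<^esub>}. P i x) = (\<Oplus>\<^bsub>M\<^esub>i\<in>{..k}. P i x)"
    by (rule M.add.finprod_mono_neutral_cong_left) (use k' x proj_closed in auto)
  ultimately show ?thesis using k(2) by simp
qed

lemma F_decomposition: "x \<in> F n \<Longrightarrow> (\<Oplus>\<^bsub>M\<^esub>i\<in>{..n}. P i x) = x"
  by (rule decomposition) (auto simp: filtered_part_def not_less[symmetric])

lemma F_span: "F n = additive_span M (\<Union>d\<in>{..n}. H d)"
proof
  show "F n \<subseteq> additive_span M (\<Union>d\<in>{..n}. H d)"
  proof
    fix x assume x: "x \<in> F n"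
    have "(\<Oplus>\<^bsub>M\<^esub>i\<in>{..n}. P i x) \<in> additive_span M (\<Union>d\<in>{..n}. H d)"
      by (rule additive_span_finsum[OF M.abelian_group_axioms])
         (use proj_H F_closed[OF x] H_closed in \<open>auto intro!: additive_span.base\<close>)
    then show "x \<in> additive_span M (\<Union>d\<in>{..n}. H d)" using F_decomposition[OF x] by simp
  qed
  show "additive_span M (\<Union>d\<in>{..n}. H d) \<subseteq> F n"
  proof
    fix x assume "x \<in> additive_span M (\<Union>d\<in>{..n}. H d)"
    then show "x \<in> F n"
      by induction (use H_subset_F in \<open>auto simp: F_zero F_add\<close>)
  qed
qed

lemma F_maps_eqI:
  assumes "abelian_group N" "f \<in> additive_maps M N" "g \<in> additive_maps M N" "x \<in> F n"
    and "\<And>d x. d \<le> n \<Longrightarrow> x \<in> H d \<Longrightarrow> f x = g x"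
  shows "f x = g x"
  by (rule additive_maps_eq[OF M.abelian_group_axioms assms(1-3), of x "\<Union>d\<in>{..n}. H d"])
     (use assms(4,5) F_span H_closed in auto)

lemma F_exhaustive: "(\<Union>n. F n) = carrier M"
proof
  show "carrier M \<subseteq> (\<Union>n. F n)"
  proof
    fix x assume x: "x \<in> carrier M"
    then obtain k where "\<forall>i>k. P i x = \<zero>\<^bsub>M\<^esub>" using decomposition_exists by blast
    then have "x \<in> F k" using x by (simp add: filtered_part_def)
    then show "x \<in> (\<Union>n. F n)" by blast
  qed
qed (auto simp: filtered_part_def)

subsection \<open>The Rees embedding\<close>

abbreviation "psi \<equiv> rees M Mt P"
abbreviation "chi \<equiv> homogenize M Mt P"

lemma rees_summand: "(\<lambda>x n. if j \<le> n then P (n - j) x else \<zero>\<^bsub>M\<^esub>) \<in> additive_maps M Mt"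
proof -
  have cl: "(\<lambda>n. if j \<le> n then P (n - j) x else \<zero>\<^bsub>M\<^esub>) \<in> carrier Mt" if x: "x \<in> carrier M" for x
  proof -
    have "{n. (if j \<le> n then P (n - j) x else \<zero>\<^bsub>M\<^esub>) \<noteq> \<zero>\<^bsub>M\<^esub>} \<subseteq> (\<lambda>i. i + j) ` {i. P i x \<noteq> \<zero>\<^bsub>M\<^esub>}"
    proof
      fix n assume "n \<in> {n. (if j \<le> n then P (n - j) x else \<zero>\<^bsub>M\<^esub>) \<noteq> \<zero>\<^bsub>M\<^esub>}"
      then have "j \<le> n" "P (n - j) x \<noteq> \<zero>\<^bsub>M\<^esub>" by (auto split: if_splits)
      then show "n \<in> (\<lambda>i. i + j) ` {i. P i x \<noteq> \<zero>\<^bsub>M\<^esub>}" by (intro image_eqI[of _ _ "n - j"]) auto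
    qed
    then have "finite {n. (if j \<le> n then P (n - j) x else \<zero>\<^bsub>M\<^esub>) \<noteq> \<zero>\<^bsub>M\<^esub>}"
      by (rule finite_subset) (intro finite_imageI finite_proj x)
    then show ?thesis using proj_closed[OF x] by (simp add: Pf.carrier_P)
  qed
  show ?thesis
    by (rule additive_mapsI) (auto simp: cl Pf.add_P module_homs_add[OF proj_hom] fun_eq_iff)
qed

lemma homogenize_summand: "(\<lambda>x j. if j \<le> n then P (n - j) x else \<zero>\<^bsub>M\<^esub>) \<in> additive_maps M Mt"
proof -
  have cl: "(\<lambda>j. if j \<le> n then P (n - j) x else \<zero>\<^bsub>M\<^esub>) \<in> carrier Mt" if x: "x \<in> carrier M" for x
  proof -
    have "{j. (if j \<le> n then P (n - j) x else \<zero>\<^bsub>M\<^esub>) \<noteq> \<zero>\<^bsub>M\<^esub>} \<subseteq> {..n}" by auto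
    then have "finite {j. (if j \<le> n then P (n - j) x else \<zero>\<^bsub>M\<^esub>) \<noteq> \<zero>\<^bsub>M\<^esub>}"
      by (rule finite_subset) simp
    then show ?thesis using proj_closed[OF x] by (simp add: Pf.carrier_P)
  qed
  show ?thesis
    by (rule additive_mapsI) (auto simp: cl Pf.add_P module_homs_add[OF proj_hom] fun_eq_iff)
qed

lemma psi_additive: "psi \<in> additive_maps Mt Mt"
  unfolding rees_def by (rule Pf.support_sum_additive[OF Pf.group_P rees_summand])

lemma chi_additive: "chi \<in> additive_maps Mt Mt"
  unfolding homogenize_def by (rule Pf.support_sum_additive[OF Pf.group_P homogenize_summand])

lemma psi_fsingle:
  assumes "x \<in> H d" shows "psi (fsingle M j x) = fsingle M (d + j) x"
proof -
  have "psi (fsingle M j x) = (\<lambda>n. if j \<le> n then P (n - j) x else \<zero>\<^bsub>M\<^esub>)"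
    unfolding rees_def by (rule Pf.support_sum_fsingle[OF Pf.group_P rees_summand UNIV_I H_closed[OF assms]])
  also have "\<dots> = fsingle M (d + j) x"
    using assms by (auto simp: fsingle_def H_proj fun_eq_iff)
  finally show ?thesis .
qed

lemma chi_fsingle:
  assumes "x \<in> carrier M" shows "chi (fsingle M n x) = (\<lambda>j. if j \<le> n then P (n - j) x else \<zero>\<^bsub>M\<^esub>)"
  unfolding homogenize_def by (rule Pf.support_sum_fsingle[OF Pf.group_P homogenize_summand UNIV_I assms])

lemma chi_fsingle_H:
  assumes "x \<in> H d" "d \<le> n" shows "chi (fsingle M n x) = fsingle M (n - d) x"
  using assms(2) unfolding chi_fsingle[OF H_closed[OF assms(1)]] H_proj[OF assms(1)]
  by (auto simp: fsingle_def fun_eq_iff)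

lemma poly_graded_maps_eqI:
  assumes "abelian_group N" "f \<in> additive_maps Mt N" "g \<in> additive_maps Mt N" "p \<in> carrier Mt"
    and "\<And>d j x. x \<in> H d \<Longrightarrow> f (fsingle M j x) = g (fsingle M j x)"
  shows "f p = g p"
proof (rule Pf.additive_maps_eqI[OF assms(1-4)])
  fix j x assume x: "x \<in> carrier M"
  show "f (fsingle M j x) = g (fsingle M j x)"
    by (rule graded_maps_eqI[OF assms(1) additive_maps_comp[OF Pf.fsingle_additive assms(2)]
          additive_maps_comp[OF Pf.fsingle_additive assms(3)] x assms(5)]) auto
qed

text \<open>
  \<open>chi\<close> is not \<open>K[t]\<close>-linear: it discards components. Linearity of maps built from \<open>chi\<close> will be
  deduced from this lemma and the injectivity of \<open>psi\<close>.
\<close>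

lemma psi_hom: "psi \<in> module_homs (UP K) Mt Mt"
proof (rule poly_homI[OF module_Mt psi_additive])
  fix i j r x assume r: "r \<in> carrier K" and x: "x \<in> carrier M"
  have sa: "(\<lambda>x. r \<odot>\<^bsub>M\<^esub> x) \<in> additive_maps M M"
    using r by (intro additive_mapsI) (auto simp: smult_r_distr)
  show "psi (fsingle M (i + j) (r \<odot>\<^bsub>M\<^esub> x)) = fsingle K i r \<odot>\<^bsub>Mt\<^esub> psi (fsingle M j x)"
    by (rule graded_maps_eqI[OF Pf.group_P
          additive_maps_comp[OF sa additive_maps_comp[OF Pf.fsingle_additive psi_additive]]
          additive_maps_comp[OF additive_maps_comp[OF Pf.fsingle_additive psi_additive] smult_right_additive] x])
       (use r in \<open>auto simp: H_smult psi_fsingle smult_fsingle H_closed Kt.fsingle_closed add.left_commute\<close>)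
qed

lemma chi_psi: "p \<in> carrier Mt \<Longrightarrow> chi (psi p) = p"
  by (rule poly_graded_maps_eqI[OF Pf.group_P additive_maps_comp[OF psi_additive chi_additive] additive_maps_id])
     (simp_all add: psi_fsingle chi_fsingle_H)

lemma psi_inj: "inj_on psi (carrier Mt)"
  by (rule inj_on_inverseI[where g = chi]) (rule chi_psi)

lemma poly_eq_sum:
  assumes "p \<in> carrier Mt" shows "support_sum M Mt (fsingle M) p = p"
  by (rule Pf.additive_maps_eqI[OF Pf.group_P Pf.support_sum_additive[OF Pf.group_P Pf.fsingle_additive] additive_maps_id assms])
     (simp_all add: Pf.support_sum_fsingle[OF Pf.group_P Pf.fsingle_additive])

lemma poly_mem_spanI:
  assumes "p \<in> carrier Mt" "X \<subseteq> carrier Mt" "\<And>n. fsingle M n (p n) \<in> additive_span Mt X"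
  shows "p \<in> additive_span Mt X"
  using additive_span_finsum[OF Pf.group_P assms(2), of "{n. p n \<noteq> \<zero>\<^bsub>M\<^esub>}" "\<lambda>n. fsingle M n (p n)"] assms(3)
    poly_eq_sum[OF assms(1)] by (simp add: support_sum_def)

definition "rees_module = {q \<in> carrier Mt. \<forall>n. q n \<in> F n}"

text \<open>
  The polynomials in question are spanned by the \<open>x t\<^sup>n\<close> with \<open>x\<close> homogeneous of degree at most
  \<open>n\<close>, and on these nothing is discarded.
\<close>

lemma psi_chi:
  assumes "q \<in> rees_module" shows "psi (chi q) = q"
proof (rule additive_maps_eq[OF Pf.group_P Pf.group_P additive_maps_comp[OF chi_additive psi_additive] additive_maps_id])
  let ?X = "{fsingle M n x | n x. \<exists>d\<le>n. x \<in> H d}"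
  show X: "?X \<subseteq> carrier Mt" using H_closed by (auto intro!: Pf.fsingle_closed)
  have q: "q \<in> carrier Mt" "\<And>n. q n \<in> F n" using assms by (auto simp: rees_module_def)
  show "q \<in> additive_span Mt ?X"
  proof (rule poly_mem_spanI[OF q(1) X])
    fix n
    have "q n \<in> additive_span M (\<Union>d\<in>{..n}. H d)" using q(2) F_span by simp
    then have "fsingle M n (q n) \<in> additive_span Mt (fsingle M n ` (\<Union>d\<in>{..n}. H d))"
      by (rule additive_span_image[OF M.abelian_group_axioms Pf.group_P Pf.fsingle_additive, rotated -1]) (use H_closed in auto)
    then show "fsingle M n (q n) \<in> additive_span Mt ?X"
      by (rule additive_span_trans) (auto intro!: additive_span.base)
  qed
  fix x assume "x \<in> ?X"
  then show "psi (chi x) = x" by (auto simp: chi_fsingle_H psi_fsingle)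
qed

lemma psi_rees_module:
  assumes "p \<in> carrier Mt" shows "psi p \<in> rees_module"
proof -
  have "psi p n \<in> F n" for n
  proof -
    let ?X = "{fsingle M j x | d j x. x \<in> H d}"
    have X: "?X \<subseteq> carrier Mt" using H_closed by (auto intro!: Pf.fsingle_closed)
    have "p \<in> additive_span Mt ?X"
    proof (rule poly_mem_spanI[OF assms X])
      fix j
      have "p j \<in> additive_span M (\<Union>d. H d)" using Pf.value_closed[OF assms] generated by simp
      then have "fsingle M j (p j) \<in> additive_span Mt (fsingle M j ` (\<Union>d. H d))"
        by (rule additive_span_image[OF M.abelian_group_axioms Pf.group_P Pf.fsingle_additive, rotated -1]) (use H_closed in auto)
      then show "fsingle M j (p j) \<in> additive_span Mt ?X"
        by (rule additive_span_trans) (auto intro!: additive_span.base)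
    qed
    then have "psi p n \<in> F n \<and> p \<in> carrier Mt"
    proof induction
      case zero
      have "psi \<zero>\<^bsub>Mt\<^esub> = \<zero>\<^bsub>Mt\<^esub>" by (rule additive_maps_zero[OF Pf.group_P Pf.group_P psi_additive])
      then show ?case using Pf.zero_P F_zero Pf.P.zero_closed by simp
    next
      case (base p)
      then obtain d j x where x: "p = fsingle M j x" "x \<in> H d" by blast
      have "fsingle M (d + j) x n \<in> F n" using H_subset_F[of d n] x F_zero by (auto simp: fsingle_def)
      then show ?case using x X base by (auto simp: psi_fsingle)
    next
      case (add p q)
      have c: "psi p \<in> carrier Mt" "psi q \<in> carrier Mt" using add additive_maps_closed[OF psi_additive] by auto
      have "psi (p \<oplus>\<^bsub>Mt\<^esub> q) n = psi p n \<oplus>\<^bsub>M\<^esub> psi q n"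
        using add additive_maps_add[OF psi_additive, of p q] Pf.add_P[OF c] by simp
      then show ?case using add F_add by simp
    qed
    then show ?thesis ..
  qed
  then show ?thesis using additive_maps_closed[OF psi_additive assms] by (simp add: rees_module_def)
qed

subsection \<open>Homogeneous polynomials\<close>

abbreviation "Hp \<equiv> poly_degree M H"

lemma Hp_closed: "p \<in> Hp n \<Longrightarrow> p \<in> carrier Mt"
proof -
  assume p: "p \<in> Hp n"
  have "p j \<in> carrier M" for j using p H_closed by (cases "j \<le> n") (auto simp: poly_degree_def)
  moreover have "{j. p j \<noteq> \<zero>\<^bsub>M\<^esub>} \<subseteq> {..n}" using p by (auto simp: poly_degree_def not_less[symmetric])
  then have "finite {j. p j \<noteq> \<zero>\<^bsub>M\<^esub>}" by (rule finite_subset) simp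
  ultimately show ?thesis by (simp add: Pf.carrier_P)
qed

lemma chi_Hp: "y \<in> carrier M \<Longrightarrow> chi (fsingle M n y) \<in> Hp n"
  by (simp add: chi_fsingle poly_degree_def proj_H)

lemma Hp_eq_chi:
  assumes "p \<in> Hp n" shows "chi (fsingle M n (eval_at_one M p)) = p"
proof (rule additive_maps_eq[OF Pf.group_P Pf.group_P
      additive_maps_comp[OF eval_additive additive_maps_comp[OF Pf.fsingle_additive chi_additive]] additive_maps_id])
  let ?X = "{fsingle M j x | j x. j \<le> n \<and> x \<in> H (n - j)}"
  show X: "?X \<subseteq> carrier Mt" using H_closed by (auto intro!: Pf.fsingle_closed)
  have pz: "p j = \<zero>\<^bsub>M\<^esub>" if "\<not> j \<le> n" for j using assms that by (simp add: poly_degree_def)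
  have z: "fsingle M j \<zero>\<^bsub>M\<^esub> = \<zero>\<^bsub>Mt\<^esub>" for j by (auto simp: fsingle_def Pf.zero_P)
  show "p \<in> additive_span Mt ?X"
  proof (rule poly_mem_spanI[OF Hp_closed[OF assms] X])
    fix j show "fsingle M j (p j) \<in> additive_span Mt ?X"
      using assms by (cases "j \<le> n") (auto intro!: additive_span.base additive_span.zero simp: poly_degree_def z)
  qed
  fix x assume "x \<in> ?X"
  then show "chi (fsingle M n (eval_at_one M x)) = x" by (auto simp: eval_fsingle H_closed chi_fsingle_H)
qed auto

lemma eval_chi:
  assumes "y \<in> F n" shows "eval_at_one M (chi (fsingle M n y)) = y"
  by (rule F_maps_eqI[OF M.abelian_group_axioms
        additive_maps_comp[OF additive_maps_comp[OF Pf.fsingle_additive chi_additive] eval_additive] additive_maps_id assms])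
     (auto simp: chi_fsingle_H eval_fsingle H_closed)

lemma eval_Hp:
  assumes "p \<in> Hp n" shows "eval_at_one M p \<in> F n" "psi p = fsingle M n (eval_at_one M p)"
proof -
  let ?X = "{fsingle M j x | j x. j \<le> n \<and> x \<in> H (n - j)}"
  have X: "?X \<subseteq> carrier Mt" using H_closed by (auto intro!: Pf.fsingle_closed)
  have z: "fsingle M j \<zero>\<^bsub>M\<^esub> = \<zero>\<^bsub>Mt\<^esub>" for j by (auto simp: fsingle_def Pf.zero_P)
  have p: "p \<in> additive_span Mt ?X"
  proof (rule poly_mem_spanI[OF Hp_closed[OF assms] X])
    fix j show "fsingle M j (p j) \<in> additive_span Mt ?X"
      using assms by (cases "j \<le> n") (auto intro!: additive_span.base additive_span.zero simp: poly_degree_def z)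
  qed
  show eq: "psi p = fsingle M n (eval_at_one M p)"
    by (rule additive_maps_eq[OF Pf.group_P Pf.group_P psi_additive
          additive_maps_comp[OF eval_additive Pf.fsingle_additive] p X])
       (auto simp: psi_fsingle eval_fsingle H_closed)
  have "psi p n \<in> F n" using psi_rees_module[OF Hp_closed[OF assms]] by (simp add: rees_module_def)
  then show "eval_at_one M p \<in> F n" unfolding eq by (simp add: fsingle_def)
qed

lemma fsingle_Hp: "x \<in> H d \<Longrightarrow> fsingle M j x \<in> Hp (d + j)"
  by (auto simp: poly_degree_def fsingle_def H_zero)

end

section \<open>Homogeneous maps of polynomial modules and filtered maps\<close>

text \<open>
  The two directions of the correspondence between homogeneous \<open>K[t]\<close>-linear maps \<open>f\<close> and filtered
  \<open>K\<close>-linear maps \<open>f1\<close>: \<open>at_one\<close> is evaluation at \<open>t = 1\<close>, and \<open>rees_extension\<close> is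
  characterized by \<open>psi (f p) = f1 (psi p)\<close>, coefficient by coefficient.
\<close>

locale graded_pair = M: graded_module K M PM + N: graded_module K N PN
  for K :: "('k, 'x) ring_scheme" and M :: "('k, 'm, 'y) module_scheme" and PM
    and N :: "('k, 'n, 'z) module_scheme" and PN
begin

definition "at_one f x = eval_at_one N (f (fsingle M 0 x))"

definition "rees_extension f1 p = N.chi (\<lambda>n. f1 (M.psi p n))"

lemma at_one_hom:
  assumes "f \<in> module_homs (UP K) M.Mt N.Mt"
  shows "at_one f \<in> module_homs K M N"
proof (rule module_homsI)
  show "at_one f \<in> additive_maps M N"
    unfolding at_one_def
    by (rule additive_maps_comp[OF additive_maps_comp[OF M.Pf.fsingle_additive module_homs_additive[OF assms]] N.eval_additive]) simp
  fix r x assume rx: "r \<in> carrier K" "x \<in> carrier M"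
  have "f (fsingle M 0 (r \<odot>\<^bsub>M\<^esub> x)) = f (fsingle K 0 r \<odot>\<^bsub>M.Mt\<^esub> fsingle M 0 x)"
    using rx by (simp add: M.smult_fsingle)
  also have "\<dots> = fsingle K 0 r \<odot>\<^bsub>N.Mt\<^esub> f (fsingle M 0 x)"
    using rx by (simp add: module_homs_smult[OF assms] M.Kt.fsingle_closed M.Pf.fsingle_closed)
  finally show "at_one f (r \<odot>\<^bsub>M\<^esub> x) = r \<odot>\<^bsub>N\<^esub> at_one f x"
    unfolding at_one_def using rx
    by (simp add: semilinear_maps_smult[OF N.eval_semilinear] M.Kt.fsingle_closed M.Pf.fsingle_closed
        module_homs_closed[OF assms] N.eval_K_fsingle)
qed

lemma eval_at_one_hom:
  assumes f: "f \<in> module_homs (UP K) M.Mt N.Mt" and p: "p \<in> carrier M.Mt"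
  shows "eval_at_one N (f p) = at_one f (eval_at_one M p)"
proof (rule M.Pf.additive_maps_eqI[OF N.M.abelian_group_axioms additive_maps_comp[OF module_homs_additive[OF f] N.eval_additive]
      additive_maps_comp[OF M.eval_additive module_homs_additive[OF at_one_hom[OF f]]] p])
  fix j x assume x: "x \<in> carrier M"
  have "f (fsingle M j x) = fsingle K j \<one>\<^bsub>K\<^esub> \<odot>\<^bsub>N.Mt\<^esub> f (fsingle M 0 x)"
    using x M.t_power_const[OF x, of j]
    by (simp add: module_homs_smult[OF f, symmetric] M.Kt.fsingle_closed M.Pf.fsingle_closed)
  then show "eval_at_one N (f (fsingle M j x)) = at_one f (eval_at_one M (fsingle M j x))"
    using x by (simp add: at_one_def M.eval_fsingle semilinear_maps_smult[OF N.eval_semilinear] M.Kt.fsingle_closed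
        M.Pf.fsingle_closed module_homs_closed[OF f] N.eval_K_fsingle N.eval_semilinear additive_maps_closed[OF N.eval_additive])
qed

context
  fixes f
  assumes f: "f \<in> module_homs (UP K) M.Mt N.Mt"
    and f_degree: "\<And>n. f ` M.Hp n \<subseteq> N.Hp n"
begin

text \<open>
  For \<open>x\<close> of degree \<open>d\<close>, the polynomial \<open>f (x t\<^sup>j)\<close> is homogeneous of degree \<open>d + j\<close> with value
  \<open>f1 x\<close> at \<open>t = 1\<close>, hence \<open>psi\<close> sends it to \<open>f1 x t\<^bsup>d+j\<^esup>\<close>.
\<close>

lemma psi_hom_commute:
  assumes p: "p \<in> carrier M.Mt"
  shows "N.psi (f p) = (\<lambda>n. at_one f (M.psi p n))"
proof (rule M.poly_graded_maps_eqI[OF N.Pf.group_P additive_maps_comp[OF module_homs_additive[OF f] N.psi_additive]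
      additive_maps_comp[OF M.psi_additive module_homs_additive[OF coeffwise_hom(1)[OF M.module_axioms N.module_axioms at_one_hom[OF f]]]] p])
  fix d j x assume x: "x \<in> M.H d"
  then have "f (fsingle M j x) \<in> N.Hp (d + j)" using f_degree M.fsingle_Hp by blast
  from N.eval_Hp(2)[OF this]
  show "N.psi (f (fsingle M j x)) = (\<lambda>n. at_one f (M.psi (fsingle M j x) n))"
    using x coeffwise_hom(2)[OF M.module_axioms N.module_axioms at_one_hom[OF f] M.H_closed[OF x]]
    by (simp add: M.psi_fsingle eval_at_one_hom[OF f] M.Pf.fsingle_closed M.H_closed M.eval_fsingle)
qed

lemma hom_fsingle:
  assumes x: "x \<in> M.H d"
  shows "f (fsingle M 0 x) = N.chi (fsingle N d (at_one f x))" "at_one f x \<in> N.F d"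
proof -
  have h: "f (fsingle M 0 x) \<in> N.Hp d" using f_degree[of d] M.fsingle_Hp[OF x, of 0] by auto
  show "f (fsingle M 0 x) = N.chi (fsingle N d (at_one f x))"
    using N.Hp_eq_chi[OF h] by (simp add: at_one_def)
  show "at_one f x \<in> N.F d" using N.eval_Hp(1)[OF h] by (simp add: at_one_def)
qed

lemma at_one_filtered: "x \<in> M.F n \<Longrightarrow> at_one f x \<in> N.F n"
proof -
  assume "x \<in> M.F n"
  then have "x \<in> additive_span M (\<Union>d\<in>{..n}. M.H d)" using M.F_span by simp
  then have "at_one f x \<in> N.F n \<and> x \<in> carrier M"
  proof induction
    case zero
    then show ?case using additive_maps_zero[OF M.M.abelian_group_axioms N.M.abelian_group_axioms module_homs_additive[OF at_one_hom[OF f]]]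
      by (simp add: N.F_zero)
  next
    case (base x)
    then show ?case using hom_fsingle(2) N.F_mono M.H_closed by blast
  next
    case (add x y)
    then show ?case by (simp add: module_homs_add[OF at_one_hom[OF f]] N.F_add)
  qed
  then show ?thesis ..
qed

text \<open>
  Homogenizing \<open>f1 x\<close> in degree \<open>d\<close> puts its component of degree \<open>d - j\<close> in front of
  \<open>t\<^sup>j\<close>; in front of \<open>t\<^sup>0\<close> stands the leading component.
\<close>

lemma at_one_symbol: "x \<in> M.H d \<Longrightarrow> PN d (at_one f x) = f (fsingle M 0 x) 0"
  using hom_fsingle[of x d] by (simp add: N.chi_fsingle N.F_closed)

end

context
  fixes f1
  assumes f1: "f1 \<in> module_homs K M N"
    and f1_filtered: "\<And>n x. x \<in> M.F n \<Longrightarrow> f1 x \<in> N.F n"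
begin

lemma coeffwise_closed: "p \<in> carrier M.Mt \<Longrightarrow> (\<lambda>n. f1 (M.psi p n)) \<in> N.rees_module"
  using M.psi_rees_module[of p] f1_filtered module_homs_closed[OF coeffwise_hom(1)[OF M.module_axioms N.module_axioms f1]]
  by (auto simp: N.rees_module_def M.rees_module_def)

lemma psi_rees_extension: "p \<in> carrier M.Mt \<Longrightarrow> N.psi (rees_extension f1 p) = (\<lambda>n. f1 (M.psi p n))"
  unfolding rees_extension_def by (rule N.psi_chi[OF coeffwise_closed])

lemma rees_extension_additive: "rees_extension f1 \<in> additive_maps M.Mt N.Mt"
proof -
  note c = module_homs_additive[OF coeffwise_hom(1)[OF M.module_axioms N.module_axioms f1]]
  show ?thesis
    using additive_maps_comp[OF additive_maps_comp[OF M.psi_additive c] N.chi_additive]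
    by (simp add: rees_extension_def[abs_def])
qed

lemma rees_extension_hom: "rees_extension f1 \<in> module_homs (UP K) M.Mt N.Mt"
proof (rule module_homsI[OF rees_extension_additive])
  note c = coeffwise_hom(1)[OF M.module_axioms N.module_axioms f1]
  note rc = additive_maps_closed[OF rees_extension_additive]
  fix a p assume a: "a \<in> carrier (UP K)" and p: "p \<in> carrier M.Mt"
  show "rees_extension f1 (a \<odot>\<^bsub>M.Mt\<^esub> p) = a \<odot>\<^bsub>N.Mt\<^esub> rees_extension f1 p"
  proof (rule inj_onD[OF N.psi_inj])
    have "N.psi (rees_extension f1 (a \<odot>\<^bsub>M.Mt\<^esub> p)) = (\<lambda>n. f1 (M.psi (a \<odot>\<^bsub>M.Mt\<^esub> p) n))"
      using a p by (simp add: psi_rees_extension)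
    also have "\<dots> = a \<odot>\<^bsub>N.Mt\<^esub> (\<lambda>n. f1 (M.psi p n))"
      using module_homs_smult[OF module_homs_comp[OF M.psi_hom c] a p] by simp
    also have "\<dots> = a \<odot>\<^bsub>N.Mt\<^esub> N.psi (rees_extension f1 p)" using p by (simp add: psi_rees_extension)
    also have "\<dots> = N.psi (a \<odot>\<^bsub>N.Mt\<^esub> rees_extension f1 p)"
      using a rc[OF p] by (simp add: module_homs_smult[OF N.psi_hom])
    finally show "N.psi (rees_extension f1 (a \<odot>\<^bsub>M.Mt\<^esub> p)) = N.psi (a \<odot>\<^bsub>N.Mt\<^esub> rees_extension f1 p)" .
  qed (use a p rc in auto)
qed

lemma rees_extension_chi:
  assumes "p \<in> M.Hp n"
  shows "rees_extension f1 p = N.chi (fsingle N n (f1 (eval_at_one M p)))"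
  using coeffwise_hom(2)[OF M.module_axioms N.module_axioms f1 M.F_closed[OF M.eval_Hp(1)[OF assms]]]
  by (simp add: rees_extension_def M.eval_Hp(2)[OF assms])

lemma rees_extension_degree: "rees_extension f1 ` M.Hp n \<subseteq> N.Hp n"
  using N.chi_Hp module_homs_closed[OF f1] M.F_closed[OF M.eval_Hp(1)] by (auto simp: rees_extension_chi)

lemma at_one_rees_extension:
  assumes "x \<in> carrier M" shows "at_one (rees_extension f1) x = f1 x"
proof (rule M.graded_maps_eqI[OF N.M.abelian_group_axioms module_homs_additive[OF at_one_hom[OF rees_extension_hom]] module_homs_additive[OF f1] assms])
  fix d x assume x: "x \<in> M.H d"
  then have h: "fsingle M 0 x \<in> M.Hp d" using M.fsingle_Hp[OF x, of 0] by simp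
  have "f1 x \<in> N.F d" using x M.H_subset_F f1_filtered by blast
  then show "at_one (rees_extension f1) x = f1 x"
    by (simp add: at_one_def rees_extension_chi[OF h] M.eval_fsingle M.H_closed[OF x] N.eval_chi)
qed

end

end

section \<open>The grading of a tensor product\<close>

definition tensor_proj ::
  "('r, 'x) ring_scheme \<Rightarrow> ('r, 'm, 'y) module_scheme \<Rightarrow> (nat \<Rightarrow> 'm \<Rightarrow> 'm) \<Rightarrow> ('r, 'n, 'z) module_scheme \<Rightarrow> (nat \<Rightarrow> 'n \<Rightarrow> 'n)
    \<Rightarrow> nat \<Rightarrow> ('m \<times> 'n \<Rightarrow> 'r) set \<Rightarrow> ('m \<times> 'n \<Rightarrow> 'r) set" where
  "tensor_proj K M PM N PN n w = (\<Oplus>\<^bsub>tensor K M N\<^esub>i\<in>{..n}. tensor_map K M N (PM i) (PN (n - i)) w)"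

locale graded_tensor = graded_pair K M PM N PN
  for K :: "('k, 'x) ring_scheme" and M :: "('k, 'm, 'y) module_scheme" and PM
    and N :: "('k, 'n, 'z) module_scheme" and PN
begin

sublocale PTP: poly_tensor_product K M N by unfold_locales

abbreviation "T \<equiv> tensor K M N"
abbreviation "PT' \<equiv> tensor_proj K M PM N PN"

lemma tensor_proj_hom: "PT' n \<in> module_homs K T T"
  unfolding tensor_proj_def[abs_def]
  by (rule module_homs_sum[OF PTP.TP.module_T])
     (auto intro!: PTP.TP.tensor_map_hom M.module_axioms N.module_axioms M.proj_hom N.proj_hom)

text \<open>
  Only the summand \<open>i = a\<close> of the projection of degree \<open>n = a + b\<close> does not vanish on
  \<open>x \<otimes> y\<close>.
\<close>

lemma tens_homogeneous:
  assumes x: "x \<in> M.H a" and y: "y \<in> N.H b"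
  shows "tens K M N x y \<in> homogeneous T PT' (a + b)"
proof -
  note xc = M.H_closed[OF x] and yc = N.H_closed[OF y]
  have "PT' n (tens K M N x y) = (if n = a + b then tens K M N x y else \<zero>\<^bsub>T\<^esub>)" for n
  proof -
    have "PT' n (tens K M N x y) = (\<Oplus>\<^bsub>T\<^esub>i\<in>{..n}. if a = i then (if n = a + b then tens K M N x y else \<zero>\<^bsub>T\<^esub>) else \<zero>\<^bsub>T\<^esub>)"
      unfolding tensor_proj_def
      by (rule PTP.TP.T.M.finsum_cong')
         (use xc yc in \<open>auto simp: PTP.TP.tensor_map_tens[OF M.module_axioms N.module_axioms M.proj_hom N.proj_hom]
           M.H_proj[OF x] N.H_proj[OF y] PTP.TP.tens_zero PTP.TP.zero_tens\<close>)
    also have "\<dots> = (if n = a + b then tens K M N x y else \<zero>\<^bsub>T\<^esub>)"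
    proof (cases "a \<le> n")
      case True
      then show ?thesis
        using xc yc PTP.TP.T.M.finsum_singleton[of a "{..n}" "\<lambda>_. if n = a + b then tens K M N x y else \<zero>\<^bsub>T\<^esub>"] by simp
    next
      case False
      have "(\<Oplus>\<^bsub>T\<^esub>i\<in>{..n}. if a = i then (if n = a + b then tens K M N x y else \<zero>\<^bsub>T\<^esub>) else \<zero>\<^bsub>T\<^esub>) = (\<Oplus>\<^bsub>T\<^esub>i\<in>{..n}. \<zero>\<^bsub>T\<^esub>)"
        by (rule PTP.TP.T.M.finsum_cong') (use False in auto)
      then show ?thesis using False by simp
    qed
    finally show ?thesis .
  qed
  then show ?thesis using xc yc by (simp add: homogeneous_def)
qed

definition "homogeneous_tensors = {tens K M N x y | x y a b. x \<in> M.H a \<and> y \<in> N.H b}"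

lemma homogeneous_tensors_closed: "homogeneous_tensors \<subseteq> carrier T"
  using M.H_closed N.H_closed by (auto simp: homogeneous_tensors_def)

lemma tensor_generated: "carrier T = additive_span T homogeneous_tensors"
proof
  note tl = module_homs_additive[OF bilinear_maps_left[OF PTP.TP.tens_bilinear]]
  note tr = module_homs_additive[OF bilinear_maps_right[OF PTP.TP.tens_bilinear]]
  note Tab = PTP.TP.T.M.abelian_group_axioms
  show "additive_span T homogeneous_tensors \<subseteq> carrier T"
    by (rule additive_span_subset[OF Tab homogeneous_tensors_closed])
  have 1: "tens K M N x y \<in> additive_span T homogeneous_tensors" if "x \<in> M.H a" "y \<in> carrier N" for x a y
  proof -
    have "tens K M N x y \<in> additive_span T (tens K M N x ` (\<Union>d. N.H d))"
      by (rule additive_span_image[OF N.M.abelian_group_axioms Tab tr N.UN_H_closed])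
         (use that M.H_closed N.generated in auto)
    then show ?thesis
      by (rule additive_span_trans) (use that in \<open>auto intro!: additive_span.base simp: homogeneous_tensors_def\<close>)
  qed
  have 2: "tens K M N x y \<in> additive_span T homogeneous_tensors" if "x \<in> carrier M" "y \<in> carrier N" for x y
  proof -
    have "tens K M N x y \<in> additive_span T ((\<lambda>x. tens K M N x y) ` (\<Union>d. M.H d))"
      by (rule additive_span_image[OF M.M.abelian_group_axioms Tab tl M.UN_H_closed])
         (use that M.generated in auto)
    then show ?thesis by (rule additive_span_trans) (use that 1 in auto)
  qed
  show "carrier T \<subseteq> additive_span T homogeneous_tensors"
  proof
    fix w assume "w \<in> carrier T"
    then show "w \<in> additive_span T homogeneous_tensors"
      by (induction rule: PTP.TP.tensor_induct) (auto intro: 2 additive_span.zero additive_span.add)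
  qed
qed

lemma graded_module_T: "graded_module K T PT'"
proof (intro graded_module.intro PTP.Tp.poly_coeffs_axioms graded_module_axioms.intro tensor_proj_hom)
  have X: "(\<Union>d. homogeneous T PT' d) \<subseteq> carrier T" by (auto simp: homogeneous_def)
  show "carrier T = additive_span T (\<Union>d. homogeneous T PT' d)"
  proof
    show "carrier T \<subseteq> additive_span T (\<Union>d. homogeneous T PT' d)"
    proof
      fix w assume "w \<in> carrier T"
      then have "w \<in> additive_span T homogeneous_tensors" using tensor_generated by simp
      then show "w \<in> additive_span T (\<Union>d. homogeneous T PT' d)"
        by (rule additive_span_trans) (use tens_homogeneous in \<open>fastforce intro!: additive_span.base simp: homogeneous_tensors_def\<close>)
    qed
    show "additive_span T (\<Union>d. homogeneous T PT' d) \<subseteq> carrier T"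
      by (rule additive_span_subset[OF PTP.TP.T.M.abelian_group_axioms X])
  qed
qed

sublocale T: graded_module K T PT' by (rule graded_module_T)

lemma homogeneous_tensor_eqI:
  assumes "abelian_group P" "f \<in> additive_maps T P" "g \<in> additive_maps T P" "w \<in> carrier T"
    and "\<And>x y a b. x \<in> M.H a \<Longrightarrow> y \<in> N.H b \<Longrightarrow> f (tens K M N x y) = g (tens K M N x y)"
  shows "f w = g w"
  by (rule additive_maps_eq[OF PTP.TP.T.M.abelian_group_axioms assms(1-3) _ homogeneous_tensors_closed])
     (use assms(4,5) tensor_generated in \<open>auto simp: homogeneous_tensors_def\<close>)

text \<open>
  The Rees embedding is compatible with tensor products because degrees add up. Together with the
  bijection \<open>PT\<close> this gives the injectivity of its tensor powers.
\<close>

lemma psi_poly_tensor: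
  assumes p: "p \<in> carrier M.Mt" and q: "q \<in> carrier N.Mt"
  shows "T.psi (poly_tensor K M N p q) = poly_tensor K M N (M.psi p) (N.psi q)"
proof -
  note Mc = additive_maps_closed[OF M.psi_additive] and Nc = additive_maps_closed[OF N.psi_additive]
  note pl = PTP.poly_tensor_left and pr = PTP.poly_tensor_right
  have 1: "T.psi (poly_tensor K M N (fsingle M j x) q) = poly_tensor K M N (M.psi (fsingle M j x)) (N.psi q)"
    if x: "x \<in> M.H a" for a j x
    by (rule N.poly_graded_maps_eqI[OF PTP.Tp.Pf.group_P additive_maps_comp[OF pr T.psi_additive]
          additive_maps_comp[OF N.psi_additive pr] q])
       (use x in \<open>simp_all add: Mc M.Pf.fsingle_closed M.H_closed N.H_closed PTP.poly_tensor_fsingle M.psi_fsingle N.psi_fsingle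
          T.psi_fsingle[OF tens_homogeneous] ac_simps\<close>)
  show ?thesis
    by (rule M.poly_graded_maps_eqI[OF PTP.Tp.Pf.group_P additive_maps_comp[OF pl T.psi_additive]
          additive_maps_comp[OF M.psi_additive pl] p 1]) (use q Nc in auto)
qed

end

locale graded_square = M: graded_module K M P
  for K :: "('k, 'x) ring_scheme" and M :: "('k, 'm, 'y) module_scheme" and P
begin

sublocale GT: graded_tensor K M P M P by unfold_locales

lemma tensor_degree_span:
  assumes "\<And>i. submodule (G i) K M"
  shows "tensor_degree K M G n = additive_span GT.T {tens K M M x y | x y i j. i + j = n \<and> x \<in> G i \<and> y \<in> G j}"
  unfolding tensor_degree_def
proof (rule module_span_eq_additive_span[OF GT.PTP.TP.module_T])
  have G: "x \<in> carrier M" if "x \<in> G i" for x i using M.submoduleE(1)[OF assms] that by auto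
  then show "{tens K M M x y | x y i j. i + j = n \<and> x \<in> G i \<and> y \<in> G j} \<subseteq> carrier GT.T" by auto
  fix r z assume r: "r \<in> carrier K" and z: "z \<in> {tens K M M x y | x y i j. i + j = n \<and> x \<in> G i \<and> y \<in> G j}"
  then obtain x y i j where "z = tens K M M x y" "i + j = n" "x \<in> G i" "y \<in> G j" by blast
  then show "r \<odot>\<^bsub>GT.T\<^esub> z \<in> {tens K M M x y | x y i j. i + j = n \<and> x \<in> G i \<and> y \<in> G j}"
    using r G GT.PTP.TP.tens_smult_left[of r x y, symmetric] M.submoduleE(4)[OF assms, of r x i]
      by (intro CollectI exI[of _ "r \<odot>\<^bsub>M\<^esub> x"] exI[of _ y] exI[of _ i] exI[of _ j]) auto
qed

lemma H_submodule: "submodule (M.H d) K M"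
proof (rule M.submoduleI)
  fix a b assume "a \<in> M.H d" "b \<in> M.H d"
  then show "a \<oplus>\<^bsub>M\<^esub> b \<in> M.H d" by (auto simp: homogeneous_def module_homs_add[OF M.proj_hom])
next
  fix a assume "a \<in> M.H d"
  then show "\<ominus>\<^bsub>M\<^esub> a \<in> M.H d"
    by (auto simp: homogeneous_def additive_maps_minus[OF M.M.abelian_group_axioms M.M.abelian_group_axioms M.proj_additive])
qed (auto simp: M.H_zero M.H_smult dest: M.H_closed)

lemma tensor_degree_H: "tensor_degree K M M.H n = GT.T.H n"
proof
  let ?X = "{tens K M M x y | x y i j. i + j = n \<and> x \<in> M.H i \<and> y \<in> M.H j}"
  note Tab = GT.PTP.TP.T.M.abelian_group_axioms
  have span: "tensor_degree K M M.H n = additive_span GT.T ?X" by (rule tensor_degree_span[OF H_submodule])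
  show "tensor_degree K M M.H n \<subseteq> GT.T.H n"
  proof
    fix w assume "w \<in> tensor_degree K M M.H n"
    then have "w \<in> additive_span GT.T ?X" using span by simp
    then show "w \<in> GT.T.H n"
    proof induction
      case (add x y)
      then show ?case by (auto simp: homogeneous_def module_homs_add[OF GT.tensor_proj_hom])
    qed (use GT.tens_homogeneous in \<open>auto simp: GT.T.H_zero\<close>)
  qed
  show "GT.T.H n \<subseteq> tensor_degree K M M.H n"
  proof
    fix w assume w: "w \<in> GT.T.H n"
    have "w \<in> additive_span GT.T GT.homogeneous_tensors" using GT.T.H_closed[OF w] GT.tensor_generated by simp
    then have "GT.PT' n w \<in> additive_span GT.T (GT.PT' n ` GT.homogeneous_tensors)"
      by (rule additive_span_image[OF Tab Tab module_homs_additive[OF GT.tensor_proj_hom] GT.homogeneous_tensors_closed])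
    then have "GT.PT' n w \<in> additive_span GT.T ?X"
    proof (rule additive_span_trans)
      fix z assume "z \<in> GT.PT' n ` GT.homogeneous_tensors"
      then obtain x y a b where z: "z = GT.PT' n (tens K M M x y)" "x \<in> M.H a" "y \<in> M.H b"
        by (auto simp: GT.homogeneous_tensors_def)
      show "z \<in> additive_span GT.T ?X"
        unfolding z(1) GT.T.H_proj[OF GT.tens_homogeneous[OF z(2,3)]]
        using z(2,3) by (auto intro!: additive_span.base additive_span.zero)
    qed
    then show "w \<in> tensor_degree K M M.H n" using GT.T.H_proj[OF w, of n] span by simp
  qed
qed

text \<open>
  A tensor of elements of \<open>F i\<close> and \<open>F j\<close> has no components beyond degree \<open>i + j\<close>. Conversely, a
  component of degree \<open>d \<le> n\<close> is a sum of tensors of homogeneous elements whose degrees add up to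
  \<open>d\<close>.
\<close>

lemma tensor_degree_F: "tensor_degree K M M.F n = GT.T.F n"
proof
  let ?X = "{tens K M M x y | x y i j. i + j = n \<and> x \<in> M.F i \<and> y \<in> M.F j}"
  have span: "tensor_degree K M M.F n = additive_span GT.T ?X" by (rule tensor_degree_span[OF M.F_submodule])
  note Tab = GT.PTP.TP.T.M.abelian_group_axioms
  show "tensor_degree K M M.F n \<subseteq> GT.T.F n"
  proof
    fix w assume "w \<in> tensor_degree K M M.F n"
    then have "w \<in> additive_span GT.T ?X" using span by simp
    then show "w \<in> GT.T.F n"
    proof induction
      case (base w)
      then obtain x y i j where w: "w = tens K M M x y" "i + j = n" "x \<in> M.F i" "y \<in> M.F j" by blast
      have "GT.PT' m w = \<zero>\<^bsub>GT.T\<^esub>" if "m > n" for m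
      proof -
        have "GT.PT' m w = (\<Oplus>\<^bsub>GT.T\<^esub>k\<in>{..m}. \<zero>\<^bsub>GT.T\<^esub>)"
          unfolding tensor_proj_def
        proof (rule GT.PTP.TP.T.M.finsum_cong')
          fix k assume k: "k \<in> {..m}"
          have "i < k \<or> j < m - k" using that w(2) k by auto
          then show "tensor_map K M M (P k) (P (m - k)) w = \<zero>\<^bsub>GT.T\<^esub>"
            using w M.proj_closed
            by (auto simp: GT.PTP.TP.tensor_map_tens[OF M.module_axioms M.module_axioms M.proj_hom M.proj_hom]
              filtered_part_def GT.PTP.TP.tens_zero GT.PTP.TP.zero_tens)
        qed auto
        then show ?thesis by simp
      qed
      moreover have "w \<in> carrier GT.T"
        unfolding w(1) by (rule GT.PTP.TP.tens_closed[OF M.F_closed[OF w(3)] M.F_closed[OF w(4)]])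
      ultimately show ?case unfolding filtered_part_def by blast
    next
      case (add x y)
      from GT.T.F_add[OF add.IH] show ?case .
    qed (simp add: GT.T.F_zero)
  qed
  show "GT.T.F n \<subseteq> tensor_degree K M M.F n"
  proof
    fix w assume w: "w \<in> GT.T.F n"
    have X: "?X \<subseteq> carrier GT.T" using M.F_closed by auto
    have "w \<in> additive_span GT.T (\<Union>d\<in>{..n}. GT.T.H d)" using w GT.T.F_span by simp
    then have "w \<in> additive_span GT.T ?X"
    proof (rule additive_span_trans)
      fix z assume "z \<in> (\<Union>d\<in>{..n}. GT.T.H d)"
      then obtain d where d: "d \<le> n" "z \<in> GT.T.H d" by blast
      then have "z \<in> additive_span GT.T {tens K M M x y | x y i j. i + j = d \<and> x \<in> M.H i \<and> y \<in> M.H j}"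
        using tensor_degree_H tensor_degree_span[OF H_submodule] by simp
      then show "z \<in> additive_span GT.T ?X"
      proof (rule additive_span_trans)
        fix z assume "z \<in> {tens K M M x y | x y i j. i + j = d \<and> x \<in> M.H i \<and> y \<in> M.H j}"
        then obtain x y i j where z: "z = tens K M M x y" "i + j = d" "x \<in> M.H i" "y \<in> M.H j" by blast
        \<comment> \<open>\<open>y\<close> is regarded as an element of \<open>F (n - i)\<close>, since \<open>i + j = d\<close> may be less than \<open>n\<close>\<close>
        have "j \<le> n - i" using z(2) d(1) by simp
        then have "x \<in> M.F i" "y \<in> M.F (n - i)" using M.H_subset_F[of i i] M.H_subset_F[of j "n - i"] z(3,4) by auto
        then have "z \<in> ?X" using z d by (intro CollectI exI[of _ x] exI[of _ y] exI[of _ i] exI[of _ "n - i"]) auto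
        then show "z \<in> additive_span GT.T ?X" by (rule additive_span.base)
      qed
    qed
    then show "w \<in> tensor_degree K M M.F n" using span by simp
  qed
qed

end

section \<open>Graded bialgebras and their liftings\<close>

context graded_bialgebra
begin

abbreviation "proj \<equiv> (\<lambda>i x. component B G x i)"
abbreviation "FB \<equiv> filtration_of B G"

lemma B_module: "module K B" by (rule module_axioms)
lemmas B_group = M.abelian_group_axioms

lemma G_submodule: "submodule (G i) K B"
  using grading by (simp add: module_grading_def)

lemma G_closed: "x \<in> G i \<Longrightarrow> x \<in> carrier B"
  using submoduleE(1)[OF G_submodule[of i]] by auto

lemma G_zero: "\<zero>\<^bsub>B\<^esub> \<in> G i"
  using G_submodule[of i] by (auto simp: submodule_def subgroup_def)

text \<open>
  The condition that characterizes \<open>component B G x\<close>. The projections \<open>proj i\<close> are linear because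
  sums and multiples of decompositions are decompositions.
\<close>

definition "decomposes x f \<longleftrightarrow> (\<forall>i. f i \<in> G i) \<and> finite {i. f i \<noteq> \<zero>\<^bsub>B\<^esub>} \<and>
        x = (\<Oplus>\<^bsub>B\<^esub>i\<in>{i. f i \<noteq> \<zero>\<^bsub>B\<^esub>}. f i)"

lemma decomposes_ex1: "x \<in> carrier B \<Longrightarrow> \<exists>!f. decomposes x f"
  using grading unfolding module_grading_def decomposes_def by simp

lemma component_eq: "component B G x = (THE f. decomposes x f)"
  unfolding component_def decomposes_def by simp

lemma decomposes_component: "x \<in> carrier B \<Longrightarrow> decomposes x (component B G x)"
  unfolding component_eq by (rule theI'[OF decomposes_ex1])

lemma decomposes_unique: "x \<in> carrier B \<Longrightarrow> decomposes x f \<Longrightarrow> component B G x = f"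
  unfolding component_eq by (rule the1_equality[OF decomposes_ex1])

lemma decomposes_sum:
  assumes "\<And>i. f i \<in> G i" "finite A" "{i. f i \<noteq> \<zero>\<^bsub>B\<^esub>} \<subseteq> A"
  shows "(\<Oplus>\<^bsub>B\<^esub>i\<in>{i. f i \<noteq> \<zero>\<^bsub>B\<^esub>}. f i) = (\<Oplus>\<^bsub>B\<^esub>i\<in>A. f i)"
  by (rule M.add.finprod_mono_neutral_cong_left) (use assms G_closed in auto)

lemma decomposesI:
  assumes "\<And>i. f i \<in> G i" "finite A" "{i. f i \<noteq> \<zero>\<^bsub>B\<^esub>} \<subseteq> A" "x = (\<Oplus>\<^bsub>B\<^esub>i\<in>A. f i)"
  shows "decomposes x f"
  using assms decomposes_sum[OF assms(1-3)] finite_subset[OF assms(3,2)] by (simp add: decomposes_def)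

lemma proj_G: "x \<in> carrier B \<Longrightarrow> proj i x \<in> G i"
  using decomposes_component[of x] by (simp add: decomposes_def)

lemma proj_of_G:
  assumes "x \<in> G d" shows "proj i x = (if i = d then x else \<zero>\<^bsub>B\<^esub>)"
proof -
  have "decomposes x (\<lambda>i. if i = d then x else \<zero>\<^bsub>B\<^esub>)"
    by (rule decomposesI[of _ "{d}"]) (use assms G_zero G_closed in auto)
  from decomposes_unique[OF G_closed[OF assms] this] show ?thesis by simp
qed

lemma proj_module_hom: "proj i \<in> module_homs K B B"
proof (intro module_homsI additive_mapsI)
  fix x assume x: "x \<in> carrier B"
  show "proj i x \<in> carrier B" using proj_G[OF x] G_closed by blast
  note dx = decomposes_component[OF x, unfolded decomposes_def]
  fix y assume y: "y \<in> carrier B"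
  note dy = decomposes_component[OF y, unfolded decomposes_def]
  let ?A = "{i. proj i x \<noteq> \<zero>\<^bsub>B\<^esub>} \<union> {i. proj i y \<noteq> \<zero>\<^bsub>B\<^esub>}"
  have fin: "finite ?A" using dx dy by simp
  have "decomposes (x \<oplus>\<^bsub>B\<^esub> y) (\<lambda>i. proj i x \<oplus>\<^bsub>B\<^esub> proj i y)"
  proof (rule decomposesI[OF _ fin])
    show "proj i x \<oplus>\<^bsub>B\<^esub> proj i y \<in> G i" for i
      using submoduleE(5)[OF G_submodule] proj_G x y by simp
    have "x = (\<Oplus>\<^bsub>B\<^esub>i\<in>?A. proj i x)" "y = (\<Oplus>\<^bsub>B\<^esub>i\<in>?A. proj i y)"
      using dx dy decomposes_sum[of "component B G x" ?A] decomposes_sum[of "component B G y" ?A] fin by auto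
    then show "x \<oplus>\<^bsub>B\<^esub> y = (\<Oplus>\<^bsub>B\<^esub>i\<in>?A. proj i x \<oplus>\<^bsub>B\<^esub> proj i y)"
      using proj_G[OF x, THEN G_closed] proj_G[OF y, THEN G_closed] by (subst M.finsum_addf) auto
  qed auto
  from decomposes_unique[OF _ this] show "proj i (x \<oplus>\<^bsub>B\<^esub> y) = proj i x \<oplus>\<^bsub>B\<^esub> proj i y" using x y by simp
next
  fix r x assume r: "r \<in> carrier K" and x: "x \<in> carrier B"
  note dx = decomposes_component[OF x, unfolded decomposes_def]
  let ?A = "{i. proj i x \<noteq> \<zero>\<^bsub>B\<^esub>}"
  have fin: "finite ?A" using dx by simp
  have "decomposes (r \<odot>\<^bsub>B\<^esub> x) (\<lambda>i. r \<odot>\<^bsub>B\<^esub> proj i x)"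
  proof (rule decomposesI[OF _ fin])
    show "r \<odot>\<^bsub>B\<^esub> proj i x \<in> G i" for i
      using submoduleE(4)[OF G_submodule] proj_G x r by simp
    have "x = (\<Oplus>\<^bsub>B\<^esub>i\<in>?A. proj i x)" using dx by simp
    then show "r \<odot>\<^bsub>B\<^esub> x = (\<Oplus>\<^bsub>B\<^esub>i\<in>?A. r \<odot>\<^bsub>B\<^esub> proj i x)"
      using proj_G[OF x, THEN G_closed] r fin finsum_smult_ldistr[of ?A r "\<lambda>i. proj i x"] by auto
  qed (use r in auto)
  from decomposes_unique[OF _ this] show "proj i (r \<odot>\<^bsub>B\<^esub> x) = r \<odot>\<^bsub>B\<^esub> proj i x" using r x by simp
qed

lemma homogeneous_eq_G: "homogeneous B proj d = G d"
proof
  show "homogeneous B proj d \<subseteq> G d" using proj_G by (auto simp: homogeneous_def) metis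
  show "G d \<subseteq> homogeneous B proj d" using proj_of_G G_closed by (auto simp: homogeneous_def)
qed

lemma graded_module_B: "graded_module K B proj"
proof (intro graded_module.intro poly_coeffs.intro B_module graded_module_axioms.intro proj_module_hom)
  show "carrier B = additive_span B (\<Union>d. homogeneous B proj d)"
  proof
    show "additive_span B (\<Union>d. homogeneous B proj d) \<subseteq> carrier B"
      by (rule additive_span_subset[OF B_group]) (auto simp: homogeneous_def)
    show "carrier B \<subseteq> additive_span B (\<Union>d. homogeneous B proj d)"
    proof
      fix x assume x: "x \<in> carrier B"
      have "(\<Oplus>\<^bsub>B\<^esub>i\<in>{i. proj i x \<noteq> \<zero>\<^bsub>B\<^esub>}. proj i x) \<in> additive_span B (\<Union>d. homogeneous B proj d)"
        by (rule additive_span_finsum[OF B_group])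
           (use proj_G[OF x] G_closed in \<open>auto intro!: additive_span.base simp: homogeneous_eq_G\<close>)
      then show "x \<in> additive_span B (\<Union>d. homogeneous B proj d)"
        using decomposes_component[OF x] by (simp add: decomposes_def)
    qed
  qed
qed

sublocale BG: graded_module K B proj by (rule graded_module_B)
sublocale SQ: graded_square K B proj by unfold_locales

abbreviation "TB \<equiv> tensor K B B"
lemmas TB_group = SQ.GT.PTP.TP.T.M.abelian_group_axioms and TB_module = SQ.GT.PTP.TP.module_T
abbreviation "projT \<equiv> tensor_proj K B proj B proj"

lemma FB_eq: "FB n = BG.F n"
proof
  show "FB n \<subseteq> BG.F n"
  proof
    fix x assume "x \<in> FB n"
    then obtain f where f: "x = (\<Oplus>\<^bsub>B\<^esub>j\<in>{..n}. f j)" "\<forall>j\<le>n. f j \<in> G j" by (auto simp: filtration_of_def)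
    have "(\<Oplus>\<^bsub>B\<^esub>j\<in>{..n}. f j) \<in> additive_span B (\<Union>d\<in>{..n}. BG.H d)"
      by (rule additive_span_finsum[OF B_group]) (use f G_closed in \<open>auto intro!: additive_span.base simp: homogeneous_eq_G\<close>)
    then show "x \<in> BG.F n" using f(1) BG.F_span by simp
  qed
  show "BG.F n \<subseteq> FB n"
    using BG.F_decomposition proj_G[OF BG.F_closed] by (force simp: filtration_of_def)
qed

lemma tensor_degree_G: "tensor_degree K B G n = SQ.GT.T.H n"
proof -
  have "G = BG.H" by (simp add: fun_eq_iff homogeneous_eq_G)
  then show ?thesis using SQ.tensor_degree_H by simp
qed

lemma tensor_degree_FB: "tensor_degree K B FB n = SQ.GT.T.F n"
proof -
  have "FB = BG.F" by (simp add: fun_eq_iff FB_eq)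
  then show ?thesis using SQ.tensor_degree_F by simp
qed

lemma poly_degree_G: "poly_degree B G n = BG.Hp n"
proof -
  have "G = BG.H" by (simp add: fun_eq_iff homogeneous_eq_G)
  then show ?thesis by simp
qed

lemma poly_degree_T: "poly_degree TB (tensor_degree K B G) n = SQ.GT.T.Hp n"
proof -
  have "tensor_degree K B G = SQ.GT.T.H" by (simp add: fun_eq_iff tensor_degree_G)
  then show ?thesis by simp
qed

sublocale MB: graded_pair K TB projT B proj by unfold_locales
sublocale DB: graded_pair K B proj TB projT by unfold_locales

end

context graded_module
begin

text \<open>
  The step of the filtration before \<open>F n\<close>, by \<open>lower_0\<close> and \<open>lower_Suc\<close>. In this form it needs
  no case distinction and is visibly the kernel of the leading term.
\<close>

definition "lower n = {x \<in> F n. P n x = \<zero>\<^bsub>M\<^esub>}"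

lemma lower_0: "lower 0 = {\<zero>\<^bsub>M\<^esub>}"
proof -
  have "x = \<zero>\<^bsub>M\<^esub>" if x: "x \<in> F 0" "P 0 x = \<zero>\<^bsub>M\<^esub>" for x
    using F_decomposition[OF x(1)] x(2) by simp
  then show ?thesis by (auto simp: lower_def F_zero proj_zero)
qed

lemma lower_Suc: "lower (Suc n) = F n"
proof (rule Set.set_eqI)
  fix x
  have "(\<forall>i>Suc n. P i x = \<zero>\<^bsub>M\<^esub>) \<and> P (Suc n) x = \<zero>\<^bsub>M\<^esub> \<longleftrightarrow> (\<forall>i>n. P i x = \<zero>\<^bsub>M\<^esub>)"
  proof (intro iffI allI impI conjI)
    fix i assume "(\<forall>i>Suc n. P i x = \<zero>\<^bsub>M\<^esub>) \<and> P (Suc n) x = \<zero>\<^bsub>M\<^esub>" "n < i"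
    then show "P i x = \<zero>\<^bsub>M\<^esub>" by (cases "i = Suc n") auto
  qed auto
  then show "x \<in> lower (Suc n) \<longleftrightarrow> x \<in> F n"
    unfolding lower_def filtered_part_def by blast
qed

lemma minus_proj_lower: "x \<in> F n \<Longrightarrow> x \<ominus>\<^bsub>M\<^esub> P n x \<in> lower n"
proof -
  assume x: "x \<in> F n"
  note xc = F_closed[OF x]
  have "P n x \<in> F n" using proj_H[OF xc] H_subset_F[of n n] by auto
  then have "x \<ominus>\<^bsub>M\<^esub> P n x \<in> F n" using x by (simp add: a_minus_def F_add F_minus)
  moreover have "P n (x \<ominus>\<^bsub>M\<^esub> P n x) = \<zero>\<^bsub>M\<^esub>"
    using xc proj_closed[of x n]
    by (simp add: additive_maps_diff[OF M.abelian_group_axioms M.abelian_group_axioms proj_additive] proj_proj)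
       (simp add: a_minus_def M.r_neg)
  ultimately show ?thesis by (simp add: lower_def)
qed

lemma lower_submodule: "submodule (lower n) K M"
proof (rule submoduleI)
  fix a b assume "a \<in> lower n" "b \<in> lower n"
  then show "a \<oplus>\<^bsub>M\<^esub> b \<in> lower n" using F_closed by (auto simp: lower_def F_add module_homs_add[OF proj_hom])
next
  fix r b assume "r \<in> carrier K" "b \<in> lower n"
  then show "r \<odot>\<^bsub>M\<^esub> b \<in> lower n" using F_closed by (auto simp: lower_def F_smult module_homs_smult[OF proj_hom])
next
  fix a assume "a \<in> lower n"
  then show "\<ominus>\<^bsub>M\<^esub> a \<in> lower n" using F_closed
    by (auto simp: lower_def F_minus additive_maps_minus[OF M.abelian_group_axioms M.abelian_group_axioms proj_additive])
qed (auto simp: lower_def F_zero proj_zero dest: F_closed)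

end

context graded_pair
begin

lemma filtered_lower:
  assumes f: "f \<in> additive_maps M N" and filt: "\<And>n x. x \<in> M.F n \<Longrightarrow> f x \<in> N.F n" and x: "x \<in> M.lower n"
  shows "f x \<in> N.lower n"
proof (cases n)
  case 0
  then show ?thesis using x additive_maps_zero[OF M.M.abelian_group_axioms N.M.abelian_group_axioms f]
    by (simp add: M.lower_0 N.lower_0)
next
  case (Suc k)
  then show ?thesis using x filt by (simp add: M.lower_Suc N.lower_Suc)
qed

text \<open>
  A filtered map induces a map of associated graded modules: the leading term of \<open>f x\<close> only depends on
  that of \<open>x\<close>.
\<close>

lemma filtered_leading:
  assumes f: "f \<in> additive_maps M N" and filt: "\<And>n x. x \<in> M.F n \<Longrightarrow> f x \<in> N.F n" and x: "x \<in> M.F n"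
  shows "PN n (f x) = PN n (f (PM n x))"
proof -
  note xc = M.F_closed[OF x]
  note pc = M.proj_closed[OF xc]
  have d: "x \<ominus>\<^bsub>M\<^esub> PM n x \<in> carrier M" using xc pc by simp
  have "f (x \<ominus>\<^bsub>M\<^esub> PM n x) \<in> N.lower n"
    by (rule filtered_lower[OF f filt M.minus_proj_lower[OF x]])
  moreover have "x = (x \<ominus>\<^bsub>M\<^esub> PM n x) \<oplus>\<^bsub>M\<^esub> PM n x"
    using xc pc by (simp add: a_minus_def M.M.a_assoc M.M.l_neg)
  then have "f x = f (x \<ominus>\<^bsub>M\<^esub> PM n x) \<oplus>\<^bsub>N\<^esub> f (PM n x)"
    using additive_maps_add[OF f d pc] by metis
  ultimately show ?thesis
    using additive_maps_closed[OF f] d pc N.proj_closed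
    by (simp add: module_homs_add[OF N.proj_hom] N.lower_def)
qed

end

lemma tensor_null_module_cong:
  assumes "carrier M = carrier M'" "add M = add M'" "smult M = smult M'"
    and "carrier N = carrier N'" "add N = add N'" "smult N = smult N'"
  shows "tensor_null R M N = tensor_null R M' N'"
  unfolding tensor_null_def tensor_relators_def Let_def assms ..

lemma tensor_module_cong:
  assumes "carrier M = carrier M'" "add M = add M'" "smult M = smult M'"
    and "carrier N = carrier N'" "add N = add N'" "smult N = smult N'"
  shows "tensor R M N = tensor R M' N'"
  unfolding tensor_def tensor_null_module_cong[OF assms] assms ..

lemma tens_module_cong:
  assumes "carrier M = carrier M'" "add M = add M'" "smult M = smult M'"
    and "carrier N = carrier N'" "add N = add N'" "smult N = smult N'"
  shows "tens R M N = tens R M' N'"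
  unfolding tens_def[abs_def] tensor_null_module_cong[OF assms] assms ..

lemma tensor_map_module_cong:
  assumes "carrier M = carrier M'" "add M = add M'" "smult M = smult M'"
    and "carrier N = carrier N'" "add N = add N'" "smult N = smult N'"
  shows "tensor_map R M N f g = tensor_map R M' N' f g"
  unfolding tensor_map_def tensor_module_cong[OF assms] tens_module_cong[OF assms] ..

lemma add_monoid_cong:
  assumes "carrier M = carrier M'" "zero M = zero M'" "add M = add M'"
  shows "add_monoid M = add_monoid M'"
  using assms by simp

text \<open>
  A lifting shares the underlying module with \<open>B\<close>, and all constructions with modules only use the
  carrier, the addition, the zero and the scalar multiplication. The facts below rewrite them to
  constructions with \<open>B\<close>.
\<close>

locale same_module = graded_bialgebra K B G
  for K :: "('k, 'x) ring_scheme" and B :: "('k, 'b) bialg" and G +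
  fixes U :: "('k, 'b) bialg"
  assumes carrier_U: "carrier U = carrier B" and zero_U: "zero U = zero B"
    and add_U: "add U = add B" and smult_U: "smult U = smult B"
begin

lemma tensor_U: "tensor K U U = TB"
  by (rule tensor_module_cong) (simp_all add: carrier_U add_U smult_U)
lemma tens_U: "tens K U U = tens K B B"
  by (rule tens_module_cong) (simp_all add: carrier_U add_U smult_U)
lemma tensor_map_U: "tensor_map K U U f g = tensor_map K B B f g"
  by (rule tensor_map_module_cong) (simp_all add: carrier_U add_U smult_U)
lemma finsum_U: "finsum U = finsum B"
  unfolding finsum_def add_monoid_cong[OF carrier_U zero_U add_U] ..
lemma tensor_lift_U: "tensor_lift K U \<beta> = tensor_lift K B \<beta>"
  unfolding tensor_lift_def[abs_def] finsum_U smult_U ..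
lemma poly_module_U: "poly_module K U = poly_module K B"
  by (simp add: poly_module_def carrier_U zero_U add_U smult_U finsum_U)
lemma module_homs_U: "module_homs K U N = module_homs K B N" "module_homs K M U = module_homs K M B"
  by (simp_all add: module_homs_def carrier_U add_U smult_U)
lemma bilinear_U: "bilinear_maps K U U U = bilinear_maps K B B B"
  by (simp add: bilinear_maps_def module_homs_U carrier_U)
lemma additive_U: "additive_maps U N = additive_maps B N" "additive_maps M U = additive_maps M B"
  by (simp_all add: additive_maps_def carrier_U add_U)
lemma module_U: "module K U"
  by (rule module_surjective_image[OF B_module, of "\<lambda>x. x"]) (simp_all add: carrier_U zero_U add_U smult_U)
lemma coset_U: "a_r_coset U = a_r_coset B"
  unfolding a_r_coset_def[abs_def] add_monoid_cong[OF carrier_U zero_U add_U] ..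
lemma submodule_U: "submodule N K U \<longleftrightarrow> submodule N K B"
  unfolding submodule_def submodule_axioms_def add_monoid_cong[OF carrier_U zero_U add_U] smult_U ..
lemma tensor_degree_U: "tensor_degree K U = tensor_degree K B"
  unfolding tensor_degree_def[abs_def] tensor_U tens_U ..
lemma pred_filtration_U: "pred_filtration U = pred_filtration B"
  unfolding pred_filtration_def[abs_def] zero_U ..
lemma gr_class_U: "gr_class U = gr_class B"
  unfolding gr_class_def[abs_def] pred_filtration_U coset_U ..

lemmas same = carrier_U zero_U add_U smult_U

end

text \<open>
  A filtered bialgebra on the filtered module of \<open>B\<close>. In this locale \<open>gr U\<close> is computed: a coset in
  \<open>F n\<close> modulo the preceding step is determined by the leading term \<open>proj n u\<close> of any
  representative \<open>u\<close>, so a choice of representatives never matters.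
\<close>

locale filtered_lift = same_module +
  assumes U_bialgebra: "bialgebra K U"
    and U_one: "one U \<in> BG.F 0"
    and U_mult: "x \<in> BG.F i \<Longrightarrow> y \<in> BG.F j \<Longrightarrow> x \<otimes>\<^bsub>U\<^esub> y \<in> BG.F (i + j)"
    and U_comult: "x \<in> BG.F n \<Longrightarrow> comult U x \<in> SQ.GT.T.F n"
begin

sublocale U: bialgebra K U by (rule U_bialgebra)
sublocale UP: prebialgebra K U by (rule U.prebialgebra)

lemma comult_U_hom: "comult U \<in> module_homs K B TB"
  using U.comult_module_hom by (simp add: tensor_U module_homs_U)

lemma mult_U_bilinear: "mult U \<in> bilinear_maps K B B B"
  using UP.mult_bilinear by (simp add: bilinear_U)

abbreviation "cls \<equiv> gr_class U FB"
abbreviation "gr \<equiv> gr_algebra U FB"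
abbreviation "iota \<equiv> gr_ident B G"

lemma pred_eq: "pred_filtration U FB = BG.lower"
proof
  fix n show "pred_filtration U FB n = BG.lower n"
    by (cases n) (simp_all add: pred_filtration_def BG.lower_0 BG.lower_Suc zero_U FB_eq)
qed

lemma quotient_lower: "quotient K B (BG.lower n)"
  by (intro quotient.intro B_module quotient_axioms.intro BG.lower_submodule)

lemma cls_eq: "cls n u = BG.lower n +>\<^bsub>B\<^esub> u"
  by (simp add: gr_class_def pred_eq coset_U)

lemma mem_cls:
  assumes "u \<in> BG.F n" "v \<in> cls n u" shows "v \<in> BG.F n" "proj n v = proj n u"
proof -
  obtain l where l: "l \<in> BG.lower n" "v = l \<oplus>\<^bsub>B\<^esub> u"
    using assms quotient.coset_mem_iff[OF quotient_lower BG.F_closed[OF assms(1)]] by (auto simp: cls_eq)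
  have lF: "l \<in> BG.F n" "proj n l = \<zero>\<^bsub>B\<^esub>" using l(1) by (auto simp: BG.lower_def)
  show "v \<in> BG.F n" using l(2) lF(1) assms(1) by (simp add: BG.F_add)
  show "proj n v = proj n u"
    unfolding l(2) module_homs_add[OF BG.proj_hom BG.F_closed[OF lF(1)] BG.F_closed[OF assms(1)]] lF(2)
    using BG.proj_closed[OF BG.F_closed[OF assms(1)]] by simp
qed

lemma self_cls: "u \<in> BG.F n \<Longrightarrow> u \<in> cls n u"
  unfolding cls_eq by (rule quotient.mem_coset_self[OF quotient_lower BG.F_closed])

lemma rep_cls:
  assumes "u \<in> BG.F n" shows "rep (cls n u) \<in> BG.F n" "proj n (rep (cls n u)) = proj n u"
proof -
  have "rep (cls n u) \<in> cls n u" unfolding rep_def by (rule someI[of "\<lambda>x. x \<in> cls n u", OF self_cls[OF assms]])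
  from mem_cls[OF assms this] show "rep (cls n u) \<in> BG.F n" "proj n (rep (cls n u)) = proj n u" .
qed

lemma cls_eq_iff:
  assumes u: "u \<in> BG.F n" and v: "v \<in> BG.F n" shows "cls n u = cls n v \<longleftrightarrow> proj n u = proj n v"
proof
  assume "cls n u = cls n v"
  then show "proj n u = proj n v" using rep_cls(2)[OF u] rep_cls(2)[OF v] by simp
next
  assume e: "proj n u = proj n v"
  note uc = BG.F_closed[OF u] and vc = BG.F_closed[OF v]
  have "proj n (u \<ominus>\<^bsub>B\<^esub> v) = \<zero>\<^bsub>B\<^esub>"
    using uc vc BG.proj_closed[OF vc] e
    by (simp add: additive_maps_diff[OF B_group B_group BG.proj_additive]) (simp add: a_minus_def M.r_neg)
  moreover have "u \<ominus>\<^bsub>B\<^esub> v \<in> BG.F n" using u v by (simp add: a_minus_def BG.F_add BG.F_minus)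
  ultimately have l: "u \<ominus>\<^bsub>B\<^esub> v \<in> BG.lower n" by (simp add: BG.lower_def)
  have "u = (u \<ominus>\<^bsub>B\<^esub> v) \<oplus>\<^bsub>B\<^esub> v" using uc vc by (simp add: a_minus_def M.a_assoc M.l_neg)
  then have "u \<in> cls n v" using l quotient.coset_mem_iff[OF quotient_lower vc] unfolding cls_eq by blast
  then show "cls n u = cls n v" unfolding cls_eq by (rule quotient.coset_eq[OF quotient_lower vc])
qed

lemma proj_F: "x \<in> carrier B \<Longrightarrow> proj n x \<in> BG.F n"
  using BG.proj_H BG.H_subset_F[of n n] by blast

lemma proj_idem: "x \<in> carrier B \<Longrightarrow> proj n (proj n x) = proj n x"
  by (simp add: BG.proj_proj)

lemma cls_proj: "u \<in> BG.F n \<Longrightarrow> cls n (proj n u) = cls n u"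
  using cls_eq_iff[OF proj_F[OF BG.F_closed]] BG.F_closed by (simp add: proj_idem)

lemma cls_zero: "cls n \<zero>\<^bsub>B\<^esub> = BG.lower n"
  unfolding cls_eq by (rule quotient.coset_zero[OF quotient_lower])

lemma cls_eq_lower_iff: "u \<in> BG.F n \<Longrightarrow> cls n u = BG.lower n \<longleftrightarrow> proj n u = \<zero>\<^bsub>B\<^esub>"
  using cls_eq_iff[OF _ BG.F_zero, of u n] by (simp add: cls_zero BG.proj_zero)

lemma iota_eq: "iota b i = cls i (proj i b)"
  by (simp add: gr_ident_def gr_class_U)

lemma iota_rep:
  assumes "b \<in> carrier B"
  shows "rep (iota b i) \<in> BG.F i" "proj i (rep (iota b i)) = proj i b"
  using rep_cls[OF proj_F[OF assms]] assms by (simp_all add: iota_eq proj_idem)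

lemma gr_carrier: "X \<in> carrier gr \<longleftrightarrow> (\<forall>i. X i \<in> cls i ` BG.F i) \<and> finite {i. X i \<noteq> BG.lower i}"
  by (simp add: gr_algebra_def pred_eq FB_eq)

lemma iota_support: "b \<in> carrier B \<Longrightarrow> {i. iota b i \<noteq> BG.lower i} = {i. proj i b \<noteq> \<zero>\<^bsub>B\<^esub>}"
  using cls_eq_lower_iff[OF proj_F] by (simp add: iota_eq proj_idem)

lemma iota_closed: "b \<in> carrier B \<Longrightarrow> iota b \<in> carrier gr"
  using BG.finite_proj[of b] proj_F by (simp add: gr_carrier iota_support) (simp add: iota_eq)

lemma iota_eqI:
  assumes "b \<in> carrier B" "\<And>i. X i \<in> cls i ` BG.F i" "\<And>i. proj i (rep (X i)) = proj i b"
  shows "X = iota b"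
proof
  fix i
  obtain u where u: "u \<in> BG.F i" "X i = cls i u" using assms(2) by blast
  have "proj i b = proj i u" using assms(3)[of i] u rep_cls(2)[OF u(1)] by simp
  then show "X i = iota b i" using u cls_proj[OF u(1)] by (simp add: iota_eq)
qed

lemma iota_surj: "iota ` carrier B = carrier gr"
proof
  show "iota ` carrier B \<subseteq> carrier gr" using iota_closed by auto
  show "carrier gr \<subseteq> iota ` carrier B"
  proof
    fix X assume "X \<in> carrier gr"
    then have X: "\<And>i. X i \<in> cls i ` BG.F i" and fin: "finite {i. X i \<noteq> BG.lower i}" by (simp_all add: gr_carrier)
    let ?f = "\<lambda>i. proj i (rep (X i))" and ?A = "{i. X i \<noteq> BG.lower i}"
    have XF: "rep (X i) \<in> BG.F i" for i
    proof -
      obtain u where u: "u \<in> BG.F i" "X i = cls i u" using X by blast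
      then show ?thesis using rep_cls(1) by simp
    qed
    have fG: "?f i \<in> G i" for i using proj_G BG.F_closed[OF XF] by simp
    have supp: "{i. ?f i \<noteq> \<zero>\<^bsub>B\<^esub>} \<subseteq> ?A"
    proof (intro subsetI CollectI notI)
      fix i assume i: "i \<in> {i. ?f i \<noteq> \<zero>\<^bsub>B\<^esub>}" and "X i = BG.lower i"
      then have "X i = cls i \<zero>\<^bsub>B\<^esub>" by (simp add: cls_zero)
      then show False using i rep_cls(2)[OF BG.F_zero, of i] by (simp add: BG.proj_zero)
    qed
    let ?b = "\<Oplus>\<^bsub>B\<^esub>i\<in>?A. ?f i"
    have b: "?b \<in> carrier B" using fG G_closed by (intro M.finsum_closed) auto
    have "decomposes ?b ?f" by (rule decomposesI[OF fG fin supp refl])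
    then have "proj i ?b = ?f i" for i using decomposes_unique[OF b] by simp
    then have "X = iota ?b" by (intro iota_eqI[OF b X]) simp
    then show "X \<in> iota ` carrier B" using b by blast
  qed
qed

lemma iota_inj: "inj_on iota (carrier B)"
proof (rule inj_onI)
  fix b c assume bc: "b \<in> carrier B" "c \<in> carrier B" "iota b = iota c"
  have "proj i b = proj i c" for i
    using bc iota_rep(2)[OF bc(1), of i] iota_rep(2)[OF bc(2), of i] by simp
  then have "component B G b = component B G c" by (simp add: fun_eq_iff)
  then show "b = c" using decomposes_component[OF bc(1)] decomposes_component[OF bc(2)] by (simp add: decomposes_def)
qed

lemma cls_mem: "u \<in> BG.F n \<Longrightarrow> cls n u \<in> cls n ` BG.F n" by simp

lemma iota_add:
  assumes b: "b \<in> carrier B" and c: "c \<in> carrier B"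
  shows "iota (b \<oplus>\<^bsub>B\<^esub> c) = iota b \<oplus>\<^bsub>gr\<^esub> iota c"
proof -
  have r: "rep (iota b i) \<oplus>\<^bsub>B\<^esub> rep (iota c i) \<in> BG.F i" for i
    using iota_rep(1)[OF b] iota_rep(1)[OF c] by (rule BG.F_add)
  have e: "(iota b \<oplus>\<^bsub>gr\<^esub> iota c) i = cls i (rep (iota b i) \<oplus>\<^bsub>B\<^esub> rep (iota c i))" for i
    by (simp add: gr_algebra_def add_U)
  show ?thesis
    by (rule iota_eqI[symmetric])
       (use b c r in \<open>auto simp: e rep_cls(2)[OF r] module_homs_add[OF BG.proj_hom] BG.F_closed[OF iota_rep(1)] iota_rep(2)\<close>)
qed

lemma iota_smult:
  assumes k: "k \<in> carrier K" and b: "b \<in> carrier B"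
  shows "iota (k \<odot>\<^bsub>B\<^esub> b) = k \<odot>\<^bsub>gr\<^esub> iota b"
proof -
  have r: "k \<odot>\<^bsub>B\<^esub> rep (iota b i) \<in> BG.F i" for i
    using iota_rep(1)[OF b] by (rule BG.F_smult[OF k])
  have e: "(k \<odot>\<^bsub>gr\<^esub> iota b) i = cls i (k \<odot>\<^bsub>B\<^esub> rep (iota b i))" for i
    by (simp add: gr_algebra_def smult_U)
  show ?thesis
    by (rule iota_eqI[symmetric])
       (use b k r in \<open>auto simp: e rep_cls(2)[OF r] module_homs_smult[OF BG.proj_hom] BG.F_closed[OF iota_rep(1)] iota_rep(2)\<close>)
qed

lemma iota_zero: "iota \<zero>\<^bsub>B\<^esub> = \<zero>\<^bsub>gr\<^esub>"
  by (simp add: fun_eq_iff iota_eq BG.proj_zero cls_zero gr_algebra_def pred_eq)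

lemma gr_module: "module K gr"
  by (rule module_surjective_image[OF B_module iota_surj iota_add iota_smult iota_zero])

lemma iota_hom: "iota \<in> module_homs K B gr"
  by (intro module_homsI additive_mapsI) (simp_all add: iota_closed iota_add iota_smult)

lemma gr_in_eq: "u \<in> BG.F i \<Longrightarrow> gr_in U FB i u = iota (proj i u)"
  by (auto simp: gr_in_def fun_eq_iff iota_eq pred_eq BG.proj_proj BG.F_closed cls_proj cls_zero)

lemma iota_one_iff: "iota \<one>\<^bsub>B\<^esub> = one (gr_bialgebra K U FB) \<longleftrightarrow> \<one>\<^bsub>U\<^esub> = \<one>\<^bsub>B\<^esub>"
proof -
  have "one (gr_bialgebra K U FB) = iota (proj 0 \<one>\<^bsub>U\<^esub>)"
    by (simp add: gr_bialgebra_def gr_algebra_def gr_in_eq[OF U_one])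
  moreover have "proj 0 \<one>\<^bsub>U\<^esub> = \<one>\<^bsub>U\<^esub>" using BG.F_decomposition[OF U_one] BG.proj_closed[OF BG.F_closed[OF U_one]] by simp
  ultimately show ?thesis
    using inj_on_eq_iff[OF iota_inj, of "\<one>\<^bsub>B\<^esub>" "\<one>\<^bsub>U\<^esub>"] BG.F_closed[OF U_one] one_degree[THEN G_closed] by auto
qed

subsection \<open>The multiplication of the associated graded bialgebra\<close>

lemma U_mult_closed: "x \<in> carrier B \<Longrightarrow> y \<in> carrier B \<Longrightarrow> x \<otimes>\<^bsub>U\<^esub> y \<in> carrier B"
  using UP.mult_closed_A by (simp add: carrier_U)

text \<open>
  The products of \<open>F i\<close> with \<open>lower j\<close> and of \<open>lower i\<close> with \<open>F j\<close> lie in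
  \<open>lower (i + j)\<close>, so only the product of the leading terms contributes in degree \<open>i + j\<close>.
\<close>

lemma leading_mult:
  assumes u: "u \<in> BG.F i" and v: "v \<in> BG.F j"
  shows "proj (i + j) (u \<otimes>\<^bsub>U\<^esub> v) = proj (i + j) (proj i u \<otimes>\<^bsub>U\<^esub> proj j v)"
proof -
  note uc = BG.F_closed[OF u] and vc = BG.F_closed[OF v]
  have m_low: "x \<otimes>\<^bsub>U\<^esub> y \<in> BG.lower (i + j)" if "x \<in> BG.lower i" "y \<in> BG.F j" for x y
  proof (cases i)
    case 0
    then have "x = \<zero>\<^bsub>B\<^esub>" using that BG.lower_0 by simp
    then have "x \<otimes>\<^bsub>U\<^esub> y = \<zero>\<^bsub>B\<^esub>"
      using additive_maps_zero[OF B_group B_group module_homs_additive[OF bilinear_maps_left[OF mult_U_bilinear BG.F_closed[OF that(2)]]]] by simp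
    then show ?thesis using BG.F_zero BG.proj_zero by (simp add: BG.lower_def)
  next
    case (Suc k)
    then show ?thesis using that U_mult[of x k y j] by (simp add: BG.lower_Suc)
  qed
  have m_low': "x \<otimes>\<^bsub>U\<^esub> y \<in> BG.lower (i + j)" if "x \<in> BG.F i" "y \<in> BG.lower j" for x y
  proof (cases j)
    case 0
    then have "y = \<zero>\<^bsub>B\<^esub>" using that BG.lower_0 by simp
    then have "x \<otimes>\<^bsub>U\<^esub> y = \<zero>\<^bsub>B\<^esub>"
      using additive_maps_zero[OF B_group B_group module_homs_additive[OF bilinear_maps_right[OF mult_U_bilinear BG.F_closed[OF that(1)]]]] by simp
    then show ?thesis using BG.F_zero BG.proj_zero by (simp add: BG.lower_def)
  next
    case (Suc k)
    then show ?thesis using that U_mult[of x i y k] by (simp add: BG.lower_Suc)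
  qed
  define u' v' where "u' = u \<ominus>\<^bsub>B\<^esub> proj i u" and "v' = v \<ominus>\<^bsub>B\<^esub> proj j v"
  have l: "u' \<in> BG.lower i" "v' \<in> BG.lower j" unfolding u'_def v'_def using BG.minus_proj_lower u v by auto
  have c: "u' \<in> carrier B" "v' \<in> carrier B" "proj i u \<in> carrier B" "proj j v \<in> carrier B"
    using l BG.F_closed BG.proj_closed uc vc by (auto simp: BG.lower_def)
  have e: "u = u' \<oplus>\<^bsub>B\<^esub> proj i u" "v = v' \<oplus>\<^bsub>B\<^esub> proj j v"
    unfolding u'_def v'_def using uc vc BG.proj_closed by (simp_all add: a_minus_def M.a_assoc M.l_neg)
  have "u \<otimes>\<^bsub>U\<^esub> v = u' \<otimes>\<^bsub>U\<^esub> v \<oplus>\<^bsub>B\<^esub> proj i u \<otimes>\<^bsub>U\<^esub> v"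
    using module_homs_add[OF bilinear_maps_left[OF mult_U_bilinear vc] c(1,3)] e(1) by metis
  moreover have "proj i u \<otimes>\<^bsub>U\<^esub> v = proj i u \<otimes>\<^bsub>U\<^esub> v' \<oplus>\<^bsub>B\<^esub> proj i u \<otimes>\<^bsub>U\<^esub> proj j v"
    using module_homs_add[OF bilinear_maps_right[OF mult_U_bilinear c(3)] c(2,4)] e(2) by metis
  moreover have "proj (i + j) (u' \<otimes>\<^bsub>U\<^esub> v) = \<zero>\<^bsub>B\<^esub>" "proj (i + j) (proj i u \<otimes>\<^bsub>U\<^esub> v') = \<zero>\<^bsub>B\<^esub>"
    using m_low[OF l(1) v] m_low'[OF proj_F[OF uc] l(2)] by (auto simp: BG.lower_def)
  ultimately show ?thesis
    using c uc vc U_mult_closed BG.proj_closed by (simp add: module_homs_add[OF BG.proj_hom])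
qed

lemma gr_mult:
  assumes b: "b \<in> carrier B" and c: "c \<in> carrier B"
  shows "(iota b \<otimes>\<^bsub>gr\<^esub> iota c) n \<in> cls n ` BG.F n"
    and "proj n (rep ((iota b \<otimes>\<^bsub>gr\<^esub> iota c) n)) = (\<Oplus>\<^bsub>B\<^esub>i\<in>{..n}. proj n (proj i b \<otimes>\<^bsub>U\<^esub> proj (n - i) c))"
proof -
  let ?t = "\<lambda>i. rep (iota b i) \<otimes>\<^bsub>U\<^esub> rep (iota c (n - i))"
  have t: "?t i \<in> BG.F n" if "i \<in> {..n}" for i
    using U_mult[OF iota_rep(1)[OF b] iota_rep(1)[OF c], of i "n - i"] that by simp
  interpret Fn: submodule "BG.F n" K B by (rule BG.F_submodule)
  have sum: "(\<Oplus>\<^bsub>B\<^esub>i\<in>{..n}. ?t i) \<in> BG.F n"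
  proof -
    have "(\<Oplus>\<^bsub>B\<^esub>i\<in>A. ?t i) \<in> BG.F n" if "A \<subseteq> {..n}" for A
    proof -
      have "finite A" using that finite_subset by blast
      then show ?thesis using that
      proof (induction A rule: finite_induct)
        case empty
        show ?case by (simp add: BG.F_zero)
      next
        case (insert a A)
        have "?t \<in> A \<rightarrow> carrier B" "?t a \<in> carrier B" using insert(4) t BG.F_closed by auto
        then show ?case using insert t by (simp add: M.finsum_insert BG.F_add)
      qed
    qed
    then show ?thesis by blast
  qed
  have e: "(iota b \<otimes>\<^bsub>gr\<^esub> iota c) n = cls n (\<Oplus>\<^bsub>B\<^esub>i\<in>{..n}. ?t i)"
    by (simp add: gr_algebra_def finsum_U)
  show "(iota b \<otimes>\<^bsub>gr\<^esub> iota c) n \<in> cls n ` BG.F n" unfolding e by (rule cls_mem[OF sum])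
  have "proj n (\<Oplus>\<^bsub>B\<^esub>i\<in>{..n}. ?t i) = (\<Oplus>\<^bsub>B\<^esub>i\<in>{..n}. proj n (?t i))"
    by (rule additive_maps_finsum[OF B_group B_group BG.proj_additive]) (use t BG.F_closed in auto)
  also have "\<dots> = (\<Oplus>\<^bsub>B\<^esub>i\<in>{..n}. proj n (proj i b \<otimes>\<^bsub>U\<^esub> proj (n - i) c))"
  proof (rule M.finsum_cong')
    have "proj n (proj i b \<otimes>\<^bsub>U\<^esub> proj (n - i) c) \<in> carrier B" if "i \<in> {..n}" for i
      using b c BG.proj_closed U_mult_closed by simp
    then show "(\<lambda>i. proj n (proj i b \<otimes>\<^bsub>U\<^esub> proj (n - i) c)) \<in> {..n} \<rightarrow> carrier B" by auto
    fix i assume "i \<in> {..n}"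
    then show "proj n (?t i) = proj n (proj i b \<otimes>\<^bsub>U\<^esub> proj (n - i) c)"
      using leading_mult[OF iota_rep(1)[OF b] iota_rep(1)[OF c], of i "n - i"] iota_rep(2)[OF b] iota_rep(2)[OF c] by simp
  qed simp
  finally show "proj n (rep ((iota b \<otimes>\<^bsub>gr\<^esub> iota c) n)) = (\<Oplus>\<^bsub>B\<^esub>i\<in>{..n}. proj n (proj i b \<otimes>\<^bsub>U\<^esub> proj (n - i) c))"
    unfolding e rep_cls(2)[OF sum] .
qed

text \<open>
  A bilinear map whose leading terms on homogeneous elements are the products of \<open>B\<close> has these products
  as leading terms in general; both sides are biadditive.
\<close>

lemma graded_mult_sum:
  assumes b: "b \<in> carrier B" and c: "c \<in> carrier B"
    and bilin: "\<mu> \<in> bilinear_maps K B B B"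
    and deg: "\<And>i j x y. x \<in> G i \<Longrightarrow> y \<in> G j \<Longrightarrow> proj (i + j) (\<mu> x y) = x \<otimes>\<^bsub>B\<^esub> y"
  shows "(\<Oplus>\<^bsub>B\<^esub>i\<in>{..n}. proj n (\<mu> (proj i b) (proj (n - i) c))) = proj n (b \<otimes>\<^bsub>B\<^esub> c)"
proof -
  interpret PB: prebialgebra K B by (rule prebialgebra)
  note ml = module_homs_additive[OF bilinear_maps_left[OF PB.mult_bilinear]]
    and mr = module_homs_additive[OF bilinear_maps_right[OF PB.mult_bilinear]]
  note bl = module_homs_additive[OF bilinear_maps_left[OF bilin]]
    and br = module_homs_additive[OF bilinear_maps_right[OF bilin]]
  have mucl: "\<mu> x y \<in> carrier B" if "x \<in> carrier B" "y \<in> carrier B" for x y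
    using additive_maps_closed[OF br] that by simp
  have 0: "(\<Oplus>\<^bsub>B\<^esub>i\<in>{..n}. proj n (\<mu> (proj i x) (proj (n - i) y))) = proj n (x \<otimes>\<^bsub>B\<^esub> y)"
    if x: "x \<in> G d" and y: "y \<in> G e" for x y d e
  proof -
    note xc = G_closed[OF x] and yc = G_closed[OF y]
    have mz: "\<mu> \<zero>\<^bsub>B\<^esub> y = \<zero>\<^bsub>B\<^esub>" "\<mu> \<zero>\<^bsub>B\<^esub> \<zero>\<^bsub>B\<^esub> = \<zero>\<^bsub>B\<^esub>" "\<mu> x \<zero>\<^bsub>B\<^esub> = \<zero>\<^bsub>B\<^esub>"
      using additive_maps_zero[OF B_group B_group bl] additive_maps_zero[OF B_group B_group br] xc yc by auto
    have "(\<Oplus>\<^bsub>B\<^esub>i\<in>{..n}. proj n (\<mu> (proj i x) (proj (n - i) y))) =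
       (\<Oplus>\<^bsub>B\<^esub>i\<in>{..n}. if d = i then proj n (x \<otimes>\<^bsub>B\<^esub> y) else \<zero>\<^bsub>B\<^esub>)"
    proof (rule M.finsum_cong')
      fix i assume i: "i \<in> {..n}"
      have "proj n (\<mu> x (if n - d = e then y else \<zero>\<^bsub>B\<^esub>)) = proj n (x \<otimes>\<^bsub>B\<^esub> y)" if "d \<le> n"
        using deg[OF x y] proj_of_G[OF mult_degree[OF x y]] that by (auto simp: mz BG.proj_zero)
      then show "proj n (\<mu> (proj i x) (proj (n - i) y)) = (if d = i then proj n (x \<otimes>\<^bsub>B\<^esub> y) else \<zero>\<^bsub>B\<^esub>)"
        using i by (auto simp: proj_of_G[OF x] proj_of_G[OF y] mz BG.proj_zero)
    qed (use xc yc BG.proj_closed PB.mult_closed_A in auto)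
    also have "\<dots> = proj n (x \<otimes>\<^bsub>B\<^esub> y)"
    proof (cases "d \<le> n")
      case True
      then show ?thesis
        using M.finsum_singleton[of d "{..n}" "\<lambda>_. proj n (x \<otimes>\<^bsub>B\<^esub> y)"] BG.proj_closed PB.mult_closed_A xc yc by simp
    next
      case False
      have "(\<Oplus>\<^bsub>B\<^esub>i\<in>{..n}. if d = i then proj n (x \<otimes>\<^bsub>B\<^esub> y) else \<zero>\<^bsub>B\<^esub>) = (\<Oplus>\<^bsub>B\<^esub>i\<in>{..n}. \<zero>\<^bsub>B\<^esub>)"
        by (rule M.finsum_cong') (use False in auto)
      then show ?thesis using False proj_of_G[OF mult_degree[OF x y], of n] by simp
    qed
    finally show ?thesis .
  qed
  have 1: "(\<Oplus>\<^bsub>B\<^esub>i\<in>{..n}. proj n (\<mu> (proj i x) (proj (n - i) c))) = proj n (x \<otimes>\<^bsub>B\<^esub> c)"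
    if x: "x \<in> G d" for x d
    by (rule BG.graded_maps_eqI[OF B_group additive_maps_sum[OF B_group] additive_maps_comp[OF mr BG.proj_additive] c])
       (use G_closed[OF x] 0[OF x] in \<open>auto intro!: additive_maps_comp[OF BG.proj_additive] additive_maps_comp[OF br BG.proj_additive]
          simp: BG.proj_closed homogeneous_eq_G\<close>)
  show ?thesis
    by (rule BG.graded_maps_eqI[OF B_group additive_maps_sum[OF B_group] additive_maps_comp[OF ml BG.proj_additive] b])
       (use c 1 in \<open>auto intro!: additive_maps_comp[OF BG.proj_additive] additive_maps_comp[OF bl BG.proj_additive]
          simp: BG.proj_closed homogeneous_eq_G\<close>)
qed

lemma iota_mult_iff:
  "(\<forall>b\<in>carrier B. \<forall>c\<in>carrier B. iota (b \<otimes>\<^bsub>B\<^esub> c) = iota b \<otimes>\<^bsub>gr\<^esub> iota c)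
    \<longleftrightarrow> (\<forall>i j. \<forall>x\<in>G i. \<forall>y\<in>G j. proj (i + j) (x \<otimes>\<^bsub>U\<^esub> y) = x \<otimes>\<^bsub>B\<^esub> y)"
proof
  assume h: "\<forall>b\<in>carrier B. \<forall>c\<in>carrier B. iota (b \<otimes>\<^bsub>B\<^esub> c) = iota b \<otimes>\<^bsub>gr\<^esub> iota c"
  show "\<forall>i j. \<forall>x\<in>G i. \<forall>y\<in>G j. proj (i + j) (x \<otimes>\<^bsub>U\<^esub> y) = x \<otimes>\<^bsub>B\<^esub> y"
  proof (intro allI ballI)
    fix i j x y assume x: "x \<in> G i" and y: "y \<in> G j"
    note xc = G_closed[OF x] and yc = G_closed[OF y]
    have xy: "x \<otimes>\<^bsub>B\<^esub> y \<in> G (i + j)" by (rule mult_degree[OF x y])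
    have "x \<otimes>\<^bsub>B\<^esub> y = proj (i + j) (x \<otimes>\<^bsub>B\<^esub> y)" using proj_of_G[OF xy] by simp
    also have "\<dots> = proj (i + j) (rep (iota (x \<otimes>\<^bsub>B\<^esub> y) (i + j)))" using iota_rep(2)[OF G_closed[OF xy]] by simp
    also have "\<dots> = (\<Oplus>\<^bsub>B\<^esub>k\<in>{..i + j}. proj (i + j) (proj k x \<otimes>\<^bsub>U\<^esub> proj (i + j - k) y))"
      using h xc yc gr_mult(2)[OF xc yc] by simp
    also have "\<dots> = (\<Oplus>\<^bsub>B\<^esub>k\<in>{..i + j}. if i = k then proj (i + j) (x \<otimes>\<^bsub>U\<^esub> y) else \<zero>\<^bsub>B\<^esub>)"
      by (rule M.finsum_cong')
         (use xc yc U_mult_closed BG.proj_closed additive_maps_zero[OF B_group B_group module_homs_additive[OF bilinear_maps_left[OF mult_U_bilinear]]]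
          in \<open>auto simp: proj_of_G[OF x] proj_of_G[OF y] BG.proj_zero\<close>)
    also have "\<dots> = proj (i + j) (x \<otimes>\<^bsub>U\<^esub> y)"
      using M.finsum_singleton[of i "{..i + j}" "\<lambda>_. proj (i + j) (x \<otimes>\<^bsub>U\<^esub> y)"] BG.proj_closed U_mult_closed xc yc by simp
    finally show "proj (i + j) (x \<otimes>\<^bsub>U\<^esub> y) = x \<otimes>\<^bsub>B\<^esub> y" by (rule sym)
  qed
next
  assume h: "\<forall>i j. \<forall>x\<in>G i. \<forall>y\<in>G j. proj (i + j) (x \<otimes>\<^bsub>U\<^esub> y) = x \<otimes>\<^bsub>B\<^esub> y"
  interpret PB: prebialgebra K B by (rule prebialgebra)
  show "\<forall>b\<in>carrier B. \<forall>c\<in>carrier B. iota (b \<otimes>\<^bsub>B\<^esub> c) = iota b \<otimes>\<^bsub>gr\<^esub> iota c"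
  proof (intro ballI)
    fix b c assume b: "b \<in> carrier B" and c: "c \<in> carrier B"
    show "iota (b \<otimes>\<^bsub>B\<^esub> c) = iota b \<otimes>\<^bsub>gr\<^esub> iota c"
      by (rule iota_eqI[symmetric])
         (use h b c in \<open>auto simp: PB.mult_closed_A gr_mult graded_mult_sum[OF b c mult_U_bilinear]\<close>)
  qed
qed

end

context graded_bialgebra
begin

text \<open>
  Every summand of the projection other than the one with index \<open>i\<close> contains a component of \<open>x\<close>
  beyond degree \<open>i\<close> or one of \<open>y\<close> beyond degree \<open>j\<close>.
\<close>

lemma projT_tens_F:
  assumes x: "x \<in> BG.F i" and y: "y \<in> BG.F j"
  shows "projT (i + j) (tens K B B x y) = tens K B B (proj i x) (proj j y)"
proof -
  note xc = BG.F_closed[OF x] and yc = BG.F_closed[OF y]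
  have "projT (i + j) (tens K B B x y) = (\<Oplus>\<^bsub>TB\<^esub>k\<in>{..i + j}. if i = k then tens K B B (proj i x) (proj j y) else \<zero>\<^bsub>TB\<^esub>)"
    unfolding tensor_proj_def
  proof (rule SQ.GT.PTP.TP.T.M.finsum_cong')
    fix k assume k: "k \<in> {..i + j}"
    have "proj k x = \<zero>\<^bsub>B\<^esub>" if "i < k" using x that by (simp add: filtered_part_def)
    moreover have "proj (i + j - k) y = \<zero>\<^bsub>B\<^esub>" if "k < i" using y that by (simp add: filtered_part_def)
    ultimately show "tensor_map K B B (proj k) (proj (i + j - k)) (tens K B B x y) =
       (if i = k then tens K B B (proj i x) (proj j y) else \<zero>\<^bsub>TB\<^esub>)"
      using xc yc BG.proj_closed
      by (cases i k rule: linorder_cases)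
         (auto simp: SQ.GT.PTP.TP.tensor_map_tens[OF B_module B_module BG.proj_hom BG.proj_hom]
           SQ.GT.PTP.TP.tens_zero SQ.GT.PTP.TP.zero_tens)
  qed (use xc yc BG.proj_closed in auto)
  also have "\<dots> = tens K B B (proj i x) (proj j y)"
    using SQ.GT.PTP.TP.T.M.finsum_singleton[of i "{..i + j}" "\<lambda>_. tens K B B (proj i x) (proj j y)"] xc yc BG.proj_closed by simp
  finally show ?thesis .
qed

end

context filtered_lift
begin

subsection \<open>The comultiplication of the associated graded bialgebra\<close>

sublocale TGR: tensor_product K gr gr using gr_module gr_module by (rule tensor_product.intro)

abbreviation "iota2 \<equiv> tensor_map K gr gr iota iota"

lemmas iota2_hom = SQ.GT.PTP.TP.tensor_map_hom[OF gr_module gr_module iota_hom iota_hom]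
lemmas iota2_tens = SQ.GT.PTP.TP.tensor_map_tens[OF gr_module gr_module iota_hom iota_hom]

lemma TGR_group: "abelian_group TGR.T" by (rule TGR.T.M.abelian_group_axioms)

text \<open>
  \<open>iota\<close> has a linear inverse, and the tensor square of the inverse is an inverse of the tensor square.
\<close>

lemma iota2_inj: "inj_on iota2 (carrier TB)"
proof (rule inj_on_inverseI)
  let ?k = "inv_into (carrier B) iota"
  have k: "?k (iota b) = b" if "b \<in> carrier B" for b using iota_inj that by simp
  have kh: "?k \<in> module_homs K gr B"
  proof (intro module_homsI additive_mapsI)
    fix X assume X: "X \<in> carrier gr"
    then obtain b where b: "b \<in> carrier B" "X = iota b" using iota_surj by blast
    then show "?k X \<in> carrier B" using k by simp
    fix r assume "r \<in> carrier K"
    then show "?k (r \<odot>\<^bsub>gr\<^esub> X) = r \<odot>\<^bsub>B\<^esub> ?k X" using b by (simp add: k iota_smult[symmetric])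
  next
    fix X Y assume X: "X \<in> carrier gr" "Y \<in> carrier gr"
    then obtain b c where b: "b \<in> carrier B" "X = iota b" "c \<in> carrier B" "Y = iota c" using iota_surj by blast
    then show "?k (X \<oplus>\<^bsub>gr\<^esub> Y) = ?k X \<oplus>\<^bsub>B\<^esub> ?k Y" by (simp add: k iota_add[symmetric])
  qed
  fix w assume w: "w \<in> carrier TB"
  have "tensor_map K B B ?k ?k (iota2 w) = tensor_map K B B (\<lambda>x. ?k (iota x)) (\<lambda>x. ?k (iota x)) w"
    by (rule SQ.GT.PTP.TP.tensor_map_comp[OF gr_module gr_module iota_hom iota_hom B_module B_module kh kh w])
  also have "\<dots> = w"
    by (rule SQ.GT.PTP.TP.tensor_map_ident[OF module_homs_comp[OF iota_hom kh] module_homs_comp[OF iota_hom kh] k k w])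
  finally show "tensor_map K B B ?k ?k (iota2 w) = w" .
qed

lemma sub_module: "module K (U\<lparr>carrier := FB i\<rparr>)"
proof -
  have "submodule (FB i) K U" using BG.F_submodule by (simp add: FB_eq submodule_U)
  from submodule.submodule_is_module[OF this module_U] show ?thesis .
qed

abbreviation "incl \<equiv> tensor_map K U U (\<lambda>x. x) (\<lambda>y. y)"

lemma incl_hom: "(\<lambda>x. x) \<in> module_homs K (U\<lparr>carrier := FB i\<rparr>) U"
  using BG.F_closed by (intro module_homsI additive_mapsI) (auto simp: FB_eq carrier_U)

lemma gr_in_hom: "gr_in U FB i \<in> module_homs K (U\<lparr>carrier := FB i\<rparr>) gr"
proof (intro module_homsI additive_mapsI)
  fix x assume x: "x \<in> carrier (U\<lparr>carrier := FB i\<rparr>)"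
  then have xF: "x \<in> BG.F i" by (simp add: FB_eq)
  show "gr_in U FB i x \<in> carrier gr"
    using iota_closed BG.proj_closed BG.F_closed[OF xF] by (simp add: gr_in_eq[OF xF])
  fix r assume r: "r \<in> carrier K"
  show "gr_in U FB i (r \<odot>\<^bsub>U\<lparr>carrier := FB i\<rparr>\<^esub> x) = r \<odot>\<^bsub>gr\<^esub> gr_in U FB i x"
    using xF r BG.F_closed[OF xF] BG.proj_closed
    by (simp add: smult_U gr_in_eq BG.F_smult module_homs_smult[OF BG.proj_hom] iota_smult)
next
  fix x y assume "x \<in> carrier (U\<lparr>carrier := FB i\<rparr>)" "y \<in> carrier (U\<lparr>carrier := FB i\<rparr>)"
  then have xF: "x \<in> BG.F i" "y \<in> BG.F i" by (simp_all add: FB_eq)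
  then show "gr_in U FB i (x \<oplus>\<^bsub>U\<lparr>carrier := FB i\<rparr>\<^esub> y) = gr_in U FB i x \<oplus>\<^bsub>gr\<^esub> gr_in U FB i y"
    using BG.F_closed BG.proj_closed
    by (simp add: add_U gr_in_eq BG.F_add module_homs_add[OF BG.proj_hom] iota_add)
qed

text \<open>
  On \<open>F i \<otimes> F (n - i)\<close> the projection of degree \<open>n\<close> only sees the product of the leading terms.
  This expresses the image in \<open>gr U \<otimes> gr U\<close> through the image in \<open>U \<otimes> U\<close>.
\<close>

lemma gr_piece:
  assumes i: "i \<le> n" and a: "a \<in> carrier (tensor K (U\<lparr>carrier := FB i\<rparr>) (U\<lparr>carrier := FB (n - i)\<rparr>))"
  shows "tensor_map K gr gr (gr_in U FB i) (gr_in U FB (n - i)) a = iota2 (projT n (incl a))" "incl a \<in> carrier TB"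
proof -
  interpret S: tensor_product K "U\<lparr>carrier := FB i\<rparr>" "U\<lparr>carrier := FB (n - i)\<rparr>"
    using sub_module sub_module by (rule tensor_product.intro)
  note ih = S.tensor_map_hom[OF module_U module_U incl_hom incl_hom]
  note it = S.tensor_map_tens[OF module_U module_U incl_hom incl_hom]
  note gh = S.tensor_map_hom[OF gr_module gr_module gr_in_hom gr_in_hom]
  note gt = S.tensor_map_tens[OF gr_module gr_module gr_in_hom gr_in_hom]
  have ih': "incl \<in> module_homs K S.T TB" using ih by (simp add: tensor_U)
  show "incl a \<in> carrier TB" by (rule module_homs_closed[OF ih' a])
  show "tensor_map K gr gr (gr_in U FB i) (gr_in U FB (n - i)) a = iota2 (projT n (incl a))"
  proof (rule S.tensor_maps_eqI[OF TGR_group module_homs_additive[OF gh]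
        module_homs_additive[OF module_homs_comp[OF module_homs_comp[OF ih' SQ.GT.tensor_proj_hom] iota2_hom]] a])
    fix x y assume x: "x \<in> carrier (U\<lparr>carrier := FB i\<rparr>)" and y: "y \<in> carrier (U\<lparr>carrier := FB (n - i)\<rparr>)"
    then have F: "x \<in> BG.F i" "y \<in> BG.F (n - i)" by (simp_all add: FB_eq)
    show "tensor_map K gr gr (gr_in U FB i) (gr_in U FB (n - i)) (tens K (U\<lparr>carrier := FB i\<rparr>) (U\<lparr>carrier := FB (n - i)\<rparr>) x y) =
      iota2 (projT n (incl (tens K (U\<lparr>carrier := FB i\<rparr>) (U\<lparr>carrier := FB (n - i)\<rparr>) x y)))"
      using BG.F_closed[OF F(1)] BG.F_closed[OF F(2)] BG.proj_closed
      by (simp add: gt[OF x y] it[OF x y] tens_U projT_tens_F[OF F, unfolded le_add_diff_inverse[OF i]] iota2_tens gr_in_eq F)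
  qed
qed

text \<open>
  A pure tensor in \<open>F i \<otimes> F j\<close> is represented by the family concentrated at the index \<open>i\<close>.
\<close>

lemma comult_pieces_exist:
  assumes "v \<in> tensor_degree K B FB n"
  shows "\<exists>w. (\<forall>i\<le>n. w i \<in> carrier (tensor K (U\<lparr>carrier := FB i\<rparr>) (U\<lparr>carrier := FB (n - i)\<rparr>))) \<and>
    v = (\<Oplus>\<^bsub>TB\<^esub>i\<in>{..n}. incl (w i))"
proof -
  have sub: "submodule (FB i) K B" for i using BG.F_submodule by (simp add: FB_eq)
  let ?S = "\<lambda>i. tensor K (U\<lparr>carrier := FB i\<rparr>) (U\<lparr>carrier := FB (n - i)\<rparr>)"
  have tp: "tensor_product K (U\<lparr>carrier := FB i\<rparr>) (U\<lparr>carrier := FB (n - i)\<rparr>)" for i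
    using sub_module sub_module by (rule tensor_product.intro)
  have Sm: "module K (?S i)" for i by (rule tensor_product.module_T[OF tp])
  have Sg: "abelian_group (?S i)" for i using Sm by (simp add: module_def)
  have ih: "incl \<in> module_homs K (?S i) TB" for i
    using tensor_product.tensor_map_hom[OF tp module_U module_U incl_hom incl_hom] by (simp add: tensor_U)
  note ia = module_homs_additive[OF ih]
  have i0: "incl \<zero>\<^bsub>?S i\<^esub> = \<zero>\<^bsub>TB\<^esub>" for i by (rule additive_maps_zero[OF Sg TB_group ia])
  have z: "\<zero>\<^bsub>?S i\<^esub> \<in> carrier (?S i)" for i using Sg[of i] by (simp add: abelian_group_def abelian_monoid.zero_closed)
  have "v \<in> additive_span TB {tens K B B x y | x y i j. i + j = n \<and> x \<in> FB i \<and> y \<in> FB j}"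
    using assms SQ.tensor_degree_span[OF sub] by simp
  then show ?thesis
  proof induction
    case zero
    show ?case by (rule exI[of _ "\<lambda>i. \<zero>\<^bsub>?S i\<^esub>"]) (simp add: i0 z)
  next
    case (base v)
    then obtain x y i j where v: "v = tens K B B x y" "i + j = n" "x \<in> FB i" "y \<in> FB j" by blast
    have xy: "x \<in> carrier (U\<lparr>carrier := FB i\<rparr>)" "y \<in> carrier (U\<lparr>carrier := FB (n - i)\<rparr>)" using v by auto
    let ?t = "tens K (U\<lparr>carrier := FB i\<rparr>) (U\<lparr>carrier := FB (n - i)\<rparr>) x y"
    have tc: "?t \<in> carrier (?S i)" by (rule tensor_product.tens_closed[OF tp xy])
    have it: "incl ?t = v"
      using tensor_product.tensor_map_tens[OF tp module_U module_U incl_hom incl_hom xy] by (simp add: tens_U v(1))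
    have vc: "v \<in> carrier TB" using module_homs_closed[OF ih tc] it by simp
    let ?w = "\<lambda>k. if i = k then ?t else \<zero>\<^bsub>?S k\<^esub>"
    have "(\<Oplus>\<^bsub>TB\<^esub>k\<in>{..n}. incl (?w k)) = (\<Oplus>\<^bsub>TB\<^esub>k\<in>{..n}. if i = k then v else \<zero>\<^bsub>TB\<^esub>)"
      by (rule SQ.GT.PTP.TP.T.M.finsum_cong') (auto simp: it i0 vc)
    also have "\<dots> = v" using SQ.GT.PTP.TP.T.M.finsum_singleton[of i "{..n}" "\<lambda>_. v"] v(2) vc by simp
    finally show ?case by (intro exI[of _ ?w]) (auto simp: tc z)
  next
    case (add u v)
    then obtain w w' where w: "\<forall>i\<le>n. w i \<in> carrier (?S i)" "u = (\<Oplus>\<^bsub>TB\<^esub>i\<in>{..n}. incl (w i))"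
      "\<forall>i\<le>n. w' i \<in> carrier (?S i)" "v = (\<Oplus>\<^bsub>TB\<^esub>i\<in>{..n}. incl (w' i))" by blast
    have c: "incl (w i) \<in> carrier TB" "incl (w' i) \<in> carrier TB" if "i \<le> n" for i
      using w(1,3) that module_homs_closed[OF ih] by auto
    have ad: "w i \<oplus>\<^bsub>?S i\<^esub> w' i \<in> carrier (?S i)" if "i \<le> n" for i
      using w(1,3) that Sg[of i] by (simp add: abelian_group_def abelian_monoid.a_closed)
    have "(\<Oplus>\<^bsub>TB\<^esub>i\<in>{..n}. incl (w i \<oplus>\<^bsub>?S i\<^esub> w' i)) = (\<Oplus>\<^bsub>TB\<^esub>i\<in>{..n}. incl (w i) \<oplus>\<^bsub>TB\<^esub> incl (w' i))"
      by (rule SQ.GT.PTP.TP.T.M.finsum_cong') (use c w(1,3) additive_maps_add[OF ia] in auto)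
    also have "\<dots> = u \<oplus>\<^bsub>TB\<^esub> v"
      unfolding w(2,4) by (rule SQ.GT.PTP.TP.T.M.finsum_addf) (use c in auto)
    finally show ?case using ad by (intro exI[of _ "\<lambda>i. w i \<oplus>\<^bsub>?S i\<^esub> w' i"]) auto
  qed
qed

lemma comult_U_closed: "u \<in> carrier B \<Longrightarrow> comult U u \<in> carrier TB"
  by (rule module_homs_closed[OF comult_U_hom])

lemma projT_closed: "w \<in> carrier TB \<Longrightarrow> projT n w \<in> carrier TB"
  by (rule module_homs_closed[OF SQ.GT.tensor_proj_hom])

text \<open>
  By \<open>gr_piece\<close>, every admissible family gives the same value, which justifies the definite
  description.
\<close>

lemma gr_comult_class_eq:
  assumes u: "u \<in> BG.F n"
  shows "gr_comult_class K U FB n u = iota2 (projT n (comult U u))"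
proof -
  let ?P = "\<lambda>w. (\<forall>i\<le>n. w i \<in> carrier (tensor K (U\<lparr>carrier := FB i\<rparr>) (U\<lparr>carrier := FB (n - i)\<rparr>))) \<and>
      comult U u = (\<Oplus>\<^bsub>TB\<^esub>i\<in>{..n}. incl (w i))"
  let ?z = "\<lambda>w. \<Oplus>\<^bsub>TGR.T\<^esub>i\<in>{..n}. tensor_map K gr gr (gr_in U FB i) (gr_in U FB (n - i)) (w i)"
  have val: "?z w = iota2 (projT n (comult U u))" if w: "?P w" for w
  proof -
    note h = module_homs_additive[OF module_homs_comp[OF SQ.GT.tensor_proj_hom iota2_hom]]
    have "?z w = (\<Oplus>\<^bsub>TGR.T\<^esub>i\<in>{..n}. iota2 (projT n (incl (w i))))"
      by (rule TGR.T.M.finsum_cong')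
         (use w gr_piece in \<open>auto intro!: module_homs_closed[OF iota2_hom] projT_closed\<close>)
    also have "\<dots> = iota2 (projT n (\<Oplus>\<^bsub>TB\<^esub>i\<in>{..n}. incl (w i)))"
      by (rule additive_maps_finsum[OF TB_group TGR_group h, symmetric]) (use w gr_piece(2) in auto)
    finally show ?thesis using w by simp
  qed
  have "comult U u \<in> tensor_degree K B FB n" using U_comult[OF u] by (simp add: tensor_degree_FB)
  then obtain w where "?P w" using comult_pieces_exist by blast
  then show ?thesis
    unfolding gr_comult_class_def tensor_U
    by (intro the_equality) (use val in auto)
qed

abbreviation "grb \<equiv> gr_bialgebra K U FB"

lemma grb_simps: "carrier grb = carrier gr" "add grb = add gr" "zero grb = zero gr" "smult grb = smult gr" "mult grb = mult gr"
  by (simp_all add: gr_bialgebra_def)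

lemma tensor_map_grb: "tensor_map K grb grb f g = tensor_map K gr gr f g"
  by (rule tensor_map_module_cong) (simp_all add: grb_simps)

lemma gr_comult:
  assumes b: "b \<in> carrier B"
  shows "comult grb (iota b) = iota2 (\<Oplus>\<^bsub>TB\<^esub>n\<in>{n. proj n b \<noteq> \<zero>\<^bsub>B\<^esub>}. projT n (comult U (proj n b)))"
proof -
  have pc: "projT n (comult U (proj n b)) \<in> carrier TB" for n
    by (intro projT_closed comult_U_closed BG.proj_closed b)
  have "comult grb (iota b) = (\<Oplus>\<^bsub>TGR.T\<^esub>n\<in>{n. proj n b \<noteq> \<zero>\<^bsub>B\<^esub>}. gr_comult_class K U FB n (rep (iota b n)))"
    by (simp add: gr_bialgebra_def pred_eq iota_support[OF b])
  also have "\<dots> = (\<Oplus>\<^bsub>TGR.T\<^esub>n\<in>{n. proj n b \<noteq> \<zero>\<^bsub>B\<^esub>}. iota2 (projT n (comult U (proj n b))))"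
  proof (rule TGR.T.M.finsum_cong')
    fix n
    have "projT n (comult U (rep (iota b n))) = projT n (comult U (proj n (rep (iota b n))))"
      by (rule DB.filtered_leading[OF module_homs_additive[OF comult_U_hom] U_comult iota_rep(1)[OF b]])
    then show "gr_comult_class K U FB n (rep (iota b n)) = iota2 (projT n (comult U (proj n b)))"
      using gr_comult_class_eq[OF iota_rep(1)[OF b]] iota_rep(2)[OF b] by simp
  qed (use module_homs_closed[OF iota2_hom] pc in auto)
  also have "\<dots> = iota2 (\<Oplus>\<^bsub>TB\<^esub>n\<in>{n. proj n b \<noteq> \<zero>\<^bsub>B\<^esub>}. projT n (comult U (proj n b)))"
    by (rule additive_maps_finsum[OF TB_group TGR_group module_homs_additive[OF iota2_hom], symmetric]) (use pc in auto)
  finally show ?thesis .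
qed

lemma comult_B_closed: "b \<in> carrier B \<Longrightarrow> comult B b \<in> carrier TB"
  by (rule module_homs_closed[OF comult_module_hom])

lemma iota_comult_iff:
  "(\<forall>b\<in>carrier B. comult grb (iota b) = tensor_map K grb grb iota iota (comult B b))
    \<longleftrightarrow> (\<forall>n. \<forall>x\<in>G n. projT n (comult U x) = comult B x)"
proof
  assume h: "\<forall>b\<in>carrier B. comult grb (iota b) = tensor_map K grb grb iota iota (comult B b)"
  show "\<forall>n. \<forall>x\<in>G n. projT n (comult U x) = comult B x"
  proof (intro allI ballI)
    fix n x assume x: "x \<in> G n"
    note xc = G_closed[OF x]
    have pc: "projT n (comult U x) \<in> carrier TB" by (intro projT_closed comult_U_closed xc)
    have z: "projT n (comult U \<zero>\<^bsub>B\<^esub>) = \<zero>\<^bsub>TB\<^esub>"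
      by (rule additive_maps_zero[OF B_group TB_group module_homs_additive[OF module_homs_comp[OF comult_U_hom SQ.GT.tensor_proj_hom]]])
    have "(\<Oplus>\<^bsub>TB\<^esub>k\<in>{k. proj k x \<noteq> \<zero>\<^bsub>B\<^esub>}. projT k (comult U (proj k x))) = projT n (comult U x)"
    proof (cases "x = \<zero>\<^bsub>B\<^esub>")
      case True
      then show ?thesis using z by (simp add: BG.proj_zero)
    next
      case False
      then have "{k. proj k x \<noteq> \<zero>\<^bsub>B\<^esub>} = {n}" using proj_of_G[OF x] by auto
      then show ?thesis using pc proj_of_G[OF x, of n] by simp
    qed
    then have "iota2 (projT n (comult U x)) = iota2 (comult B x)"
      using h xc gr_comult[OF xc] by (simp add: tensor_map_grb)
    then show "projT n (comult U x) = comult B x" using inj_onD[OF iota2_inj] pc comult_B_closed[OF xc] by simp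
  qed
next
  assume h: "\<forall>n. \<forall>x\<in>G n. projT n (comult U x) = comult B x"
  show "\<forall>b\<in>carrier B. comult grb (iota b) = tensor_map K grb grb iota iota (comult B b)"
  proof
    fix b assume b: "b \<in> carrier B"
    let ?A = "{n. proj n b \<noteq> \<zero>\<^bsub>B\<^esub>}"
    have "(\<Oplus>\<^bsub>TB\<^esub>n\<in>?A. projT n (comult U (proj n b))) = (\<Oplus>\<^bsub>TB\<^esub>n\<in>?A. comult B (proj n b))"
      using h proj_G[OF b] by simp
    also have "\<dots> = comult B (\<Oplus>\<^bsub>B\<^esub>n\<in>?A. proj n b)"
      by (rule additive_maps_finsum[OF B_group TB_group module_homs_additive[OF comult_module_hom], symmetric])
         (use b BG.proj_closed in auto)
    also have "\<dots> = comult B b" using BG.decomposition[OF b BG.finite_proj[OF b] order_refl] by simp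
    finally show "comult grb (iota b) = tensor_map K grb grb iota iota (comult B b)"
      using gr_comult[OF b] by (simp add: tensor_map_grb)
  qed
qed

lemma iota_counit_iff:
  "(\<forall>b\<in>carrier B. counit grb (iota b) = counit B b) \<longleftrightarrow> (\<forall>x\<in>G 0. counit U x = counit B x)"
proof -
  interpret PB: prebialgebra K B by (rule prebialgebra)
  have F0: "proj 0 x = x" if "x \<in> BG.F 0" for x
    using BG.F_decomposition[OF that] BG.proj_closed[OF BG.F_closed[OF that]] by simp
  have l: "counit grb (iota b) = counit U (proj 0 b)" if b: "b \<in> carrier B" for b
    using F0[OF iota_rep(1)[OF b]] iota_rep(2)[OF b, of 0] by (simp add: gr_bialgebra_def)
  have r: "counit B b = counit B (proj 0 b)" if b: "b \<in> carrier B" for b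
  proof (rule BG.graded_maps_eqI[OF R.abelian_group_axioms PB.counit_additive additive_maps_comp[OF BG.proj_additive PB.counit_additive] b])
    fix d x assume "x \<in> BG.H d"
    then have x: "x \<in> G d" by (simp add: homogeneous_eq_G)
    show "counit B x = counit B (proj 0 x)"
      using counit_degree[OF _ x] additive_maps_zero[OF B_group R.abelian_group_axioms PB.counit_additive]
      by (cases "d = 0") (simp_all add: proj_of_G[OF x])
  qed
  show ?thesis
  proof
    assume h: "\<forall>b\<in>carrier B. counit grb (iota b) = counit B b"
    show "\<forall>x\<in>G 0. counit U x = counit B x"
      using h l G_closed proj_of_G[of _ 0 0] by force
  next
    assume h: "\<forall>x\<in>G 0. counit U x = counit B x"
    show "\<forall>b\<in>carrier B. counit grb (iota b) = counit B b"
      using h l r proj_G by simp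
  qed
qed

lemma iota_degree: "iota ` G n = gr_degree U FB n"
proof -
  have "gr_in U FB n ` BG.F n = (\<lambda>u. iota (proj n u)) ` BG.F n"
    by (rule image_cong[OF refl]) (rule gr_in_eq)
  then have "gr_degree U FB n = (\<lambda>u. iota (proj n u)) ` BG.F n"
    by (simp only: gr_degree_def FB_eq[of n])
  moreover have "proj n ` BG.F n = G n"
  proof
    show "proj n ` BG.F n \<subseteq> G n" using proj_G BG.F_closed by auto
    show "G n \<subseteq> proj n ` BG.F n"
    proof
      fix x assume x: "x \<in> G n"
      then have "x \<in> BG.F n" using BG.H_subset_F[of n n] by (auto simp: homogeneous_eq_G)
      then show "x \<in> proj n ` BG.F n" using proj_of_G[OF x, of n] by force
    qed
  qed
  ultimately show ?thesis by (metis image_image)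
qed

text \<open>
  The condition \<open>gr U = B\<close>, spelled out: the structure maps of \<open>U\<close> have those of \<open>B\<close> as symbols.
\<close>

lemma gr_ident_iso_iff:
  "iota \<in> graded_bialg_iso K B G grb (gr_degree U FB) \<longleftrightarrow>
    \<one>\<^bsub>U\<^esub> = \<one>\<^bsub>B\<^esub> \<and> (\<forall>x\<in>G 0. counit U x = counit B x)
    \<and> (\<forall>i j. \<forall>x\<in>G i. \<forall>y\<in>G j. proj (i + j) (x \<otimes>\<^bsub>U\<^esub> y) = x \<otimes>\<^bsub>B\<^esub> y)
    \<and> (\<forall>n. \<forall>x\<in>G n. projT n (comult U x) = comult B x)"
proof -
  have mh: "iota \<in> module_homs K B grb" using iota_hom by (simp add: module_homs_def grb_simps)
  have bij: "bij_betw iota (carrier B) (carrier grb)"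
    using iota_inj iota_surj by (simp add: bij_betw_def grb_simps)
  have ring: "iota \<in> ring_hom B grb \<longleftrightarrow>
      (\<forall>b\<in>carrier B. \<forall>c\<in>carrier B. iota (b \<otimes>\<^bsub>B\<^esub> c) = iota b \<otimes>\<^bsub>gr\<^esub> iota c) \<and> iota \<one>\<^bsub>B\<^esub> = one grb"
    by (auto simp: ring_hom_def grb_simps iota_closed iota_add)
  show ?thesis
    unfolding graded_bialg_iso_def bialg_iso_def ring_iso_def
    using mh bij by (simp add: ring iota_degree iota_mult_iff iota_one_iff iota_comult_iff iota_counit_iff) blast
qed

lemma gr_map_iff:
  assumes \<theta>: "\<theta> \<in> module_homs K B B" and filt: "\<And>n x. x \<in> BG.F n \<Longrightarrow> \<theta> x \<in> BG.F n"
  shows "(\<forall>b\<in>carrier B. gr_map U FB \<theta> (iota b) = iota b) \<longleftrightarrow> (\<forall>n. \<forall>x\<in>G n. proj n (\<theta> x) = x)"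
proof -
  have eq: "gr_map U FB \<theta> (iota b) i = iota b i \<longleftrightarrow> proj i (\<theta> (proj i b)) = proj i b" if b: "b \<in> carrier B" for b i
  proof -
    have "proj i (\<theta> (rep (iota b i))) = proj i (\<theta> (proj i (rep (iota b i))))"
      by (rule SQ.GT.filtered_leading[OF module_homs_additive[OF \<theta>] filt iota_rep(1)[OF b]])
    then show ?thesis
      using cls_eq_iff[OF filt[OF iota_rep(1)[OF b]] proj_F[OF b], of i] iota_rep(2)[OF b] b
      by (simp add: gr_map_def iota_eq proj_idem)
  qed
  show ?thesis
  proof
    assume h: "\<forall>b\<in>carrier B. gr_map U FB \<theta> (iota b) = iota b"
    show "\<forall>n. \<forall>x\<in>G n. proj n (\<theta> x) = x"
    proof (intro allI ballI)
      fix n x assume x: "x \<in> G n"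
      then have "gr_map U FB \<theta> (iota x) n = iota x n" using h G_closed by simp
      then show "proj n (\<theta> x) = x" using eq[OF G_closed[OF x]] proj_of_G[OF x] by simp
    qed
  next
    assume h: "\<forall>n. \<forall>x\<in>G n. proj n (\<theta> x) = x"
    show "\<forall>b\<in>carrier B. gr_map U FB \<theta> (iota b) = iota b"
      using h eq proj_G by (auto simp: fun_eq_iff)
  qed
qed

end

subsection \<open>A description of liftings without the associated graded bialgebra\<close>

text \<open>
  From here on this description replaces the associated graded bialgebra.
\<close>

locale lifting = filtered_lift +
  assumes one_eq: "\<one>\<^bsub>U\<^esub> = \<one>\<^bsub>B\<^esub>"
    and counit_G0: "x \<in> G 0 \<Longrightarrow> counit U x = counit B x"
    and mult_leading: "x \<in> G i \<Longrightarrow> y \<in> G j \<Longrightarrow> proj (i + j) (x \<otimes>\<^bsub>U\<^esub> y) = x \<otimes>\<^bsub>B\<^esub> y"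
    and comult_leading: "x \<in> G n \<Longrightarrow> projT n (comult U x) = comult B x"

context graded_bialgebra
begin

lemma liftings_iff: "U \<in> liftings K B G \<longleftrightarrow> lifting K B G U"
proof
  assume U: "U \<in> liftings K B G"
  then interpret S: same_module K B G U
    by unfold_locales (auto simp: liftings_def)
  interpret FU: filtered_bialgebra K U FB using U by (simp add: liftings_def)
  interpret L: filtered_lift K B G U
    by unfold_locales
       (use FU.one_filtration FU.mult_filtration FU.comult_filtration in
         \<open>auto simp: FB_eq FU.bialgebra_axioms S.tensor_degree_U tensor_degree_FB\<close>)
  have "L.iota \<in> graded_bialg_iso K B G L.grb (gr_degree U FB)" using U by (simp add: liftings_def)
  then show "lifting K B G U"
    unfolding L.gr_ident_iso_iff by (intro lifting.intro L.filtered_lift_axioms lifting_axioms.intro) auto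
next
  assume "lifting K B G U"
  then interpret L: lifting K B G U .
  have "filtered_bialgebra K U FB"
  proof (intro filtered_bialgebra.intro L.U_bialgebra filtered_bialgebra_axioms.intro)
    fix i show "submodule (FB i) K U" using BG.F_submodule by (simp add: FB_eq L.submodule_U)
    show "FB i \<subseteq> FB (Suc i)" using BG.F_mono[of i "Suc i"] by (simp add: FB_eq)
    show "(\<Union>i. FB i) = carrier U" using BG.F_exhaustive by (simp add: FB_eq L.carrier_U)
    show "\<one>\<^bsub>U\<^esub> \<in> FB 0" using L.U_one by (simp add: FB_eq)
  next
    fix x y i j assume "x \<in> FB i" "y \<in> FB j"
    then show "x \<otimes>\<^bsub>U\<^esub> y \<in> FB (i + j)" using L.U_mult by (simp add: FB_eq)
  next
    fix x n assume "x \<in> FB n"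
    then show "comult U x \<in> tensor_degree K U FB n"
      using L.U_comult by (simp add: FB_eq L.tensor_degree_U tensor_degree_FB)
  qed
  moreover have "L.iota \<in> graded_bialg_iso K B G L.grb (gr_degree U FB)"
    unfolding L.gr_ident_iso_iff using L.one_eq L.counit_G0 L.mult_leading L.comult_leading by blast
  ultimately show "U \<in> liftings K B G" by (simp add: liftings_def L.same)
qed

text \<open>
  The filtered linear maps \<open>\<theta>\<close> with \<open>gr \<theta> = Id\<close>. With respect to the grading they are triangular with
  identities on the diagonal, and so they are bijective.
\<close>

definition "unitriangular \<theta> \<longleftrightarrow> \<theta> \<in> module_homs K B B \<and> (\<forall>n. \<forall>x\<in>BG.F n. \<theta> x \<in> BG.F n) \<and>
  (\<forall>n. \<forall>x\<in>G n. proj n (\<theta> x) = x)"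

text \<open>
  Induction on \<open>n\<close>: every \<open>y\<close> in \<open>F n\<close> differs from \<open>\<theta> y\<close> by an element of the preceding step,
  which is in the image already. In particular the inverse of such a map is filtered.
\<close>

lemma unitriangular_image:
  assumes "unitriangular \<theta>" shows "\<theta> ` BG.F n = BG.F n"
proof -
  have \<theta>: "\<theta> \<in> module_homs K B B" and filt: "\<And>n x. x \<in> BG.F n \<Longrightarrow> \<theta> x \<in> BG.F n"
    and lead: "\<And>n x. x \<in> G n \<Longrightarrow> proj n (\<theta> x) = x" using assms by (auto simp: unitriangular_def)
  note \<theta>a = module_homs_additive[OF \<theta>]
  have step: "\<exists>z\<in>BG.lower n. y = \<theta> y \<oplus>\<^bsub>B\<^esub> z" if y: "y \<in> BG.F n" for y n
  proof
    note yc = BG.F_closed[OF y] and tc = BG.F_closed[OF filt[OF y]]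
    show "y = \<theta> y \<oplus>\<^bsub>B\<^esub> (y \<ominus>\<^bsub>B\<^esub> \<theta> y)" using yc tc by (simp add: a_minus_def M.a_lcomm M.r_neg)
    have "proj n (\<theta> y) = proj n y"
      using SQ.GT.filtered_leading[OF \<theta>a filt y] lead[OF proj_G[OF yc]] by simp
    then have "proj n (y \<ominus>\<^bsub>B\<^esub> \<theta> y) = \<zero>\<^bsub>B\<^esub>"
      using yc tc BG.proj_closed[OF yc]
      by (simp add: additive_maps_diff[OF B_group B_group BG.proj_additive]) (simp add: a_minus_def M.r_neg)
    moreover have "y \<ominus>\<^bsub>B\<^esub> \<theta> y \<in> BG.F n" using y filt[OF y] by (simp add: a_minus_def BG.F_add BG.F_minus)
    ultimately show "y \<ominus>\<^bsub>B\<^esub> \<theta> y \<in> BG.lower n" by (simp add: BG.lower_def)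
  qed
  have surj: "BG.F n \<subseteq> \<theta> ` BG.F n" for n
  proof (induction n)
    case 0
    show ?case
    proof
      fix y assume y: "y \<in> BG.F 0"
      then obtain z where z: "z \<in> BG.lower 0" "y = \<theta> y \<oplus>\<^bsub>B\<^esub> z" using step by blast
      have "\<theta> y \<oplus>\<^bsub>B\<^esub> z = \<theta> y"
        using z(1) module_homs_closed[OF \<theta> BG.F_closed[OF y]] by (simp add: BG.lower_0)
      from trans[OF z(2) this] show "y \<in> \<theta> ` BG.F 0" using y by (rule image_eqI)
    qed
  next
    case (Suc n)
    show ?case
    proof
      fix y assume y: "y \<in> BG.F (Suc n)"
      then obtain z where z: "z \<in> BG.F n" "y = \<theta> y \<oplus>\<^bsub>B\<^esub> z" using step[OF y] by (auto simp: BG.lower_Suc)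
      then obtain x where x: "x \<in> BG.F n" "z = \<theta> x" using Suc.IH by blast
      have "\<theta> (y \<oplus>\<^bsub>B\<^esub> x) = \<theta> y \<oplus>\<^bsub>B\<^esub> z"
        using x(2) module_homs_add[OF \<theta> BG.F_closed[OF y] BG.F_closed[OF x(1)]] by simp
      from trans[OF z(2) this[symmetric]] have "y = \<theta> (y \<oplus>\<^bsub>B\<^esub> x)" .
      moreover have "y \<oplus>\<^bsub>B\<^esub> x \<in> BG.F (Suc n)" using BG.F_add[OF y subsetD[OF BG.F_mono x(1)]] by simp
      ultimately show "y \<in> \<theta> ` BG.F (Suc n)" by (rule image_eqI)
    qed
  qed
  show ?thesis
    by (rule equalityI[OF image_subsetI surj]) (rule filt)
qed

lemma unitriangular_bij:
  assumes "unitriangular \<theta>" shows "bij_betw \<theta> (carrier B) (carrier B)"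
proof -
  have \<theta>: "\<theta> \<in> module_homs K B B" and filt: "\<And>n x. x \<in> BG.F n \<Longrightarrow> \<theta> x \<in> BG.F n"
    and lead: "\<And>n x. x \<in> G n \<Longrightarrow> proj n (\<theta> x) = x" using assms by (auto simp: unitriangular_def)
  note \<theta>a = module_homs_additive[OF \<theta>]
  have ker: "x = \<zero>\<^bsub>B\<^esub>" if "x \<in> BG.F n" "\<theta> x = \<zero>\<^bsub>B\<^esub>" for x n
    using that
  proof (induction n)
    case 0
    have "proj 0 x = x" using BG.F_decomposition[OF 0(1)] BG.proj_closed[OF BG.F_closed[OF 0(1)]] by simp
    then show ?case using lead[OF proj_G[OF BG.F_closed[OF 0(1)]], of 0] 0(2) by (simp add: BG.proj_zero)
  next
    case (Suc n)
    have "proj (Suc n) x = proj (Suc n) (\<theta> (proj (Suc n) x))" using lead[OF proj_G[OF BG.F_closed[OF Suc(2)]]] by simp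
    also have "\<dots> = proj (Suc n) (\<theta> x)" using SQ.GT.filtered_leading[OF \<theta>a filt Suc(2)] by simp
    finally have "x \<in> BG.lower (Suc n)" using Suc(2,3) by (simp add: BG.lower_def BG.proj_zero)
    then show ?case using Suc by (simp add: BG.lower_Suc)
  qed
  have "inj_on \<theta> (carrier B)"
  proof (rule additive_maps_inj_onI[OF B_group B_group \<theta>a])
    fix x assume "x \<in> carrier B" "\<theta> x = \<zero>\<^bsub>B\<^esub>"
    then show "x = \<zero>\<^bsub>B\<^esub>" using ker BG.F_exhaustive by blast
  qed
  moreover have "\<theta> ` carrier B = carrier B"
  proof -
    have "\<theta> ` (\<Union>n. BG.F n) = (\<Union>n. BG.F n)" unfolding image_UN unitriangular_image[OF assms] ..
    then show ?thesis by (simp only: BG.F_exhaustive)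
  qed
  ultimately show ?thesis by (simp add: bij_betw_def)
qed

text \<open>
  The isomorphisms of the equivalence of liftings; their bijectivity is \<open>unitriangular_bij\<close>.
\<close>

definition "lift_iso U V \<theta> \<longleftrightarrow> unitriangular \<theta> \<and> \<theta> \<one>\<^bsub>U\<^esub> = \<one>\<^bsub>V\<^esub> \<and>
  (\<forall>x\<in>carrier B. \<forall>y\<in>carrier B. \<theta> (x \<otimes>\<^bsub>U\<^esub> y) = \<theta> x \<otimes>\<^bsub>V\<^esub> \<theta> y) \<and>
  (\<forall>x\<in>carrier B. counit V (\<theta> x) = counit U x) \<and>
  (\<forall>x\<in>carrier B. comult V (\<theta> x) = tensor_map K B B \<theta> \<theta> (comult U x))"

lemma lifting_equiv_iff:
  "(U, V) \<in> lifting_equiv K B G \<longleftrightarrow> lifting K B G U \<and> lifting K B G V \<and> (\<exists>\<theta>. lift_iso U V \<theta>)"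
proof -
  have "(\<exists>\<theta> \<in> filtered_bialg_iso K U FB V FB. \<forall>b\<in>carrier B. gr_map V FB \<theta> (gr_ident B G b) = gr_ident B G b)
     \<longleftrightarrow> (\<exists>\<theta>. lift_iso U V \<theta>)" if "lifting K B G U" "lifting K B G V"
  proof -
    interpret U: lifting K B G U by fact
    interpret V: lifting K B G V by fact
    have homs: "module_homs K U V = module_homs K B B" by (simp add: U.module_homs_U V.module_homs_U)
    have "\<theta> \<in> filtered_bialg_iso K U FB V FB \<and> (\<forall>b\<in>carrier B. gr_map V FB \<theta> (gr_ident B G b) = gr_ident B G b)
      \<longleftrightarrow> lift_iso U V \<theta>" for \<theta>
    proof
      assume h: "\<theta> \<in> filtered_bialg_iso K U FB V FB \<and> (\<forall>b\<in>carrier B. gr_map V FB \<theta> (gr_ident B G b) = gr_ident B G b)"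
      then have \<theta>: "\<theta> \<in> module_homs K B B" and F: "\<And>n. \<theta> ` BG.F n = BG.F n" and rh: "\<theta> \<in> ring_hom U V"
        and ce: "\<forall>x\<in>carrier B. counit V (\<theta> x) = counit U x"
        and cm: "\<forall>x\<in>carrier B. comult V (\<theta> x) = tensor_map K B B \<theta> \<theta> (comult U x)"
        by (auto simp: filtered_bialg_iso_def bialg_iso_def ring_iso_def homs FB_eq U.carrier_U V.tensor_map_U)
      have filt: "\<And>n x. x \<in> BG.F n \<Longrightarrow> \<theta> x \<in> BG.F n" using F by blast
      have "unitriangular \<theta>"
        using h V.gr_map_iff[OF \<theta> filt] \<theta> filt by (auto simp: unitriangular_def)
      then show "lift_iso U V \<theta>"
        using ce cm ring_hom_mult[OF rh] ring_hom_one[OF rh] by (simp add: lift_iso_def U.carrier_U)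
    next
      assume h: "lift_iso U V \<theta>"
      then have ut: "unitriangular \<theta>" by (simp add: lift_iso_def)
      then have \<theta>: "\<theta> \<in> module_homs K B B" and filt: "\<And>n x. x \<in> BG.F n \<Longrightarrow> \<theta> x \<in> BG.F n"
        by (auto simp: unitriangular_def)
      have "\<theta> \<in> ring_hom U V"
        by (rule ring_hom_memI)
           (use h module_homs_closed[OF \<theta>] module_homs_add[OF \<theta>] in \<open>auto simp: lift_iso_def U.carrier_U V.carrier_U U.add_U V.add_U\<close>)
      then have "\<theta> \<in> filtered_bialg_iso K U FB V FB"
        using h unitriangular_bij[OF ut] \<theta> unitriangular_image[OF ut]
        by (simp add: filtered_bialg_iso_def bialg_iso_def ring_iso_def homs FB_eq U.carrier_U V.carrier_U V.tensor_map_U lift_iso_def)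
      moreover have "\<forall>b\<in>carrier B. gr_map V FB \<theta> (gr_ident B G b) = gr_ident B G b"
        using V.gr_map_iff[OF \<theta> filt] ut by (simp add: unitriangular_def)
      ultimately show "\<theta> \<in> filtered_bialg_iso K U FB V FB \<and> (\<forall>b\<in>carrier B. gr_map V FB \<theta> (gr_ident B G b) = gr_ident B G b)"
        by simp
    qed
    then show ?thesis by blast
  qed
  then show ?thesis by (auto simp: lifting_equiv_def liftings_iff)
qed

end

section \<open>Deformations\<close>

lemma module_homs_cong:
  assumes "carrier M = carrier M'" "add M = add M'" "smult M = smult M'"
    and "carrier N = carrier N'" "add N = add N'" "smult N = smult N'"
  shows "module_homs R M N = module_homs R M' N'"
  unfolding module_homs_def assms ..

context poly_coeffs
begin

text \<open>
  A \<open>K[t]\<close>-linear map induces a map modulo \<open>t\<close>; in particular a congruence modulo \<open>t\<close> needs to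
  be checked on constant polynomials only.
\<close>

lemma hom_coeff_0:
  assumes "module K N" "f \<in> module_homs (UP K) Mt (poly_module K N)" "p \<in> carrier Mt"
  shows "f p 0 = f (fsingle M 0 (p 0)) 0"
proof -
  interpret N: poly_coeffs K N by (rule poly_coeffs.intro[OF assms(1)])
  note fa = module_homs_additive[OF assms(2)]
  have c0: "(\<lambda>q. q 0) \<in> additive_maps N.Mt N" by (rule N.Pf.value_additive)
  have z: "fsingle M 0 \<zero>\<^bsub>M\<^esub> = \<zero>\<^bsub>Mt\<^esub>" by (auto simp: fsingle_def Pf.zero_P)
  have fz: "f \<zero>\<^bsub>Mt\<^esub> = \<zero>\<^bsub>N.Mt\<^esub>" by (rule additive_maps_zero[OF Pf.group_P N.Pf.group_P fa])
  show ?thesis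
  proof (rule Pf.additive_maps_eqI[OF N.M.abelian_group_axioms additive_maps_comp[OF fa c0]
        additive_maps_comp[OF Pf.value_additive additive_maps_comp[OF additive_maps_comp[OF Pf.fsingle_additive fa] c0]] assms(3)])
    fix j x assume x: "x \<in> carrier M"
    show "f (fsingle M j x) 0 = f (fsingle M 0 (fsingle M j x 0)) 0"
    proof (cases "j = 0")
      case True
      then show ?thesis by (simp add: fsingle_def)
    next
      case False
      have q: "f (fsingle M 0 x) \<in> carrier N.Mt" using module_homs_closed[OF assms(2)] x by (simp add: Pf.fsingle_closed)
      have "f (fsingle M j x) = fsingle K j \<one>\<^bsub>K\<^esub> \<odot>\<^bsub>N.Mt\<^esub> f (fsingle M 0 x)"
        using module_homs_smult[OF assms(2), of "fsingle K j \<one>\<^bsub>K\<^esub>" "fsingle M 0 x"] x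
        by (simp add: Kt.fsingle_closed Pf.fsingle_closed t_power_const)
      then have "f (fsingle M j x) 0 = \<zero>\<^bsub>N\<^esub>"
        using False N.Pf.value_closed[OF q, of 0]
        by (simp add: N.smult_Mt Kt.fsingle_closed convolution_def) (simp add: fsingle_def)
      moreover have "fsingle M 0 (fsingle M j x 0) = \<zero>\<^bsub>Mt\<^esub>" using False z by (simp add: fsingle_def)
      ultimately show ?thesis using fz by (simp add: N.Pf.zero_P)
    qed
  qed auto
qed

end

context poly_tensor_product
begin

lemma eval_poly_tensor:
  assumes p: "p \<in> carrier Mp.Mt" and q: "q \<in> carrier Np.Mt"
  shows "eval_at_one TP.T (poly_tensor K M N p q) = tens K M N (eval_at_one M p) (eval_at_one N q)"
proof -
  note tl = module_homs_additive[OF bilinear_maps_left[OF TP.tens_bilinear]]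
    and tr = module_homs_additive[OF bilinear_maps_right[OF TP.tens_bilinear]]
  note Tab = TP.T.M.abelian_group_axioms
  have 1: "eval_at_one TP.T (poly_tensor K M N (fsingle M i x) q) = tens K M N (eval_at_one M (fsingle M i x)) (eval_at_one N q)"
    if "x \<in> carrier M" for i x
    by (rule Np.Pf.additive_maps_eqI[OF Tab additive_maps_comp[OF poly_tensor_right Tp.eval_additive]
          additive_maps_comp[OF Np.eval_additive tr] q])
       (use that in \<open>simp_all add: Mp.Pf.fsingle_closed Mp.eval_fsingle Np.eval_fsingle Tp.eval_fsingle poly_tensor_fsingle\<close>)
  show ?thesis
    by (rule Mp.Pf.additive_maps_eqI[OF Tab additive_maps_comp[OF poly_tensor_left Tp.eval_additive]
          additive_maps_comp[OF Mp.eval_additive tl] p 1])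
       (use q additive_maps_closed[OF Np.eval_additive] in auto)
qed

lemma PT_inj: "inj_on PT (carrier TT.T)"
  using PT_bij by (simp add: bij_betw_def)

lemma PT_inv_hom: "PT_inv \<in> module_homs (UP K) Tp.Mt TT.T"
proof (rule module_homsI[OF PT_inv_additive])
  fix a w assume a: "a \<in> carrier (UP K)" and w: "w \<in> carrier Tp.Mt"
  note c = additive_maps_closed[OF PT_inv_additive]
  show "PT_inv (a \<odot>\<^bsub>Tp.Mt\<^esub> w) = a \<odot>\<^bsub>TT.T\<^esub> PT_inv w"
    by (rule inj_onD[OF PT_inj]) (use a w c in \<open>simp_all add: PT_PT_inv module_homs_smult[OF PT_hom]\<close>)
qed

end

text \<open>
  The polynomial module with the structure maps given by \<open>mt\<close> and \<open>\<Delta>t\<close>. The base \<open>U\<close> is arbitrary so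
  that this covers deformations of \<open>B\<close> as well as the trivial deformation of a lifting.
\<close>

locale predeformation = U: prebialgebra K U
  for K :: "('k, 'x) ring_scheme" and U :: "('k, 'b) bialg" +
  fixes mt \<Delta>t
  assumes mt_hom: "mt \<in> module_homs (UP K) (poly_module K (tensor K U U)) (poly_module K U)"
    and \<Delta>t_hom: "\<Delta>t \<in> module_homs (UP K) (poly_module K U) (poly_module K (tensor K U U))"
begin

sublocale PP: poly_tensor_product K U U by unfold_locales

abbreviation "Ut \<equiv> poly_module K U"
abbreviation "Dt \<equiv> deformation_bialgebra K U (mt, \<Delta>t)"

lemma Dt_simps: "carrier Dt = carrier Ut" "zero Dt = zero Ut" "add Dt = add Ut" "smult Dt = smult Ut"
  "one Dt = fsingle U 0 \<one>\<^bsub>U\<^esub>" "counit Dt = (\<lambda>p j. counit U (p j))"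
  "mult Dt = (\<lambda>p q. mt (poly_tensor K U U p q))"
  by (simp_all add: deformation_bialgebra_def PP.Mp.poly_const_eq poly_tens_eq)

lemma tensor_Dt: "tensor (UP K) Dt Dt = PP.TT.T"
  by (rule tensor_module_cong) (simp_all add: Dt_simps)
lemma tens_Dt: "tens (UP K) Dt Dt = tens (UP K) Ut Ut"
  by (rule tens_module_cong) (simp_all add: Dt_simps)
lemma tensor_map_Dt: "tensor_map (UP K) Dt Dt f g = tensor_map (UP K) Ut Ut f g"
  by (rule tensor_map_module_cong) (simp_all add: Dt_simps)
lemma module_homs_Dt: "module_homs (UP K) Dt N = module_homs (UP K) Ut N" "module_homs (UP K) M Dt = module_homs (UP K) M Ut"
  by (simp_all add: module_homs_def Dt_simps)
lemma additive_Dt: "additive_maps Dt N = additive_maps Ut N" "additive_maps M Dt = additive_maps M Ut"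
  by (simp_all add: additive_maps_def Dt_simps)
lemma bilinear_Dt: "bilinear_maps (UP K) Dt Dt Dt = bilinear_maps (UP K) Ut Ut Ut"
  by (simp add: bilinear_maps_def module_homs_Dt Dt_simps)

lemma comult_Dt:
  assumes "p \<in> carrier Ut"
  shows "comult Dt p = PP.PT_inv (\<Delta>t p)" "PP.PT (comult Dt p) = \<Delta>t p" "comult Dt p \<in> carrier PP.TT.T"
proof -
  have d: "\<Delta>t p \<in> carrier PP.Tp.Mt" by (rule module_homs_closed[OF \<Delta>t_hom assms])
  have c: "PP.PT_inv (\<Delta>t p) \<in> carrier PP.TT.T" by (rule additive_maps_closed[OF PP.PT_inv_additive d])
  have "comult Dt p = inv_into (carrier PP.TT.T) PP.PT (\<Delta>t p)"
    by (simp add: deformation_bialgebra_def poly_tensor_iso_eq)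
  also have "\<dots> = PP.PT_inv (\<Delta>t p)"
    by (rule inv_into_f_eq[OF PP.PT_inj c PP.PT_PT_inv[OF d]])
  finally show e: "comult Dt p = PP.PT_inv (\<Delta>t p)" .
  show "PP.PT (comult Dt p) = \<Delta>t p" "comult Dt p \<in> carrier PP.TT.T"
    unfolding e using PP.PT_PT_inv[OF d] c by auto
qed

lemma counit_Dt_additive: "(\<lambda>p j. counit U (p j)) \<in> additive_maps Ut (UP K)"
proof (rule additive_mapsI)
  have z: "counit U \<zero>\<^bsub>U\<^esub> = \<zero>\<^bsub>K\<^esub>"
    by (rule additive_maps_zero[OF U.A.M.abelian_group_axioms U.A.R.abelian_group_axioms U.counit_additive])
  have cl: "(\<lambda>j. counit U (p j)) \<in> carrier (UP K)" if p: "p \<in> carrier Ut" for p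
  proof -
    have "{j. counit U (p j) \<noteq> \<zero>\<^bsub>K\<^esub>} \<subseteq> {j. p j \<noteq> \<zero>\<^bsub>U\<^esub>}" using z by auto
    then have "finite {j. counit U (p j) \<noteq> \<zero>\<^bsub>K\<^esub>}" by (rule finite_subset) (rule PP.Mp.Pf.finite_support[OF p])
    then show ?thesis using U.counit_closed PP.Mp.Pf.value_closed[OF p] by (simp add: PP.Mp.Kt.carrier_P)
  qed
  fix p assume p: "p \<in> carrier Ut"
  show "(\<lambda>j. counit U (p j)) \<in> carrier (UP K)" by (rule cl[OF p])
  fix q assume q: "q \<in> carrier Ut"
  show "(\<lambda>j. counit U ((p \<oplus>\<^bsub>Ut\<^esub> q) j)) = (\<lambda>j. counit U (p j)) \<oplus>\<^bsub>UP K\<^esub> (\<lambda>j. counit U (q j))"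
    using PP.Mp.Pf.value_closed[OF p] PP.Mp.Pf.value_closed[OF q]
    by (simp add: PP.Mp.Kt.add_P cl p q PP.Mp.Pf.add_P U.counit_add)
qed

lemma counit_Dt_fsingle: "(\<lambda>j. counit U (fsingle U i x j)) = fsingle K i (counit U x)"
  using additive_maps_zero[OF U.A.M.abelian_group_axioms U.A.R.abelian_group_axioms U.counit_additive]
  by (auto simp: fsingle_def)

lemma prebialgebra_Dt: "prebialgebra (UP K) Dt"
proof (intro prebialgebra.intro prebialgebra_axioms.intro)
  show "module (UP K) Dt"
    by (rule module_surjective_image[OF PP.Mp.module_Mt, of "\<lambda>x. x"]) (simp_all add: Dt_simps)
  show "\<one>\<^bsub>Dt\<^esub> \<in> carrier Dt" by (simp add: Dt_simps PP.Mp.Pf.fsingle_closed U.one_closed_A)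
  note pl = bilinear_maps_left[OF PP.poly_tensor_bilinear] and pr = bilinear_maps_right[OF PP.poly_tensor_bilinear]
  show "mult Dt \<in> bilinear_maps (UP K) Dt Dt Dt"
    unfolding bilinear_Dt Dt_simps by (intro bilinear_mapsI module_homs_comp[OF pl mt_hom] module_homs_comp[OF pr mt_hom])
  show "counit Dt \<in> additive_maps Dt (UP K)" using counit_Dt_additive by (simp add: additive_Dt Dt_simps)
  show "comult Dt \<in> module_homs (UP K) Dt (tensor (UP K) Dt Dt)"
    unfolding tensor_Dt module_homs_Dt
    using module_homs_comp[OF \<Delta>t_hom PP.PT_inv_hom] by (simp add: module_homs_def comult_Dt Pi_def)
  let ?S = "\<lparr>carrier = carrier (UP K), mult = mult (UP K), one = one (UP K), zero = zero (UP K), add = add (UP K), smult = mult (UP K)\<rparr>"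
  have S: "module (UP K) ?S" by (rule ring_is_module[OF PP.Mp.UPK.UP_cring])
  have "(\<lambda>p j. counit U (p j)) \<in> module_homs (UP K) Ut ?S"
  proof (rule PP.Mp.poly_homI[OF S])
    show "(\<lambda>p j. counit U (p j)) \<in> additive_maps Ut ?S" using counit_Dt_additive by (simp add: additive_maps_def)
    fix i j r x assume "r \<in> carrier K" "x \<in> carrier U"
    then show "(\<lambda>ja. counit U (fsingle U (i + j) (r \<odot>\<^bsub>U\<^esub> x) ja)) = fsingle K i r \<odot>\<^bsub>?S\<^esub> (\<lambda>ja. counit U (fsingle U j x ja))"
      unfolding counit_Dt_fsingle by (simp add: PP.Mp.mult_fsingle U.counit_smult_A U.counit_closed)
  qed
  from module_homs_smult[OF this]
  show "counit Dt (a \<odot>\<^bsub>Dt\<^esub> p) = a \<otimes>\<^bsub>UP K\<^esub> counit Dt p" if "a \<in> carrier (UP K)" "p \<in> carrier Dt" for a p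
    using that by (simp add: Dt_simps)
qed

sublocale Dt: prebialgebra "UP K" Dt by (rule prebialgebra_Dt)

end

context graded_bialgebra
begin

lemma prebialgebra_B: "prebialgebra K B" by (rule prebialgebra)

sublocale PB: prebialgebra K B by (rule prebialgebra)

lemma mult_lift_hom: "\<beta> \<in> bilinear_maps K B B B \<Longrightarrow> tensor_lift K B \<beta> \<in> module_homs K TB B"
  by (rule SQ.GT.PTP.TP.tensor_lift_hom[OF B_module])
lemma mult_lift_tens: "\<beta> \<in> bilinear_maps K B B B \<Longrightarrow> x \<in> carrier B \<Longrightarrow> y \<in> carrier B \<Longrightarrow>
    tensor_lift K B \<beta> (tens K B B x y) = \<beta> x y"
  by (rule SQ.GT.PTP.TP.tensor_lift_tens[OF B_module])

lemma tens_F: "x \<in> BG.F i \<Longrightarrow> y \<in> BG.F j \<Longrightarrow> tens K B B x y \<in> SQ.GT.T.F (i + j)"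
proof -
  assume "x \<in> BG.F i" "y \<in> BG.F j"
  then have "tens K B B x y \<in> tensor_degree K B BG.F (i + j)"
    unfolding SQ.tensor_degree_span[OF BG.F_submodule] by (intro additive_span.base) blast
  then show ?thesis using SQ.tensor_degree_F by simp
qed

text \<open>
  By \<open>tensor_degree_F\<close>, this step of the filtration is spanned by the \<open>x \<otimes> y\<close> with \<open>x\<close> in
  \<open>F i\<close>, \<open>y\<close> in \<open>F j\<close> and \<open>i + j = n\<close>.
\<close>

lemma T_F_induct [consumes 1, case_names zero tens add]:
  assumes "w \<in> SQ.GT.T.F n" "Q \<zero>\<^bsub>TB\<^esub>"
    "\<And>x y i j. i + j = n \<Longrightarrow> x \<in> BG.F i \<Longrightarrow> y \<in> BG.F j \<Longrightarrow> Q (tens K B B x y)"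
    "\<And>u v. u \<in> carrier TB \<Longrightarrow> v \<in> carrier TB \<Longrightarrow> Q u \<Longrightarrow> Q v \<Longrightarrow> Q (u \<oplus>\<^bsub>TB\<^esub> v)"
  shows "Q w"
proof -
  let ?X = "{tens K B B x y | x y i j. i + j = n \<and> x \<in> BG.F i \<and> y \<in> BG.F j}"
  have X: "?X \<subseteq> carrier TB" using BG.F_closed by auto
  have Tab: "abelian_group TB" by (rule TB_group)
  have "w \<in> additive_span TB ?X"
    using assms(1) SQ.tensor_degree_F[of n] SQ.tensor_degree_span[where G=BG.F and n=n, OF BG.F_submodule] by simp
  then show ?thesis
  proof induction
    case (add u v)
    have "u \<in> carrier TB" "v \<in> carrier TB" using add(1,2) additive_span_subset[OF Tab X] by auto
    then show ?case using assms(4) add by blast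
  qed (use assms(2,3) in auto)
qed

end

subsection \<open>The specialization of a deformation is a lifting\<close>

locale deformation = graded_bialgebra K B G
  for K :: "('k, 'x) ring_scheme" and B :: "('k, 'b) bialg" and G +
  fixes mt \<Delta>t
  assumes D_deformation: "(mt, \<Delta>t) \<in> deformations K B G"
begin

lemma deformation_facts:
  "mt \<in> module_homs (UP K) (poly_module K TB) (poly_module K B)"
  "\<Delta>t \<in> module_homs (UP K) (poly_module K B) (poly_module K TB)"
  "mt ` SQ.GT.T.Hp n \<subseteq> BG.Hp n" "\<Delta>t ` BG.Hp n \<subseteq> SQ.GT.T.Hp n"
  "bialgebra (UP K) (deformation_bialgebra K B (mt, \<Delta>t))"
  "w \<in> carrier (poly_module K TB) \<Longrightarrow> cong_mod_t K B (mt w) (\<lambda>n. tensor_lift K B (mult B) (w n))"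
  "p \<in> carrier (poly_module K B) \<Longrightarrow> cong_mod_t K TB (\<Delta>t p) (\<lambda>n. comult B (p n))"
  using D_deformation by (simp_all add: deformations_def Let_def poly_degree_G poly_degree_T)

sublocale PD: predeformation K B mt \<Delta>t
  by unfold_locales (rule deformation_facts)+

abbreviation "Dt \<equiv> deformation_bialgebra K B (mt, \<Delta>t)"
abbreviation "V \<equiv> specialization K B (mt, \<Delta>t)"
abbreviation "m1 \<equiv> MB.at_one mt"
abbreviation "\<Delta>1 \<equiv> DB.at_one \<Delta>t"

lemma V_simps: "carrier V = carrier B" "zero V = zero B" "add V = add B" "smult V = smult B" "one V = one B"
  "counit V = counit B" "mult V = (\<lambda>x y. m1 (tens K B B x y))" "comult V = \<Delta>1"
  by (simp_all add: specialization_def MB.at_one_def DB.at_one_def[abs_def] SQ.GT.PTP.Tp.poly_const_eq BG.poly_const_eq)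

sublocale SV: same_module K B G V by unfold_locales (simp_all add: V_simps)

lemmas m1_hom = MB.at_one_hom[OF deformation_facts(1)]
lemmas \<Delta>1_hom = DB.at_one_hom[OF deformation_facts(2)]
lemmas m1_filtered = MB.at_one_filtered[OF deformation_facts(1,3)]
lemmas \<Delta>1_filtered = DB.at_one_filtered[OF deformation_facts(2,4)]

lemma V_mult_bilinear: "(\<lambda>x y. m1 (tens K B B x y)) \<in> bilinear_maps K B B B"
  by (intro bilinear_mapsI module_homs_comp[OF bilinear_maps_left[OF SQ.GT.PTP.TP.tens_bilinear] m1_hom]
      module_homs_comp[OF bilinear_maps_right[OF SQ.GT.PTP.TP.tens_bilinear] m1_hom])

lemma V_prebialgebra: "prebialgebra K V"
  by (intro prebialgebra.intro SV.module_U prebialgebra_axioms.intro)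
     (use V_mult_bilinear \<Delta>1_hom PB.counit_additive PB.one_closed_A PB.counit_smult_A in
       \<open>simp_all add: SV.bilinear_U SV.additive_U SV.tensor_U SV.module_homs_U V_simps\<close>)

lemma eval_tensor:
  assumes w: "w \<in> carrier SQ.GT.PTP.TT.T"
  shows "semi_tensor (UP K) (eval_scalar K) K V V (eval_at_one B) (eval_at_one B) w = eval_at_one TB (SQ.GT.PTP.PT w)"
proof -
  have sl: "eval_at_one B \<in> semilinear_maps (UP K) (eval_scalar K) BG.Mt V"
    using BG.eval_semilinear by (simp add: semilinear_maps_def SV.additive_U V_simps)
  note st = SQ.GT.PTP.TT.semi_tensor_semilinear[OF BG.eval_ring_hom SV.module_U SV.module_U sl sl]
    and sv = SQ.GT.PTP.TT.semi_tensor_tens[OF BG.eval_ring_hom SV.module_U SV.module_U sl sl]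
  note sa = semilinear_maps_additive[OF st, unfolded SV.tensor_U]
  show ?thesis
    by (rule SQ.GT.PTP.TT.tensor_maps_eqI[OF TB_group sa
         additive_maps_comp[OF module_homs_additive[OF SQ.GT.PTP.PT_hom] SQ.GT.PTP.Tp.eval_additive] w])
       (simp add: sv SQ.GT.PTP.PT_tens SQ.GT.PTP.eval_poly_tensor SV.tens_U)
qed

text \<open>
  Evaluation at \<open>t = 1\<close> commutes with \<open>K[t]\<close>-linear maps \<open>f\<close> in the sense that
  \<open>f(p)(1) = f(p(1))(1)\<close>, where \<open>p(1)\<close> is regarded as a constant polynomial.
\<close>

lemma eval_morphism: "bialgebra_morphism (UP K) Dt K V (eval_scalar K) (eval_at_one B)"
proof (intro bialgebra_morphism.intro PD.prebialgebra_Dt V_prebialgebra bialgebra_morphism_axioms.intro)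
  show "eval_scalar K \<in> ring_hom (UP K) K" by (rule BG.eval_ring_hom)
  show "eval_at_one B \<in> semilinear_maps (UP K) (eval_scalar K) Dt V"
    using BG.eval_semilinear by (simp add: semilinear_maps_def PD.additive_Dt PD.Dt_simps SV.additive_U V_simps)
  show "eval_at_one B \<one>\<^bsub>Dt\<^esub> = \<one>\<^bsub>V\<^esub>" by (simp add: PD.Dt_simps V_simps BG.eval_fsingle PB.one_closed_A)
next
  fix p q assume "p \<in> carrier Dt" "q \<in> carrier Dt"
  then have pq: "p \<in> carrier BG.Mt" "q \<in> carrier BG.Mt" by (simp_all add: PD.Dt_simps)
  then show "eval_at_one B (p \<otimes>\<^bsub>Dt\<^esub> q) = eval_at_one B p \<otimes>\<^bsub>V\<^esub> eval_at_one B q"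
    by (simp add: PD.Dt_simps V_simps MB.eval_at_one_hom[OF deformation_facts(1)] SQ.GT.PTP.poly_tensor_closed SQ.GT.PTP.eval_poly_tensor)
next
  fix p assume "p \<in> carrier Dt"
  then have p: "p \<in> carrier BG.Mt" by (simp add: PD.Dt_simps)
  show "eval_scalar K (counit Dt p) = counit V (eval_at_one B p)"
    unfolding PD.Dt_simps V_simps
    by (rule BG.Pf.additive_maps_eqI[OF R.abelian_group_axioms additive_maps_comp[OF PD.counit_Dt_additive BG.eval_K_additive]
         additive_maps_comp[OF BG.eval_additive PB.counit_additive] p])
       (simp add: PD.counit_Dt_fsingle BG.eval_K_fsingle BG.eval_fsingle PB.counit_closed)
  show "semi_tensor (UP K) (eval_scalar K) K V V (eval_at_one B) (eval_at_one B) (comult Dt p) = comult V (eval_at_one B p)"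
    unfolding eval_tensor[OF PD.comult_Dt(3)[OF p]] PD.comult_Dt(2)[OF p]
    by (simp add: V_simps DB.eval_at_one_hom[OF deformation_facts(2) p])
qed

lemma V_bialgebra: "bialgebra K V"
proof -
  interpret E: bialgebra_morphism "UP K" Dt K V "eval_scalar K" "eval_at_one B" by (rule eval_morphism)
  show ?thesis
  proof (rule E.bialgebra_pushforward[OF deformation_facts(5)])
    show "carrier V = additive_span V E.generators"
    proof
      show "additive_span V E.generators \<subseteq> carrier V"
        by (rule additive_span_subset[OF E.A'.A.M.abelian_group_axioms]) (auto simp: E.f_closed)
      show "carrier V \<subseteq> additive_span V E.generators"
      proof
        fix x assume x: "x \<in> carrier V"
        then have "x = \<one>\<^bsub>K\<^esub> \<odot>\<^bsub>V\<^esub> eval_at_one B (fsingle B 0 x)" by (simp add: V_simps BG.eval_fsingle)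
        moreover have "fsingle B 0 x \<in> carrier Dt" using x by (simp add: V_simps PD.Dt_simps BG.Pf.fsingle_closed)
        ultimately show "x \<in> additive_span V E.generators" by (intro additive_span.base) blast
      qed
    qed
  qed
qed

text \<open>
  Homogeneity of \<open>m\<^sub>t\<close> and \<open>\<Delta>\<^sub>t\<close> makes the specialized maps filtered, and the congruence modulo
  \<open>t\<close> determines their symbols.
\<close>

lemma V_lifting: "lifting K B G V"
proof (intro lifting.intro filtered_lift.intro SV.same_module_axioms filtered_lift_axioms.intro lifting_axioms.intro V_bialgebra)
  show "\<one>\<^bsub>V\<^esub> \<in> BG.F 0" using one_degree BG.H_subset_F[of 0 0] by (auto simp: V_simps homogeneous_eq_G)
  show "x \<otimes>\<^bsub>V\<^esub> y \<in> BG.F (i + j)" if "x \<in> BG.F i" "y \<in> BG.F j" for x y i j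
    using m1_filtered[OF tens_F[OF that]] by (simp add: V_simps)
  show "comult V x \<in> SQ.GT.T.F n" if "x \<in> BG.F n" for x n
    using \<Delta>1_filtered[OF that] by (simp add: V_simps)
  show "\<one>\<^bsub>V\<^esub> = \<one>\<^bsub>B\<^esub>" by (simp add: V_simps)
  show "counit V x = counit B x" for x by (simp add: V_simps)
  show "proj (i + j) (x \<otimes>\<^bsub>V\<^esub> y) = x \<otimes>\<^bsub>B\<^esub> y" if x: "x \<in> G i" and y: "y \<in> G j" for x y i j
  proof -
    have h: "tens K B B x y \<in> SQ.GT.T.H (i + j)" by (rule SQ.GT.tens_homogeneous) (use x y in \<open>simp_all add: homogeneous_eq_G\<close>)
    note hc = SQ.GT.T.H_closed[OF h]
    have w: "fsingle TB 0 (tens K B B x y) \<in> carrier (poly_module K TB)" by (rule SQ.GT.PTP.Tp.Pf.fsingle_closed[OF UNIV_I hc])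
    have c: "(\<lambda>n. tensor_lift K B (mult B) (fsingle TB 0 (tens K B B x y) n)) \<in> carrier BG.Mt"
      by (rule module_homs_closed[OF coeffwise_hom(1)[OF TB_module B_module mult_lift_hom[OF PB.mult_bilinear]] w])
    have "proj (i + j) (m1 (tens K B B x y)) = mt (fsingle TB 0 (tens K B B x y)) 0"
      by (rule MB.at_one_symbol[OF deformation_facts(1,3) h])
    also have "\<dots> = tensor_lift K B (mult B) (fsingle TB (0::nat) (tens K B B x y) 0)"
      using deformation_facts(6)[OF w] BG.cong_mod_t_iff[OF module_homs_closed[OF deformation_facts(1) w] c] by simp
    also have "\<dots> = x \<otimes>\<^bsub>B\<^esub> y" using G_closed[OF x] G_closed[OF y] by (simp add: fsingle_def mult_lift_tens[OF PB.mult_bilinear])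
    finally show ?thesis by (simp add: V_simps)
  qed
  show "projT n (comult V x) = comult B x" if x: "x \<in> G n" for x n
  proof -
    have h: "x \<in> BG.H n" using x by (simp add: homogeneous_eq_G)
    have p: "fsingle B 0 x \<in> carrier BG.Mt" by (rule BG.Pf.fsingle_closed[OF UNIV_I G_closed[OF x]])
    have c: "(\<lambda>n. comult B (fsingle B 0 x n)) \<in> carrier (poly_module K TB)"
      by (rule module_homs_closed[OF coeffwise_hom(1)[OF B_module TB_module comult_module_hom] p])
    have "projT n (\<Delta>1 x) = \<Delta>t (fsingle B 0 x) 0"
      by (rule DB.at_one_symbol[OF deformation_facts(2,4) h])
    also have "\<dots> = comult B (fsingle B (0::nat) x 0)"
      using deformation_facts(7)[OF p] SQ.GT.PTP.Tp.cong_mod_t_iff[OF module_homs_closed[OF deformation_facts(2) p] c] by simp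
    finally show ?thesis by (simp add: V_simps fsingle_def)
  qed
qed

end

section \<open>Unitriangular maps\<close>

context graded_bialgebra
begin

lemma unitriangularD:
  assumes "unitriangular \<theta>"
  shows "\<theta> \<in> module_homs K B B" "x \<in> BG.F n \<Longrightarrow> \<theta> x \<in> BG.F n" "x \<in> G n \<Longrightarrow> proj n (\<theta> x) = x"
  using assms by (auto simp: unitriangular_def)

lemma unitriangular_leading:
  assumes "unitriangular \<theta>" "x \<in> BG.F n" shows "proj n (\<theta> x) = proj n x"
  using SQ.GT.filtered_leading[OF module_homs_additive[OF unitriangularD(1)[OF assms(1)]] unitriangularD(2)[OF assms(1)] assms(2)]
    unitriangularD(3)[OF assms(1) proj_G[OF BG.F_closed[OF assms(2)]]] by simp

lemma unitriangular_id: "unitriangular (\<lambda>x. x)"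
  by (auto simp: unitriangular_def module_homs_id proj_of_G)

lemma unitriangular_comp:
  assumes "unitriangular \<theta>" "unitriangular \<eta>" shows "unitriangular (\<lambda>x. \<eta> (\<theta> x))"
proof -
  have "proj n (\<eta> (\<theta> x)) = x" if x: "x \<in> G n" for n x
  proof -
    have xF: "x \<in> BG.F n" using x BG.H_subset_F[of n n] by (auto simp: homogeneous_eq_G)
    show ?thesis
      using unitriangular_leading[OF assms(2) unitriangularD(2)[OF assms(1) xF]] unitriangularD(3)[OF assms(1) x] by simp
  qed
  then show ?thesis
    unfolding unitriangular_def
    using module_homs_comp[OF unitriangularD(1)[OF assms(1)] unitriangularD(1)[OF assms(2)]]
      unitriangularD(2)[OF assms(1)] unitriangularD(2)[OF assms(2)] by simp
qed

abbreviation "inverse_map \<theta> \<equiv> inv_into (carrier B) \<theta>"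

lemma inverse_map:
  assumes "unitriangular \<theta>"
  shows "x \<in> carrier B \<Longrightarrow> inverse_map \<theta> x \<in> carrier B" "x \<in> carrier B \<Longrightarrow> \<theta> (inverse_map \<theta> x) = x"
    "x \<in> carrier B \<Longrightarrow> inverse_map \<theta> (\<theta> x) = x"
  using unitriangular_bij[OF assms] inv_into_into[of x \<theta> "carrier B"]
  by (auto simp: bij_betw_def f_inv_into_f)

lemma unitriangular_inverse:
  assumes "unitriangular \<theta>" shows "unitriangular (inverse_map \<theta>)"
proof -
  note \<theta> = unitriangularD[OF assms] and i = inverse_map[OF assms]
  have inj: "x = y" if "x \<in> carrier B" "y \<in> carrier B" "\<theta> x = \<theta> y" for x y
    using unitriangular_bij[OF assms] that by (auto simp: bij_betw_def dest: inj_onD)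
  have hom: "inverse_map \<theta> \<in> module_homs K B B"
  proof (intro module_homsI additive_mapsI)
    fix x y assume "x \<in> carrier B" "y \<in> carrier B"
    then show "inverse_map \<theta> (x \<oplus>\<^bsub>B\<^esub> y) = inverse_map \<theta> x \<oplus>\<^bsub>B\<^esub> inverse_map \<theta> y"
      by - (rule inj, simp_all add: i module_homs_add[OF \<theta>(1)])
  next
    fix r x assume "r \<in> carrier K" "x \<in> carrier B"
    then show "inverse_map \<theta> (r \<odot>\<^bsub>B\<^esub> x) = r \<odot>\<^bsub>B\<^esub> inverse_map \<theta> x"
      by - (rule inj, simp_all add: i module_homs_smult[OF \<theta>(1)])
  qed (rule i)
  have filt: "inverse_map \<theta> x \<in> BG.F n" if x: "x \<in> BG.F n" for x n
  proof -
    obtain y where y: "y \<in> BG.F n" "x = \<theta> y" using x unitriangular_image[OF assms, of n] by blast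
    then show ?thesis using i(3)[OF BG.F_closed[OF y(1)]] by simp
  qed
  have "proj n (inverse_map \<theta> x) = x" if x: "x \<in> G n" for n x
  proof -
    have xF: "x \<in> BG.F n" using x BG.H_subset_F[of n n] by (auto simp: homogeneous_eq_G)
    show ?thesis
      using unitriangular_leading[OF assms filt[OF xF]] i(2)[OF BG.F_closed[OF xF]] proj_of_G[OF x, of n] by simp
  qed
  then show ?thesis using hom filt by (simp add: unitriangular_def)
qed

lemmas square_hom = SQ.GT.PTP.TP.tensor_map_hom[OF B_module B_module]
lemmas square_tens = SQ.GT.PTP.TP.tensor_map_tens[OF B_module B_module]

text \<open>
  Needed to see that transport along \<open>\<theta>\<close> does not change the symbol of the comultiplication.
\<close>

lemma tensor_square_unitriangular:
  assumes "unitriangular \<theta>" and w: "w \<in> SQ.GT.T.F n"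
  shows "tensor_map K B B \<theta> \<theta> w \<in> SQ.GT.T.F n" "projT n (tensor_map K B B \<theta> \<theta> w) = projT n w"
proof -
  note \<theta> = unitriangularD[OF assms(1)]
  note h = square_hom[OF \<theta>(1) \<theta>(1)] and t = square_tens[OF \<theta>(1) \<theta>(1)]
  note Tab = TB_group
  have "tensor_map K B B \<theta> \<theta> w \<in> SQ.GT.T.F n \<and> projT n (tensor_map K B B \<theta> \<theta> w) = projT n w"
    using w
  proof (induction rule: T_F_induct)
    case zero
    then show ?case by (simp add: additive_maps_zero[OF Tab Tab module_homs_additive[OF h]] SQ.GT.T.F_zero)
  next
    case (tens x y i j)
    note xc = BG.F_closed[OF tens(2)] and yc = BG.F_closed[OF tens(3)]
    show ?case
      using tens_F[OF \<theta>(2)[OF tens(2)] \<theta>(2)[OF tens(3)]] projT_tens_F[OF \<theta>(2)[OF tens(2)] \<theta>(2)[OF tens(3)]]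
        projT_tens_F[OF tens(2,3)] unitriangular_leading[OF assms(1) tens(2)] unitriangular_leading[OF assms(1) tens(3)]
      by (simp add: t[OF xc yc] tens(1))
  next
    case (add u v)
    then show ?case
      using module_homs_closed[OF h]
      by (simp add: module_homs_add[OF h] SQ.GT.T.F_add module_homs_add[OF SQ.GT.tensor_proj_hom])
  qed
  then show "tensor_map K B B \<theta> \<theta> w \<in> SQ.GT.T.F n" "projT n (tensor_map K B B \<theta> \<theta> w) = projT n w" by auto
qed

subsection \<open>The equivalence relation on liftings\<close>

lemma lift_iso_id:
  assumes "lifting K B G U" shows "lift_iso U U (\<lambda>x. x)"
proof -
  interpret U: lifting K B G U by fact
  show ?thesis
    using SQ.GT.PTP.TP.tensor_map_ident[OF module_homs_id module_homs_id] U.comult_U_closed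
    by (simp add: lift_iso_def unitriangular_id)
qed

lemma lift_iso_comp:
  assumes "lifting K B G U" "lift_iso U V \<theta>" "lift_iso V W \<eta>"
  shows "lift_iso U W (\<lambda>x. \<eta> (\<theta> x))"
proof -
  interpret U: lifting K B G U by fact
  have u: "unitriangular \<theta>" "unitriangular \<eta>" using assms by (auto simp: lift_iso_def)
  note \<theta> = unitriangularD(1)[OF u(1)] and \<eta> = unitriangularD(1)[OF u(2)]
  have 1: "\<theta> \<one>\<^bsub>U\<^esub> = \<one>\<^bsub>V\<^esub>" "\<eta> \<one>\<^bsub>V\<^esub> = \<one>\<^bsub>W\<^esub>" using assms(2,3) by (simp_all add: lift_iso_def)
  have m: "\<theta> (x \<otimes>\<^bsub>U\<^esub> y) = \<theta> x \<otimes>\<^bsub>V\<^esub> \<theta> y" "\<eta> (x \<otimes>\<^bsub>V\<^esub> y) = \<eta> x \<otimes>\<^bsub>W\<^esub> \<eta> y"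
    if "x \<in> carrier B" "y \<in> carrier B" for x y
    using assms(2,3) that by (simp_all add: lift_iso_def)
  have ce: "counit V (\<theta> x) = counit U x" "counit W (\<eta> x) = counit V x" if "x \<in> carrier B" for x
    using assms(2,3) that by (simp_all add: lift_iso_def)
  have cm: "comult V (\<theta> x) = tensor_map K B B \<theta> \<theta> (comult U x)" "comult W (\<eta> x) = tensor_map K B B \<eta> \<eta> (comult V x)"
    if "x \<in> carrier B" for x
    using assms(2,3) that by (simp_all add: lift_iso_def)
  note c = module_homs_closed[OF \<theta>]
  show ?thesis
    unfolding lift_iso_def
  proof (intro conjI ballI unitriangular_comp[OF u])
    show "\<eta> (\<theta> \<one>\<^bsub>U\<^esub>) = \<one>\<^bsub>W\<^esub>" by (simp only: 1)
  next
    fix x assume x: "x \<in> carrier B"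
    show "counit W (\<eta> (\<theta> x)) = counit U x" using ce(1)[OF x] ce(2)[OF c[OF x]] by simp
    show "comult W (\<eta> (\<theta> x)) = tensor_map K B B (\<lambda>x. \<eta> (\<theta> x)) (\<lambda>x. \<eta> (\<theta> x)) (comult U x)"
      unfolding cm(2)[OF c[OF x]] cm(1)[OF x]
      by (rule SQ.GT.PTP.TP.tensor_map_comp[OF B_module B_module \<theta> \<theta> B_module B_module \<eta> \<eta> U.comult_U_closed[OF x]])
    fix y assume y: "y \<in> carrier B"
    show "\<eta> (\<theta> (x \<otimes>\<^bsub>U\<^esub> y)) = \<eta> (\<theta> x) \<otimes>\<^bsub>W\<^esub> \<eta> (\<theta> y)"
      unfolding m(1)[OF x y] by (rule m(2)[OF c[OF x] c[OF y]])
  qed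
qed

lemma lift_iso_inverse:
  assumes "lifting K B G U" "lifting K B G V" "lift_iso U V \<theta>"
  shows "lift_iso V U (inverse_map \<theta>)"
proof -
  interpret U: lifting K B G U by fact
  interpret V: lifting K B G V by fact
  have u: "unitriangular \<theta>" using assms by (auto simp: lift_iso_def)
  note i = inverse_map[OF u] and ui = unitriangular_inverse[OF u]
  note \<theta> = unitriangularD(1)[OF u] and \<iota> = unitriangularD(1)[OF ui]
  have m: "\<theta> (x \<otimes>\<^bsub>U\<^esub> y) = \<theta> x \<otimes>\<^bsub>V\<^esub> \<theta> y" if "x \<in> carrier B" "y \<in> carrier B" for x y
    using assms(3) that by (simp add: lift_iso_def)
  have o: "\<theta> \<one>\<^bsub>U\<^esub> = \<one>\<^bsub>V\<^esub>" using assms(3) by (simp add: lift_iso_def)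
  have ce: "counit V (\<theta> x) = counit U x" if "x \<in> carrier B" for x using assms(3) that by (simp add: lift_iso_def)
  have cm: "comult V (\<theta> x) = tensor_map K B B \<theta> \<theta> (comult U x)" if "x \<in> carrier B" for x
    using assms(3) that by (simp add: lift_iso_def)
  have "tensor_map K B B (inverse_map \<theta>) (inverse_map \<theta>) (tensor_map K B B \<theta> \<theta> w) = w" if w: "w \<in> carrier TB" for w
    using SQ.GT.PTP.TP.tensor_map_comp[OF B_module B_module \<theta> \<theta> B_module B_module \<iota> \<iota> w]
      SQ.GT.PTP.TP.tensor_map_ident[OF module_homs_comp[OF \<theta> \<iota>] module_homs_comp[OF \<theta> \<iota>] i(3) i(3) w] by simp
  then have "comult U (inverse_map \<theta> x) = tensor_map K B B (inverse_map \<theta>) (inverse_map \<theta>) (comult V x)" if "x \<in> carrier B" for x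
    using cm[OF i(1)[OF that]] i(1,2)[OF that] U.comult_U_closed by simp
  moreover have "inverse_map \<theta> (x \<otimes>\<^bsub>V\<^esub> y) = inverse_map \<theta> x \<otimes>\<^bsub>U\<^esub> inverse_map \<theta> y" if "x \<in> carrier B" "y \<in> carrier B" for x y
    using m[OF i(1)[OF that(1)] i(1)[OF that(2)]] i(2)[OF that(1)] i(2)[OF that(2)]
      i(3)[OF U.U_mult_closed[OF i(1)[OF that(1)] i(1)[OF that(2)]]] by simp
  moreover have "inverse_map \<theta> \<one>\<^bsub>V\<^esub> = \<one>\<^bsub>U\<^esub>" using o i(3)[of "\<one>\<^bsub>U\<^esub>"] PB.one_closed_A by (simp add: U.one_eq)
  moreover have "counit U (inverse_map \<theta> x) = counit V x" if "x \<in> carrier B" for x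
    using ce[OF i(1)[OF that]] i(2)[OF that] by simp
  ultimately show ?thesis using ui by (simp add: lift_iso_def)
qed

lemma lifting_equiv_equiv: "equiv (liftings K B G) (lifting_equiv K B G)"
proof (rule equivI)
  show "lifting_equiv K B G \<subseteq> liftings K B G \<times> liftings K B G"
    by (auto simp: lifting_equiv_def)
  show "refl_on (liftings K B G) (lifting_equiv K B G)"
    by (rule refl_onI) (auto simp: lifting_equiv_iff liftings_iff intro: lift_iso_id)
  show "sym (lifting_equiv K B G)"
    by (rule symI) (auto simp: lifting_equiv_iff intro: lift_iso_inverse)
  show "trans (lifting_equiv K B G)"
    by (rule transI) (auto simp: lifting_equiv_iff intro: lift_iso_comp)
qed

subsection \<open>Transport of a lifting along a unitriangular map\<close>

text \<open>
  The structure for which \<open>\<theta>\<close> becomes an isomorphism from \<open>U\<close>. The unit and the counit are taken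
  over from \<open>B\<close>, which is correct when \<open>\<theta>\<close> maps those of \<open>U\<close> to them.
\<close>

definition transport :: "('k, 'b) bialg \<Rightarrow> ('b \<Rightarrow> 'b) \<Rightarrow> ('k, 'b) bialg" where
  "transport U \<theta> = B\<lparr>mult := (\<lambda>x y. \<theta> (inverse_map \<theta> x \<otimes>\<^bsub>U\<^esub> inverse_map \<theta> y)),
     comult := (\<lambda>x. tensor_map K B B \<theta> \<theta> (comult U (inverse_map \<theta> x)))\<rparr>"

lemma transport_lifting:
  assumes "lifting K B G U" and u: "unitriangular \<theta>" and o: "\<theta> \<one>\<^bsub>B\<^esub> = \<one>\<^bsub>B\<^esub>"
    and ce: "\<And>x. x \<in> carrier B \<Longrightarrow> counit B (\<theta> x) = counit U x"
  shows "lifting K B G (transport U \<theta>)" "lift_iso U (transport U \<theta>) \<theta>"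
proof -
  interpret U: lifting K B G U by fact
  let ?V = "transport U \<theta>"
  have V_simps: "carrier ?V = carrier B" "zero ?V = zero B" "add ?V = add B" "smult ?V = smult B" "one ?V = one B"
    "counit ?V = counit B" "mult ?V = (\<lambda>x y. \<theta> (inverse_map \<theta> x \<otimes>\<^bsub>U\<^esub> inverse_map \<theta> y))"
    "comult ?V = (\<lambda>x. tensor_map K B B \<theta> \<theta> (comult U (inverse_map \<theta> x)))"
    by (simp_all add: transport_def)
  interpret SV: same_module K B G ?V by unfold_locales (simp_all add: V_simps)
  note i = inverse_map[OF u] and ui = unitriangular_inverse[OF u]
  note \<theta> = unitriangularD(1)[OF u] and \<iota> = unitriangularD(1)[OF ui]
  note sq = square_hom[OF \<theta> \<theta>]
  have m: "\<theta> (x \<otimes>\<^bsub>U\<^esub> y) = \<theta> x \<otimes>\<^bsub>?V\<^esub> \<theta> y" if "x \<in> carrier B" "y \<in> carrier B" for x y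
    using that by (simp add: V_simps i(3))
  have cm: "comult ?V (\<theta> x) = tensor_map K B B \<theta> \<theta> (comult U x)" if "x \<in> carrier B" for x
    using that by (simp add: V_simps i(3))
  show iso: "lift_iso U ?V \<theta>"
    using u o ce m cm by (simp add: lift_iso_def U.one_eq V_simps)
  have pre: "prebialgebra K ?V"
  proof (intro prebialgebra.intro SV.module_U prebialgebra_axioms.intro)
    note ml = bilinear_maps_left[OF U.mult_U_bilinear] and mr = bilinear_maps_right[OF U.mult_U_bilinear]
    show "mult ?V \<in> bilinear_maps K ?V ?V ?V"
      unfolding SV.bilinear_U unfolding V_simps
      by (intro bilinear_mapsI module_homs_comp[OF \<iota> module_homs_comp[OF ml \<theta>]] module_homs_comp[OF \<iota> module_homs_comp[OF mr \<theta>]] i(1))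
    show "comult ?V \<in> module_homs K ?V (tensor K ?V ?V)"
      unfolding SV.tensor_U SV.module_homs_U unfolding V_simps
      by (rule module_homs_comp[OF module_homs_comp[OF \<iota> U.comult_U_hom] sq])
  qed (use PB.counit_additive PB.one_closed_A PB.counit_smult_A in \<open>simp_all add: SV.additive_U V_simps\<close>)
  interpret PV: prebialgebra K ?V by (rule pre)
  have \<theta>s: "\<theta> \<in> semilinear_maps K (\<lambda>r. r) U ?V"
    using \<theta> by (simp add: module_homs_semilinear[symmetric] U.module_homs_U SV.module_homs_U)
  have idr: "(\<lambda>r. r) \<in> ring_hom K K" by (auto simp: ring_hom_def)
  have st: "semi_tensor K (\<lambda>r. r) K ?V ?V \<theta> \<theta> w = tensor_map K B B \<theta> \<theta> w" if w: "w \<in> carrier TB" for w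
  proof -
    note s1 = U.UP.TP.semi_tensor_semilinear[OF idr SV.module_U SV.module_U \<theta>s \<theta>s]
      and s2 = U.UP.TP.semi_tensor_tens[OF idr SV.module_U SV.module_U \<theta>s \<theta>s]
    note s3 = semilinear_maps_additive[OF s1, unfolded SV.tensor_U U.tensor_U]
    show ?thesis
      by (rule SQ.GT.PTP.TP.tensor_maps_eqI[OF TB_group s3 module_homs_additive[OF sq] w])
         (simp add: square_tens[OF \<theta> \<theta>] s2[unfolded U.carrier_U U.tens_U SV.tens_U])
  qed
  interpret E: bialgebra_morphism K U K ?V "\<lambda>r. r" \<theta>
  proof (intro bialgebra_morphism.intro U.UP.prebialgebra_axioms pre bialgebra_morphism_axioms.intro idr \<theta>s)
    show "\<theta> \<one>\<^bsub>U\<^esub> = \<one>\<^bsub>?V\<^esub>" using o by (simp add: U.one_eq V_simps)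
  next
    fix x assume "x \<in> carrier U"
    then have x: "x \<in> carrier B" by (simp add: U.carrier_U)
    show "counit U x = counit ?V (\<theta> x)" using ce[OF x] by (simp add: V_simps)
    show "semi_tensor K (\<lambda>r. r) K ?V ?V \<theta> \<theta> (comult U x) = comult ?V (\<theta> x)"
      using st[OF U.comult_U_closed[OF x]] cm[OF x] by simp
    fix y assume "y \<in> carrier U"
    then have y: "y \<in> carrier B" by (simp add: U.carrier_U)
    show "\<theta> (x \<otimes>\<^bsub>U\<^esub> y) = \<theta> x \<otimes>\<^bsub>?V\<^esub> \<theta> y" by (rule m[OF x y])
  qed
  have bi: "bialgebra K ?V"
  proof (rule E.bialgebra_pushforward[OF U.U_bialgebra])
    show "carrier ?V = additive_span ?V E.generators"
    proof
      show "additive_span ?V E.generators \<subseteq> carrier ?V"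
        by (rule additive_span_subset[OF PV.A.M.abelian_group_axioms]) (auto simp: E.f_closed)
      show "carrier ?V \<subseteq> additive_span ?V E.generators"
      proof
        fix x assume x: "x \<in> carrier ?V"
        then have "x = \<one>\<^bsub>K\<^esub> \<odot>\<^bsub>?V\<^esub> \<theta> (inverse_map \<theta> x)" "inverse_map \<theta> x \<in> carrier U"
          using i by (simp_all add: V_simps U.carrier_U)
        then show "x \<in> additive_span ?V E.generators" by (intro additive_span.base) blast
      qed
    qed
  qed
  show "lifting K B G ?V"
  proof (intro lifting.intro filtered_lift.intro SV.same_module_axioms filtered_lift_axioms.intro lifting_axioms.intro bi)
    show "\<one>\<^bsub>?V\<^esub> \<in> BG.F 0" using one_degree BG.H_subset_F[of 0 0] by (auto simp: V_simps homogeneous_eq_G)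
    show "x \<otimes>\<^bsub>?V\<^esub> y \<in> BG.F (i + j)" if "x \<in> BG.F i" "y \<in> BG.F j" for x y i j
      unfolding V_simps using that by (intro unitriangularD(2)[OF u] U.U_mult unitriangularD(2)[OF ui])
    show "comult ?V x \<in> SQ.GT.T.F n" if "x \<in> BG.F n" for x n
      unfolding V_simps using that by (intro tensor_square_unitriangular(1)[OF u] U.U_comult unitriangularD(2)[OF ui])
    show "\<one>\<^bsub>?V\<^esub> = \<one>\<^bsub>B\<^esub>" by (simp add: V_simps)
    show "counit ?V x = counit B x" for x by (simp add: V_simps)
    have GF: "x \<in> BG.F n" if "x \<in> G n" for x n using that BG.H_subset_F[of n n] by (auto simp: homogeneous_eq_G)
    show "proj (i + j) (x \<otimes>\<^bsub>?V\<^esub> y) = x \<otimes>\<^bsub>B\<^esub> y" if x: "x \<in> G i" and y: "y \<in> G j" for x y i j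
    proof -
      note ix = unitriangularD(2)[OF ui GF[OF x]] and iy = unitriangularD(2)[OF ui GF[OF y]]
      have "proj (i + j) (\<theta> (inverse_map \<theta> x \<otimes>\<^bsub>U\<^esub> inverse_map \<theta> y)) = proj (i + j) (inverse_map \<theta> x \<otimes>\<^bsub>U\<^esub> inverse_map \<theta> y)"
        by (rule unitriangular_leading[OF u U.U_mult[OF ix iy]])
      also have "\<dots> = proj (i + j) (x \<otimes>\<^bsub>U\<^esub> y)"
        using U.leading_mult[OF ix iy] unitriangularD(3)[OF ui x] unitriangularD(3)[OF ui y] by simp
      also have "\<dots> = x \<otimes>\<^bsub>B\<^esub> y" by (rule U.mult_leading[OF x y])
      finally show ?thesis by (simp add: V_simps)
    qed
    show "projT n (comult ?V x) = comult B x" if x: "x \<in> G n" for x n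
    proof -
      note ix = unitriangularD(2)[OF ui GF[OF x]]
      have "projT n (tensor_map K B B \<theta> \<theta> (comult U (inverse_map \<theta> x))) = projT n (comult U (inverse_map \<theta> x))"
        by (rule tensor_square_unitriangular(2)[OF u U.U_comult[OF ix]])
      also have "\<dots> = projT n (comult U (proj n (inverse_map \<theta> x)))"
        by (rule DB.filtered_leading[OF module_homs_additive[OF U.comult_U_hom] U.U_comult ix])
      also have "\<dots> = comult B x" using unitriangularD(3)[OF ui x] U.comult_leading[OF x] by simp
      finally show ?thesis by (simp add: V_simps)
    qed
  qed
qed

text \<open>
  The difference \<open>\<epsilon>\<^sub>U - \<epsilon>\<close> vanishes in degree \<open>0\<close>. Hence \<open>b \<mapsto> b + (\<epsilon>\<^sub>U(b) - \<epsilon>(b)) 1\<close>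
  changes elements of positive degree by elements of degree \<open>0\<close> only, and it carries \<open>\<epsilon>\<^sub>U\<close> to
  \<open>\<epsilon>\<close>.
\<close>

lemma lifting_normalize:
  assumes "lifting K B G U"
  obtains \<theta> where "lifting K B G (transport U \<theta>)" "lift_iso U (transport U \<theta>) \<theta>"
proof -
  interpret U: lifting K B G U by fact
  let ?d = "\<lambda>x. counit U x \<ominus>\<^bsub>K\<^esub> counit B x"
  let ?\<theta> = "\<lambda>x. x \<oplus>\<^bsub>B\<^esub> ?d x \<odot>\<^bsub>B\<^esub> \<one>\<^bsub>B\<^esub>"
  have eU: "counit U x \<in> carrier K" if "x \<in> carrier B" for x using U.UP.counit_closed that by (simp add: U.carrier_U)
  have dc: "?d x \<in> carrier K" if "x \<in> carrier B" for x using eU[OF that] PB.counit_closed[OF that] by simp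
  have dadd: "?d (x \<oplus>\<^bsub>B\<^esub> y) = ?d x \<oplus>\<^bsub>K\<^esub> ?d y" if xy: "x \<in> carrier B" "y \<in> carrier B" for x y
  proof -
    have "counit U (x \<oplus>\<^bsub>B\<^esub> y) = counit U x \<oplus>\<^bsub>K\<^esub> counit U y" using U.UP.counit_add[of x y] xy by (simp add: U.carrier_U U.add_U)
    then show ?thesis using eU xy PB.counit_closed PB.counit_add
      by (simp add: a_minus_def R.minus_add R.a_ac)
  qed
  have dsm: "?d (r \<odot>\<^bsub>B\<^esub> x) = r \<otimes>\<^bsub>K\<^esub> ?d x" if rx: "r \<in> carrier K" "x \<in> carrier B" for r x
  proof -
    have "counit U (r \<odot>\<^bsub>B\<^esub> x) = r \<otimes>\<^bsub>K\<^esub> counit U x" using U.UP.counit_smult_A[of r x] rx by (simp add: U.carrier_U U.smult_U)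
    then show ?thesis using eU rx PB.counit_closed PB.counit_smult_A
      by (simp add: a_minus_def R.r_distr R.r_minus)
  qed
  note one = PB.one_closed_A
  have one0: "\<one>\<^bsub>B\<^esub> \<in> BG.F n" for n using one_degree BG.H_subset_F[of 0 n] by (auto simp: homogeneous_eq_G)
  have dhom: "(\<lambda>x. ?d x \<odot>\<^bsub>B\<^esub> \<one>\<^bsub>B\<^esub>) \<in> module_homs K B B"
    by (intro module_homsI additive_mapsI) (simp_all add: dc dadd dsm one smult_l_distr smult_assoc1)
  have d0: "?d x = \<zero>\<^bsub>K\<^esub>" if "x \<in> G 0" for x
    using U.counit_G0[OF that] PB.counit_closed[OF G_closed[OF that]] by (simp add: a_minus_def R.r_neg)
  have u: "unitriangular ?\<theta>"
    unfolding unitriangular_def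
  proof (intro conjI allI ballI)
    show "?\<theta> \<in> module_homs K B B" by (rule module_homs_plus[OF B_module module_homs_id dhom])
    show "?\<theta> x \<in> BG.F n" if x: "x \<in> BG.F n" for x n
      using BG.F_add[OF x BG.F_smult[OF dc[OF BG.F_closed[OF x]] one0]] .
    show "proj n (?\<theta> x) = x" if x: "x \<in> G n" for x n
    proof (cases "n = 0")
      case True
      then show ?thesis using d0[of x] x one G_closed[OF x] proj_of_G[OF x, of n] by simp
    next
      case False
      then show ?thesis
        using x one G_closed[OF x] dc[OF G_closed[OF x]] proj_of_G[OF x, of n] proj_of_G[OF one_degree, of n]
        by (simp add: module_homs_add[OF BG.proj_hom] module_homs_smult[OF BG.proj_hom])
    qed
  qed
  have o: "?\<theta> \<one>\<^bsub>B\<^esub> = \<one>\<^bsub>B\<^esub>" using d0[OF one_degree] one by simp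
  have ce: "counit B (?\<theta> x) = counit U x" if x: "x \<in> carrier B" for x
  proof -
    have "counit B (?\<theta> x) = counit B x \<oplus>\<^bsub>K\<^esub> ?d x"
      using x dc[OF x] one ring_hom_one[OF counit_ring_hom] by (simp add: PB.counit_add PB.counit_smult_A)
    then show ?thesis using eU[OF x] PB.counit_closed[OF x]
        R.a_lcomm[of "counit B x" "counit U x" "\<ominus>\<^bsub>K\<^esub> counit B x"]
      by (simp add: a_minus_def R.r_neg)
  qed
  show ?thesis using transport_lifting[OF assms u o ce] that by blast
qed

end

section \<open>The deformation of a lifting\<close>

text \<open>
  The bialgebra \<open>U[t]\<close> with coefficientwise structure maps is generated over \<open>K[t]\<close> by the
  constants, so its axioms follow from those of \<open>U\<close>.
\<close>

lemma trivial_deformation_bialgebra: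
  fixes K :: "('k, 'x) ring_scheme" and U :: "('k, 'b) bialg"
  assumes "bialgebra K U"
  defines "m \<equiv> \<lambda>w n. tensor_lift K U (mult U) (w n)" and "d \<equiv> \<lambda>p n. comult U (p n)"
  shows "predeformation K U m d" and "bialgebra (UP K) (deformation_bialgebra K U (m, d))"
proof -
  interpret U: bialgebra K U by fact
  interpret P: prebialgebra K U by (rule U.prebialgebra)
  note m1 = P.TP.tensor_lift_hom[OF U.module_axioms P.mult_bilinear] and m1t = P.TP.tensor_lift_tens[OF U.module_axioms P.mult_bilinear]
  show pre: "predeformation K U m d"
    unfolding m_def d_def
    by (intro predeformation.intro P.prebialgebra_axioms predeformation_axioms.intro
        coeffwise_hom(1)[OF P.TP.module_T U.module_axioms m1] coeffwise_hom(1)[OF U.module_axioms P.TP.module_T P.comult_hom])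
  interpret Q: predeformation K U m d by (rule pre)
  note single = Q.PP.Mp.Pf.fsingle_closed[OF UNIV_I]
  have st: "semi_tensor K (fsingle K 0) (UP K) Q.Dt Q.Dt (fsingle U 0) (fsingle U 0) = Q.PP.const_tensor"
    unfolding semi_tensor_def Q.tensor_Dt Q.tens_Dt ..
  interpret E: bialgebra_morphism K U "UP K" Q.Dt "fsingle K 0" "fsingle U 0"
  proof (intro bialgebra_morphism.intro P.prebialgebra_axioms Q.prebialgebra_Dt bialgebra_morphism_axioms.intro Q.PP.Mp.const_ring_hom)
    show "fsingle U 0 \<in> semilinear_maps K (fsingle K 0) U Q.Dt"
      using Q.PP.Mp.const_semilinear by (simp add: semilinear_maps_def Q.additive_Dt Q.Dt_simps)
    show "fsingle U 0 \<one>\<^bsub>U\<^esub> = \<one>\<^bsub>Q.Dt\<^esub>" by (simp add: Q.Dt_simps)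
  next
    fix x assume x: "x \<in> carrier U"
    show "fsingle K 0 (counit U x) = counit Q.Dt (fsingle U 0 x)"
      unfolding Q.Dt_simps Q.counit_Dt_fsingle ..
    have c: "Q.PP.const_tensor (comult U x) \<in> carrier Q.PP.TT.T"
      by (rule additive_maps_closed[OF Q.PP.const_tensor_additive P.comult_closed[OF x]])
    show "semi_tensor K (fsingle K 0) (UP K) Q.Dt Q.Dt (fsingle U 0) (fsingle U 0) (comult U x) = comult Q.Dt (fsingle U 0 x)"
    proof (rule inj_onD[OF Q.PP.PT_inj])
      show "Q.PP.PT (semi_tensor K (fsingle K 0) (UP K) Q.Dt Q.Dt (fsingle U 0) (fsingle U 0) (comult U x)) = Q.PP.PT (comult Q.Dt (fsingle U 0 x))"
        unfolding st Q.PP.PT_const_tensor[OF P.comult_closed[OF x]] Q.comult_Dt(2)[OF single[OF x]]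
        unfolding d_def coeffwise_hom(2)[OF U.module_axioms P.TP.module_T P.comult_hom x] ..
    qed (use c st Q.comult_Dt(3)[OF single[OF x]] in auto)
    fix y assume y: "y \<in> carrier U"
    show "fsingle U 0 (x \<otimes>\<^bsub>U\<^esub> y) = fsingle U 0 x \<otimes>\<^bsub>Q.Dt\<^esub> fsingle U 0 y"
      unfolding Q.Dt_simps Q.PP.poly_tensor_fsingle[OF x y]
      unfolding m_def coeffwise_hom(2)[OF P.TP.module_T U.module_axioms m1 P.TP.tens_closed[OF x y]] m1t[OF x y] by simp
  qed
  show "bialgebra (UP K) Q.Dt"
  proof (rule E.bialgebra_pushforward[OF assms(1)])
    have gcl: "E.generators \<subseteq> carrier Q.Dt" by (auto simp: E.f_closed)
    show "carrier Q.Dt = additive_span Q.Dt E.generators"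
    proof
      show "additive_span Q.Dt E.generators \<subseteq> carrier Q.Dt"
        by (rule additive_span_subset[OF Q.Dt.A.M.abelian_group_axioms gcl])
      show "carrier Q.Dt \<subseteq> additive_span Q.Dt E.generators"
      proof
        fix p assume "p \<in> carrier Q.Dt"
        then have "p \<in> additive_span Q.Ut {fsingle U s x | s x. s \<in> UNIV \<and> x \<in> carrier U}"
          using Q.PP.Mp.Pf.carrier_eq_span by (simp add: Q.Dt_simps)
        then show "p \<in> additive_span Q.Dt E.generators"
        proof induction
          case zero
          then show ?case using additive_span.zero[of Q.Dt] by (simp add: Q.Dt_simps)
        next
          case (base p)
          then obtain i x where px: "p = fsingle U i x" "x \<in> carrier U" by blast
          then have "p = fsingle K i \<one>\<^bsub>K\<^esub> \<odot>\<^bsub>Q.Dt\<^esub> fsingle U 0 x" by (simp add: Q.Dt_simps Q.PP.Mp.t_power_const)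
          moreover have "fsingle K i \<one>\<^bsub>K\<^esub> \<in> carrier (UP K)" by (simp add: Q.PP.Mp.Kt.fsingle_closed)
          ultimately show ?case using px(2) by (intro additive_span.base) blast
        next
          case (add p q)
          then show ?case using additive_span.add[of p Q.Dt E.generators q] by (simp add: Q.Dt_simps)
        qed
      qed
    qed
  qed
qed

context graded_bialgebra
begin

sublocale GT3: graded_tensor K B proj TB projT by unfold_locales

abbreviation "Bt \<equiv> poly_module K B"
abbreviation "TTt \<equiv> tensor (UP K) Bt Bt"
abbreviation "PT2 \<equiv> poly_tensor_map K B B"

text \<open>
  The counit vanishes in positive degrees, and in degree \<open>0\<close> the Rees embedding changes nothing.
\<close>

lemma counit_psi:
  assumes p: "p \<in> carrier Bt" shows "(\<lambda>j. counit B (BG.psi p j)) = (\<lambda>j. counit B (p j))"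
proof -
  have K0: "(\<lambda>p j. counit B (p j)) \<in> additive_maps Bt (UP K)"
  proof -
    interpret P0: predeformation K B "\<lambda>w n. tensor_lift K B (mult B) (w n)" "\<lambda>p n. comult B (p n)"
      by (rule trivial_deformation_bialgebra(1)) unfold_locales
    show ?thesis by (rule P0.counit_Dt_additive)
  qed
  have cz: "counit B \<zero>\<^bsub>B\<^esub> = \<zero>\<^bsub>K\<^esub>"
    by (rule additive_maps_zero[OF B_group R.abelian_group_axioms PB.counit_additive])
  show ?thesis
  proof (rule BG.poly_graded_maps_eqI[OF BG.Kt.group_P additive_maps_comp[OF BG.psi_additive K0] K0 p])
    fix d j x assume x: "x \<in> BG.H d"
    then have "counit B x = \<zero>\<^bsub>K\<^esub>" if "d > 0" using counit_degree[OF that] by (simp add: homogeneous_eq_G)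
    then show "(\<lambda>i. counit B (BG.psi (fsingle B j x) i)) = (\<lambda>i. counit B (fsingle B j x i))"
      unfolding BG.psi_fsingle[OF x] by (cases "d = 0") (auto simp: fsingle_def cz)
  qed
qed

text \<open>
  The tensor cube of the Rees embedding is injective: after identifying
  \<open>B[t] \<otimes> (B[t] \<otimes> B[t])\<close> with \<open>(B \<otimes> (B \<otimes> B))[t]\<close> it becomes the Rees embedding of
  the graded module \<open>B \<otimes> (B \<otimes> B)\<close>. The module \<open>C\<close> is \<open>B[t]\<close> with a different
  multiplicative structure.
\<close>

lemma tensor3_inj:
  assumes "module (UP K) C" and C: "carrier C = carrier Bt" "add C = add Bt" "smult C = smult Bt"
    and f2: "f2 \<in> semilinear_maps (UP K) (\<lambda>r. r) TTt (tensor (UP K) C C)"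
    and f2_PT: "\<And>w. w \<in> carrier TTt \<Longrightarrow> PT2 (f2 w) = SQ.GT.T.psi (PT2 w)"
    and psi: "BG.psi \<in> semilinear_maps (UP K) (\<lambda>r. r) Bt C"
  shows "inj_on (semi_tensor (UP K) (\<lambda>r. r) (UP K) C (tensor (UP K) C C) BG.psi f2) (carrier (tensor (UP K) Bt TTt))"
proof -
  let ?Tt = "poly_module K TB"
  have TC: "tensor (UP K) C C = TTt" by (rule tensor_module_cong) (simp_all add: C)
  have TC3: "tensor (UP K) C TTt = tensor (UP K) Bt TTt" by (rule tensor_module_cong) (simp_all add: C)
  have tC3: "tens (UP K) C TTt = tens (UP K) Bt TTt" by (rule tens_module_cong) (simp_all add: C)
  interpret S3: tensor_product "UP K" Bt TTt
    using BG.module_Mt SQ.GT.PTP.TT.module_T by (rule tensor_product.intro)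
  have idr: "(\<lambda>r. r) \<in> ring_hom (UP K) (UP K)" by (auto simp: ring_hom_def)
  let ?f3 = "semi_tensor (UP K) (\<lambda>r. r) (UP K) C (tensor (UP K) C C) BG.psi f2"
  have f2': "f2 \<in> semilinear_maps (UP K) (\<lambda>r. r) TTt TTt" using f2 by (simp add: TC)
  note f3h = S3.semi_tensor_semilinear[OF idr assms(1) SQ.GT.PTP.TT.module_T psi f2', folded TC, unfolded TC TC3]
  note f3t = S3.semi_tensor_tens[OF idr assms(1) SQ.GT.PTP.TT.module_T psi f2', unfolded tC3]
  note PTh = SQ.GT.PTP.PT_hom and PIh = SQ.GT.PTP.PT_inv_hom
  note Ttm = SQ.GT.PTP.Tp.module_Mt
  let ?J = "tensor_map (UP K) Bt ?Tt (\<lambda>x. x) PT2"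
  let ?J' = "tensor_map (UP K) Bt TTt (\<lambda>x. x) SQ.GT.PTP.PT_inv"
  note Jh = S3.tensor_map_hom[OF BG.module_Mt Ttm module_homs_id PTh]
  note Jt = S3.tensor_map_tens[OF BG.module_Mt Ttm module_homs_id PTh]
  have J'J: "?J' (?J w) = w" if w: "w \<in> carrier S3.T" for w
  proof -
    have "?J' (?J w) = tensor_map (UP K) Bt TTt (\<lambda>x. x) (\<lambda>y. SQ.GT.PTP.PT_inv (PT2 y)) w"
      by (rule S3.tensor_map_comp[OF BG.module_Mt Ttm module_homs_id PTh BG.module_Mt SQ.GT.PTP.TT.module_T module_homs_id PIh w])
    also have "\<dots> = w"
      by (rule S3.tensor_map_ident[OF module_homs_id module_homs_comp[OF PTh PIh] _ _ w]) (simp_all add: SQ.GT.PTP.PT_inv_PT)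
    finally show ?thesis .
  qed
  note P3h = GT3.PTP.PT_hom and P3i = GT3.PTP.PT_inj
  let ?L = "\<lambda>w. GT3.T.psi (poly_tensor_map K B TB (?J w))"
  have f3_closed: "?f3 w \<in> carrier S3.T" if "w \<in> carrier S3.T" for w
    using additive_maps_closed[OF semilinear_maps_additive[OF f3h] that] by (simp add: TC)
  have f3_add: "?f3 \<in> additive_maps S3.T S3.T"
    using semilinear_maps_additive[OF f3h] by (simp add: TC)
  have eq: "poly_tensor_map K B TB (?J (?f3 w)) = ?L w" if w: "w \<in> carrier S3.T" for w
  proof (rule S3.tensor_maps_eqI[OF GT3.PTP.Tp.Pf.group_P _ _ w])
    show "(\<lambda>w. poly_tensor_map K B TB (?J (?f3 w))) \<in> additive_maps S3.T GT3.PTP.Tp.Mt"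
      by (rule additive_maps_comp[OF f3_add additive_maps_comp[OF module_homs_additive[OF Jh] module_homs_additive[OF P3h]]])
    show "?L \<in> additive_maps S3.T GT3.PTP.Tp.Mt"
      by (rule additive_maps_comp[OF additive_maps_comp[OF module_homs_additive[OF Jh] module_homs_additive[OF P3h]] GT3.T.psi_additive])
    fix p v assume p: "p \<in> carrier Bt" and v: "v \<in> carrier TTt"
    note pc = additive_maps_closed[OF BG.psi_additive p]
    have fv: "f2 v \<in> carrier TTt" using additive_maps_closed[OF semilinear_maps_additive[OF f2'] v] .
    have Pv: "PT2 v \<in> carrier ?Tt" by (rule module_homs_closed[OF PTh v])
    have Pv': "SQ.GT.T.psi (PT2 v) \<in> carrier ?Tt" by (rule additive_maps_closed[OF SQ.GT.T.psi_additive Pv])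
    have "?J (?f3 (tens (UP K) Bt TTt p v)) = tens (UP K) Bt ?Tt (BG.psi p) (SQ.GT.T.psi (PT2 v))"
      using f3t[OF p v] Jt[OF pc fv] by (simp add: TC f2_PT[OF v])
    then have "poly_tensor_map K B TB (?J (?f3 (tens (UP K) Bt TTt p v))) = poly_tensor K B TB (BG.psi p) (SQ.GT.T.psi (PT2 v))"
      by (simp add: GT3.PTP.PT_tens[OF pc Pv'])
    also have "\<dots> = GT3.T.psi (poly_tensor K B TB p (PT2 v))" by (rule GT3.psi_poly_tensor[OF p Pv, symmetric])
    also have "\<dots> = ?L (tens (UP K) Bt TTt p v)" by (simp add: Jt[OF p v] GT3.PTP.PT_tens[OF p Pv])
    finally show "poly_tensor_map K B TB (?J (?f3 (tens (UP K) Bt TTt p v))) = ?L (tens (UP K) Bt TTt p v)" .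
  qed
  show ?thesis
  proof (rule inj_onI)
    fix u w assume u: "u \<in> carrier S3.T" and w: "w \<in> carrier S3.T" and e: "?f3 u = ?f3 w"
    have J: "?J u \<in> carrier GT3.PTP.TT.T" "?J w \<in> carrier GT3.PTP.TT.T" using module_homs_closed[OF Jh] u w by auto
    have "?L u = ?L w" using eq[OF u] eq[OF w] e by simp
    then have "poly_tensor_map K B TB (?J u) = poly_tensor_map K B TB (?J w)"
      using inj_onD[OF GT3.T.psi_inj] module_homs_closed[OF P3h] J by simp
    then have "?J u = ?J w" using inj_onD[OF P3i] J by simp
    from arg_cong[OF this, of ?J'] show "u = w" unfolding J'J[OF u] J'J[OF w] .
  qed
qed

end

text \<open>
  For such liftings the Rees embedding \<open>B[t] \<rightarrow> U[t]\<close> respects the counits.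
\<close>

locale normalized_lifting = lifting +
  assumes counit_eq: "x \<in> carrier B \<Longrightarrow> counit U x = counit B x"
begin

definition "m1 = tensor_lift K B (mult U)"
definition "mt = MB.rees_extension m1"
definition "\<Delta>t = DB.rees_extension (comult U)"

lemma m1_hom: "m1 \<in> module_homs K TB B" unfolding m1_def by (rule mult_lift_hom[OF mult_U_bilinear])
lemma m1_tens: "x \<in> carrier B \<Longrightarrow> y \<in> carrier B \<Longrightarrow> m1 (tens K B B x y) = x \<otimes>\<^bsub>U\<^esub> y"
  unfolding m1_def by (rule mult_lift_tens[OF mult_U_bilinear])

lemma m1_filtered: "w \<in> SQ.GT.T.F n \<Longrightarrow> m1 w \<in> BG.F n"
proof (induction rule: T_F_induct)
  case zero
  then show ?case
    using additive_maps_zero[OF TB_group B_group module_homs_additive[OF m1_hom]] by (simp add: BG.F_zero)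
next
  case (tens x y i j)
  then show ?case using U_mult BG.F_closed by (auto simp: m1_tens)
next
  case (add u v)
  then show ?case by (simp add: module_homs_add[OF m1_hom] BG.F_add)
qed

text \<open>
  The leading terms of products of homogeneous elements determine the symbol on all of
  \<open>B \<otimes> B\<close>.
\<close>

lemma m1_leading:
  assumes w: "w \<in> SQ.GT.T.H n" shows "proj n (m1 w) = tensor_lift K B (mult B) w"
proof -
  note Th = module_homs_additive[OF SQ.GT.tensor_proj_hom]
  note b = module_homs_additive[OF mult_lift_hom[OF PB.mult_bilinear]]
  have z: "m1 \<zero>\<^bsub>TB\<^esub> = \<zero>\<^bsub>B\<^esub>" "tensor_lift K B (mult B) \<zero>\<^bsub>TB\<^esub> = \<zero>\<^bsub>B\<^esub>"
    using additive_maps_zero[OF TB_group B_group module_homs_additive[OF m1_hom]]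
      additive_maps_zero[OF TB_group B_group b] by simp_all
  have "proj n (m1 (projT n w)) = tensor_lift K B (mult B) (projT n w)"
  proof (rule SQ.GT.homogeneous_tensor_eqI[OF B_group additive_maps_comp[OF Th additive_maps_comp[OF module_homs_additive[OF m1_hom] BG.proj_additive]]
        additive_maps_comp[OF Th b] SQ.GT.T.H_closed[OF w]])
    fix x y i j assume x: "x \<in> BG.H i" and y: "y \<in> BG.H j"
    note xc = BG.H_closed[OF x] and yc = BG.H_closed[OF y]
    show "proj n (m1 (projT n (tens K B B x y))) = tensor_lift K B (mult B) (projT n (tens K B B x y))"
      using mult_leading[of x i y j] x y
      by (simp add: SQ.GT.T.H_proj[OF SQ.GT.tens_homogeneous[OF x y]] z BG.proj_zero m1_tens[OF xc yc]
          mult_lift_tens[OF PB.mult_bilinear xc yc] homogeneous_eq_G)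
  qed
  then show ?thesis using SQ.GT.T.H_proj[OF w, of n] by simp
qed

lemma mt_hom: "mt \<in> module_homs (UP K) (poly_module K TB) Bt"
  unfolding mt_def by (rule MB.rees_extension_hom[OF m1_hom m1_filtered])
lemma \<Delta>t_hom: "\<Delta>t \<in> module_homs (UP K) Bt (poly_module K TB)"
  unfolding \<Delta>t_def by (rule DB.rees_extension_hom[OF comult_U_hom U_comult])

lemma mt_degree: "mt ` SQ.GT.T.Hp n \<subseteq> BG.Hp n"
  unfolding mt_def by (rule MB.rees_extension_degree[OF m1_hom m1_filtered])
lemma \<Delta>t_degree: "\<Delta>t ` BG.Hp n \<subseteq> SQ.GT.T.Hp n"
  unfolding \<Delta>t_def by (rule DB.rees_extension_degree[OF comult_U_hom U_comult])

lemma psi_mt: "w \<in> carrier (poly_module K TB) \<Longrightarrow> BG.psi (mt w) = (\<lambda>n. m1 (SQ.GT.T.psi w n))"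
  unfolding mt_def by (rule MB.psi_rees_extension[OF m1_hom m1_filtered])
lemma psi_\<Delta>t: "p \<in> carrier Bt \<Longrightarrow> SQ.GT.T.psi (\<Delta>t p) = (\<lambda>n. comult U (BG.psi p n))"
  unfolding \<Delta>t_def by (rule DB.psi_rees_extension[OF comult_U_hom U_comult])

lemma mt_at_one: "w \<in> carrier TB \<Longrightarrow> MB.at_one mt w = m1 w"
  unfolding mt_def by (rule MB.at_one_rees_extension[OF m1_hom m1_filtered])
lemma \<Delta>t_at_one: "x \<in> carrier B \<Longrightarrow> DB.at_one \<Delta>t x = comult U x"
  unfolding \<Delta>t_def by (rule DB.at_one_rees_extension[OF comult_U_hom U_comult])

lemma predeformation_D: "predeformation K B mt \<Delta>t"
  by (intro predeformation.intro prebialgebra_B predeformation_axioms.intro mt_hom \<Delta>t_hom)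

lemma poly_tensor_U: "poly_tensor K U U = poly_tensor K B B"
  unfolding poly_tensor_def tensor_U tens_U ..
lemma poly_tensor_map_U: "poly_tensor_map K U U = PT2"
  unfolding poly_tensor_map_def poly_tensor_U tensor_U ..
lemma fsingle_U: "fsingle U = fsingle B"
  unfolding fsingle_def[abs_def] zero_U ..

text \<open>
  The maps \<open>m\<^sub>t\<close> and \<open>\<Delta>\<^sub>t\<close> are made so that \<open>psi\<close> is a morphism from \<open>B[t]\<close> to the
  bialgebra \<open>U[t]\<close>. Since its tensor powers are injective, the axioms can be pulled back.
\<close>

lemma deformation_is_bialgebra: "bialgebra (UP K) (deformation_bialgebra K B (mt, \<Delta>t))"
proof -
  let ?m = "\<lambda>w n. tensor_lift K U (mult U) (w n)" and ?d = "\<lambda>p n. comult U (p n)"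
  interpret D: predeformation K B mt \<Delta>t by (rule predeformation_D)
  interpret Q: predeformation K U ?m ?d by (rule trivial_deformation_bialgebra(1)[OF U_bialgebra])
  have bQ: "bialgebra (UP K) Q.Dt" by (rule trivial_deformation_bialgebra(2)[OF U_bialgebra])
  let ?C = "Q.Dt"
  have C: "carrier ?C = carrier Bt" "zero ?C = zero Bt" "add ?C = add Bt" "smult ?C = smult Bt"
    "one ?C = fsingle B 0 \<one>\<^bsub>B\<^esub>" "counit ?C = (\<lambda>p j. counit U (p j))"
    "mult ?C = (\<lambda>p q n. m1 (poly_tensor K B B p q n))"
    unfolding Q.Dt_simps by (simp_all add: poly_module_U fsingle_U one_eq m1_def tensor_lift_U poly_tensor_U)
  have CPT: "PT2 (comult ?C p) = (\<lambda>n. comult U (p n))" "comult ?C p \<in> carrier TTt" if "p \<in> carrier Bt" for p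
    using Q.comult_Dt(2,3)[of p] that by (simp_all add: poly_module_U poly_tensor_map_U)
  have TC: "tensor (UP K) ?C ?C = TTt" by (rule tensor_module_cong) (simp_all add: C)
  have tC: "tens (UP K) ?C ?C = tens (UP K) Bt Bt" by (rule tens_module_cong) (simp_all add: C)
  have idr: "(\<lambda>r. r) \<in> ring_hom (UP K) (UP K)" by (auto simp: ring_hom_def)
  have psi_s: "BG.psi \<in> semilinear_maps (UP K) (\<lambda>r. r) Bt ?C"
    using BG.psi_hom unfolding module_homs_semilinear by (simp add: semilinear_maps_def additive_maps_def C)
  have psi_s': "BG.psi \<in> semilinear_maps (UP K) (\<lambda>r. r) D.Dt ?C"
    using psi_s by (simp add: semilinear_maps_def D.additive_Dt D.Dt_simps)
  have Cm: "module (UP K) ?C" by (rule Q.Dt.A.module_axioms)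
  let ?f2 = "semi_tensor (UP K) (\<lambda>r. r) (UP K) ?C ?C BG.psi BG.psi"
  note f2h = SQ.GT.PTP.TT.semi_tensor_semilinear[OF idr Cm Cm psi_s psi_s]
  note f2t = SQ.GT.PTP.TT.semi_tensor_tens[OF idr Cm Cm psi_s psi_s, unfolded tC]
  have f2_PT: "PT2 (?f2 w) = SQ.GT.T.psi (PT2 w)" if w: "w \<in> carrier TTt" for w
  proof (rule SQ.GT.PTP.TT.tensor_maps_eqI[OF SQ.GT.PTP.Tp.Pf.group_P _ _ w])
    show "(\<lambda>w. PT2 (?f2 w)) \<in> additive_maps TTt (poly_module K TB)"
      by (rule additive_maps_comp[OF _ module_homs_additive[OF SQ.GT.PTP.PT_hom]])
         (use semilinear_maps_additive[OF f2h] in \<open>simp add: TC\<close>)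
    show "(\<lambda>w. SQ.GT.T.psi (PT2 w)) \<in> additive_maps TTt (poly_module K TB)"
      by (rule additive_maps_comp[OF module_homs_additive[OF SQ.GT.PTP.PT_hom] SQ.GT.T.psi_additive])
    fix p q assume pq: "p \<in> carrier Bt" "q \<in> carrier Bt"
    then show "PT2 (?f2 (tens (UP K) Bt Bt p q)) = SQ.GT.T.psi (PT2 (tens (UP K) Bt Bt p q))"
      using additive_maps_closed[OF BG.psi_additive]
      by (simp add: f2t SQ.GT.PTP.PT_tens SQ.GT.psi_poly_tensor)
  qed
  have f2_closed: "?f2 w \<in> carrier TTt" if "w \<in> carrier TTt" for w
    using additive_maps_closed[OF semilinear_maps_additive[OF f2h] that] by (simp add: TC)
  interpret E: bialgebra_morphism "UP K" D.Dt "UP K" ?C "\<lambda>r. r" BG.psi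
  proof (intro bialgebra_morphism.intro D.prebialgebra_Dt Q.prebialgebra_Dt bialgebra_morphism_axioms.intro idr psi_s')
    show "BG.psi \<one>\<^bsub>D.Dt\<^esub> = \<one>\<^bsub>?C\<^esub>"
      using BG.psi_fsingle[of "\<one>\<^bsub>B\<^esub>" 0 0] one_degree by (simp add: D.Dt_simps C homogeneous_eq_G)
  next
    fix p assume "p \<in> carrier D.Dt"
    then have p: "p \<in> carrier Bt" by (simp add: D.Dt_simps)
    note pc = additive_maps_closed[OF BG.psi_additive p]
    show "counit D.Dt p = counit ?C (BG.psi p)"
      using counit_psi[OF p] counit_eq BG.Pf.value_closed[OF pc] by (simp add: D.Dt_simps C)
    show "?f2 (comult D.Dt p) = comult ?C (BG.psi p)"
    proof (rule inj_onD[OF SQ.GT.PTP.PT_inj])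
      show "PT2 (?f2 (comult D.Dt p)) = PT2 (comult ?C (BG.psi p))"
        unfolding f2_PT[OF D.comult_Dt(3)[OF p]] D.comult_Dt(2)[OF p] CPT(1)[OF pc] psi_\<Delta>t[OF p] ..
    qed (use f2_closed[OF D.comult_Dt(3)[OF p]] CPT(2)[OF pc] in auto)
    fix q assume "q \<in> carrier D.Dt"
    then have q: "q \<in> carrier Bt" by (simp add: D.Dt_simps)
    show "BG.psi (p \<otimes>\<^bsub>D.Dt\<^esub> q) = BG.psi p \<otimes>\<^bsub>?C\<^esub> BG.psi q"
      by (simp add: D.Dt_simps C psi_mt SQ.GT.PTP.poly_tensor_closed p q SQ.GT.psi_poly_tensor)
  qed
  have TD3: "tensor (UP K) D.Dt (tensor (UP K) D.Dt D.Dt) = tensor (UP K) Bt TTt"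
    unfolding D.tensor_Dt by (rule tensor_module_cong) (simp_all add: D.Dt_simps)
  show ?thesis
  proof (rule E.bialgebra_pullback[OF bQ])
    show "inj_on BG.psi (carrier D.Dt)" using BG.psi_inj by (simp add: D.Dt_simps)
    show "inj_on ?f2 (carrier (tensor (UP K) D.Dt D.Dt))"
      unfolding D.tensor_Dt
    proof (rule inj_onI)
      fix u w assume u: "u \<in> carrier TTt" and w: "w \<in> carrier TTt" and e: "?f2 u = ?f2 w"
      have "SQ.GT.T.psi (PT2 u) = SQ.GT.T.psi (PT2 w)" using f2_PT[OF u] f2_PT[OF w] e by simp
      then have "PT2 u = PT2 w" using inj_onD[OF SQ.GT.T.psi_inj] module_homs_closed[OF SQ.GT.PTP.PT_hom] u w by simp
      then show "u = w" using inj_onD[OF SQ.GT.PTP.PT_inj] u w by simp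
    qed
    show "inj_on (semi_tensor (UP K) (\<lambda>r. r) (UP K) ?C (tensor (UP K) ?C ?C) BG.psi ?f2) (carrier (tensor (UP K) D.Dt (tensor (UP K) D.Dt D.Dt)))"
      unfolding TD3 by (rule tensor3_inj[OF Cm _ _ _ f2h f2_PT psi_s]) (simp_all add: C)
  qed simp
qed

lemma deformation_mem: "(mt, \<Delta>t) \<in> deformations K B G"
proof -
  have 1: "cong_mod_t K B (mt w) (\<lambda>n. tensor_lift K B (mult B) (w n))" if w: "w \<in> carrier (poly_module K TB)" for w
  proof -
    note bh = mult_lift_hom[OF PB.mult_bilinear]
    note c = module_homs_closed[OF coeffwise_hom(1)[OF TB_module B_module bh] w]
    have w0: "w 0 \<in> carrier TB" by (rule SQ.GT.PTP.Tp.Pf.value_closed[OF w])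
    have "mt (fsingle TB 0 (w 0)) 0 = tensor_lift K B (mult B) (w 0)"
    proof (rule SQ.GT.T.graded_maps_eqI[OF B_group additive_maps_comp[OF SQ.GT.PTP.Tp.Pf.fsingle_additive[OF UNIV_I]
            additive_maps_comp[OF module_homs_additive[OF mt_hom] BG.Pf.value_additive]] module_homs_additive[OF bh] w0])
      fix d v assume v: "v \<in> SQ.GT.T.H d"
      show "mt (fsingle TB 0 v) 0 = tensor_lift K B (mult B) v"
        using MB.at_one_symbol[OF mt_hom mt_degree v] m1_leading[OF v] by (simp add: mt_at_one SQ.GT.T.H_closed[OF v])
    qed
    then show ?thesis
      using SQ.GT.PTP.Tp.hom_coeff_0[OF B_module mt_hom w] BG.cong_mod_t_iff[OF module_homs_closed[OF mt_hom w] c] by simp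
  qed
  have 2: "cong_mod_t K TB (\<Delta>t p) (\<lambda>n. comult B (p n))" if p: "p \<in> carrier Bt" for p
  proof -
    note bh = comult_module_hom
    note c = module_homs_closed[OF coeffwise_hom(1)[OF B_module TB_module bh] p]
    have p0: "p 0 \<in> carrier B" by (rule BG.Pf.value_closed[OF p])
    have "\<Delta>t (fsingle B 0 (p 0)) 0 = comult B (p 0)"
    proof (rule BG.graded_maps_eqI[OF TB_group additive_maps_comp[OF BG.Pf.fsingle_additive[OF UNIV_I]
            additive_maps_comp[OF module_homs_additive[OF \<Delta>t_hom] SQ.GT.PTP.Tp.Pf.value_additive]] module_homs_additive[OF bh] p0])
      fix d v assume v: "v \<in> BG.H d"
      then have "v \<in> G d" by (simp add: homogeneous_eq_G)
      then show "\<Delta>t (fsingle B 0 v) 0 = comult B v"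
        using DB.at_one_symbol[OF \<Delta>t_hom \<Delta>t_degree v] comult_leading[of v d] by (simp add: \<Delta>t_at_one BG.H_closed[OF v])
    qed
    then show ?thesis
      using BG.hom_coeff_0[OF TB_module \<Delta>t_hom p]
        SQ.GT.PTP.Tp.cong_mod_t_iff[OF module_homs_closed[OF \<Delta>t_hom p] c] by simp
  qed
  show ?thesis
    using mt_hom \<Delta>t_hom mt_degree \<Delta>t_degree deformation_is_bialgebra 1 2
    by (simp add: deformations_def Let_def poly_degree_G poly_degree_T)
qed

lemma deformation_D: "deformation K B G mt \<Delta>t"
  by (intro deformation.intro graded_bialgebra_axioms deformation_axioms.intro deformation_mem)

lemma lift_iso_specialization:
  assumes "lift_iso W U \<theta>" "lifting K B G W"
  shows "lift_iso W (specialization K B (mt, \<Delta>t)) \<theta>"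
proof -
  interpret D: deformation K B G mt \<Delta>t by (rule deformation_D)
  interpret W: lifting K B G W by fact
  have th: "\<theta> x \<in> carrier B" if "x \<in> carrier B" for x
    using assms(1) that module_homs_closed[OF unitriangularD(1)] by (simp add: lift_iso_def)
  show ?thesis
    using assms(1) th counit_eq one_eq
    by (simp add: lift_iso_def D.V_simps mt_at_one \<Delta>t_at_one m1_tens)
qed

end

context graded_bialgebra
begin

text \<open>
  The specialization of the deformation of a normalized lifting has the structure maps of that lifting,
  so it is equivalent to the lifting before normalization.
\<close>

lemma lifting_deformation_exists:
  assumes "U \<in> liftings K B G"
  shows "\<exists>D\<in>deformations K B G. (U, specialization K B D) \<in> lifting_equiv K B G"
proof -
  have U: "lifting K B G U" using assms by (simp add: liftings_iff)
  obtain \<theta> where \<theta>: "lifting K B G (transport U \<theta>)" "lift_iso U (transport U \<theta>) \<theta>"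
    using lifting_normalize[OF U] by blast
  interpret N: normalized_lifting K B G "transport U \<theta>"
    by (intro normalized_lifting.intro \<theta>(1) normalized_lifting_axioms.intro) (simp add: transport_def)
  interpret D: deformation K B G N.mt N.\<Delta>t by (rule N.deformation_D)
  have "(U, specialization K B (N.mt, N.\<Delta>t)) \<in> lifting_equiv K B G"
    using U D.V_lifting N.lift_iso_specialization[OF \<theta>(2) U] by (auto simp: lifting_equiv_iff)
  then show ?thesis using N.deformation_mem by blast
qed

end

section \<open>Isomorphic deformations and equivalent liftings\<close>

context deformation
begin

text \<open>
  Any deformation, not only one that was constructed from a lifting, embeds into \<open>V[t]\<close> for its
  specialization \<open>V\<close>.
\<close>

lemma psi_mult:
  assumes "p \<in> carrier Bt" "q \<in> carrier Bt"
  shows "BG.psi (p \<otimes>\<^bsub>Dt\<^esub> q) = (\<lambda>n. m1 (poly_tensor K B B (BG.psi p) (BG.psi q) n))"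
  using MB.psi_hom_commute[OF deformation_facts(1,3) SQ.GT.PTP.poly_tensor_closed[OF assms]]
  by (simp add: PD.Dt_simps SQ.GT.psi_poly_tensor[OF assms])

lemma psi_comult:
  assumes p: "p \<in> carrier Bt"
  shows "SQ.GT.T.psi (PT2 (comult Dt p)) = (\<lambda>n. \<Delta>1 (BG.psi p n))"
  unfolding PD.comult_Dt(2)[OF p] by (rule DB.psi_hom_commute[OF deformation_facts(2,4) p])

end

locale two_deformations = D: deformation K B G mt \<Delta>t + D': deformation K B G mt' \<Delta>t'
  for K :: "('k, 'x) ring_scheme" and B :: "('k, 'b) bialg" and G and mt \<Delta>t mt' \<Delta>t'
begin

lemma bialg_iso_iff:
  "\<phi> \<in> bialg_iso (UP K) D.Dt D'.Dt \<longleftrightarrow> bij_betw \<phi> (carrier D.Bt) (carrier D.Bt) \<and> \<phi> \<in> module_homs (UP K) D.Bt D.Bt \<and>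
     (\<forall>p\<in>carrier D.Bt. \<forall>q\<in>carrier D.Bt. \<phi> (p \<otimes>\<^bsub>D.Dt\<^esub> q) = \<phi> p \<otimes>\<^bsub>D'.Dt\<^esub> \<phi> q) \<and> \<phi> (fsingle B 0 \<one>\<^bsub>B\<^esub>) = fsingle B 0 \<one>\<^bsub>B\<^esub> \<and>
     (\<forall>p\<in>carrier D.Bt. (\<lambda>j. counit B (\<phi> p j)) = (\<lambda>j. counit B (p j))) \<and>
     (\<forall>p\<in>carrier D.Bt. comult D'.Dt (\<phi> p) = tensor_map (UP K) D.Bt D.Bt \<phi> \<phi> (comult D.Dt p))"
  (is "?L \<longleftrightarrow> ?R")
proof -
  have one: "one D.Dt = fsingle B 0 \<one>\<^bsub>B\<^esub>" "one D'.Dt = fsingle B 0 \<one>\<^bsub>B\<^esub>" by (simp_all add: D.PD.Dt_simps D'.PD.Dt_simps)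
  have c: "carrier D.Dt = carrier D.Bt" "carrier D'.Dt = carrier D.Bt" by (simp_all add: D.PD.Dt_simps D'.PD.Dt_simps)
  have a: "add D.Dt = add D.Bt" "add D'.Dt = add D.Bt" by (simp_all add: D.PD.Dt_simps D'.PD.Dt_simps)
  have e: "counit D.Dt = (\<lambda>p j. counit B (p j))" "counit D'.Dt = (\<lambda>p j. counit B (p j))" by (simp_all add: D.PD.Dt_simps D'.PD.Dt_simps)
  have mh: "module_homs (UP K) D.Dt D'.Dt = module_homs (UP K) D.Bt D.Bt"
    by (rule module_homs_cong) (simp_all add: D.PD.Dt_simps D'.PD.Dt_simps)
  have rh: "\<phi> \<in> ring_hom D.Dt D'.Dt \<longleftrightarrow>
    (\<forall>p\<in>carrier D.Bt. \<forall>q\<in>carrier D.Bt. \<phi> (p \<otimes>\<^bsub>D.Dt\<^esub> q) = \<phi> p \<otimes>\<^bsub>D'.Dt\<^esub> \<phi> q) \<and> \<phi> (fsingle B 0 \<one>\<^bsub>B\<^esub>) = fsingle B 0 \<one>\<^bsub>B\<^esub>"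
    if "\<phi> \<in> module_homs (UP K) D.Bt D.Bt"
    unfolding ring_hom_def one c a using that by (auto simp: module_homs_def)
  show ?thesis
    unfolding bialg_iso_def ring_iso_def mem_Collect_eq D'.PD.tensor_map_Dt mh c e using rh by blast
qed

text \<open>
  All identities for the specialized map are values at \<open>t = 1\<close> of identities for \<open>\<phi>\<close>; the congruence of
  \<open>\<phi>\<close> with the identity modulo \<open>t\<close> makes it unitriangular.
\<close>

lemma lift_iso_at_one:
  assumes iso: "\<phi> \<in> bialg_iso (UP K) D.Dt D'.Dt"
    and deg: "\<And>n. \<phi> ` D.BG.Hp n \<subseteq> D.BG.Hp n"
    and cong: "\<And>p. p \<in> carrier D.Bt \<Longrightarrow> cong_mod_t K B (\<phi> p) p"
  shows "D.lift_iso D.V D'.V (D.SQ.GT.at_one \<phi>)"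
proof -
  note R = iso[unfolded bialg_iso_iff]
  have \<phi>: "\<phi> \<in> module_homs (UP K) D.Bt D.Bt" using R by blast
  let ?\<theta> = "D.SQ.GT.at_one \<phi>"
  note \<theta> = D.SQ.GT.at_one_hom[OF \<phi>] and ev = D.SQ.GT.eval_at_one_hom[OF \<phi>]
  note single = D.BG.Pf.fsingle_closed[OF UNIV_I]
  have \<phi>c: "\<phi> p \<in> carrier D.Bt" if "p \<in> carrier D.Bt" for p by (rule module_homs_closed[OF \<phi> that])
  have u: "D.unitriangular ?\<theta>"
    unfolding D.unitriangular_def
  proof (intro conjI allI ballI \<theta>)
    show "?\<theta> x \<in> D.BG.F n" if "x \<in> D.BG.F n" for x n by (rule D.SQ.GT.at_one_filtered[OF \<phi> deg that])
    show "component B G (?\<theta> x) n = x" if x: "x \<in> G n" for x n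
    proof -
      have h: "x \<in> D.BG.H n" using x by (simp add: D.homogeneous_eq_G)
      note s = single[OF D.G_closed[OF x], of 0]
      have "component B G (?\<theta> x) n = \<phi> (fsingle B 0 x) 0" by (rule D.SQ.GT.at_one_symbol[OF \<phi> deg h])
      also have "\<dots> = fsingle B (0::nat) x 0" using cong[OF s] D.BG.cong_mod_t_iff[OF \<phi>c[OF s] s] by simp
      finally show ?thesis by (simp add: fsingle_def)
    qed
  qed
  interpret E: bialgebra_morphism "UP K" D.Dt K D.V "eval_scalar K" "eval_at_one B" by (rule D.eval_morphism)
  interpret E': bialgebra_morphism "UP K" D'.Dt K D'.V "eval_scalar K" "eval_at_one B" by (rule D'.eval_morphism)
  have es: "eval_at_one B (fsingle B 0 x) = x" if "x \<in> carrier B" for x using D.BG.eval_fsingle that by simp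
  have th: "?\<theta> x = eval_at_one B (\<phi> (fsingle B 0 x))" for x by (simp add: D.SQ.GT.at_one_def)
  have c: "carrier D.Dt = carrier D.Bt" "carrier D'.Dt = carrier D.Bt" by (simp_all add: D.PD.Dt_simps D'.PD.Dt_simps)
  show ?thesis
    unfolding D.lift_iso_def
  proof (intro conjI ballI u)
    show "?\<theta> \<one>\<^bsub>D.V\<^esub> = \<one>\<^bsub>D'.V\<^esub>"
      using R es[OF D.PB.one_closed_A] by (simp add: th D.V_simps D'.V_simps)
  next
    fix x assume x: "x \<in> carrier B"
    note s = single[OF x, of 0]
    have "counit D'.V (?\<theta> x) = eval_scalar K (counit D'.Dt (\<phi> (fsingle B 0 x)))"
      using E'.f_counit[of "\<phi> (fsingle B 0 x)"] \<phi>c[OF s] by (simp add: c th)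
    also have "\<dots> = eval_scalar K (counit D.Dt (fsingle B 0 x))"
      using R s by (simp add: D.PD.Dt_simps D'.PD.Dt_simps)
    also have "\<dots> = counit D.V x" using E.f_counit[of "fsingle B 0 x"] s by (simp add: c es[OF x])
    finally show "counit D'.V (?\<theta> x) = counit D.V x" .
    let ?w = "comult D.Dt (fsingle B 0 x)"
    have w: "?w \<in> carrier D.TTt" by (rule D.PD.comult_Dt(3)[OF s])
    note Ph = D.SQ.GT.PTP.PT_hom and TTh = D.SQ.GT.PTP.TT.tensor_map_hom[OF D.BG.module_Mt D.BG.module_Mt \<phi> \<phi>]
    note TTt = D.SQ.GT.PTP.TT.tensor_map_tens[OF D.BG.module_Mt D.BG.module_Mt \<phi> \<phi>]
    have nat: "eval_at_one D.TB (D.PT2 (tensor_map (UP K) D.Bt D.Bt \<phi> \<phi> v)) = tensor_map K B B ?\<theta> ?\<theta> (eval_at_one D.TB (D.PT2 v))"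
      if v: "v \<in> carrier D.TTt" for v
    proof (rule D.SQ.GT.PTP.TT.tensor_maps_eqI[OF D.TB_group
          additive_maps_comp[OF module_homs_additive[OF module_homs_comp[OF TTh Ph]] D.SQ.GT.PTP.Tp.eval_additive]
          additive_maps_comp[OF additive_maps_comp[OF module_homs_additive[OF Ph] D.SQ.GT.PTP.Tp.eval_additive]
             module_homs_additive[OF D.square_hom[OF \<theta> \<theta>]]] v])
      fix p q assume p: "p \<in> carrier D.Bt" and q: "q \<in> carrier D.Bt"
      note epc = additive_maps_closed[OF D.BG.eval_additive p] and eqc = additive_maps_closed[OF D.BG.eval_additive q]
      show "eval_at_one D.TB (D.PT2 (tensor_map (UP K) D.Bt D.Bt \<phi> \<phi> (tens (UP K) D.Bt D.Bt p q))) =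
        tensor_map K B B ?\<theta> ?\<theta> (eval_at_one D.TB (D.PT2 (tens (UP K) D.Bt D.Bt p q)))"
        unfolding TTt[OF p q] D.SQ.GT.PTP.PT_tens[OF p q] D.SQ.GT.PTP.PT_tens[OF \<phi>c[OF p] \<phi>c[OF q]]
          D.SQ.GT.PTP.eval_poly_tensor[OF p q] D.SQ.GT.PTP.eval_poly_tensor[OF \<phi>c[OF p] \<phi>c[OF q]]
          D.square_tens[OF \<theta> \<theta> epc eqc] ev[OF p] ev[OF q] ..
    qed
    have "comult D'.V (?\<theta> x) = eval_at_one D.TB (D.PT2 (comult D'.Dt (\<phi> (fsingle B 0 x))))"
      using E'.f_comult[of "\<phi> (fsingle B 0 x)"] \<phi>c[OF s] D'.eval_tensor[OF D'.PD.comult_Dt(3)[OF \<phi>c[OF s]]] by (simp add: c th)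
    also have "\<dots> = eval_at_one D.TB (D.PT2 (tensor_map (UP K) D.Bt D.Bt \<phi> \<phi> ?w))" using R s by simp
    also have "\<dots> = tensor_map K B B ?\<theta> ?\<theta> (eval_at_one D.TB (D.PT2 ?w))" by (rule nat[OF w])
    also have "eval_at_one D.TB (D.PT2 ?w) = comult D.V x"
      using E.f_comult[of "fsingle B 0 x"] s D.eval_tensor[OF w] by (simp add: c es[OF x])
    finally show "comult D'.V (?\<theta> x) = tensor_map K B B ?\<theta> ?\<theta> (comult D.V x)" .
    fix y assume y: "y \<in> carrier B"
    note s' = single[OF y, of 0]
    have p: "fsingle B 0 x \<otimes>\<^bsub>D.Dt\<^esub> fsingle B 0 y \<in> carrier D.Bt" using D.PD.Dt.mult_closed_A s s' by (simp add: c)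
    have "?\<theta> (x \<otimes>\<^bsub>D.V\<^esub> y) = ?\<theta> (eval_at_one B (fsingle B 0 x \<otimes>\<^bsub>D.Dt\<^esub> fsingle B 0 y))"
      using E.f_mult[of "fsingle B 0 x" "fsingle B 0 y"] s s' by (simp add: c es x y)
    also have "\<dots> = eval_at_one B (\<phi> (fsingle B 0 x \<otimes>\<^bsub>D.Dt\<^esub> fsingle B 0 y))" by (rule ev[OF p, symmetric])
    also have "\<dots> = eval_at_one B (\<phi> (fsingle B 0 x) \<otimes>\<^bsub>D'.Dt\<^esub> \<phi> (fsingle B 0 y))" using R s s' by simp
    also have "\<dots> = ?\<theta> x \<otimes>\<^bsub>D'.V\<^esub> ?\<theta> y"
      using E'.f_mult[of "\<phi> (fsingle B 0 x)" "\<phi> (fsingle B 0 y)"] \<phi>c[OF s] \<phi>c[OF s'] by (simp add: c th)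
    finally show "?\<theta> (x \<otimes>\<^bsub>D.V\<^esub> y) = ?\<theta> x \<otimes>\<^bsub>D'.V\<^esub> ?\<theta> y" .
  qed
qed

text \<open>
  The homogenization of \<open>\<theta>\<close> has the homogenization of its inverse as inverse. Its compatibility with
  the structure maps is checked after applying the injective map \<open>psi\<close>, where it becomes the one of
  \<open>\<theta>\<close>, coefficient by coefficient.
\<close>

lemma rees_extension_iso:
  assumes iso: "D.lift_iso D.V D'.V \<theta>"
  shows "D.SQ.GT.rees_extension \<theta> \<in> bialg_iso (UP K) D.Dt D'.Dt"
    and "D.SQ.GT.rees_extension \<theta> ` D.BG.Hp n \<subseteq> D.BG.Hp n"
    and "p \<in> carrier D.Bt \<Longrightarrow> cong_mod_t K B (D.SQ.GT.rees_extension \<theta> p) p"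
proof -
  have u: "D.unitriangular \<theta>" using iso by (simp add: D.lift_iso_def)
  note \<theta> = D.unitriangularD(1)[OF u] and filt = D.unitriangularD(2)[OF u]
  let ?\<eta> = "D.inverse_map \<theta>"
  note ui = D.unitriangular_inverse[OF u]
  note \<eta> = D.unitriangularD(1)[OF ui] and filti = D.unitriangularD(2)[OF ui]
  let ?\<phi> = "D.SQ.GT.rees_extension \<theta>" and ?\<psi> = "D.SQ.GT.rees_extension ?\<eta>"
  have \<phi>: "?\<phi> \<in> module_homs (UP K) D.Bt D.Bt" by (rule D.SQ.GT.rees_extension_hom[OF \<theta> filt])
  have \<psi>: "?\<psi> \<in> module_homs (UP K) D.Bt D.Bt" by (rule D.SQ.GT.rees_extension_hom[OF \<eta> filti])
  note \<phi>c = module_homs_closed[OF \<phi>] and \<psi>c = module_homs_closed[OF \<psi>]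
  have ps: "D.BG.psi (?\<phi> p) = (\<lambda>n. \<theta> (D.BG.psi p n))" if "p \<in> carrier D.Bt" for p
    using that by (rule D.SQ.GT.psi_rees_extension[OF \<theta> filt, rotated -1])
  have ps': "D.BG.psi (?\<psi> p) = (\<lambda>n. ?\<eta> (D.BG.psi p n))" if "p \<in> carrier D.Bt" for p
    using that by (rule D.SQ.GT.psi_rees_extension[OF \<eta> filti, rotated -1])
  note pc = additive_maps_closed[OF D.BG.psi_additive]
  note val = D.BG.Pf.value_closed
  have psi_eq: "p = q" if "p \<in> carrier D.Bt" "q \<in> carrier D.Bt" "D.BG.psi p = D.BG.psi q" for p q
    using inj_onD[OF D.BG.psi_inj] that by simp
  note single = D.BG.Pf.fsingle_closed[OF UNIV_I]
  show deg: "?\<phi> ` D.BG.Hp n \<subseteq> D.BG.Hp n" for n by (rule D.SQ.GT.rees_extension_degree[OF \<theta> filt])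
  have bij: "bij_betw ?\<phi> (carrier D.Bt) (carrier D.Bt)"
  proof (rule bij_betwI[where g = ?\<psi>])
    show "?\<phi> \<in> carrier D.Bt \<rightarrow> carrier D.Bt" "?\<psi> \<in> carrier D.Bt \<rightarrow> carrier D.Bt" using \<phi>c \<psi>c by auto
    show "?\<psi> (?\<phi> p) = p" if p: "p \<in> carrier D.Bt" for p
      by (rule psi_eq) (use p \<phi>c \<psi>c val[OF pc[OF p]] in \<open>simp_all add: ps ps' D.inverse_map[OF u]\<close>)
    show "?\<phi> (?\<psi> p) = p" if p: "p \<in> carrier D.Bt" for p
      by (rule psi_eq) (use p \<phi>c \<psi>c val[OF pc[OF p]] in \<open>simp_all add: ps ps' D.inverse_map[OF u]\<close>)
  qed
  note sq = D.square_hom[OF \<theta> \<theta>] and sqt = D.square_tens[OF \<theta> \<theta>]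
  let ?T\<theta> = "tensor_map K B B \<theta> \<theta>"
  have T\<theta>: "poly_tensor K B B (\<lambda>n. \<theta> (p n)) (\<lambda>n. \<theta> (q n)) = (\<lambda>n. ?T\<theta> (poly_tensor K B B p q n))"
    if p: "p \<in> carrier D.Bt" and q: "q \<in> carrier D.Bt" for p q
  proof
    fix n
    have "?T\<theta> (poly_tensor K B B p q n) = (\<Oplus>\<^bsub>D.TB\<^esub>i\<in>{..n}. ?T\<theta> (tens K B B (p i) (q (n - i))))"
      unfolding poly_tensor_def convolution_def
      by (rule additive_maps_finsum[OF D.TB_group D.TB_group module_homs_additive[OF sq]])
         (use val[OF p] val[OF q] in auto)
    also have "\<dots> = poly_tensor K B B (\<lambda>n. \<theta> (p n)) (\<lambda>n. \<theta> (q n)) n"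
      unfolding poly_tensor_def convolution_def
      by (rule D.SQ.GT.PTP.TP.T.M.finsum_cong')
         (use val[OF p] val[OF q] module_homs_closed[OF \<theta>] in \<open>auto simp: sqt\<close>)
    finally show "poly_tensor K B B (\<lambda>n. \<theta> (p n)) (\<lambda>n. \<theta> (q n)) n = ?T\<theta> (poly_tensor K B B p q n)" by (rule sym)
  qed
  have m1: "\<theta> (D.m1 w) = D'.m1 (?T\<theta> w)" if w: "w \<in> carrier D.TB" for w
  proof (rule D.SQ.GT.PTP.TP.tensor_maps_eqI[OF D.B_group module_homs_additive[OF module_homs_comp[OF D.m1_hom \<theta>]]
        module_homs_additive[OF module_homs_comp[OF sq D'.m1_hom]] w])
    fix x y assume xy: "x \<in> carrier B" "y \<in> carrier B"
    then show "\<theta> (D.m1 (tens K B B x y)) = D'.m1 (?T\<theta> (tens K B B x y))"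
      using iso by (simp add: D.lift_iso_def sqt D.V_simps D'.V_simps)
  qed
  have mult: "?\<phi> (p \<otimes>\<^bsub>D.Dt\<^esub> q) = ?\<phi> p \<otimes>\<^bsub>D'.Dt\<^esub> ?\<phi> q" if p: "p \<in> carrier D.Bt" and q: "q \<in> carrier D.Bt" for p q
  proof (rule psi_eq)
    have pq: "p \<otimes>\<^bsub>D.Dt\<^esub> q \<in> carrier D.Bt" using D.PD.Dt.mult_closed_A[of p q] p q by (simp add: D.PD.Dt_simps)
    show "?\<phi> (p \<otimes>\<^bsub>D.Dt\<^esub> q) \<in> carrier D.Bt" by (rule \<phi>c[OF pq])
    show "?\<phi> p \<otimes>\<^bsub>D'.Dt\<^esub> ?\<phi> q \<in> carrier D.Bt"
      using D'.PD.Dt.mult_closed_A[of "?\<phi> p" "?\<phi> q"] \<phi>c[OF p] \<phi>c[OF q] by (simp add: D'.PD.Dt_simps)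
    have t: "poly_tensor K B B (D.BG.psi p) (D.BG.psi q) n \<in> carrier D.TB" for n
      by (rule D.SQ.GT.PTP.Tp.Pf.value_closed[OF D.SQ.GT.PTP.poly_tensor_closed[OF pc[OF p] pc[OF q]]])
    have "D.BG.psi (?\<phi> (p \<otimes>\<^bsub>D.Dt\<^esub> q)) = (\<lambda>n. \<theta> (D.m1 (poly_tensor K B B (D.BG.psi p) (D.BG.psi q) n)))"
      unfolding ps[OF pq] D.psi_mult[OF p q] ..
    also have "\<dots> = (\<lambda>n. D'.m1 (poly_tensor K B B (\<lambda>n. \<theta> (D.BG.psi p n)) (\<lambda>n. \<theta> (D.BG.psi q n)) n))"
      unfolding T\<theta>[OF pc[OF p] pc[OF q]] m1[OF t] ..
    also have "\<dots> = D.BG.psi (?\<phi> p \<otimes>\<^bsub>D'.Dt\<^esub> ?\<phi> q)"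
      unfolding D'.psi_mult[OF \<phi>c[OF p] \<phi>c[OF q]] ps[OF p] ps[OF q] ..
    finally show "D.BG.psi (?\<phi> (p \<otimes>\<^bsub>D.Dt\<^esub> q)) = D.BG.psi (?\<phi> p \<otimes>\<^bsub>D'.Dt\<^esub> ?\<phi> q)" .
  qed
  have one: "?\<phi> (fsingle B 0 \<one>\<^bsub>B\<^esub>) = fsingle B 0 \<one>\<^bsub>B\<^esub>"
  proof (rule psi_eq)
    have p1: "D.BG.psi (fsingle B 0 \<one>\<^bsub>B\<^esub>) = fsingle B 0 \<one>\<^bsub>B\<^esub>"
      using D.BG.psi_fsingle[of "\<one>\<^bsub>B\<^esub>" 0 0] D.one_degree by (simp add: D.homogeneous_eq_G)
    have t1: "\<theta> \<one>\<^bsub>B\<^esub> = \<one>\<^bsub>B\<^esub>" using iso by (simp add: D.lift_iso_def D.V_simps D'.V_simps)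
    show "D.BG.psi (?\<phi> (fsingle B 0 \<one>\<^bsub>B\<^esub>)) = D.BG.psi (fsingle B 0 \<one>\<^bsub>B\<^esub>)"
      unfolding ps[OF single[OF D.PB.one_closed_A]] p1
      using coeffwise_hom(2)[OF D.B_module D.B_module \<theta> D.PB.one_closed_A] t1 by simp
  qed (use \<phi>c single D.PB.one_closed_A in auto)
  have counit: "(\<lambda>j. counit B (?\<phi> p j)) = (\<lambda>j. counit B (p j))" if p: "p \<in> carrier D.Bt" for p
  proof -
    have "counit B (\<theta> x) = counit B x" if "x \<in> carrier B" for x
      using iso that by (simp add: D.lift_iso_def D.V_simps D'.V_simps)
    then have "(\<lambda>j. counit B (D.BG.psi (?\<phi> p) j)) = (\<lambda>j. counit B (D.BG.psi p j))"
      unfolding ps[OF p] using val[OF pc[OF p]] by simp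
    then show ?thesis using D.counit_psi[OF p] D.counit_psi[OF \<phi>c[OF p]] by simp
  qed
  note Ph = D.SQ.GT.PTP.PT_hom and TTh = D.SQ.GT.PTP.TT.tensor_map_hom[OF D.BG.module_Mt D.BG.module_Mt \<phi> \<phi>]
  note TTt = D.SQ.GT.PTP.TT.tensor_map_tens[OF D.BG.module_Mt D.BG.module_Mt \<phi> \<phi>]
  note cw = coeffwise_hom(1)[OF D.TB_module D.TB_module sq]
  have nat: "D.SQ.GT.T.psi (D.PT2 (tensor_map (UP K) D.Bt D.Bt ?\<phi> ?\<phi> v)) = (\<lambda>n. ?T\<theta> (D.SQ.GT.T.psi (D.PT2 v) n))"
    if v: "v \<in> carrier D.TTt" for v
  proof (rule D.SQ.GT.PTP.TT.tensor_maps_eqI[OF D.SQ.GT.PTP.Tp.Pf.group_P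
        additive_maps_comp[OF module_homs_additive[OF module_homs_comp[OF TTh Ph]] D.SQ.GT.T.psi_additive]
        additive_maps_comp[OF additive_maps_comp[OF module_homs_additive[OF Ph] D.SQ.GT.T.psi_additive] module_homs_additive[OF cw]] v])
    fix p q assume p: "p \<in> carrier D.Bt" and q: "q \<in> carrier D.Bt"
    show "D.SQ.GT.T.psi (D.PT2 (tensor_map (UP K) D.Bt D.Bt ?\<phi> ?\<phi> (tens (UP K) D.Bt D.Bt p q))) =
      (\<lambda>n. ?T\<theta> (D.SQ.GT.T.psi (D.PT2 (tens (UP K) D.Bt D.Bt p q)) n))"
      unfolding TTt[OF p q] D.SQ.GT.PTP.PT_tens[OF p q] D.SQ.GT.PTP.PT_tens[OF \<phi>c[OF p] \<phi>c[OF q]]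
        D.SQ.GT.psi_poly_tensor[OF p q] D.SQ.GT.psi_poly_tensor[OF \<phi>c[OF p] \<phi>c[OF q]]
        ps[OF p] ps[OF q] T\<theta>[OF pc[OF p] pc[OF q]] ..
  qed
  have comult: "comult D'.Dt (?\<phi> p) = tensor_map (UP K) D.Bt D.Bt ?\<phi> ?\<phi> (comult D.Dt p)" if p: "p \<in> carrier D.Bt" for p
  proof -
    note w = D.PD.comult_Dt(3)[OF p] and w' = D'.PD.comult_Dt(3)[OF \<phi>c[OF p]]
    note Tw = module_homs_closed[OF TTh w]
    have e: "D'.\<Delta>1 (\<theta> x) = ?T\<theta> (D.\<Delta>1 x)" if "x \<in> carrier B" for x
      using iso that by (simp add: D.lift_iso_def D.V_simps D'.V_simps)
    have "D.SQ.GT.T.psi (D.PT2 (comult D'.Dt (?\<phi> p))) = (\<lambda>n. D'.\<Delta>1 (\<theta> (D.BG.psi p n)))"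
      unfolding D'.psi_comult[OF \<phi>c[OF p]] ps[OF p] ..
    also have "\<dots> = (\<lambda>n. ?T\<theta> (D.\<Delta>1 (D.BG.psi p n)))" using e val[OF pc[OF p]] by simp
    also have "\<dots> = D.SQ.GT.T.psi (D.PT2 (tensor_map (UP K) D.Bt D.Bt ?\<phi> ?\<phi> (comult D.Dt p)))"
      unfolding nat[OF w] D.psi_comult[OF p] ..
    finally have "D.PT2 (comult D'.Dt (?\<phi> p)) = D.PT2 (tensor_map (UP K) D.Bt D.Bt ?\<phi> ?\<phi> (comult D.Dt p))"
      by (rule inj_onD[OF D.SQ.GT.T.psi_inj _ module_homs_closed[OF Ph w'] module_homs_closed[OF Ph Tw]])
    then show ?thesis by (rule inj_onD[OF D.SQ.GT.PTP.PT_inj _ w' Tw])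
  qed
  show "?\<phi> \<in> bialg_iso (UP K) D.Dt D'.Dt"
    unfolding bialg_iso_iff using bij \<phi> mult one counit comult by blast
  assume p: "p \<in> carrier D.Bt"
  have p0: "p 0 \<in> carrier B" by (rule val[OF p])
  have "?\<phi> (fsingle B 0 (p 0)) 0 = p 0"
  proof (rule D.BG.graded_maps_eqI[OF D.B_group additive_maps_comp[OF D.BG.Pf.fsingle_additive[OF UNIV_I]
          additive_maps_comp[OF module_homs_additive[OF \<phi>] D.BG.Pf.value_additive]] additive_maps_id p0])
    fix d x assume x: "x \<in> D.BG.H d"
    then have xG: "x \<in> G d" by (simp add: D.homogeneous_eq_G)
    have one_val: "D.SQ.GT.at_one ?\<phi> x = \<theta> x"
      using D.BG.H_closed[OF x] by (rule D.SQ.GT.at_one_rees_extension[OF \<theta> filt, rotated -1])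
    show "?\<phi> (fsingle B 0 x) 0 = x"
      using D.SQ.GT.at_one_symbol[OF \<phi> deg x] one_val D.unitriangularD(3)[OF u xG] by simp
  qed
  then show "cong_mod_t K B (?\<phi> p) p"
    using D.BG.hom_coeff_0[OF D.B_module \<phi> p] D.BG.cong_mod_t_iff[OF \<phi>c[OF p] p] by simp
qed

lemma deformation_iso_iff:
  "((mt, \<Delta>t), (mt', \<Delta>t')) \<in> deformation_iso K B G \<longleftrightarrow> (D.V, D'.V) \<in> lifting_equiv K B G"
proof
  assume "((mt, \<Delta>t), (mt', \<Delta>t')) \<in> deformation_iso K B G"
  then obtain \<phi> where \<phi>: "\<phi> \<in> bialg_iso (UP K) D.Dt D'.Dt" "\<And>n. \<phi> ` D.BG.Hp n \<subseteq> D.BG.Hp n"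
    "\<And>p. p \<in> carrier D.Bt \<Longrightarrow> cong_mod_t K B (\<phi> p) p"
    by (auto simp: deformation_iso_def D.poly_degree_G)
  from lift_iso_at_one[OF this] show "(D.V, D'.V) \<in> lifting_equiv K B G"
    using D.V_lifting D'.V_lifting by (auto simp: D.lifting_equiv_iff)
next
  assume "(D.V, D'.V) \<in> lifting_equiv K B G"
  then obtain \<theta> where "D.lift_iso D.V D'.V \<theta>" by (auto simp: D.lifting_equiv_iff)
  from rees_extension_iso[OF this] show "((mt, \<Delta>t), (mt', \<Delta>t')) \<in> deformation_iso K B G"
    unfolding deformation_iso_def D.poly_degree_G
    using D.D_deformation D'.D_deformation by blast
qed

end

context graded_bialgebra
begin

lemma specialization_lifting: "D \<in> deformations K B G \<Longrightarrow> specialization K B D \<in> liftings K B G"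
proof -
  assume D: "D \<in> deformations K B G"
  obtain mt \<Delta>t where e: "D = (mt, \<Delta>t)" by (cases D)
  interpret deformation K B G mt \<Delta>t
    by (intro deformation.intro graded_bialgebra_axioms deformation_axioms.intro) (use D e in simp)
  show ?thesis unfolding e liftings_iff by (rule V_lifting)
qed

lemma deformation_iso_iff_specialization:
  assumes "D \<in> deformations K B G" "D' \<in> deformations K B G"
  shows "(D, D') \<in> deformation_iso K B G \<longleftrightarrow> (specialization K B D, specialization K B D') \<in> lifting_equiv K B G"
proof -
  obtain mt \<Delta>t where e: "D = (mt, \<Delta>t)" by (cases D)
  obtain mt' \<Delta>t' where e': "D' = (mt', \<Delta>t')" by (cases D')
  interpret two_deformations K B G mt \<Delta>t mt' \<Delta>t'
    by (intro two_deformations.intro deformation.intro graded_bialgebra_axioms deformation_axioms.intro) (use assms e e' in simp_all)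
  show ?thesis unfolding e e' by (rule deformation_iso_iff)
qed

end

text \<open>
  The class of \<open>s d\<close> is sent to the class of \<open>d\<close>. That \<open>R\<close> is an equivalence relation follows from
  \<open>R\<close> being the preimage of \<open>E\<close> under \<open>s\<close>.
\<close>

lemma bij_betw_quotients:
  assumes E: "equiv A E" and s: "\<And>d. d \<in> D \<Longrightarrow> s d \<in> A"
    and surj: "\<And>a. a \<in> A \<Longrightarrow> \<exists>d\<in>D. (a, s d) \<in> E"
    and R: "R \<subseteq> D \<times> D" "\<And>d d'. d \<in> D \<Longrightarrow> d' \<in> D \<Longrightarrow> (d, d') \<in> R \<longleftrightarrow> (s d, s d') \<in> E"
  shows "\<exists>\<Phi>. bij_betw \<Phi> (A // E) (D // R) \<and> (\<forall>d\<in>D. \<Phi> (E `` {s d}) = R `` {d})"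
proof -
  have cls: "E `` {a} = E `` {b} \<longleftrightarrow> (a, b) \<in> E" if "a \<in> A" "b \<in> A" for a b
    using eq_equiv_class_iff[OF E that] by simp
  have Rcls: "R `` {d} = R `` {d'} \<longleftrightarrow> E `` {s d} = E `` {s d'}" if d: "d \<in> D" and d': "d' \<in> D" for d d'
  proof
    assume "R `` {d} = R `` {d'}"
    moreover have "(d', d') \<in> R" using R(2)[OF d' d'] equiv_class_self[OF E s[OF d']] by simp
    ultimately have "(d, d') \<in> R" by blast
    then show "E `` {s d} = E `` {s d'}" using R(2)[OF d d'] cls[OF s[OF d] s[OF d']] by simp
  next
    assume e: "E `` {s d} = E `` {s d'}"
    have "x \<in> R `` {d} \<longleftrightarrow> x \<in> R `` {d'}" for x
    proof (cases "x \<in> D")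
      case True
      have "(s d, s x) \<in> E \<longleftrightarrow> (s d', s x) \<in> E" using e by blast
      then show ?thesis using R(2)[OF d True] R(2)[OF d' True] by simp
    next
      case False
      then show ?thesis using R(1) by blast
    qed
    then show "R `` {d} = R `` {d'}" by blast
  qed
  define pick where "pick X = (SOME d. d \<in> D \<and> E `` {s d} = X)" for X
  have pick: "pick X \<in> D \<and> E `` {s (pick X)} = X" if X: "X \<in> A // E" for X
  proof -
    obtain a where a: "a \<in> A" "X = E `` {a}" using X by (rule quotientE)
    obtain d where d: "d \<in> D" "(a, s d) \<in> E" using surj[OF a(1)] by blast
    then have "d \<in> D \<and> E `` {s d} = X" using a cls[OF a(1) s[OF d(1)]] by simp
    then show ?thesis unfolding pick_def by (rule someI)
  qed
  let ?\<Phi> = "\<lambda>X. R `` {pick X}"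
  have val: "?\<Phi> (E `` {s d}) = R `` {d}" if d: "d \<in> D" for d
    using pick[OF quotientI[OF s[OF d]]] Rcls[of "pick (E `` {s d})" d] d by simp
  have "bij_betw ?\<Phi> (A // E) (D // R)"
  proof (rule bij_betw_imageI)
    show "inj_on ?\<Phi> (A // E)"
    proof (rule inj_onI)
      fix X Y assume X: "X \<in> A // E" and Y: "Y \<in> A // E" and e: "R `` {pick X} = R `` {pick Y}"
      show "X = Y" using e pick[OF X] pick[OF Y] Rcls[of "pick X" "pick Y"] by simp
    qed
    show "?\<Phi> ` (A // E) = D // R"
    proof
      show "?\<Phi> ` (A // E) \<subseteq> D // R" using pick by (auto intro!: quotientI)
      show "D // R \<subseteq> ?\<Phi> ` (A // E)"
      proof
        fix Y assume "Y \<in> D // R"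
        then obtain d where d: "d \<in> D" "Y = R `` {d}" by (rule quotientE)
        then show "Y \<in> ?\<Phi> ` (A // E)" using val[OF d(1)] quotientI[OF s[OF d(1)]] by (metis imageI)
      qed
    qed
  qed
  then show ?thesis using val by blast
qed

theorem theorem2p2:
  fixes K :: "('k, 'x) ring_scheme" and B :: "('k, 'b) bialg" and G :: "nat \<Rightarrow> 'b set"
  assumes "field K" and "graded_bialgebra K B G"
  shows "\<exists>\<Phi>. bij_betw \<Phi> (Lift K B G) (iso_deformations K B G) \<and>
    (\<forall>D\<in>deformations K B G. specialization K B D \<in> liftings K B G \<and>
        \<Phi> (lifting_equiv K B G `` {specialization K B D}) = deformation_iso K B G `` {D})"
proof -
  interpret graded_bialgebra K B G by fact
  have "deformation_iso K B G \<subseteq> deformations K B G \<times> deformations K B G"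
    by (auto simp: deformation_iso_def)
  from bij_betw_quotients[OF lifting_equiv_equiv specialization_lifting lifting_deformation_exists this
      deformation_iso_iff_specialization]
  show ?thesis
    unfolding Lift_def iso_deformations_def using specialization_lifting by blast
qed

end
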